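(* Let $s\geq 3$ and $s+2\leq t\leq 2s-1$ be integers. There exists a constant $c=c(s,t)$ such that for all sufficiently large $n$, \[f_{s,t}(n)\leq n^{\alpha_{s,t}}(\log n)^{c}.\]
   Context: For integers $s<t$ and $n$, the Erdős–Rogers function $f_{s,t}(n)$ is the minimum, over all $K_t$-free graphs $G$ on $n$ vertices, of the maximum number of vertices of an induced $K_s$-free subgraph of $G$. For $s\geq 3$ and $s+2\leq t\leq 2s-1$, call the pair $(s,t)$ regular if either $s\geq 11$ and $s+3\leq t\leq 2s-4$, or $(s,t)\in\{(10,14),(10,15)\}$; otherwise call it exceptional. Define \[\alpha_{s,t}=\frac{(s-2)(t-s)(t+s-1)+2t-2s}{(2s-3)(t-s)(t+s-1)-2s+4}\ \text{ if }(s,t)\text{ is regular},\qquad \alpha_{s,t}=\frac{(s-2)(t-s)(s-1)+s-1}{(2s-3)(t-s)(s-1)+2s-t}\ \text{ if }(s,t)\text{ is exceptional}.\] *)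

theory Defs
  imports Complex_Main "HOL-Library.Ramsey"
begin

text \<open>
  A finite simple graph is a pair of a finite vertex set \<open>V\<close> and an edge set \<open>E\<close> of
  two-element subsets of \<open>V\<close>; \<open>[V]\<^bsup>r\<^esup>\<close> denotes the \<open>r\<close>-element subsets of \<open>V\<close>.
\<close>

definition simple_graph :: "'a set \<Rightarrow> 'a set set \<Rightarrow> bool" where
  "simple_graph V E \<longleftrightarrow> finite V \<and> E \<subseteq> [V]\<^bsup>2\<^esup>"

definition induced_edges :: "'a set set \<Rightarrow> 'a set \<Rightarrow> 'a set set" where
  "induced_edges E W = {e \<in> E. e \<subseteq> W}"

definition K_free :: "nat \<Rightarrow> 'a set \<Rightarrow> 'a set set \<Rightarrow> bool" where
  "K_free r V E \<longleftrightarrow> \<not> (\<exists>S\<in>[V]\<^bsup>r\<^esup>. [S]\<^bsup>2\<^esup> \<subseteq> E)"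

definition max_induced_K_free :: "nat \<Rightarrow> 'a set \<Rightarrow> 'a set set \<Rightarrow> nat" where
  "max_induced_K_free s V E = Max {card W | W. W \<subseteq> V \<and> K_free s W (induced_edges E W)}"

text \<open>
  Every finite graph is isomorphic to one with vertices in \<open>nat\<close>, so the minimum may be
  taken over those; \<open>Inf\<close> of a nonempty set of naturals is its least element, and
  \<open>erdos_rogers_attained\<close> shows that the set is nonempty for \<open>t \<ge> 2\<close>.
\<close>

definition erdos_rogers :: "nat \<Rightarrow> nat \<Rightarrow> nat \<Rightarrow> nat" where
  "erdos_rogers s t n =
     Inf {max_induced_K_free s V E | (V :: nat set) E.
            simple_graph V E \<and> card V = n \<and> K_free t V E}"

definition regular_pair :: "nat \<Rightarrow> nat \<Rightarrow> bool" where
  "regular_pair s t \<longleftrightarrow>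
     (s \<ge> 11 \<and> s + 3 \<le> t \<and> t \<le> 2 * s - 4) \<or> (s, t) \<in> {(10, 14), (10, 15)}"

definition alpha :: "nat \<Rightarrow> nat \<Rightarrow> real" where
  "alpha s t = (let s' = real s; t' = real t in
     if regular_pair s t
     then ((s' - 2) * (t' - s') * (t' + s' - 1) + 2 * t' - 2 * s') /
          ((2 * s' - 3) * (t' - s') * (t' + s' - 1) - 2 * s' + 4)
     else ((s' - 2) * (t' - s') * (s' - 1) + s' - 1) /
          ((2 * s' - 3) * (t' - s') * (s' - 1) + 2 * s' - t'))"

lemma max_induced_K_free_attained:
  assumes "finite V" "s \<ge> 1"
  shows "\<exists>W\<subseteq>V. K_free s W (induced_edges E W) \<and> card W = max_induced_K_free s V E"
    and "\<And>W. W \<subseteq> V \<Longrightarrow> K_free s W (induced_edges E W) \<Longrightarrow> card W \<le> max_induced_K_free s V E"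
proof -
  let ?A = "{card W | W. W \<subseteq> V \<and> K_free s W (induced_edges E W)}"
  have "K_free s {} (induced_edges E {})"
    using assms(2) by (auto simp: K_free_def nsets_def)
  then have ne: "?A \<noteq> {}" by blast
  have "?A \<subseteq> card ` Pow V" by auto
  then have fin: "finite ?A" using assms(1) by (meson finite_Pow_iff finite_imageI finite_subset)
  from Max_in[OF fin ne] show "\<exists>W\<subseteq>V. K_free s W (induced_edges E W) \<and> card W = max_induced_K_free s V E"
    unfolding max_induced_K_free_def by (auto 4 4)
  show "card W \<le> max_induced_K_free s V E" if "W \<subseteq> V" "K_free s W (induced_edges E W)" for W
    unfolding max_induced_K_free_def using that by (intro Max_ge[OF fin]) blast
qed

lemma erdos_rogers_attained:
  assumes "t \<ge> 2"
  shows "\<exists>(V :: nat set) E. simple_graph V E \<and> card V = n \<and> K_free t V E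
           \<and> max_induced_K_free s V E = erdos_rogers s t n"
proof -
  let ?A = "{max_induced_K_free s V E | (V :: nat set) E.
               simple_graph V E \<and> card V = n \<and> K_free t V E}"
  have "[S]\<^bsup>2\<^esup> \<noteq> {}" if "card S = t" "finite S" for S :: "nat set"
    using that assms by (simp add: nsets_eq_empty_iff)
  then have "K_free t {..<n} {}"
    unfolding K_free_def nsets_def[of _ t] by blast
  then have "max_induced_K_free s {..<n} {} \<in> ?A"
    by (intro CollectI exI[of _ "{..<n}"] exI[of _ "{}"]) (simp add: simple_graph_def)
  then have "?A \<noteq> {}" by blast
  then have "Inf ?A \<in> ?A" by (rule Inf_nat_def1)
  then show ?thesis unfolding erdos_rogers_def by (auto 4 4)
qed

end

theory Submission
  imports Defs "HOL-Probability.Product_PMF"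
begin

text \<open>
  Take \<open>M\<close> random blocks in \<open>{..<n}\<close>: every vertex joins every block with probability \<open>p = n\<^bsup>\<alpha>-1\<^esup>\<close> and
  then receives a random label in \<open>{1..s}\<close>. Inside each block put a clique on every rainbow \<open>s\<close>-set that is not
  \<^emph>\<open>spoilt\<close> by the other blocks. A copy of \<open>K\<^sub>t\<close> would be cut by the blocks into a linear space on \<open>t\<close> points with
  lines of size at most \<open>s\<close>. The definition of \<open>\<alpha>\<close> is what makes every such linear space too expensive to
  appear often; hence it contains a critical sub-configuration \<open>P\<close>, one that is rarer by a factor \<open>\<Lambda>\<close> than all its
  own sub-configurations, and spoiling the sets that lie in such configurations makes the graph \<open>K\<^sub>t\<close>-free.

  Every set \<open>W\<close> of \<open>w = n\<^bsup>\<alpha>\<^esup> polylog n\<close> vertices must still contain a clique. Since critical configurations are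
  rare, only a small fraction of the \<open>s\<close>-tuples of \<open>W\<close> is closed by the other blocks; this is
  deterministic in a \<^emph>\<open>quality\<close> condition that does not mention \<open>W\<close>. Colouring the blocks red and blue at
  random makes the blue blocks independent given the red ones, so all rainbow sets in \<open>W\<close> are spoilt with
  probability \<open>exp (-c (w p)\<^bsup>s\<^esup> M)\<close>, which beats the union bound over \<open>W\<close>.
\<close>

section \<open>Exponents\<close>

text \<open>The number \<alpha> comes from two linear spaces on t points: in one, a line of s points
  is the only line that is not a pair; in the other, there are two long lines, of s and t - s + 1
  points, which share a point. It is chosen so that the more frequent of the two is expected, up to
  powers of log n, exactly as often as a pair of vertices in a common block. Regular and exceptional
  pairs differ in which of the two this is. Labels keep lines short: two clique vertices in one
  block must have different labels. The obstacle is the union bound over W: there are about n^w such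
  sets, too many for a direct statement about rare configurations inside W. The density of closed
  tuples in W therefore has to follow from conditions on vertex sets of polylogarithmic size. It
  does, because the density shows in a random sample of few vertices per root, and critical
  configurations rooted in such a sample cannot form long chains of new incidences. To use this,
  some root must have little freedom once the points off its block are placed: at most about the
  size of a block.\<close>

lemma regular_identity:
  fixes S m :: real
  defines "X \<equiv> 2 * (2 * S - 3) * m + 2 * (S - 2)\<^sup>2"
    and "Y \<equiv> (S - 1) * m * (2 * S + m - 1) - 2 * S + 4 - 2 * m"
    and "N \<equiv> (S - 2) * m * (2 * S + m - 1) + 2 * m"
    and "Q \<equiv> (2 * S - 3) * m * (2 * S + m - 1) - 2 * S + 4"
  shows "(2 * S - 3) * N - (S - 2) * Q = X" "Q - N = Y"
    "X * (m * (2 * S + m - 1) / 2) - m * Q - (S - 2) * N = 0"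
    "2 * Y - (m + 2) * X = 2 * ((S\<^sup>2 - 3 * S + 1) * m - (S - 2) * m\<^sup>2 - 2 * (S - 1) * (S - 2))"
    "(S + 1) * X - 2 * Y = 2 * (S - 1) * (2 * m - m\<^sup>2 + S * (S - 2))"
    "Q - m * X = m * (2 * S\<^sup>2 - 5) - (2 * S - 3) * m\<^sup>2 - 2 * S + 4"
    "Q - 2 * N = m * (2 * S + m - 1) - 4 * m - 2 * S + 4"
  unfolding X_def Y_def N_def Q_def by (simp_all add: field_simps power2_eq_square)

text \<open>Both lists of identities clear denominators, with S = s and m = t - s:
  \<open>N / Q\<close> is \<alpha>, \<open>X / Q\<close> is the exponent \<open>edge_exp\<close> and
  \<open>Y / Q\<close> is 1 - \<alpha>. The entry with right-hand side 0 records that the definition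
  of \<alpha> makes one cost inequality tight; the two cases differ in which inequality that
  is.\<close>

lemma exceptional_identity:
  fixes S m :: real
  defines "X \<equiv> S\<^sup>2 - 3 * S + 3 + (S - 2) * m"
    and "Y \<equiv> S * (S - 2) * m + 1"
    and "N \<equiv> (S - 2) * m * (S - 1) + S - 1"
    and "Q \<equiv> (2 * S - 3) * m * (S - 1) + S - m"
  shows "(2 * S - 3) * N - (S - 2) * Q = X" "Q - N = Y"
    "X * S * m + (m - 1) * (Y - X) - m * Q - (S - 2) * N = 0"
    "(m + 2) * X - 2 * Y = (S - 2) * m\<^sup>2 - (S\<^sup>2 - 3 * S + 1) * m + 2 * (S - 1) * (S - 2)"
    "(S + 1) * X - 2 * Y = S\<^sup>2 * (S - 2) + 1 - m * ((S - 2) * (S - 1))"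
    "Q - m * X = m * (S\<^sup>2 - 2 * S - 1) - (S - 2) * m\<^sup>2 + S"
    "Q - 2 * N = (S - 1) * m - m - S + 2"
  unfolding X_def Y_def N_def Q_def by (simp_all add: field_simps power2_eq_square)

text \<open>The expected number of blocks through a given pair, M p^2, will be n to the power minus
  this exponent, up to powers of log n. The value results from p = n^(\<alpha> - 1), w = n^\<alpha>
  and the demand that (w p)^s M be about w, which is what the union bound over the sets of size w
  asks for.\<close>

definition edge_exp :: "nat \<Rightarrow> nat \<Rightarrow> real" where
  "edge_exp s t = (2 * real s - 3) * alpha s t - (real s - 2)"

text \<open>The third and the fourth fact are the inequality of \<open>linear_space_cost\<close> for
  the two extremal spaces: one line of s points and m(2s + m - 1)/2 pairs, and two lines of s and m
  + 1 points that meet in a point, together with (s - 1)m pairs. The last two facts serve to pass to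
  spaces whose longest line has fewer than s points.\<close>

lemma exponent_facts:
  fixes s t :: nat
  assumes st: "s \<ge> 3" "s + 2 \<le> t" "t \<le> 2 * s - 1"
  defines "e \<equiv> edge_exp s t" and "m \<equiv> real t - real s"
  shows "0 < e" "alpha s t < 1 / 2"
    "m + (real s - 2) * alpha s t \<le> e * (m * (2 * real s + m - 1) / 2)"
    "m + (real s - 2) * alpha s t \<le> e * real s * m + (m - 1) * (1 - alpha s t - e)"
    "2 * (1 - alpha s t) \<le> (real s + 1) * e"
    "m * e \<le> 1"
proof -
  define S where "S = real s"
  have S3: "S \<ge> 3" using st by (simp add: S_def)
  have m2: "m \<ge> 2" "m \<le> S - 1" using st by (auto simp: S_def m_def)
  have tS: "real t = S + m" by (simp add: S_def m_def)
  have "0 < e \<and> alpha s t < 1 / 2 \<and>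
    m + (S - 2) * alpha s t \<le> e * (m * (2 * S + m - 1) / 2) \<and>
    m + (S - 2) * alpha s t \<le> e * S * m + (m - 1) * (1 - alpha s t - e) \<and>
    2 * (1 - alpha s t) \<le> (S + 1) * e \<and> m * e \<le> 1"
  proof (cases "regular_pair s t")
    case True
    define N where "N = (S - 2) * m * (2 * S + m - 1) + 2 * m"
    define Q where "Q = (2 * S - 3) * m * (2 * S + m - 1) - 2 * S + 4"
    define X where "X = 2 * (2 * S - 3) * m + 2 * (S - 2)\<^sup>2"
    define Y where "Y = (S - 1) * m * (2 * S + m - 1) - 2 * S + 4 - 2 * m"
    note id = regular_identity[where S = S and m = m, folded N_def Q_def X_def Y_def]
    have m_le: "m \<le> S - 4" and S10: "S \<ge> 10" and m3: "m \<ge> 3"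
      using True st by (auto simp: regular_pair_def S_def m_def)
    \<comment> \<open>The sign of this polynomial decides which of the two extremal spaces is
      cheaper; the regular pairs are those with the sign required here.\<close>
    have Phi: "(S\<^sup>2 - 3 * S + 1) * m - (S - 2) * m\<^sup>2 - 2 * (S - 1) * (S - 2) \<ge> 0"
    proof (cases "S \<ge> 11")
      case True
      \<comment> \<open>This product vanishes at the ends t = s + 3 and t = 2s - 4 of the regular
        range. What remains after subtracting it is linear in m and nonnegative for S at least
        11.\<close>
      have "(S - 2) * ((m - 3) * (S - 4 - m)) \<ge> 0" using m3 m_le S3 by simp
      moreover have "(S\<^sup>2 - 3 * S + 1) * m - (S - 2) * m\<^sup>2 - 2 * (S - 1) * (S - 2)
          - (S - 2) * ((m - 3) * (S - 4 - m)) = (S\<^sup>2 - 12 * S + 17) - (m - 3)"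
        by (simp add: algebra_simps power2_eq_square)
      moreover have "S\<^sup>2 \<ge> 11 * S" using True S3 by (simp add: power2_eq_square mult_right_mono)
      moreover have "S * S - 12 * S + 17 - (m - 3) \<ge> 0"
      proof -
        have "S * (S - 13) \<ge> - 22"
        proof (cases "S \<ge> 13")
          case False
          have "(S - 11) * (S - 2) \<ge> 0" using True by simp
          then show ?thesis by (simp add: algebra_simps)
        next
          case True
          then have "S * (S - 13) \<ge> 0" by simp
          then show ?thesis by linarith
        qed
        then show ?thesis using m_le by (simp add: algebra_simps)
      qed
      ultimately show ?thesis by (simp add: power2_eq_square)
    next
      case False
      then have "(s, t) \<in> {(10, 14), (10, 15)}" using \<open>regular_pair s t\<close>
        by (auto simp: regular_pair_def S_def)
      then show ?thesis by (auto simp: S_def m_def power2_eq_square)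
    qed
    have E: "m * (2 * S + m - 1) \<ge> 3 * (2 * S + 2)"
      using m3 S3 by (intro mult_mono) auto
    have Qpos: "Q > 0" and QN: "Q - 2 * N > 0"
    proof -
      have "m * (2 * S + m - 1) - 4 * m - 2 * S + 4 > 0"
      proof -
        define z where "z = m * (2 * S + m - 1)"
        have "z \<ge> 6 * S + 6" using E by (simp add: z_def)
        then have "z - 4 * m - 2 * S + 4 > 0" using m_le by linarith
        then show ?thesis by (simp add: z_def)
      qed
      then show "Q - 2 * N > 0" using id(7) by simp
      have "N \<ge> 0" using m3 S3 by (simp add: N_def)
      then show "Q > 0" using \<open>Q - 2 * N > 0\<close> by linarith
    qed
    have al: "alpha s t = N / Q"
      using True by (simp add: alpha_def Let_def N_def Q_def tS algebra_simps flip: S_def)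
    have e: "e = X / Q" using id(1) Qpos
      by (simp add: e_def edge_exp_def al field_simps flip: S_def)
    have a: "1 - alpha s t = Y / Q" using id(2) Qpos by (simp add: al field_simps)
    have "X > 0" using m3 S3 by (simp add: X_def add_pos_nonneg)
    then have r1: "0 < e" using Qpos by (simp add: e)
    have r2: "alpha s t < 1 / 2" using QN Qpos by (simp add: al field_simps)
    \<comment> \<open>The numerator is identically 0: in the regular case the space with a single
      long line costs exactly what is required, and the other space is compared with it through
      \<open>Phi\<close>.\<close>
    have d1: "e * (m * (2 * S + m - 1) / 2) - (m + (S - 2) * alpha s t)
        = (X * (m * (2 * S + m - 1) / 2) - m * Q - (S - 2) * N) / Q"
      using Qpos by (simp add: e al field_simps)
    then have r3: "m + (S - 2) * alpha s t \<le> e * (m * (2 * S + m - 1) / 2)" using id(3) by simp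
    have "(e * S * m + (m - 1) * (1 - alpha s t - e)) - e * (m * (2 * S + m - 1) / 2)
        = (m - 1) * (2 * Y - (m + 2) * X) / (2 * Q)"
      unfolding a using Qpos by (simp add: e field_simps)
    also have "\<dots> \<ge> 0" using id(4) Phi m2 Qpos by simp
    finally have r4: "m + (S - 2) * alpha s t \<le> e * S * m + (m - 1) * (1 - alpha s t - e)"
      using r3 by linarith
    have "(S + 1) * X - 2 * Y \<ge> 0"
    proof -
      have "(S - m) * (S + m - 2) \<ge> 0" using m2 S3 by simp
      then have "2 * m - m\<^sup>2 + S * (S - 2) \<ge> 0" by (simp add: algebra_simps power2_eq_square)
      then show ?thesis unfolding id(5) using S3 by (intro mult_nonneg_nonneg) auto
    qed
    then have r5: "2 * (1 - alpha s t) \<le> (S + 1) * e"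
      unfolding a e using Qpos by (simp add: divide_right_mono)
    have "m * ((2 * S - 3) * (S - 4 - m)) \<ge> 0" using m3 m_le S3 by simp
    moreover have "m * (11 * S - 17) \<ge> 3 * (11 * S - 17)" using m3 S3 by (intro mult_right_mono) auto
    ultimately have "Q - m * X \<ge> 0" unfolding id(6) using S3 by (simp add: algebra_simps power2_eq_square)
    then have r6: "m * e \<le> 1" using Qpos by (simp add: e)
    from r1 r2 r3 r4 r5 r6 show ?thesis by blast
  next
    case False
    define N where "N = (S - 2) * m * (S - 1) + S - 1"
    define Q where "Q = (2 * S - 3) * m * (S - 1) + S - m"
    define X where "X = S\<^sup>2 - 3 * S + 3 + (S - 2) * m"
    define Y where "Y = S * (S - 2) * m + 1"
    note id = exceptional_identity[where S = S and m = m, folded N_def Q_def X_def Y_def]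
    have cases: "t = s + 2 \<or> t = 2 * s - 1 \<or> t = 2 * s - 2 \<or> t = 2 * s - 3 \<or> s \<le> 10"
      using False st by (auto simp: regular_pair_def)
    \<comment> \<open>The opposite sign. On each of the four infinite families m is an explicit
      function of S and the value is visibly nonnegative; the remaining exceptional pairs have s at
      most 10 and are evaluated one by one.\<close>
    have Phi: "(S - 2) * m\<^sup>2 - (S\<^sup>2 - 3 * S + 1) * m + 2 * (S - 1) * (S - 2) \<ge> 0"
      using cases
    proof (elim disjE)
      assume "t = s + 2"
      then have "m = 2" by (simp add: m_def)
      then show ?thesis using S3 by (simp add: algebra_simps power2_eq_square)
    next
      assume "t = 2 * s - 1"
      then have m: "m = S - 1" using st by (simp add: m_def S_def of_nat_diff)
      have "(S - 2) * m\<^sup>2 - (S\<^sup>2 - 3 * S + 1) * m + 2 * (S - 1) * (S - 2) = (S - 1) * (2 * S - 3)"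
        unfolding m by (simp add: algebra_simps power2_eq_square)
      then show ?thesis using S3 by simp
    next
      assume "t = 2 * s - 2"
      then have m: "m = S - 2" using st by (simp add: m_def S_def of_nat_diff)
      have "(S - 2) * m\<^sup>2 - (S\<^sup>2 - 3 * S + 1) * m + 2 * (S - 1) * (S - 2) = (S - 2) * (S + 1)"
        unfolding m by (simp add: algebra_simps power2_eq_square)
      then show ?thesis using S3 by simp
    next
      assume "t = 2 * s - 3"
      then have m: "m = S - 3" using st by (simp add: m_def S_def of_nat_diff)
      have "(S - 2) * m\<^sup>2 - (S\<^sup>2 - 3 * S + 1) * m + 2 * (S - 1) * (S - 2) = 5 * S - 11"
        unfolding m by (simp add: algebra_simps power2_eq_square)
      then show ?thesis using S3 by simp
    next
      assume s10: "s \<le> 10"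
      have "s \<in> {3,4,5,6,7,8,9,10}" using s10 st by (simp, presburger)
      moreover have "t \<in> {5,6,7,8,9,10,11,12,13,14,15,16,17,18,19}"
        using s10 st by (simp, presburger)
      moreover have "(s, t) \<notin> {(10, 14), (10, 15)}" using False by (auto simp: regular_pair_def)
      ultimately show ?thesis using st
        unfolding S_def m_def power2_eq_square insert_iff empty_iff
        by (elim disjE FalseE) (simp_all)
    qed
    have mS: "(S - 2) * m \<ge> (S - 2) * 2" using m2 S3 by (intro mult_left_mono) auto
    have "(S - 1) * m - m - S + 2 > 0" using mS S3 by (simp add: algebra_simps)
    then have QN: "Q - 2 * N > 0" using id(7) by simp
    have "(S - 2) * m * (S - 1) \<ge> 0" using m2 S3 by simp
    then have "N \<ge> 0" using S3 by (simp add: N_def)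
    then have Qpos: "Q > 0" using QN by linarith
    have al: "alpha s t = N / Q"
      using False by (simp add: alpha_def Let_def N_def Q_def tS algebra_simps flip: S_def)
    have e: "e = X / Q" using id(1) Qpos
      by (simp add: e_def edge_exp_def al field_simps flip: S_def)
    have a: "1 - alpha s t = Y / Q" using id(2) Qpos by (simp add: al field_simps)
    have "X > 0"
    proof -
      have "S * (S - 3) \<ge> 0" using S3 by simp
      then have "S\<^sup>2 - 3 * S \<ge> 0" by (simp add: algebra_simps power2_eq_square)
      moreover have "(S - 2) * m \<ge> 0" using m2 S3 by simp
      ultimately show ?thesis unfolding X_def by linarith
    qed
    then have r1: "0 < e" using Qpos by (simp add: e)
    have r2: "alpha s t < 1 / 2" using QN Qpos by (simp add: al field_simps)
    \<comment> \<open>Now the space with two intersecting long lines is the tight one.\<close>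
    have d1: "e * S * m + (m - 1) * (1 - alpha s t - e) - (m + (S - 2) * alpha s t)
        = (X * S * m + (m - 1) * (Y - X) - m * Q - (S - 2) * N) / Q"
      unfolding a using Qpos by (simp add: e al field_simps)
    then have r4: "m + (S - 2) * alpha s t \<le> e * S * m + (m - 1) * (1 - alpha s t - e)"
      using id(3) by simp
    have "e * (m * (2 * S + m - 1) / 2) - (e * S * m + (m - 1) * (1 - alpha s t - e))
        = (m - 1) * ((m + 2) * X - 2 * Y) / (2 * Q)"
      unfolding a using Qpos by (simp add: e field_simps)
    also have "\<dots> \<ge> 0" using id(4) Phi m2 Qpos by simp
    finally have r3: "m + (S - 2) * alpha s t \<le> e * (m * (2 * S + m - 1) / 2)"
      using r4 by linarith
    have "m * ((S - 2) * (S - 1)) \<le> (S - 1) * ((S - 2) * (S - 1))"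
      using m2 S3 by (intro mult_right_mono) auto
    moreover have "S\<^sup>2 * (S - 2) + 1 - (S - 1) * ((S - 2) * (S - 1)) = (2 * S - 3) * (S - 1)"
      by (simp add: algebra_simps power2_eq_square)
    moreover have "(2 * S - 3) * (S - 1) \<ge> 0" using S3 by simp
    ultimately have "(S + 1) * X - 2 * Y \<ge> 0" unfolding id(5) by linarith
    then have r5: "2 * (1 - alpha s t) \<le> (S + 1) * e"
      unfolding a e using Qpos by (simp add: divide_right_mono)
    have "(m * (S - 2)) * (S - 1 - m) \<ge> 0" using m2 S3 by simp
    moreover have "m * (S - 3) \<ge> 0" using m2 S3 by simp
    ultimately have "Q - m * X \<ge> 0" unfolding id(6) using S3
      by (simp add: algebra_simps power2_eq_square)
    then have r6: "m * e \<le> 1" using Qpos by (simp add: e)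
    from r1 r2 r3 r4 r5 r6 show ?thesis by blast
  qed
  then show "0 < e" "alpha s t < 1 / 2"
    "m + (real s - 2) * alpha s t \<le> e * (m * (2 * real s + m - 1) / 2)"
    "m + (real s - 2) * alpha s t \<le> e * real s * m + (m - 1) * (1 - alpha s t - e)"
    "2 * (1 - alpha s t) \<le> (real s + 1) * e"
    "m * e \<le> 1"
    by (simp_all add: S_def)
qed

section \<open>Linear spaces with short lines\<close>

text \<open>Feasibility of a dual solution: a line with k points on the longest line and K points
  off it pays the price e for each crossing pair and \<mu> for each pair off the longest line, and
  this stays within its cost. The bound on \<mu> times \<open>min m (v - 1)\<close> is dictated by
  lines that meet the longest line and have as many points off it as possible.\<close>

lemma line_cost_le:
  fixes e a \<mu> :: real and v m k K :: nat
  assumes e: "0 < e" and mu: "0 \<le> \<mu>" "\<mu> \<le> e" "\<mu> * real (min m (v - 1)) \<le> 2 * (a - e)"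
    and K: "k \<le> 1" "2 \<le> k + K" "k + K \<le> v" "K \<le> m"
  shows "e * real k * real K + \<mu> * (real K * (real K - 1) / 2) \<le> e + (real (k + K) - 2) * a"
proof -
  have small: "\<mu> * (real K * (real K - 1) / 2) \<le> (real K - 1) * (a - e)"
    if "K \<le> min m (v - 1)" "K \<ge> 1"
  proof -
    have "\<mu> * real K \<le> \<mu> * real (min m (v - 1))"
      using that(1) mu(1) by (intro mult_left_mono) auto
    then have "\<mu> * real K \<le> 2 * (a - e)" using mu(3) by linarith
    then have "(real K - 1) * (\<mu> * real K) \<le> (real K - 1) * (2 * (a - e))"
      using that(2) by (intro mult_left_mono) auto
    then show ?thesis by (simp add: field_simps)
  qed
  have pairs: "\<mu> * (real K * (real K - 1) / 2) \<le> e + (real K - 2) * a"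
    if "e * (real K + 1) \<le> 2 * a" "K \<ge> 2"
  proof -
    have "\<mu> * (real K * (real K - 1) / 2) \<le> e * (real K * (real K - 1) / 2)"
      using mu(2) that(2) by (intro mult_right_mono) auto
    also have "\<dots> = e + (real K - 2) * (e * (real K + 1) / 2)" by (simp add: field_simps)
    also have "\<dots> \<le> e + (real K - 2) * a" using that
      by (intro add_left_mono mult_left_mono) auto
    finally show ?thesis .
  qed
  show ?thesis
  proof (cases "k = 1")
    case True
    with K have "K \<le> min m (v - 1)" "K \<ge> 1" by auto
    from small[OF this] True show ?thesis by (simp add: algebra_simps)
  next
    case False
    with K have k0: "k = 0" and K2: "K \<ge> 2" by auto
    \<comment> \<open>For a line that misses the longest line, either the price e is affordable for
      all of its pairs, or e is so large compared with a that the bound from the case k = 1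
      suffices.\<close>
    show ?thesis
    proof (cases "e * (real K + 1) \<le> 2 * a")
      case True
      from pairs[OF this K2] k0 show ?thesis by simp
    next
      case nle: False
      show ?thesis
      proof (cases "K \<le> min m (v - 1)")
        case True
        have "e * real K \<ge> a"
        proof -
          have "e * real K \<ge> e" using K2 e by simp
          then show ?thesis using nle by (simp add: algebra_simps)
        qed
        then have "(real K - 1) * (a - e) \<le> e + (real K - 2) * a" by (simp add: algebra_simps)
        moreover have "\<mu> * (real K * (real K - 1) / 2) \<le> (real K - 1) * (a - e)"
          using small[OF True] K2 by linarith
        ultimately have "\<mu> * (real K * (real K - 1) / 2) \<le> e + (real K - 2) * a" by linarith
        then show ?thesis using k0 by simp
      next
        case False
        \<comment> \<open>Only K = v escapes the bound for at most v - 1 points. There \<mu> is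
          controlled at v - 1 instead of v, and the failed inequality between e and a makes up for
          the difference.\<close>
        with K K2 k0 have "v = K" "min m (v - 1) = K - 1" by auto
        then have "\<mu> * (real K - 1) \<le> 2 * (a - e)" using mu(3) K2 by (simp add: of_nat_diff)
        then have "real K * (\<mu> * (real K - 1)) \<le> real K * (2 * (a - e))"
          by (intro mult_left_mono) auto
        then have "\<mu> * (real K * (real K - 1) / 2) \<le> real K * (a - e)" by (simp add: field_simps)
        also have "\<dots> \<le> e + (real K - 2) * a" using nle by (simp add: algebra_simps)
        finally show ?thesis using k0 by simp
      qed
    qed
  qed
qed

text \<open>When the longest line has v instead of S points, each of the two extremal inequalities
  changes by a product with the factor S - v. The other factor is nonnegative by \<open>F3\<close>
  in the first case and by t - v \<le> S - 1 in the second.\<close>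

lemma numeric_line_bounds:
  fixes e al S t v :: real
  assumes S3: "S \<ge> 3" and t: "S + 2 \<le> t" "t \<le> 2 * S - 1" and v: "2 \<le> v" "v \<le> S"
    and e: "0 < e" and al: "al < 1 / 2"
    and T1: "(t - S) + (S - 2) * al \<le> e * ((t - S) * (2 * S + (t - S) - 1) / 2)"
    and T2: "(t - S) + (S - 2) * al \<le> e * S * (t - S) + (t - S - 1) * (1 - al - e)"
    and F3: "2 * (1 - al) \<le> (S + 1) * e"
    and ae: "e \<le> 1 - al"
  shows "(t - v) + (v - 2) * al \<le> e * v * (t - v) + e * ((t - v) * (t - v - 1) / 2)"
    and "t - v \<le> S - 1 \<Longrightarrow>
      (t - v) + (v - 2) * al \<le> e * v * (t - v) + (t - v - 1) * (1 - al - e)"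
proof -
  have "(e * v * (t - v) + e * ((t - v) * (t - v - 1) / 2)) - ((t - v) + (v - 2) * al)
      = (e * ((t - S) * (2 * S + (t - S) - 1) / 2) - ((t - S) + (S - 2) * al))
        + (S - v) * (e * (S + v - 1) / 2 - (1 - al))"
    by (simp add: field_simps)
  moreover have "(S - v) * (e * (S + v - 1) / 2 - (1 - al)) \<ge> 0"
  proof -
    have "e * (S + 1) \<le> e * (S + v - 1)" using e v by (intro mult_left_mono) auto
    then have "2 * (1 - al) \<le> e * (S + v - 1)" using F3 by (simp add: mult.commute)
    then have "e * (S + v - 1) / 2 - (1 - al) \<ge> 0" by simp
    then show ?thesis using v by (intro mult_nonneg_nonneg) auto
  qed
  ultimately show "(t - v) + (v - 2) * al \<le> e * v * (t - v) + e * ((t - v) * (t - v - 1) / 2)"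
    using T1 by linarith
  assume le: "t - v \<le> S - 1"
  have "(e * v * (t - v) + (t - v - 1) * (1 - al - e)) - ((t - v) + (v - 2) * al)
      = (e * S * (t - S) + (t - S - 1) * (1 - al - e) - ((t - S) + (S - 2) * al))
        + (S - v) * (e * (S - 1 - (t - v)))"
    by (simp add: field_simps)
  moreover have "(S - v) * (e * (S - 1 - (t - v))) \<ge> 0"
    using v le e by (intro mult_nonneg_nonneg) auto
  ultimately show "(t - v) + (v - 2) * al \<le> e * v * (t - v) + (t - v - 1) * (1 - al - e)"
    using T2 by linarith
qed

text \<open>This is the regime in which the price \<mu> is limited by v - 1, because at least v
  points lie off the longest line. Either the second bound of \<open>numeric_line_bounds\<close>
  still applies, or \<open>F4\<close> and \<open>rel\<close> leave the single value v = t -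
  s.\<close>

lemma numeric_short_lines:
  fixes e al :: real and s t v :: nat
  assumes st: "s \<ge> 3" "s + 2 \<le> t" "t \<le> 2 * s - 1" and v: "3 \<le> v" "v \<le> t - v"
    and e: "0 < e" and al: "al < 1 / 2"
    and T1: "(real t - real s) + (real s - 2) * al
      \<le> e * ((real t - real s) * (2 * real s + (real t - real s) - 1) / 2)"
    and T2: "(real t - real s) + (real s - 2) * al
      \<le> e * real s * (real t - real s) + (real t - real s - 1) * (1 - al - e)"
    and F3: "2 * (1 - al) \<le> (real s + 1) * e"
    and F4: "(real t - real s) * e \<le> 1"
    and ae: "e \<le> 1 - al"
    and rel: "2 * (1 - al - e) < (real v - 1) * e"
  shows "(real t - real v) + (real v - 2) * al \<le> e * real v * (real t - real v)
      + (real t - real v) * (real t - real v - 1) * (1 - al - e) / (real v - 1)"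
proof -
  have vs: "v \<le> s" using v st by linarith
  have mv: "real t - real v \<ge> real v" using v by linarith
  have v3: "real v \<ge> 3" using v by simp
  define m where "m = real t - real v"
  define b where "b = 1 - al - e"
  have b0: "b \<ge> 0" using ae by (simp add: b_def)
  show ?thesis
  proof (cases "t - v \<le> s - 1")
    case True
    then have le: "real t - real v \<le> real s - 1" using st vs v by linarith
    have r: "real t \<le> 2 * real s - 1" "real s + 2 \<le> real t" "real s \<ge> 3" using st by linarith+
    have "m - 1 \<le> m * (m - 1) / (real v - 1)"
    proof -
      have "(m - 1) * (real v - 1) \<le> (m - 1) * m"
        using mv v3 by (intro mult_left_mono) (auto simp: m_def)
      then show ?thesis using v3 by (simp add: field_simps)
    qed
    then have "(m - 1) * b \<le> m * (m - 1) / (real v - 1) * b"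
      using b0 by (intro mult_right_mono) auto
    then have "(m - 1) * b \<le> m * (m - 1) * b / (real v - 1)" by simp
    moreover have "m + (real v - 2) * al \<le> e * real v * m + (m - 1) * b"
      using numeric_line_bounds(2)[OF r(3) r(2) r(1) _ _ e al T1 T2 F3 ae le] v vs
      by (simp add: m_def b_def)
    ultimately show ?thesis unfolding m_def[symmetric] b_def[symmetric] by linarith
  next
    case False
    then have ms: "t - v \<ge> s" by linarith
    \<comment> \<open>Otherwise \<open>rel\<close> and \<open>F4\<close> give 2(1 - al) < (v + 1)e
      \<le> 1, against al < 1/2.\<close>
    have "v + 1 > t - s"
    proof (rule ccontr)
      assume "\<not> v + 1 > t - s"
      then have "real v + 1 \<le> real t - real s" using st by linarith
      then have "(real v + 1) * e \<le> (real t - real s) * e" using e by (intro mult_right_mono) auto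
      then show False using F4 rel al by (simp add: algebra_simps)
    qed
    then have vt: "v = t - s" using ms st by linarith
    define u where "u = real v - 1"
    have tS: "real t - real s = u + 1" "real t - real v = real s" using vt st by (auto simp: u_def)
    have u2: "u \<ge> 2" "u \<le> real s - 2" using v3 vt st by (auto simp: u_def)
    \<comment> \<open>The right-hand side has 1 - al where the left has b = 1 - al - e, so e must be
      small. As t - s = v, \<open>F4\<close> gives e \<le> 1/4 for v \<ge> 4, and a factor 2 in
      front of b suffices; for v = 3 only e \<le> 1/3 is available, and the larger factor 4 is
      taken.\<close>
    have D: "(real s * (real s - 1) / u - u) * b \<ge> (real s - 1 - u) * (1 - al)"
    proof (cases "v = 3")
      case True
      then have u: "u = 2" by (simp add: u_def)
      have e3: "e \<le> 1 / 3" using F4 tS u by simp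
      have "(real s - 4) * (real s - 5) \<ge> 0"
      proof (cases "s \<ge> 5")
        case False
        then have "s = 4" using True vt st by linarith
        then show ?thesis by simp
      qed simp
      then have "4 * (real s - 3) \<le> real s * (real s - 1) / u - u"
        unfolding u by (simp add: field_simps)
      then have "4 * (real s - 3) * b \<le> (real s * (real s - 1) / u - u) * b"
        using b0 by (intro mult_right_mono) auto
      moreover have "(real s - 3) * (4 * b) \<ge> (real s - 3) * (1 - al)"
        using e3 al u2 u by (intro mult_left_mono) (auto simp: b_def)
      ultimately show ?thesis unfolding u by (simp add: algebra_simps)
    next
      case False
      then have "u + 1 \<ge> 4" using v by (simp add: u_def)
      then have "4 * e \<le> (u + 1) * e" using e by (intro mult_right_mono) auto
      then have e4: "4 * e \<le> 1" using F4 tS by simp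
      have "2 * (real s - 1 - u) * u \<le> (real s - 1 - u) * (real s - 1 + u)"
        using mult_left_mono[of "2 * u" "real s - 1 + u" "real s - 1 - u"] u2 by (simp add: mult_ac)
      also have "\<dots> \<le> real s * (real s - 1) - u * u" using st by (simp add: algebra_simps)
      finally have "2 * (real s - 1 - u) \<le> real s * (real s - 1) / u - u"
        using u2 by (simp add: field_simps)
      then have "2 * (real s - 1 - u) * b \<le> (real s * (real s - 1) / u - u) * b"
        using b0 by (intro mult_right_mono) auto
      moreover have "(real s - 1 - u) * (2 * b) \<ge> (real s - 1 - u) * (1 - al)"
        using e4 al u2 by (intro mult_left_mono) (auto simp: b_def)
      ultimately show ?thesis by (simp add: algebra_simps)
    qed
    have T2': "(u + 1) + (real s - 2) * al \<le> e * real s * (u + 1) + u * b"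
      using T2 unfolding tS b_def by simp
    have "e * (u + 1) * real s + real s * (real s - 1) * b / u - (real s + (u - 1) * al)
       = (e * real s * (u + 1) + u * b - ((u + 1) + (real s - 2) * al))
         + ((real s * (real s - 1) / u - u) * b - (real s - 1 - u) * (1 - al))"
      using u2 by (simp add: field_simps)
    then have "real s + (u - 1) * al \<le> e * (u + 1) * real s + real s * (real s - 1) * b / u"
      using T2' D by linarith
    then show ?thesis unfolding tS b_def[symmetric] by (simp add: u_def algebra_simps)
  qed
qed

section \<open>Linear spaces and the cost of their lines\<close>

definition linear_space :: "'a set \<Rightarrow> nat \<Rightarrow> 'a set set \<Rightarrow> bool" where
  "linear_space T s \<L> \<longleftrightarrow> (\<forall>l\<in>\<L>. l \<subseteq> T \<and> 2 \<le> card l \<and> card l \<le> s) \<and>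
     (\<forall>x\<in>T. \<forall>y\<in>T. x \<noteq> y \<longrightarrow> (\<exists>!l. l \<in> \<L> \<and> x \<in> l \<and> y \<in> l))"

lemma linear_space_finite: "linear_space T s \<L> \<Longrightarrow> finite T \<Longrightarrow> finite \<L>"
  by (rule finite_subset[of _ "Pow T"]) (auto simp: linear_space_def)

lemma linear_space_inter:
  assumes "linear_space T s \<L>" "finite T" "l \<in> \<L>" "l' \<in> \<L>" "l \<noteq> l'"
  shows "card (l \<inter> l') \<le> 1"
proof (rule ccontr)
  assume "\<not> card (l \<inter> l') \<le> 1"
  moreover have "finite (l \<inter> l')" using calculation by (intro card_ge_0_finite) simp
  ultimately obtain x y where "x \<in> l \<inter> l'" "y \<in> l \<inter> l'" "x \<noteq> y"
    using card_le_Suc0_iff_eq[of "l \<inter> l'"] by auto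
  then show False using assms unfolding linear_space_def by (metis IntE subsetD)
qed

text \<open>Lines partition the ordered pairs of distinct points, so any count of pairs between two
  sets splits over the lines.\<close>

lemma linear_space_pairs:
  assumes ls: "linear_space T s \<L>" "finite T" and BC: "B \<subseteq> T" "C \<subseteq> T"
  shows "card {(x, y). x \<in> B \<and> y \<in> C \<and> x \<noteq> y}
    = (\<Sum>l\<in>\<L>. card {(x, y). x \<in> l \<inter> B \<and> y \<in> l \<inter> C \<and> x \<noteq> y})"
proof -
  have fin: "finite B" "finite C" using BC ls(2) finite_subset by auto
  have "{(x, y). x \<in> B \<and> y \<in> C \<and> x \<noteq> y}
      = (\<Union>l\<in>\<L>. {(x, y). x \<in> l \<inter> B \<and> y \<in> l \<inter> C \<and> x \<noteq> y})"
    using ls(1) BC unfolding linear_space_def by blast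
  also have "card \<dots> = (\<Sum>l\<in>\<L>. card {(x, y). x \<in> l \<inter> B \<and> y \<in> l \<inter> C \<and> x \<noteq> y})"
  proof (rule card_UN_disjoint)
    show "finite \<L>" using linear_space_finite[OF ls] .
    show "\<forall>l\<in>\<L>. finite {(x, y). x \<in> l \<inter> B \<and> y \<in> l \<inter> C \<and> x \<noteq> y}"
      by (intro ballI finite_subset[OF _ finite_cartesian_product[OF fin]]) auto
    show "\<forall>i\<in>\<L>. \<forall>j\<in>\<L>. i \<noteq> j \<longrightarrow> {(x, y). x \<in> i \<inter> B \<and> y \<in> i \<inter> C \<and> x \<noteq> y} \<inter>
        {(x, y). x \<in> j \<inter> B \<and> y \<in> j \<inter> C \<and> x \<noteq> y} = {}"
      using ls(1) BC unfolding linear_space_def by blast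
  qed
  finally show ?thesis .
qed

lemma card_distinct_pairs:
  assumes "finite B"
  shows "card {(x, y). x \<in> B \<and> y \<in> B \<and> x \<noteq> y} = card B * (card B - 1)"
proof -
  have "{(x, y). x \<in> B \<and> y \<in> B \<and> x \<noteq> y} = (SIGMA x:B. B - {x})" by auto
  then show ?thesis using assms by (simp add: card_Diff_singleton)
qed

lemma card_disjoint_pairs:
  assumes "B \<inter> C = {}"
  shows "card {(x, y). x \<in> B \<and> y \<in> C \<and> x \<noteq> y} = card B * card C"
proof -
  have "{(x, y). x \<in> B \<and> y \<in> C \<and> x \<noteq> y} = B \<times> C" using assms by auto
  then show ?thesis by (simp add: card_cartesian_product)
qed

text \<open>A summand is the exponent lost by asking for a block through all points of a line, since
  M p^k is about n^(-e - (k - 2)a). The inequality says that a linear space on t points is expected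
  no more often than a pair in a common block, whose exponent is 2 - e. The proof is linear
  programming duality: fix a longest line A with v points; every other line meets A at most once,
  and the other lines share out the crossing pairs and the pairs off A, to which prices e and \<mu>
  are attached.\<close>

lemma linear_space_cost:
  fixes T :: "'a set" and s t :: nat
  assumes st: "s \<ge> 3" "s + 2 \<le> t" "t \<le> 2 * s - 1"
    and ls: "linear_space T s \<L>" "finite T" "card T = t"
  defines "e \<equiv> edge_exp s t" and "a \<equiv> 1 - alpha s t"
  shows "real t - 2 + e \<le> (\<Sum>l\<in>\<L>. e + (real (card l) - 2) * a)"
proof -
  note facts = exponent_facts[OF st, folded e_def]
  define al where "al = alpha s t"
  have al: "al < 1 / 2" and e0: "0 < e" using facts by (auto simp: al_def)
  have ae: "e \<le> 1 - al"
  proof -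
    have "(2 * real s - 3) * al \<le> (2 * real s - 3) * (1 / 2)"
      using al st by (intro mult_left_mono) auto
    then have "e \<le> 1 / 2" by (simp add: e_def edge_exp_def al_def algebra_simps)
    then show ?thesis using al by simp
  qed
  have fL: "finite \<L>" using linear_space_finite[OF ls(1,2)] .
  obtain x y where xy: "x \<in> T" "y \<in> T" "x \<noteq> y"
  proof -
    have "\<not> card T \<le> Suc 0" using ls(3) st by simp
    then show ?thesis using that card_le_Suc0_iff_eq[OF ls(2)] by blast
  qed
  then have "\<L> \<noteq> {}" using ls(1) unfolding linear_space_def by blast
  then obtain A where A: "A \<in> \<L>" "\<And>l. l \<in> \<L> \<Longrightarrow> card l \<le> card A"
  proof -
    have "Max (card ` \<L>) \<in> card ` \<L>" using fL \<open>\<L> \<noteq> {}\<close> by (intro Max_in) auto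
    then obtain A where "A \<in> \<L>" "card A = Max (card ` \<L>)" by auto
    then show ?thesis using that[of A] fL by simp
  qed
  define v where "v = card A"
  define Z where "Z = T - A"
  define m where "m = card Z"
  have AT: "A \<subseteq> T" "2 \<le> v" "v \<le> s" using A(1) ls(1) by (auto simp: linear_space_def v_def)
  have fA: "finite A" using AT ls(2) finite_subset by auto
  have mt: "m = t - v" using AT ls fA by (simp add: m_def Z_def v_def card_Diff_subset)
  have tv: "real t = real v + real m" using mt AT st by simp
  have fZ: "finite Z" using ls(2) by (simp add: Z_def)
  have cross: "real v * real m = (\<Sum>l\<in>\<L> - {A}. real (card (l \<inter> A)) * real (card (l \<inter> Z)))"
  proof -
    have "v * m = card {(x, y). x \<in> A \<and> y \<in> Z \<and> x \<noteq> y}"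
      unfolding v_def m_def by (rule card_disjoint_pairs[symmetric]) (auto simp: Z_def)
    also have "\<dots> = (\<Sum>l\<in>\<L>. card {(x, y). x \<in> l \<inter> A \<and> y \<in> l \<inter> Z \<and> x \<noteq> y})"
      by (rule linear_space_pairs[OF ls(1,2)]) (use AT in \<open>auto simp: Z_def\<close>)
    also have "\<dots> = (\<Sum>l\<in>\<L>. card (l \<inter> A) * card (l \<inter> Z))"
      by (intro sum.cong refl card_disjoint_pairs) (auto simp: Z_def)
    also have "\<dots> = (\<Sum>l\<in>\<L> - {A}. card (l \<inter> A) * card (l \<inter> Z))"
      using A(1) fL by (subst sum.remove[of _ A]) (auto simp: Z_def)
    finally have "real (v * m) = real (\<Sum>l\<in>\<L> - {A}. card (l \<inter> A) * card (l \<inter> Z))" by simp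
    then show ?thesis by simp
  qed
  have inner: "real m * (real m - 1)
      = (\<Sum>l\<in>\<L> - {A}. real (card (l \<inter> Z)) * (real (card (l \<inter> Z)) - 1))"
  proof -
    have "m * (m - 1) = card {(x, y). x \<in> Z \<and> y \<in> Z \<and> x \<noteq> y}"
      unfolding m_def by (rule card_distinct_pairs[symmetric]) (use fZ in auto)
    also have "\<dots> = (\<Sum>l\<in>\<L>. card {(x, y). x \<in> l \<inter> Z \<and> y \<in> l \<inter> Z \<and> x \<noteq> y})"
      by (rule linear_space_pairs[OF ls(1,2)]) (auto simp: Z_def)
    also have "\<dots> = (\<Sum>l\<in>\<L>. card (l \<inter> Z) * (card (l \<inter> Z) - 1))"
      by (intro sum.cong refl card_distinct_pairs) (use fZ in auto)
    also have "\<dots> = (\<Sum>l\<in>\<L> - {A}. card (l \<inter> Z) * (card (l \<inter> Z) - 1))"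
      using A(1) fL by (subst sum.remove[of _ A]) (auto simp: Z_def)
    finally have "real (m * (m - 1)) = (\<Sum>l\<in>\<L> - {A}. real (card (l \<inter> Z) * (card (l \<inter> Z) - 1)))"
      by simp
    moreover have k: "real (k * (k - 1)) = real k * (real k - 1)" for k by (cases k) (auto simp: algebra_simps)
    ultimately show ?thesis by (simp only: k)
  qed
  have split: "card l = card (l \<inter> A) + card (l \<inter> Z)" "card (l \<inter> A) \<le> 1" "card (l \<inter> Z) \<le> m"
    "2 \<le> card l" "card l \<le> v" if "l \<in> \<L> - {A}" for l
  proof -
    have "l \<subseteq> T" using that ls(1) by (auto simp: linear_space_def)
    then have "l = (l \<inter> A) \<union> (l \<inter> Z)" "finite l" using ls(2) finite_subset by (auto simp: Z_def)
    moreover have "card ((l \<inter> A) \<union> (l \<inter> Z)) = card (l \<inter> A) + card (l \<inter> Z)"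
      using calculation(2) by (intro card_Un_disjoint) (auto simp: Z_def)
    ultimately show "card l = card (l \<inter> A) + card (l \<inter> Z)" by simp
    show "card (l \<inter> A) \<le> 1" using linear_space_inter[OF ls(1,2)] that A(1) by auto
    show "card (l \<inter> Z) \<le> m" unfolding m_def by (intro card_mono fZ) auto
    show "2 \<le> card l" using that ls(1) by (auto simp: linear_space_def)
    show "card l \<le> v" using that A(2) by (auto simp: v_def)
  qed
  \<comment> \<open>The duality step for a given price \<mu>: every line can pay for its pairs, and
    all pairs together are worth enough.\<close>
  have key: "real m + (real v - 2) * al \<le> e * (real v * real m) + \<mu> * (real m * (real m - 1) / 2) \<Longrightarrow>
      (\<And>l. l \<in> \<L> - {A} \<Longrightarrow> e * real (card (l \<inter> A)) * real (card (l \<inter> Z))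
         + \<mu> * (real (card (l \<inter> Z)) * (real (card (l \<inter> Z)) - 1) / 2) \<le> e + (real (card l) - 2) * a)
      \<Longrightarrow> ?thesis" for \<mu>
  proof -
    assume num: "real m + (real v - 2) * al
        \<le> e * (real v * real m) + \<mu> * (real m * (real m - 1) / 2)"
      and line: "\<And>l. l \<in> \<L> - {A} \<Longrightarrow> e * real (card (l \<inter> A)) * real (card (l \<inter> Z))
         + \<mu> * (real (card (l \<inter> Z)) * (real (card (l \<inter> Z)) - 1) / 2) \<le> e + (real (card l) - 2) * a"
    have "e * (real v * real m) + \<mu> * (real m * (real m - 1) / 2)
        = (\<Sum>l\<in>\<L> - {A}. e * real (card (l \<inter> A)) * real (card (l \<inter> Z))
           + \<mu> * (real (card (l \<inter> Z)) * (real (card (l \<inter> Z)) - 1) / 2))"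
      unfolding cross inner by (simp add: sum.distrib sum_distrib_left sum_divide_distrib mult.assoc)
    also have "\<dots> \<le> (\<Sum>l\<in>\<L> - {A}. e + (real (card l) - 2) * a)"
      by (intro sum_mono line)
    finally have "real m + (real v - 2) * al \<le> (\<Sum>l\<in>\<L> - {A}. e + (real (card l) - 2) * a)"
      using num by linarith
    moreover have "(\<Sum>l\<in>\<L>. e + (real (card l) - 2) * a)
        = e + (real v - 2) * a + (\<Sum>l\<in>\<L> - {A}. e + (real (card l) - 2) * a)"
      using A(1) fL by (subst sum.remove[of _ A]) (auto simp: v_def)
    ultimately show ?thesis unfolding tv a_def al_def by (simp add: algebra_simps)
  qed
  have r: "real t \<le> 2 * real s - 1" "real s + 2 \<le> real t" "real s \<ge> 3" "2 \<le> real v" "real v \<le> real s"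
    using st AT by linarith+
  note B = numeric_line_bounds[OF r(3) r(2) r(1) r(4,5) e0 al facts(3,4,5)[folded al_def] ae]
  have b1: "real m + (real v - 2) * al \<le> e * (real v * real m) + e * (real m * (real m - 1) / 2)"
    using B(1) unfolding tv by (simp add: mult.assoc)
  show ?thesis
  proof (cases "v = 2")
    case True
    show ?thesis
    proof (rule key[of e, OF b1])
      fix l assume l: "l \<in> \<L> - {A}"
      have "card l = 2" using split(4,5)[OF l] True by simp
      then have "(card (l \<inter> A) = 1 \<and> card (l \<inter> Z) = 1) \<or> (card (l \<inter> A) = 0 \<and> card (l \<inter> Z) = 2)"
        using split(1,2)[OF l] by linarith
      then show "e * real (card (l \<inter> A)) * real (card (l \<inter> Z))
         + e * (real (card (l \<inter> Z)) * (real (card (l \<inter> Z)) - 1) / 2) \<le> e + (real (card l) - 2) * a"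
        using \<open>card l = 2\<close> by auto
    qed
  next
    case False
    then have v3: "v \<ge> 3" using AT by simp
    have m2: "m \<ge> 2" using mt AT st by linarith
    define h where "h = min m (v - 1)"
    have h: "real h > 0" using v3 m2 by (simp add: h_def)
    \<comment> \<open>The largest price that \<open>line_cost_le\<close> admits. According to
      whether the minimum is e, or h is m, or h is v - 1, the numerical inequality needed is one of
      three: the two of \<open>numeric_line_bounds\<close> and that of
      \<open>numeric_short_lines\<close>.\<close>
    define \<mu> where "\<mu> = min e (2 * (a - e) / real h)"
    have mu: "0 \<le> \<mu>" "\<mu> \<le> e" using ae e0 by (auto simp: \<mu>_def a_def al_def)
    have "\<mu> * real h \<le> 2 * (a - e) / real h * real h"
      unfolding \<mu>_def by (intro mult_right_mono) auto
    then have mu3: "\<mu> * real h \<le> 2 * (a - e)" using h by simp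
    show ?thesis
    proof (rule key[of \<mu>])
      fix l assume l: "l \<in> \<L> - {A}"
      show "e * real (card (l \<inter> A)) * real (card (l \<inter> Z))
         + \<mu> * (real (card (l \<inter> Z)) * (real (card (l \<inter> Z)) - 1) / 2) \<le> e + (real (card l) - 2) * a"
        unfolding split(1)[OF l]
        by (rule line_cost_le[OF e0 mu mu3[unfolded h_def]]) (use split[OF l] in auto)
    next
      show "real m + (real v - 2) * al \<le> e * (real v * real m) + \<mu> * (real m * (real m - 1) / 2)"
      proof (cases "e \<le> 2 * (a - e) / real h")
        case True
        then have "\<mu> = e" by (simp add: \<mu>_def)
        then show ?thesis using b1 by simp
      next
        case nle: False
        then have mu_eq: "\<mu> = 2 * (a - e) / real h" by (simp add: \<mu>_def)
        show ?thesis
        proof (cases "m \<le> v - 1")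
          case True
          then have hm: "h = m" by (simp add: h_def)
          have "real t - real v \<le> real s - 1" using True tv AT v3 by linarith
          from B(2)[OF this] have "real m + (real v - 2) * al
              \<le> e * real v * real m + (real m - 1) * (1 - al - e)" unfolding tv by simp
          moreover have "\<mu> * (real m * (real m - 1) / 2) = (real m - 1) * (1 - al - e)"
            using m2 unfolding mu_eq hm a_def al_def by (simp add: field_simps)
          ultimately show ?thesis by (simp only: mult.assoc)
        next
          case False
          then have hm: "h = v - 1" and vm: "v \<le> t - v" using mt by (auto simp: h_def)
          have hr: "real h = real v - 1" using hm v3 by simp
          have "2 * (1 - al - e) < (real v - 1) * e"
            using nle h unfolding hr a_def al_def by (simp add: field_simps)
          from numeric_short_lines[OF st v3 vm e0 al facts(3,4,5,6)[folded al_def] ae this]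
          have "real m + (real v - 2) * al
              \<le> e * real v * real m + real m * (real m - 1) * (1 - al - e) / (real v - 1)"
            unfolding tv by simp
          moreover have "\<mu> * (real m * (real m - 1) / 2)
              = real m * (real m - 1) * (1 - al - e) / (real v - 1)"
          proof -
            have "2 * c / y * (z / 2) = z * c / y" for c y z :: real by simp
            then show ?thesis unfolding mu_eq hr a_def al_def .
          qed
          ultimately show ?thesis by (simp only: mult.assoc)
        qed
      qed
    qed
  qed
qed

section \<open>Chains of certificates\<close>

text \<open>\<open>C c\<close> is the set of incidences that \<open>c\<close> needs and
  \<open>U\<close> what earlier members have already exposed. The condition \<open>ok U c\<close>
  will be either that \<open>c\<close> needs something new or no condition at all.\<close>

fun chain :: "('c \<Rightarrow> 'x set) \<Rightarrow> ('x set \<Rightarrow> 'c \<Rightarrow> bool) \<Rightarrow> 'c set \<Rightarrow> 'x set \<Rightarrow> 'c list \<Rightarrow> bool" where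
  "chain C ok F U [] = True"
| "chain C ok F U (c # cs) = (c \<in> F \<and> ok U c \<and> chain C ok F (U \<union> C c) cs)"

lemma chain_set: "chain C ok F U cs \<Longrightarrow> set cs \<subseteq> F"
  by (induction cs arbitrary: U) auto

lemma chain_snoc:
  "chain C ok F U (cs @ [c]) \<longleftrightarrow> chain C ok F U cs \<and> c \<in> F \<and> ok (U \<union> (\<Union>x\<in>set cs. C x)) c"
  by (induction cs arbitrary: U) (auto simp: Un_assoc)

lemma finite_chains: "finite F \<Longrightarrow> finite {cs. length cs = k \<and> chain C ok F U cs}"
  by (rule finite_subset[OF _ finite_lists_length_eq[of F k]]) (auto dest: chain_set)

text \<open>The exponent of p counts each incidence at the first member that needs it, so the sum
  can be taken over one member at a time, each contributing at most \<nu>. Since \<nu> depends on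
  how much has been exposed, the size of \<open>U\<close> has to stay below d N throughout.\<close>

lemma chain_sum:
  fixes p \<nu> :: real
  assumes F: "finite F" and C: "\<And>c. c \<in> F \<Longrightarrow> finite (C c) \<and> card (C c) \<le> d"
    and p: "0 \<le> p" and nu: "0 \<le> \<nu>"
    and bound: "\<And>U. finite U \<Longrightarrow> card U \<le> d * N \<Longrightarrow> (\<Sum>c\<in>{c\<in>F. ok U c}. p ^ card (C c - U)) \<le> \<nu>"
  shows "finite U \<Longrightarrow> card U + d * k \<le> d * N \<Longrightarrow>
    (\<Sum>cs\<in>{cs. length cs = k \<and> chain C ok F U cs}. p ^ card ((\<Union>c\<in>set cs. C c) - U)) \<le> \<nu> ^ k"
proof (induction k arbitrary: U)
  case 0
  have "{cs. cs = [] \<and> chain C ok F U cs} = {[]}" by auto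
  then show ?case by simp
next
  case (Suc k)
  let ?G = "\<lambda>c. {cs. length cs = k \<and> chain C ok F (U \<union> C c) cs}"
  let ?B = "{c\<in>F. ok U c}"
  have eq: "{cs. length cs = Suc k \<and> chain C ok F U cs} = (\<lambda>(c, cs). c # cs) ` (SIGMA c:?B. ?G c)"
    by (auto simp: image_iff length_Suc_conv)
  have inj: "inj_on (\<lambda>(c, cs). c # cs) (SIGMA c:?B. ?G c)" by (auto simp: inj_on_def)
  have "(\<Sum>cs\<in>{cs. length cs = Suc k \<and> chain C ok F U cs}. p ^ card ((\<Union>c\<in>set cs. C c) - U))
      = (\<Sum>(c, cs)\<in>(SIGMA c:?B. ?G c). p ^ card ((C c \<union> (\<Union>c\<in>set cs. C c)) - U))"
    unfolding eq by (subst sum.reindex[OF inj]) (simp add: case_prod_unfold)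
  also have "\<dots> = (\<Sum>c\<in>?B. \<Sum>cs\<in>?G c. p ^ card ((C c \<union> (\<Union>c\<in>set cs. C c)) - U))"
    using F finite_chains[OF F] by (subst sum.Sigma) auto
  also have "\<dots> = (\<Sum>c\<in>?B. \<Sum>cs\<in>?G c. p ^ card (C c - U) * p ^ card ((\<Union>c\<in>set cs. C c) - (U \<union> C c)))"
  proof (intro sum.cong refl)
    fix c cs assume c: "c \<in> ?B" and cs: "cs \<in> ?G c"
    have fin: "finite (\<Union>c\<in>set cs. C c)" using C cs chain_set by fastforce
    have "(C c \<union> (\<Union>c\<in>set cs. C c)) - U = (C c - U) \<union> ((\<Union>c\<in>set cs. C c) - (U \<union> C c))" by auto
    then have "card ((C c \<union> (\<Union>c\<in>set cs. C c)) - U)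
        = card (C c - U) + card ((\<Union>c\<in>set cs. C c) - (U \<union> C c))"
      using C c fin by (simp add: card_Un_disjoint Int_Diff Diff_Int_distrib2 Int_commute disjoint_iff)
    then show "p ^ card ((C c \<union> (\<Union>c\<in>set cs. C c)) - U)
        = p ^ card (C c - U) * p ^ card ((\<Union>c\<in>set cs. C c) - (U \<union> C c))"
      by (simp add: power_add)
  qed
  also have "\<dots> = (\<Sum>c\<in>?B. p ^ card (C c - U) * (\<Sum>cs\<in>?G c. p ^ card ((\<Union>c\<in>set cs. C c) - (U \<union> C c))))"
    by (simp add: sum_distrib_left)
  also have "\<dots> \<le> (\<Sum>c\<in>?B. p ^ card (C c - U) * \<nu> ^ k)"
  proof (intro sum_mono mult_left_mono)
    fix c assume c: "c \<in> ?B"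
    have "card (U \<union> C c) \<le> card U + d" using C c card_Un_le[of U "C c"]
      by (metis (no_types, lifting) CollectD add_left_mono order_trans)
    then show "(\<Sum>cs\<in>?G c. p ^ card ((\<Union>c\<in>set cs. C c) - (U \<union> C c))) \<le> \<nu> ^ k"
      using C c Suc.prems by (intro Suc.IH) auto
  qed (use p in auto)
  also have "\<dots> = (\<Sum>c\<in>?B. p ^ card (C c - U)) * \<nu> ^ k" by (simp add: sum_distrib_right)
  also have "\<dots> \<le> \<nu> * \<nu> ^ k"
    using Suc.prems nu by (intro mult_right_mono bound) auto
  finally show ?case by simp
qed

section \<open>Moment bounds for random incidences\<close>

text \<open>Markov's inequality for the number of events \<open>B c\<close> that occur, in
  multiplied-out form.\<close>

lemma weighted_count_prob:
  fixes \<Omega> :: "'w pmf"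
  assumes "finite S" and r: "0 \<le> r" and ge: "\<And>\<omega>. \<omega> \<in> A \<Longrightarrow> r \<le> real (card {c\<in>S. \<omega> \<in> B c})"
  shows "r * measure_pmf.prob \<Omega> A \<le> (\<Sum>c\<in>S. measure_pmf.prob \<Omega> (B c))"
proof -
  have "r * measure_pmf.prob \<Omega> A = measure_pmf.expectation \<Omega> (\<lambda>\<omega>. r * indicator A \<omega>)"
    by simp
  also have "\<dots> \<le> measure_pmf.expectation \<Omega> (\<lambda>\<omega>. \<Sum>c\<in>S. indicator (B c) \<omega>)"
  proof (rule integral_mono)
    show "integrable \<Omega> (\<lambda>\<omega>. r * indicat_real A \<omega>)"
      by (intro integrable_mult_right measure_pmf.integrable_const_bound[where B=1]) auto
    show "integrable \<Omega> (\<lambda>\<omega>. \<Sum>c\<in>S. indicat_real (B c) \<omega>)"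
      by (intro Bochner_Integration.integrable_sum measure_pmf.integrable_const_bound[where B=1]) auto
    fix \<omega>
    have "(\<Sum>c\<in>S. indicat_real (B c) \<omega>) = real (card {c\<in>S. \<omega> \<in> B c})"
      using assms(1) by (simp add: indicator_def sum.If_cases Int_def)
    then show "r * indicat_real A \<omega> \<le> (\<Sum>c\<in>S. indicat_real (B c) \<omega>)"
      using ge[of \<omega>] by (auto simp: indicator_def)
  qed
  also have "\<dots> = (\<Sum>c\<in>S. measure_pmf.prob \<Omega> (B c))"
    by (subst Bochner_Integration.integral_sum)
       (auto intro!: measure_pmf.integrable_const_bound[where B=1])
  finally show ?thesis .
qed

locale random_incidence =
  fixes \<Omega> :: "'w pmf" and I :: "'w \<Rightarrow> 'x set" and X0 :: "'x set" and p :: real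
  assumes p01: "0 \<le> p" and fin_X0: "finite X0"
    and prob_incidence: "R \<subseteq> X0 \<Longrightarrow> measure_pmf.prob \<Omega> {\<omega>. R \<subseteq> I \<omega>} \<le> p ^ card R"
begin

lemma prob_long_chain:
  assumes F: "finite F" and C: "\<And>c. c \<in> F \<Longrightarrow> C c \<subseteq> X0 \<and> card (C c) \<le> d" and nu: "0 \<le> \<nu>"
    and bound: "\<And>U. finite U \<Longrightarrow> card U \<le> d * k \<Longrightarrow> (\<Sum>c\<in>{c\<in>F. ok U c}. p ^ card (C c - U)) \<le> \<nu>"
  shows "measure_pmf.prob \<Omega> {\<omega>. \<exists>cs. length cs = k \<and> chain C ok F {} cs \<and> (\<Union>c\<in>set cs. C c) \<subseteq> I \<omega>}
    \<le> \<nu> ^ k"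
proof -
  let ?S = "{cs. length cs = k \<and> chain C ok F {} cs}"
  let ?A = "{\<omega>. \<exists>cs. length cs = k \<and> chain C ok F {} cs \<and> (\<Union>c\<in>set cs. C c) \<subseteq> I \<omega>}"
  have C': "finite (C c) \<and> card (C c) \<le> d" if "c \<in> F" for c
    using C[OF that] fin_X0 finite_subset by auto
  have "1 * measure_pmf.prob \<Omega> ?A \<le> (\<Sum>cs\<in>?S. measure_pmf.prob \<Omega> {\<omega>. (\<Union>c\<in>set cs. C c) \<subseteq> I \<omega>})"
  proof (rule weighted_count_prob[OF finite_chains[OF F]])
    fix \<omega> assume "\<omega> \<in> ?A"
    then have "{cs\<in>?S. \<omega> \<in> {\<omega>. (\<Union>c\<in>set cs. C c) \<subseteq> I \<omega>}} \<noteq> {}" by auto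
    moreover have "finite {cs\<in>?S. \<omega> \<in> {\<omega>. (\<Union>c\<in>set cs. C c) \<subseteq> I \<omega>}}"
      by (rule finite_subset[OF _ finite_chains[OF F, of k C ok "{}"]]) auto
    ultimately have "card {cs\<in>?S. \<omega> \<in> {\<omega>. (\<Union>c\<in>set cs. C c) \<subseteq> I \<omega>}} > 0"
      by (simp add: card_gt_0_iff)
    then show "1 \<le> real (card {cs\<in>?S. \<omega> \<in> {\<omega>. (\<Union>c\<in>set cs. C c) \<subseteq> I \<omega>}})" by simp
  qed simp
  also have "\<dots> \<le> (\<Sum>cs\<in>?S. p ^ card ((\<Union>c\<in>set cs. C c) - {}))"
  proof (intro sum_mono)
    fix cs assume "cs \<in> ?S"
    then have "(\<Union>c\<in>set cs. C c) \<subseteq> X0" using C chain_set by fastforce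
    then show "measure_pmf.prob \<Omega> {\<omega>. (\<Union>c\<in>set cs. C c) \<subseteq> I \<omega>} \<le> p ^ card ((\<Union>c\<in>set cs. C c) - {})"
      using prob_incidence by simp
  qed
  also have "\<dots> \<le> \<nu> ^ k"
    by (rule chain_sum[OF F C' p01 nu bound]) auto
  finally show ?thesis by simp
qed

text \<open>The k-th moment method: the k-th power of the count is the number of k-tuples of present
  members, repetitions included, and these are the chains without any condition. Overlaps are
  covered because \<open>bound\<close> measures weights relative to an arbitrary exposed set
  U.\<close>

lemma prob_large_count:
  assumes F: "finite F" and C: "\<And>c. c \<in> F \<Longrightarrow> C c \<subseteq> X0 \<and> card (C c) \<le> d" and nu: "0 \<le> \<nu>"
    and bound: "\<And>U. finite U \<Longrightarrow> card U \<le> d * k \<Longrightarrow> (\<Sum>c\<in>F. p ^ card (C c - U)) \<le> \<nu>"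
    and l: "0 < l"
  shows "measure_pmf.prob \<Omega> {\<omega>. l \<le> real (card {c\<in>F. C c \<subseteq> I \<omega>})} \<le> (\<nu> / l) ^ k"
proof -
  let ?ok = "\<lambda>U c. True"
  let ?S = "{cs. length cs = k \<and> chain C ?ok F {} cs}"
  have chain_iff: "chain C ?ok F U cs \<longleftrightarrow> set cs \<subseteq> F" for U cs
    by (induction cs arbitrary: U) auto
  let ?A = "{\<omega>. l \<le> real (card {c\<in>F. C c \<subseteq> I \<omega>})}"
  have C': "finite (C c) \<and> card (C c) \<le> d" if "c \<in> F" for c
    using C[OF that] fin_X0 finite_subset by auto
  have "l ^ k * measure_pmf.prob \<Omega> ?A \<le> (\<Sum>cs\<in>?S. measure_pmf.prob \<Omega> {\<omega>. (\<Union>c\<in>set cs. C c) \<subseteq> I \<omega>})"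
  proof (rule weighted_count_prob[OF finite_chains[OF F]])
    fix \<omega> assume w: "\<omega> \<in> ?A"
    have "{cs\<in>?S. \<omega> \<in> {\<omega>. (\<Union>c\<in>set cs. C c) \<subseteq> I \<omega>}} = {cs. set cs \<subseteq> {c\<in>F. C c \<subseteq> I \<omega>} \<and> length cs = k}"
      by (auto simp: chain_iff)
    then have "card {cs\<in>?S. \<omega> \<in> {\<omega>. (\<Union>c\<in>set cs. C c) \<subseteq> I \<omega>}} = card {c\<in>F. C c \<subseteq> I \<omega>} ^ k"
      using F by (simp add: card_lists_length_eq)
    then show "l ^ k \<le> real (card {cs\<in>?S. \<omega> \<in> {\<omega>. (\<Union>c\<in>set cs. C c) \<subseteq> I \<omega>}})"
      using w l by (simp add: power_mono)
  qed (use l in simp)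
  also have "\<dots> \<le> (\<Sum>cs\<in>?S. p ^ card ((\<Union>c\<in>set cs. C c) - {}))"
  proof (intro sum_mono)
    fix cs assume "cs \<in> ?S"
    then have "(\<Union>c\<in>set cs. C c) \<subseteq> X0" using C chain_set by fastforce
    then show "measure_pmf.prob \<Omega> {\<omega>. (\<Union>c\<in>set cs. C c) \<subseteq> I \<omega>} \<le> p ^ card ((\<Union>c\<in>set cs. C c) - {})"
      using prob_incidence by simp
  qed
  also have "\<dots> \<le> \<nu> ^ k"
    by (rule chain_sum[OF F C' p01 nu, where N = k]) (use bound in auto)
  finally show ?thesis using l by (simp add: field_simps power_divide)
qed

end

section \<open>Embeddings of patterns and their certificates\<close>

text \<open>A copy of a pattern sends points to vertices and lines to blocks. Lines stay whole sets
  although only their trace on \<open>P\<close> produces incidences, so that they can serve as names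
  of blocks.\<close>

definition embeddings :: "nat set \<Rightarrow> nat set set \<Rightarrow> nat \<Rightarrow> nat \<Rightarrow> ((nat \<Rightarrow> nat) \<times> (nat set \<Rightarrow> nat)) set" where
  "embeddings P Ls n M = {(f, g). f \<in> P \<rightarrow>\<^sub>E {..<n} \<and> g \<in> Ls \<rightarrow>\<^sub>E {..<M} \<and> inj_on f P \<and> inj_on g Ls}"

definition incidences :: "nat set \<Rightarrow> nat set set \<Rightarrow> (nat \<times> nat set) set" where
  "incidences P Ls = {(i, l). l \<in> Ls \<and> i \<in> l \<inter> P}"

definition cert :: "nat set \<Rightarrow> nat set set \<Rightarrow> (nat \<Rightarrow> nat) \<times> (nat set \<Rightarrow> nat) \<Rightarrow> (nat \<times> nat) set" where
  "cert P Ls fg = (\<lambda>(i, l). (fst fg i, snd fg l)) ` incidences P Ls"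

definition revealed :: "nat set \<Rightarrow> nat set set \<Rightarrow> (nat \<times> nat) set \<Rightarrow> (nat \<Rightarrow> nat) \<times> (nat set \<Rightarrow> nat)
    \<Rightarrow> (nat \<times> nat set) set" where
  "revealed P Ls U fg = {(i, l)\<in>incidences P Ls. (fst fg i, snd fg l) \<in> U}"

text \<open>The expected number of ways to complete an embedding whose roots \<open>R\<close> and incidences \<open>D\<close> are already known.\<close>

definition ext_weight :: "nat \<Rightarrow> nat \<Rightarrow> real \<Rightarrow> nat set \<Rightarrow> nat set set \<Rightarrow> nat set \<Rightarrow> (nat \<times> nat set) set \<Rightarrow> real" where
  "ext_weight n M p P Ls R D = real n ^ card (P - R - fst ` D) * real M ^ card (Ls - snd ` D)
     * p ^ (card (incidences P Ls) - card D)"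

lemma finite_embeddings: "finite P \<Longrightarrow> finite Ls \<Longrightarrow> finite (embeddings P Ls n M)"
  by (rule finite_subset[of _ "(P \<rightarrow>\<^sub>E {..<n}) \<times> (Ls \<rightarrow>\<^sub>E {..<M})"])
     (auto simp: embeddings_def intro!: finite_PiE)

lemma finite_incidences: "finite P \<Longrightarrow> finite Ls \<Longrightarrow> finite (incidences P Ls)"
  by (rule finite_subset[of _ "P \<times> Ls"]) (auto simp: incidences_def)

lemma cert_subset: "fg \<in> embeddings P Ls n M \<Longrightarrow> cert P Ls fg \<subseteq> {..<n} \<times> {..<M}"
  by (auto simp: embeddings_def cert_def incidences_def PiE_iff)

lemma inj_on_cert:
  assumes "fg \<in> embeddings P Ls n M"
  shows "inj_on (\<lambda>(i, l). (fst fg i, snd fg l)) (incidences P Ls)"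
proof (rule inj_onI)
  have inj: "inj_on (fst fg) P" "inj_on (snd fg) Ls" using assms by (auto simp: embeddings_def)
  fix x y assume x: "x \<in> incidences P Ls" and y: "y \<in> incidences P Ls"
    and eq: "(\<lambda>(i, l). (fst fg i, snd fg l)) x = (\<lambda>(i, l). (fst fg i, snd fg l)) y"
  obtain i l where xi: "x = (i, l)" by (cases x)
  obtain j k where yj: "y = (j, k)" by (cases y)
  have "i \<in> P" "j \<in> P" "l \<in> Ls" "k \<in> Ls" using x y xi yj by (auto simp: incidences_def)
  moreover have "fst fg i = fst fg j" "snd fg l = snd fg k" using eq xi yj by auto
  ultimately show "x = y" using inj xi yj by (metis inj_onD)
qed

text \<open>Classify embeddings by the set D of incidences that fall into U. Given D, an embedding
  is determined by the images of D, with at most |U|^|D| choices, and by the images of the unrooted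
  points and of the lines that D does not touch; the latter, weighted by the missing incidences,
  make up \<open>ext_weight\<close>. The power of 2 bounds the number of sets D.\<close>

lemma embedding_sum_le:
  fixes p \<mu> :: real
  assumes fin: "finite P" "finite Ls" "finite U" and p: "0 \<le> p"
    and DD: "\<D> \<subseteq> Pow (incidences P Ls)"
    and W: "\<And>D. D \<in> \<D> \<Longrightarrow> ext_weight n M p P Ls R D \<le> \<mu>" and mu: "0 \<le> \<mu>"
  shows "(\<Sum>fg\<in>{fg\<in>embeddings P Ls n M. (\<forall>i\<in>R. fst fg i = \<rho> i) \<and> revealed P Ls U fg \<in> \<D>}.
      p ^ card (cert P Ls fg - U))
    \<le> 2 ^ card (incidences P Ls) * (real (card U) + 1) ^ card (incidences P Ls) * \<mu>"
proof -
  let ?Inc = "incidences P Ls"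
  let ?E = "{fg\<in>embeddings P Ls n M. (\<forall>i\<in>R. fst fg i = \<rho> i) \<and> revealed P Ls U fg \<in> \<D>}"
  let ?F = "\<lambda>D. {fg\<in>embeddings P Ls n M. (\<forall>i\<in>R. fst fg i = \<rho> i) \<and> revealed P Ls U fg = D}"
  have fI: "finite ?Inc" using finite_incidences fin by auto
  have fD: "finite \<D>" using DD fI by (meson finite_Pow_iff finite_subset)
  have fF: "finite (?F D)" for D using finite_embeddings[of P Ls n M] fin by auto
  have one: "(\<Sum>fg\<in>?F D. p ^ card (cert P Ls fg - U)) \<le> (real (card U) + 1) ^ card ?Inc * \<mu>"
    if D: "D \<in> \<D>" for D
  proof -
    have DI: "D \<subseteq> ?Inc" using D DD by auto
    have fDD: "finite D" using DI fI finite_subset by auto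
    have c: "card (cert P Ls fg - U) = card ?Inc - card D" if "fg \<in> ?F D" for fg
    proof -
      let ?h = "\<lambda>(i, l). (fst fg i, snd fg l)"
      have inj: "inj_on ?h ?Inc" using inj_on_cert that by auto
      have "cert P Ls fg - U = ?h ` (?Inc - D)"
        using that by (auto simp: cert_def revealed_def)
      moreover have "inj_on ?h (?Inc - D)" using inj by (rule inj_on_subset) auto
      ultimately show ?thesis using DI fI fDD by (simp add: card_image card_Diff_subset)
    qed
    let ?\<Phi> = "\<lambda>fg. (restrict (\<lambda>(i, l). (fst fg i, snd fg l)) D,
        restrict (fst fg) (P - R - fst ` D), restrict (snd fg) (Ls - snd ` D))"
    let ?T = "(D \<rightarrow>\<^sub>E U) \<times> ((P - R - fst ` D) \<rightarrow>\<^sub>E {..<n}) \<times> ((Ls - snd ` D) \<rightarrow>\<^sub>E {..<M})"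
    have inj: "inj_on ?\<Phi> (?F D)"
    proof (rule inj_onI)
      fix x y assume x: "x \<in> ?F D" and y: "y \<in> ?F D" and eq: "?\<Phi> x = ?\<Phi> y"
      obtain f g where fg: "x = (f, g)" by (cases x)
      obtain f' g' where fg': "y = (f', g')" by (cases y)
      have e1: "\<And>i l. (i, l) \<in> D \<Longrightarrow> f i = f' i \<and> g l = g' l"
      proof -
        fix i l assume "(i, l) \<in> D"
        moreover have "restrict (\<lambda>(i, l). (f i, g l)) D = restrict (\<lambda>(i, l). (f' i, g' l)) D"
          using eq fg fg' by simp
        ultimately show "f i = f' i \<and> g l = g' l"
          by (metis (mono_tags, lifting) case_prod_conv prod.inject restrict_apply')
      qed
      have e2: "\<And>i. i \<in> P - R - fst ` D \<Longrightarrow> f i = f' i"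
      proof -
        have "restrict f (P - R - fst ` D) = restrict f' (P - R - fst ` D)" using eq fg fg' by simp
        then show "\<And>i. i \<in> P - R - fst ` D \<Longrightarrow> f i = f' i" by (metis restrict_apply')
      qed
      have e3: "\<And>l. l \<in> Ls - snd ` D \<Longrightarrow> g l = g' l"
      proof -
        have "restrict g (Ls - snd ` D) = restrict g' (Ls - snd ` D)" using eq fg fg' by simp
        then show "\<And>l. l \<in> Ls - snd ` D \<Longrightarrow> g l = g' l" by (metis restrict_apply')
      qed
      have "f = f'"
      proof (rule PiE_ext)
        show "f \<in> P \<rightarrow>\<^sub>E {..<n}" "f' \<in> P \<rightarrow>\<^sub>E {..<n}" using x y fg fg' by (auto simp: embeddings_def)
        fix i assume "i \<in> P"
        show "f i = f' i"
        proof (cases "i \<in> R")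
          case True then show ?thesis using x y fg fg' by auto
        next
          case False then show ?thesis using e1 e2 \<open>i \<in> P\<close> by fastforce
        qed
      qed
      moreover have "g = g'"
      proof (rule PiE_ext)
        show "g \<in> Ls \<rightarrow>\<^sub>E {..<M}" "g' \<in> Ls \<rightarrow>\<^sub>E {..<M}" using x y fg fg' by (auto simp: embeddings_def)
        fix l assume "l \<in> Ls"
        then show "g l = g' l" using e1 e3 by fastforce
      qed
      ultimately show "x = y" using fg fg' by simp
    qed
    have im: "?\<Phi> ` ?F D \<subseteq> ?T"
    proof (rule image_subsetI)
      fix fg assume a: "fg \<in> ?F D"
      have f: "\<And>i. i \<in> P \<Longrightarrow> fst fg i < n" and g: "\<And>l. l \<in> Ls \<Longrightarrow> snd fg l < M"
        using a by (auto simp: embeddings_def)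
      have r: "D = revealed P Ls U fg" using a by simp
      have "restrict (\<lambda>(i, l). (fst fg i, snd fg l)) D \<in> D \<rightarrow>\<^sub>E U"
        unfolding restrict_PiE_iff by (subst r) (auto simp: revealed_def)
      moreover have "restrict (fst fg) (P - R - fst ` D) \<in> (P - R - fst ` D) \<rightarrow>\<^sub>E {..<n}"
        unfolding restrict_PiE_iff using f by blast
      moreover have "restrict (snd fg) (Ls - snd ` D) \<in> (Ls - snd ` D) \<rightarrow>\<^sub>E {..<M}"
        unfolding restrict_PiE_iff using g by blast
      ultimately show "?\<Phi> fg \<in> ?T" by (intro SigmaI)
    qed
    have fT: "finite ?T" using fin fDD by (auto intro!: finite_PiE finite_cartesian_product)
    have "card (?F D) \<le> card ?T"
      using card_inj_on_le[OF inj im fT] .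
    also have "card ?T = card U ^ card D * (n ^ card (P - R - fst ` D) * M ^ card (Ls - snd ` D))"
      using fin fDD by (simp add: card_cartesian_product card_PiE)
    finally have "real (card (?F D)) \<le> real (card U ^ card D * (n ^ card (P - R - fst ` D) * M ^ card (Ls - snd ` D)))"
      by (rule of_nat_mono)
    then have cF: "real (card (?F D)) \<le> real (card U) ^ card D * (real n ^ card (P - R - fst ` D) * real M ^ card (Ls - snd ` D))"
      by (simp only: of_nat_mult of_nat_power)
    have "(\<Sum>fg\<in>?F D. p ^ card (cert P Ls fg - U)) = real (card (?F D)) * p ^ (card ?Inc - card D)"
      using c by simp
    also have "\<dots> \<le> (real (card U) ^ card D * (real n ^ card (P - R - fst ` D) * real M ^ card (Ls - snd ` D)))
         * p ^ (card ?Inc - card D)"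
      using cF p by (intro mult_right_mono) auto
    also have "\<dots> = real (card U) ^ card D * ext_weight n M p P Ls R D" by (simp add: ext_weight_def)
    also have "\<dots> \<le> (real (card U) + 1) ^ card ?Inc * \<mu>"
    proof (intro mult_mono)
      have "real (card U) ^ card D \<le> (real (card U) + 1) ^ card D" by (intro power_mono) auto
      also have "\<dots> \<le> (real (card U) + 1) ^ card ?Inc"
        using card_mono[OF fI DI] by (intro power_increasing) auto
      finally show "real (card U) ^ card D \<le> (real (card U) + 1) ^ card ?Inc" .
      show "ext_weight n M p P Ls R D \<le> \<mu>" using W D by auto
      show "0 \<le> ext_weight n M p P Ls R D" using p by (simp add: ext_weight_def)
    qed auto
    finally show ?thesis .
  qed
  have "?E = (\<Union>D\<in>\<D>. ?F D)" by auto
  then have "(\<Sum>fg\<in>?E. p ^ card (cert P Ls fg - U)) = (\<Sum>D\<in>\<D>. \<Sum>fg\<in>?F D. p ^ card (cert P Ls fg - U))"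
    using fD fF by (subst sum.UNION_disjoint[symmetric]) auto
  also have "\<dots> \<le> (\<Sum>D\<in>\<D>. (real (card U) + 1) ^ card ?Inc * \<mu>)" by (intro sum_mono one)
  also have "\<dots> = real (card \<D>) * ((real (card U) + 1) ^ card ?Inc * \<mu>)" by simp
  also have "\<dots> \<le> 2 ^ card ?Inc * ((real (card U) + 1) ^ card ?Inc * \<mu>)"
  proof (intro mult_right_mono)
    have "card \<D> \<le> card (Pow ?Inc)" using DD fI by (intro card_mono) auto
    then have "card \<D> \<le> 2 ^ card ?Inc" using fI by (simp add: card_Pow)
    then have "real (card \<D>) \<le> real (2 ^ card ?Inc)" by (rule of_nat_mono)
    then show "real (card \<D>) \<le> 2 ^ card ?Inc" by simp
  qed (use mu in auto)
  finally show ?thesis by (simp add: mult.assoc)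
qed

section \<open>Extension weights\<close>

text \<open>The order of the expected number of blocks through k given vertices. A line with at most
  one point imposes no condition and must not be counted, hence the value 1.\<close>

definition line_weight :: "nat \<Rightarrow> real \<Rightarrow> nat \<Rightarrow> real" where
  "line_weight M p k = (if 2 \<le> k then real M * p ^ k else 1)"

definition pattern_weight :: "nat \<Rightarrow> nat \<Rightarrow> real \<Rightarrow> nat set set \<Rightarrow> nat set \<Rightarrow> real" where
  "pattern_weight n M p Ls S = real n ^ card S * (\<Prod>l\<in>Ls. line_weight M p (card (l \<inter> S)))"

lemma card_incidence_fibres:
  assumes "finite P" "finite Ls" "D \<subseteq> incidences P Ls"
  shows "card D = (\<Sum>l\<in>Ls. card {i. (i, l) \<in> D})"
proof -
  have fin: "finite {i. (i, l) \<in> D}" for l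
    by (rule finite_subset[OF _ assms(1)]) (use assms(3) in \<open>auto simp: incidences_def\<close>)
  have eq: "D = (\<lambda>(l, i). (i, l)) ` (SIGMA l:Ls. {i. (i, l) \<in> D})"
    using assms(3) by (force simp: incidences_def image_iff)
  have "inj_on (\<lambda>(l, i). (i, l)) (SIGMA l:Ls. {i. (i, l) \<in> D})" by (auto simp: inj_on_def)
  from card_image[OF this] have "card D = card (SIGMA l:Ls. {i. (i, l) \<in> D})"
    unfolding eq[symmetric] .
  also have "\<dots> = (\<Sum>l\<in>Ls. card {i. (i, l) \<in> D})" using assms(2) fin by (simp add: card_SigmaI)
  finally show ?thesis .
qed

lemma ext_weight_prod:
  assumes fin: "finite P" "finite Ls" and D: "D \<subseteq> incidences P Ls"
  shows "ext_weight n M p P Ls R D = real n ^ card (P - R - fst ` D) *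
    (\<Prod>l\<in>Ls. (if l \<in> snd ` D then 1 else real M) * p ^ (card (l \<inter> P) - card {i. (i, l) \<in> D}))"
proof -
  have sub: "{i. (i, l) \<in> D} \<subseteq> l \<inter> P" for l using D by (auto simp: incidences_def)
  have "card (incidences P Ls) = (\<Sum>l\<in>Ls. card (l \<inter> P))"
    using card_incidence_fibres[OF fin order_refl]
    by (simp add: incidences_def Int_def)
  then have "card (incidences P Ls) - card D = (\<Sum>l\<in>Ls. card (l \<inter> P) - card {i. (i, l) \<in> D})"
    using card_incidence_fibres[OF fin D] fin sub by (simp add: sum_subtractf_nat card_mono)
  moreover have "real M ^ card (Ls - snd ` D) = (\<Prod>l\<in>Ls. if l \<in> snd ` D then 1 else real M)"
    using fin by (simp add: prod.If_cases Diff_eq)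
  ultimately show ?thesis by (simp add: ext_weight_def power_sum prod.distrib)
qed

text \<open>Completing a known part costs at most the ratio of the pattern weights; the known points
  are the roots and the points met by \<open>D\<close>. The comparison is line by line.
  \<open>Mp\<close> enters for an exposed line with a single known point, which the pattern weight
  of the known part ignores; \<open>x\<close> enters for an unexposed line with several known
  points.\<close>

lemma ext_weight_le:
  fixes p :: real
  assumes fin: "finite P" "finite Ls" and D: "D \<subseteq> incidences P Ls" and R: "R \<subseteq> P"
    and two: "\<And>l. l \<in> Ls \<Longrightarrow> 2 \<le> card (l \<inter> P)"
    and p: "0 < p" "p \<le> 1" and Mp: "1 \<le> real M * p" and x: "real M * p\<^sup>2 \<le> 1"
  shows "ext_weight n M p P Ls R D * pattern_weight n M p Ls (R \<union> fst ` D) \<le> pattern_weight n M p Ls P"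
proof -
  define S where "S = R \<union> fst ` D"
  have SP: "S \<subseteq> P" using R D by (auto simp: S_def incidences_def)
  have fS: "finite S" using SP fin finite_subset by auto
  have M0: "real M > 0" using Mp p by (cases "M = 0") auto
  let ?w = "\<lambda>l. (if l \<in> snd ` D then 1 else real M) * p ^ (card (l \<inter> P) - card {i. (i, l) \<in> D})"
  have line: "?w l * line_weight M p (card (l \<inter> S)) \<le> line_weight M p (card (l \<inter> P))" if l: "l \<in> Ls" for l
  proof -
    let ?Dl = "{i. (i, l) \<in> D}"
    have sub: "?Dl \<subseteq> l \<inter> S" using D by (force simp: incidences_def S_def)
    have sub2: "l \<inter> S \<subseteq> l \<inter> P" using SP by auto
    have c1: "card ?Dl \<le> card (l \<inter> S)" using sub fS by (intro card_mono) auto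
    have c2: "card (l \<inter> S) \<le> card (l \<inter> P)" using sub2 fin by (intro card_mono) auto
    have rhs: "line_weight M p (card (l \<inter> P)) = real M * p ^ card (l \<inter> P)"
      using two[OF l] by (simp add: line_weight_def)
    show ?thesis
    proof (cases "l \<in> snd ` D")
      case True
      then have "?Dl \<noteq> {}" by force
      then have c3: "1 \<le> card ?Dl" using sub fS by (metis One_nat_def Suc_leI card_gt_0_iff finite_Int finite_subset)
      show ?thesis
      proof (cases "2 \<le> card (l \<inter> S)")
        case t2: True
        have "?w l * line_weight M p (card (l \<inter> S)) = real M * p ^ (card (l \<inter> P) - card ?Dl + card (l \<inter> S))"
          using True t2 by (simp add: line_weight_def power_add)
        also have "\<dots> \<le> real M * p ^ card (l \<inter> P)"
          using c1 c2 p M0 by (intro mult_left_mono power_decreasing) auto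
        finally show ?thesis using rhs by simp
      next
        case False
        then have "card ?Dl = 1" using c1 c3 by linarith
        then have "?w l * line_weight M p (card (l \<inter> S)) = p ^ (card (l \<inter> P) - 1)"
          using True False by (simp add: line_weight_def)
        also have "\<dots> \<le> (real M * p) * p ^ (card (l \<inter> P) - 1)" using Mp p by simp
        also have "\<dots> = real M * p ^ card (l \<inter> P)"
          using two[OF l] by (simp add: power_eq_if)
        finally show ?thesis using rhs by simp
      qed
    next
      case False
      then have "?Dl = {}" by force
      then have "?w l = real M * p ^ card (l \<inter> P)" using False by simp
      moreover have "line_weight M p (card (l \<inter> S)) \<le> 1"
      proof (cases "2 \<le> card (l \<inter> S)")
        case True
        have "real M * p ^ card (l \<inter> S) \<le> real M * p ^ 2"
          using True p by (intro mult_left_mono power_decreasing) auto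
        then show ?thesis using x True by (simp add: line_weight_def)
      qed (simp add: line_weight_def)
      moreover have "real M * p ^ card (l \<inter> P) \<ge> 0" using p by simp
      ultimately show ?thesis using rhs by (simp only: mult_left_le)
    qed
  qed
  have cP: "card (P - R - fst ` D) + card S = card P"
  proof -
    have "P - R - fst ` D = P - S" by (auto simp: S_def)
    then show ?thesis using SP fin fS by (simp add: card_Diff_subset card_mono)
  qed
  have "ext_weight n M p P Ls R D * pattern_weight n M p Ls S
     = real n ^ card P * (\<Prod>l\<in>Ls. ?w l * line_weight M p (card (l \<inter> S)))"
    unfolding ext_weight_prod[OF fin D] pattern_weight_def cP[symmetric]
    by (simp add: prod.distrib power_add)
  also have "\<dots> \<le> real n ^ card P * (\<Prod>l\<in>Ls. line_weight M p (card (l \<inter> P)))"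
    using line p by (intro mult_left_mono prod_mono) (auto simp: line_weight_def)
  finally show ?thesis by (simp add: pattern_weight_def S_def)
qed

text \<open>When all points are known the ratio of pattern weights is 1 and gives nothing. The gain
  then comes from a missing incidence: on an exposed line it costs a factor p, on an unexposed one
  the whole line costs at most M p^2.\<close>

lemma ext_weight_vertices_known:
  fixes p \<mu> :: real
  assumes fin: "finite P" "finite Ls" and D: "D \<subset> incidences P Ls" and full: "R \<union> fst ` D = P"
    and two: "\<And>l. l \<in> Ls \<Longrightarrow> 2 \<le> card (l \<inter> P)"
    and p: "0 < p" "p \<le> 1" "p \<le> \<mu>" and x: "real M * p\<^sup>2 \<le> 1" "real M * p\<^sup>2 \<le> \<mu>"
  shows "ext_weight n M p P Ls R D \<le> \<mu>"
proof -
  let ?w = "\<lambda>l. (if l \<in> snd ` D then 1 else real M) * p ^ (card (l \<inter> P) - card {i. (i, l) \<in> D})"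
  have D': "D \<subseteq> incidences P Ls" using D by auto
  have outside: "?w l \<le> real M * p\<^sup>2" if "l \<in> Ls" "l \<notin> snd ` D" for l
  proof -
    have "{i. (i, l) \<in> D} = {}" using that(2) by force
    then have "?w l = real M * p ^ card (l \<inter> P)" using that by simp
    also have "\<dots> \<le> real M * p\<^sup>2"
      using two[OF that(1)] p by (intro mult_left_mono power_decreasing) auto
    finally show ?thesis .
  qed
  have le1: "0 \<le> ?w l \<and> ?w l \<le> 1" if "l \<in> Ls" for l
    using outside[OF that] x p by (auto simp: power_le_one)
  obtain i l where il: "(i, l) \<in> incidences P Ls" "(i, l) \<notin> D" using D by auto
  have lL: "l \<in> Ls" using il by (auto simp: incidences_def)
  have wl: "?w l \<le> \<mu>"
  proof (cases "l \<in> snd ` D")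
    case True
    have "{i. (i, l) \<in> D} \<subset> l \<inter> P" using D' il by (auto simp: incidences_def)
    then have "card {i. (i, l) \<in> D} < card (l \<inter> P)" using fin by (intro psubset_card_mono) auto
    then have "p ^ (card (l \<inter> P) - card {i. (i, l) \<in> D}) \<le> p ^ 1"
      using p by (intro power_decreasing) auto
    then show ?thesis using True p by simp
  next
    case False
    then show ?thesis using outside[OF lL] x by simp
  qed
  have "card (P - R - fst ` D) = 0"
  proof -
    have "P - R - fst ` D = {}" using full by blast
    then show ?thesis by (simp only: card.empty)
  qed
  then have "ext_weight n M p P Ls R D = (\<Prod>l\<in>Ls. ?w l)" unfolding ext_weight_prod[OF fin D'] by (simp only: power_0 mult_1)
  also have "\<dots> = ?w l * (\<Prod>l\<in>Ls - {l}. ?w l)" using fin lL by (simp add: prod.remove)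
  also have "\<dots> \<le> ?w l * 1" using le1 lL by (intro mult_left_mono prod_le_1) auto
  finally show ?thesis using wl by simp
qed

section \<open>Tools for the density argument: constrained tuples, maximal chains, heavy
  vertices\<close>

lemma card_PiE_two_constraints:
  assumes "finite R" "i \<in> R" "j \<in> R" "i \<noteq> j" "A \<subseteq> {..<k}" "B \<subseteq> {..<k}"
  shows "card {\<iota> \<in> R \<rightarrow>\<^sub>E {..<k}. \<iota> i \<in> A \<and> \<iota> j \<in> B} = card A * card B * k ^ (card R - 2)"
proof -
  let ?S = "\<lambda>x. if x = i then A else if x = j then B else {..<k}"
  have "{\<iota> \<in> R \<rightarrow>\<^sub>E {..<k}. \<iota> i \<in> A \<and> \<iota> j \<in> B} = PiE R ?S"
  proof (rule set_eqI)
    fix \<iota>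
    have "(\<forall>x\<in>R. \<iota> x \<in> ?S x) \<longleftrightarrow> (\<forall>x\<in>R. \<iota> x < k) \<and> \<iota> i \<in> A \<and> \<iota> j \<in> B"
    proof
      assume a: "\<forall>x\<in>R. \<iota> x \<in> ?S x"
      have "\<iota> i \<in> A" using a assms(2) by (metis (full_types))
      moreover have "\<iota> j \<in> B" using a assms(3,4) by (metis (full_types))
      moreover have "\<forall>x\<in>R. \<iota> x < k"
      proof
        fix x assume "x \<in> R"
        then have "\<iota> x \<in> ?S x" using a by blast
        moreover have "?S x \<subseteq> {..<k}" using assms(5,6) by simp
        ultimately show "\<iota> x < k" by blast
      qed
      ultimately show "(\<forall>x\<in>R. \<iota> x < k) \<and> \<iota> i \<in> A \<and> \<iota> j \<in> B" by blast
    qed auto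
    then show "\<iota> \<in> {\<iota> \<in> R \<rightarrow>\<^sub>E {..<k}. \<iota> i \<in> A \<and> \<iota> j \<in> B} \<longleftrightarrow> \<iota> \<in> PiE R ?S"
      by (auto simp only: PiE_iff mem_Collect_eq lessThan_iff)
  qed
  then have "card {\<iota> \<in> R \<rightarrow>\<^sub>E {..<k}. \<iota> i \<in> A \<and> \<iota> j \<in> B} = (\<Prod>x\<in>R. card (?S x))"
    using assms by (simp add: card_PiE)
  also have "\<dots> = card A * (\<Prod>x\<in>R - {i}. card (?S x))" using assms by (simp add: prod.remove[of R i])
  also have "(\<Prod>x\<in>R - {i}. card (?S x)) = card B * (\<Prod>x\<in>R - {i} - {j}. card (?S x))"
    using assms by (subst prod.remove[of "R - {i}" j]) auto
  also have "(\<Prod>x\<in>R - {i} - {j}. card (?S x)) = (\<Prod>x\<in>R - {i} - {j}. k)" by (intro prod.cong) auto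
  also have "\<dots> = k ^ (card R - 2)" using assms by (simp add: card_Diff_singleton numeral_2_eq_2)
  finally show ?thesis by simp
qed

lemma last_step_before_failure:
  fixes P :: "nat \<Rightarrow> bool"
  shows "P 0 \<Longrightarrow> \<not> P h \<Longrightarrow> \<exists>m<h. P m \<and> \<not> P (Suc m)"
  by (induction h) (auto simp: less_Suc_eq)

text \<open>A chain that cannot be prolonged absorbs everything: a present certificate not contained
  in its union would extend it. So the absence of chains of length h confines all present
  certificates to a set of at most d h incidences.\<close>

lemma maximal_chain:
  assumes fin: "\<And>c. c \<in> F \<Longrightarrow> finite (C c) \<and> card (C c) \<le> d"
    and no: "\<nexists>cs. length cs = h \<and> chain C (\<lambda>U c. \<not> C c \<subseteq> U) F {} cs \<and> (\<Union>c\<in>set cs. C c) \<subseteq> I"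
  shows "\<exists>U. finite U \<and> U \<subseteq> I \<and> card U \<le> d * h \<and> (\<forall>c\<in>F. C c \<subseteq> I \<longrightarrow> C c \<subseteq> U)"
proof -
  let ?ok = "\<lambda>U c. \<not> C c \<subseteq> U"
  let ?P = "\<lambda>m. \<exists>cs. length cs = m \<and> chain C ?ok F {} cs \<and> (\<Union>c\<in>set cs. C c) \<subseteq> I"
  have P0: "?P 0" by simp
  from last_step_before_failure[of ?P, OF P0 no]
  obtain m where m: "m < h" "?P m" "\<not> ?P (Suc m)" by blast
  from m(2) obtain cs where cs: "length cs = m" "chain C ?ok F {} cs" "(\<Union>c\<in>set cs. C c) \<subseteq> I" by blast
  define U where "U = (\<Union>c\<in>set cs. C c)"
  have sF: "set cs \<subseteq> F" using chain_set[OF cs(2)] .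
  have "finite U" using sF fin by (auto simp: U_def)
  moreover have "card U \<le> d * h"
  proof -
    have "card U \<le> (\<Sum>c\<in>set cs. card (C c))" unfolding U_def by (intro card_UN_le) auto
    also have "\<dots> \<le> (\<Sum>c\<in>set cs. d)" using sF fin by (intro sum_mono) auto
    also have "\<dots> = card (set cs) * d" by simp
    also have "\<dots> \<le> h * d" using m(1) cs(1) card_length[of cs] by (intro mult_right_mono) auto
    finally show ?thesis by (simp add: mult.commute)
  qed
  moreover have "C c \<subseteq> U" if c: "c \<in> F" "C c \<subseteq> I" for c
  proof (rule ccontr)
    assume "\<not> C c \<subseteq> U"
    then have "chain C ?ok F {} (cs @ [c])" using cs c by (simp add: chain_snoc U_def)
    moreover have "(\<Union>x\<in>set (cs @ [c]). C x) \<subseteq> I" using cs c by auto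
    moreover have "length (cs @ [c]) = Suc m" using cs(1) by simp
    ultimately show False using m(3) by blast
  qed
  ultimately show ?thesis using cs(3) unfolding U_def by blast
qed

lemma card_heavy:
  assumes "finite U" "g > 0"
  shows "finite {v. g < card {j. (v, j) \<in> U}}" "g * card {v. g < card {j. (v, j) \<in> U}} \<le> card U"
proof -
  let ?H = "{v. g < card {j. (v, j) \<in> U}}"
  have sub: "?H \<subseteq> fst ` U"
  proof
    fix v assume "v \<in> ?H"
    then have "card {j. (v, j) \<in> U} \<noteq> 0" by simp
    then have "{j. (v, j) \<in> U} \<noteq> {}" by (metis card.empty)
    then show "v \<in> fst ` U" by force
  qed
  then show fH: "finite ?H" using assms(1) finite_subset by auto
  have finj: "finite {j. (v, j) \<in> U}" for v
    by (rule finite_subset[of _ "snd ` U"]) (use assms(1) in force)+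
  have "g * card ?H = (\<Sum>v\<in>?H. g)" by simp
  also have "\<dots> \<le> (\<Sum>v\<in>?H. card {j. (v, j) \<in> U})" by (intro sum_mono) auto
  also have "\<dots> = card (SIGMA v:?H. {j. (v, j) \<in> U})" using fH finj by (simp add: card_SigmaI)
  also have "\<dots> \<le> card U" by (intro card_mono assms) auto
  finally show "g * card ?H \<le> card U" .
qed

section \<open>Density of closed tuples\<close>

definition closed_tuple :: "nat set \<Rightarrow> nat set set \<Rightarrow> nat set \<Rightarrow> nat \<Rightarrow> nat \<Rightarrow> (nat \<times> nat) set \<Rightarrow> (nat \<Rightarrow> nat) \<Rightarrow> bool" where
  "closed_tuple P Ls R n M I \<rho> \<longleftrightarrow>
     (\<exists>fg\<in>embeddings P Ls n M. cert P Ls fg \<subseteq> I \<and> (\<forall>i\<in>R. fst fg i = \<rho> i))"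

definition fibre :: "nat set \<Rightarrow> nat set set \<Rightarrow> nat set \<Rightarrow> nat \<Rightarrow> nat \<Rightarrow> nat \<Rightarrow> (nat \<times> nat) set \<Rightarrow> (nat \<Rightarrow> nat) \<Rightarrow> nat set" where
  "fibre P Ls Q i n M I z = {v. \<exists>fg\<in>embeddings P Ls n M. cert P Ls fg \<subseteq> I \<and> (\<forall>q\<in>Q. fst fg q = z q) \<and> fst fg i = v}"

text \<open>Each root has k sampled candidates, and the index tuples whose candidates are closed are
  counted. All relevant certificates lie in the small set U. If the candidate for i' is neither a
  heavy vertex nor in a heavy block, at most g g vertices share a block of U with it. The points of
  \<open>Qs\<close> are among these, which leaves at most (g g)^|Qs| placements, and each placement
  confines the candidate for i'' to a fibre that holds at most \<theta> candidates. Heavy vertices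
  and blocks number at most D0 / g each.\<close>

lemma sampled_count:
  fixes \<xi> :: "nat \<times> nat \<Rightarrow> nat" and g k \<theta> :: nat
  defines "Co \<equiv> \<lambda>R. {..<k} \<times> (R :: nat set)"
  assumes fin: "finite P" and R: "R \<subseteq> P" "i' \<in> R" "i'' \<in> R" "i' \<noteq> i''"
    and Qs: "Qs \<subseteq> P" "\<And>q. q \<in> Qs \<Longrightarrow> \<exists>l\<in>Ls. i' \<in> l \<and> q \<in> l"
    and IX: "I \<subseteq> {..<n} \<times> {..<M}"
    and U: "finite U" "U \<subseteq> I" "card U \<le> D0"
    and cl: "\<And>fg. fg \<in> embeddings P Ls n M \<Longrightarrow> fst fg ` R \<subseteq> \<xi> ` Co R \<Longrightarrow> cert P Ls fg \<subseteq> I \<Longrightarrow> cert P Ls fg \<subseteq> U"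
    and g: "g > 0"
    and sp1: "\<And>v. v < n \<Longrightarrow> card {c\<in>Co R. \<xi> c = v} \<le> \<theta>"
    and sp2: "\<And>j. j < M \<Longrightarrow> card {c\<in>Co R. (\<xi> c, j) \<in> I} \<le> \<theta>"
    and sp3: "\<And>z. z \<in> Qs \<rightarrow>\<^sub>E {..<n} \<Longrightarrow> card {c\<in>Co R. \<xi> c \<in> fibre P Ls Qs i'' n M I z} \<le> \<theta>"
  shows "g * card {\<iota> \<in> R \<rightarrow>\<^sub>E {..<k}. closed_tuple P Ls R n M I (\<lambda>i. \<xi> (\<iota> i, i))}
    \<le> 2 * \<theta> * D0 * k ^ (card R - 1) + g * ((g * g) ^ card Qs * \<theta> * k ^ (card R - 1))"
proof -
  have fR: "finite R" using fin R finite_subset by auto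
  have fQ: "finite Qs" using fin Qs finite_subset by auto
  have fCo: "finite (Co R)" using fR by (simp add: Co_def)
  have r2: "card R \<ge> 2"
  proof -
    have "card {i', i''} \<le> card R" using R fR by (intro card_mono) auto
    then show ?thesis using R by simp
  qed
  have kk: "k * k ^ (card R - 2) = k ^ (card R - 1)"
    using r2 by (metis Suc_1 Suc_diff_le diff_Suc_Suc diff_Suc_1 power_Suc One_nat_def diff_Suc_eq_diff_pred)
  define HV where "HV = {v. g < card {j. (v, j) \<in> U}}"
  define HJ where "HJ = {j. g < card {v. (v, j) \<in> U}}"
  have HV: "finite HV" "g * card HV \<le> D0"
    using card_heavy[OF U(1) g] U(3) by (auto simp: HV_def)
  have conv: "{v. (v, j) \<in> U} = {v. (j, v) \<in> U\<inverse>}" for j by auto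
  have HJ: "finite HJ" "g * card HJ \<le> D0"
    using card_heavy[of "U\<inverse>" g] U(1,3) g unfolding HJ_def conv by (auto simp: card_inverse)
  have UX: "(v, j) \<in> U \<Longrightarrow> v < n \<and> j < M" for v j using U(2) IX by auto
  have HVn: "v < n" if "v \<in> HV" for v
  proof -
    have "card {j. (v, j) \<in> U} \<noteq> 0" using that by (simp add: HV_def)
    then obtain j where "(v, j) \<in> U" by (metis card.empty Collect_empty_eq)
    then show ?thesis using UX by blast
  qed
  have HJM: "j < M" if "j \<in> HJ" for j
  proof -
    have "card {v. (v, j) \<in> U} \<noteq> 0" using that by (simp add: HJ_def)
    then obtain v where "(v, j) \<in> U" by (metis card.empty Collect_empty_eq)
    then show ?thesis using UX by blast
  qed
  \<comment> \<open>Discarded candidates. For heavy blocks, membership in I rather than in U is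
    used, because the spread condition \<open>sp2\<close> counts candidates through I.\<close>
  define Ub where "Ub = (\<Union>v\<in>HV. {c\<in>Co R. \<xi> c = v}) \<union> (\<Union>j\<in>HJ. {c\<in>Co R. (\<xi> c, j) \<in> I})"
  have fUb: "finite Ub" by (rule finite_subset[OF _ fCo]) (auto simp: Ub_def)
  have cUb: "g * card Ub \<le> 2 * \<theta> * D0"
  proof -
    have "card (\<Union>v\<in>HV. {c\<in>Co R. \<xi> c = v}) \<le> (\<Sum>v\<in>HV. card {c\<in>Co R. \<xi> c = v})"
      by (rule card_UN_le[OF HV(1)])
    also have "\<dots> \<le> (\<Sum>v\<in>HV. \<theta>)" using HVn sp1 by (intro sum_mono) auto
    finally have 1: "card (\<Union>v\<in>HV. {c\<in>Co R. \<xi> c = v}) \<le> card HV * \<theta>" by simp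
    have "card (\<Union>j\<in>HJ. {c\<in>Co R. (\<xi> c, j) \<in> I}) \<le> (\<Sum>j\<in>HJ. card {c\<in>Co R. (\<xi> c, j) \<in> I})"
      by (rule card_UN_le[OF HJ(1)])
    also have "\<dots> \<le> (\<Sum>j\<in>HJ. \<theta>)" using HJM sp2 by (intro sum_mono) auto
    finally have 2: "card (\<Union>j\<in>HJ. {c\<in>Co R. (\<xi> c, j) \<in> I}) \<le> card HJ * \<theta>" by simp
    have "card Ub \<le> card HV * \<theta> + card HJ * \<theta>"
      unfolding Ub_def using 1 2 card_Un_le[of "\<Union>v\<in>HV. {c\<in>Co R. \<xi> c = v}" "\<Union>j\<in>HJ. {c\<in>Co R. (\<xi> c, j) \<in> I}"]
      by linarith
    then have "g * card Ub \<le> g * (card HV * \<theta> + card HJ * \<theta>)" by (rule mult_le_mono2)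
    also have "\<dots> = (g * card HV) * \<theta> + (g * card HJ) * \<theta>" by (simp add: algebra_simps)
    also have "\<dots> \<le> D0 * \<theta> + D0 * \<theta>" using HV(2) HJ(2) by (intro add_mono mult_le_mono1)
    finally show ?thesis by (simp add: algebra_simps)
  qed
  define A1 where "A1 = {u. u < k \<and> (u, i') \<in> Ub}"
  have cA1: "card A1 \<le> card Ub"
    by (rule card_inj_on_le[of "\<lambda>u. (u, i')"]) (use fUb in \<open>auto simp: A1_def inj_on_def\<close>)
  \<comment> \<open>The vertices joined to the candidate for i' inside U. They contain the images of
    \<open>Qs\<close> because each point of \<open>Qs\<close> is on a line with i'.\<close>
  define N where "N = (\<lambda>u. {v. \<exists>j. (\<xi> (u, i'), j) \<in> U \<and> (v, j) \<in> U})"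
  define B where "B = (\<lambda>z. {u. u < k \<and> \<xi> (u, i'') \<in> fibre P Ls Qs i'' n M I z})"
  have Nn: "N u \<subseteq> {..<n}" for u using UX by (auto simp: N_def)
  have fN: "finite (N u)" for u using Nn finite_subset by blast
  have cN: "card (N u) \<le> g * g" if u: "u < k" "u \<notin> A1" for u
  proof -
    let ?y = "\<xi> (u, i')"
    have co: "(u, i') \<in> Co R" using u R by (auto simp: Co_def)
    have nUb: "(u, i') \<notin> Ub" using u by (auto simp: A1_def)
    have fj: "finite {j. (?y, j) \<in> U}"
      by (rule finite_subset[of _ "{..<M}"]) (use UX in auto)
    have "?y \<notin> HV" using nUb co by (auto simp: Ub_def)
    then have cj: "card {j. (?y, j) \<in> U} \<le> g" by (simp add: HV_def)
    have each: "card {v. (v, j) \<in> U} \<le> g" if "j \<in> {j. (?y, j) \<in> U}" for j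
    proof -
      have "(?y, j) \<in> I" using that U(2) by auto
      then have "j \<notin> HJ" using nUb co by (auto simp: Ub_def)
      then show ?thesis by (simp add: HJ_def)
    qed
    have "N u = (\<Union>j\<in>{j. (?y, j) \<in> U}. {v. (v, j) \<in> U})" by (auto simp: N_def)
    then have "card (N u) \<le> (\<Sum>j\<in>{j. (?y, j) \<in> U}. card {v. (v, j) \<in> U})"
      using card_UN_le[OF fj] by simp
    also have "\<dots> \<le> (\<Sum>j\<in>{j. (?y, j) \<in> U}. g)" using each by (intro sum_mono) auto
    also have "\<dots> \<le> g * g" using cj by simp
    finally show ?thesis .
  qed
  have cB: "card (B z) \<le> \<theta>" if z: "z \<in> Qs \<rightarrow>\<^sub>E {..<n}" for z
  proof -
    have "card (B z) \<le> card {c\<in>Co R. \<xi> c \<in> fibre P Ls Qs i'' n M I z}"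
      by (rule card_inj_on_le[of "\<lambda>u. (u, i'')"])
         (use fCo R in \<open>auto simp: B_def Co_def inj_on_def\<close>)
    then show ?thesis using sp3[OF z] by linarith
  qed
  define K where "K = {\<iota> \<in> R \<rightarrow>\<^sub>E {..<k}. closed_tuple P Ls R n M I (\<lambda>i. \<xi> (\<iota> i, i))}"
  let ?G = "\<lambda>A B. {\<iota> \<in> R \<rightarrow>\<^sub>E {..<k}. \<iota> i' \<in> A \<and> \<iota> i'' \<in> B}"
  have sub: "K \<subseteq> ?G A1 {..<k} \<union> (\<Union>u\<in>{..<k} - A1. \<Union>z\<in>Qs \<rightarrow>\<^sub>E N u. ?G {u} (B z))"
  proof
    fix \<iota> assume a: "\<iota> \<in> K"
    then have \<iota>: "\<iota> \<in> R \<rightarrow>\<^sub>E {..<k}" by (simp add: K_def)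
    have lt: "\<iota> i < k" if "i \<in> R" for i using \<iota> that by auto
    show "\<iota> \<in> ?G A1 {..<k} \<union> (\<Union>u\<in>{..<k} - A1. \<Union>z\<in>Qs \<rightarrow>\<^sub>E N u. ?G {u} (B z))"
    proof (cases "\<iota> i' \<in> A1")
      case True
      then show ?thesis using \<iota> lt[OF R(3)] by simp
    next
      case False
      obtain fg where fg: "fg \<in> embeddings P Ls n M" "cert P Ls fg \<subseteq> I" "\<forall>i\<in>R. fst fg i = \<xi> (\<iota> i, i)"
        using a by (auto simp: K_def closed_tuple_def)
      have "fst fg ` R \<subseteq> \<xi> ` Co R" using fg(3) lt by (auto simp: Co_def)
      then have cU: "cert P Ls fg \<subseteq> U" using cl fg by blast
      define z where "z = restrict (fst fg) Qs"
      have zN: "z \<in> Qs \<rightarrow>\<^sub>E N (\<iota> i')"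
      proof -
        have "fst fg q \<in> N (\<iota> i')" if q: "q \<in> Qs" for q
        proof -
          obtain l where l: "l \<in> Ls" "i' \<in> l" "q \<in> l" using Qs(2)[OF q] by blast
          have m1: "(i', l) \<in> incidences P Ls" using l R by (auto simp: incidences_def)
          have m2: "(q, l) \<in> incidences P Ls" using l Qs(1) q by (auto simp: incidences_def)
          have "(fst fg i', snd fg l) \<in> cert P Ls fg" "(fst fg q, snd fg l) \<in> cert P Ls fg"
            unfolding cert_def using m1 m2 by force+
          then have "(\<xi> (\<iota> i', i'), snd fg l) \<in> U" "(fst fg q, snd fg l) \<in> U"
            using cU fg(3) R(2) by auto
          then show ?thesis by (auto simp: N_def)
        qed
        then show ?thesis by (simp add: z_def restrict_PiE_iff)
      qed
      have "\<xi> (\<iota> i'', i'') \<in> fibre P Ls Qs i'' n M I z"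
        unfolding fibre_def z_def using fg R(3) by auto
      then have "\<iota> i'' \<in> B z" using lt[OF R(3)] by (simp add: B_def)
      then have "\<iota> \<in> ?G {\<iota> i'} (B z)" using \<iota> by simp
      then show ?thesis using zN False lt[OF R(2)] by blast
    qed
  qed
  have c1: "card (?G A1 {..<k}) \<le> card Ub * k ^ (card R - 1)"
  proof -
    have "card (?G A1 {..<k}) = card A1 * card {..<k} * k ^ (card R - 2)"
      by (rule card_PiE_two_constraints[OF fR R(2,3,4)]) (auto simp: A1_def)
    also have "\<dots> = card A1 * (k * k ^ (card R - 2))" by simp
    also have "\<dots> \<le> card Ub * k ^ (card R - 1)" unfolding kk using cA1 by (rule mult_le_mono1)
    finally show ?thesis .
  qed
  have c2: "card (\<Union>u\<in>{..<k} - A1. \<Union>z\<in>Qs \<rightarrow>\<^sub>E N u. ?G {u} (B z)) \<le> (g * g) ^ card Qs * \<theta> * k ^ (card R - 1)"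
  proof -
    have in1: "card (\<Union>z\<in>Qs \<rightarrow>\<^sub>E N u. ?G {u} (B z)) \<le> (g * g) ^ card Qs * (\<theta> * k ^ (card R - 2))"
      if u: "u \<in> {..<k} - A1" for u
    proof -
      have "card (\<Union>z\<in>Qs \<rightarrow>\<^sub>E N u. ?G {u} (B z)) \<le> (\<Sum>z\<in>Qs \<rightarrow>\<^sub>E N u. card (?G {u} (B z)))"
        by (rule card_UN_le) (use fQ fN in \<open>auto intro!: finite_PiE\<close>)
      also have "\<dots> \<le> (\<Sum>z\<in>Qs \<rightarrow>\<^sub>E N u. \<theta> * k ^ (card R - 2))"
      proof (rule sum_mono)
        fix z assume z: "z \<in> Qs \<rightarrow>\<^sub>E N u"
        have zn: "z \<in> Qs \<rightarrow>\<^sub>E {..<n}" using z Nn PiE_mono[of Qs "\<lambda>_. N u" "\<lambda>_. {..<n}"] by blast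
        have "card (?G {u} (B z)) = card {u} * card (B z) * k ^ (card R - 2)"
          by (rule card_PiE_two_constraints[OF fR R(2,3,4)]) (use u in \<open>auto simp: B_def\<close>)
        then show "card (?G {u} (B z)) \<le> \<theta> * k ^ (card R - 2)" using cB[OF zn] by simp
      qed
      also have "\<dots> = card (N u) ^ card Qs * (\<theta> * k ^ (card R - 2))"
        using fQ by (simp add: card_PiE)
      also have "\<dots> \<le> (g * g) ^ card Qs * (\<theta> * k ^ (card R - 2))"
        using cN u by (intro mult_le_mono1 power_mono) auto
      finally show ?thesis .
    qed
    have "card (\<Union>u\<in>{..<k} - A1. \<Union>z\<in>Qs \<rightarrow>\<^sub>E N u. ?G {u} (B z))
        \<le> (\<Sum>u\<in>{..<k} - A1. card (\<Union>z\<in>Qs \<rightarrow>\<^sub>E N u. ?G {u} (B z)))"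
      by (rule card_UN_le) auto
    also have "\<dots> \<le> (\<Sum>u\<in>{..<k} - A1. (g * g) ^ card Qs * (\<theta> * k ^ (card R - 2)))"
      by (intro sum_mono in1)
    also have "\<dots> = card ({..<k} - A1) * ((g * g) ^ card Qs * (\<theta> * k ^ (card R - 2)))" by simp
    also have "\<dots> \<le> k * ((g * g) ^ card Qs * (\<theta> * k ^ (card R - 2)))"
    proof (rule mult_le_mono1)
      show "card ({..<k} - A1) \<le> k" using card_mono[of "{..<k}" "{..<k} - A1"] by simp
    qed
    also have "\<dots> = (g * g) ^ card Qs * \<theta> * (k * k ^ (card R - 2))" by (simp only: mult_ac)
    finally show ?thesis unfolding kk .
  qed
  have "card K \<le> card (?G A1 {..<k} \<union> (\<Union>u\<in>{..<k} - A1. \<Union>z\<in>Qs \<rightarrow>\<^sub>E N u. ?G {u} (B z)))"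
  proof (rule card_mono[OF _ sub])
    show "finite (?G A1 {..<k} \<union> (\<Union>u\<in>{..<k} - A1. \<Union>z\<in>Qs \<rightarrow>\<^sub>E N u. ?G {u} (B z)))"
      by (rule finite_subset[of _ "R \<rightarrow>\<^sub>E {..<k}"]) (use fR in \<open>auto intro: finite_PiE\<close>)
  qed
  also have "\<dots> \<le> card (?G A1 {..<k}) + card (\<Union>u\<in>{..<k} - A1. \<Union>z\<in>Qs \<rightarrow>\<^sub>E N u. ?G {u} (B z))"
    by (rule card_Un_le)
  also have "\<dots> \<le> card Ub * k ^ (card R - 1) + (g * g) ^ card Qs * \<theta> * k ^ (card R - 1)"
    using c1 c2 by linarith
  finally have "g * card K \<le> g * (card Ub * k ^ (card R - 1) + (g * g) ^ card Qs * \<theta> * k ^ (card R - 1))"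
    by (rule mult_le_mono2)
  also have "\<dots> = (g * card Ub) * k ^ (card R - 1) + g * ((g * g) ^ card Qs * \<theta> * k ^ (card R - 1))"
    by (simp add: algebra_simps)
  also have "\<dots> \<le> 2 * \<theta> * D0 * k ^ (card R - 1) + g * ((g * g) ^ card Qs * \<theta> * k ^ (card R - 1))"
    using cUb by (intro add_right_mono mult_le_mono1)
  finally show ?thesis by (simp only: K_def)
qed

section \<open>From samples to the density in W\<close>

text \<open>A union bound over the \<theta> positions that fall into Y, written with numbers of
  functions instead of probabilities.\<close>

lemma concentrated_samples:
  fixes w b \<theta> :: nat
  assumes fin: "finite Co" "finite W" and w: "card W = w" "0 < w" and Y: "card (W \<inter> Y) \<le> b"
  shows "real (card {\<xi> \<in> Co \<rightarrow>\<^sub>E W. \<theta> \<le> card {c\<in>Co. \<xi> c \<in> Y}})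
    \<le> real w ^ card Co * (real (card Co) * real b / real w) ^ \<theta>"
proof (cases "\<theta> \<le> card Co")
  case False
  have "card {c\<in>Co. \<xi> c \<in> Y} \<le> card Co" for \<xi> :: "'a \<Rightarrow> 'b" using fin by (intro card_mono) auto
  then have "{\<xi> \<in> Co \<rightarrow>\<^sub>E W. \<theta> \<le> card {c\<in>Co. \<xi> c \<in> Y}} = {}" using False by (auto simp: not_le intro: le_less_trans)
  then have "card {\<xi> \<in> Co \<rightarrow>\<^sub>E W. \<theta> \<le> card {c\<in>Co. \<xi> c \<in> Y}} = 0" by (simp only: card.empty)
  then show ?thesis by simp
next
  case True
  let ?\<A> = "{A. A \<subseteq> Co \<and> card A = \<theta>}"
  have fA: "finite ?\<A>" using fin by auto
  have cA: "card ?\<A> \<le> card Co ^ \<theta>" using fin True by (simp add: n_subsets binomial_le_pow)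
  have one: "card {\<xi> \<in> Co \<rightarrow>\<^sub>E W. \<forall>c\<in>A. \<xi> c \<in> Y} \<le> b ^ \<theta> * w ^ (card Co - \<theta>)" if A: "A \<in> ?\<A>" for A
  proof -
    let ?S = "\<lambda>c. if c \<in> A then W \<inter> Y else W"
    have "{\<xi> \<in> Co \<rightarrow>\<^sub>E W. \<forall>c\<in>A. \<xi> c \<in> Y} \<subseteq> PiE Co ?S"
      by (auto simp only: PiE_iff mem_Collect_eq IntI subset_iff split: if_split)
    then have "card {\<xi> \<in> Co \<rightarrow>\<^sub>E W. \<forall>c\<in>A. \<xi> c \<in> Y} \<le> card (PiE Co ?S)"
      using fin by (intro card_mono finite_PiE) auto
    also have "\<dots> = (\<Prod>c\<in>Co. card (?S c))" using fin by (simp add: card_PiE)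
    also have "\<dots> = (\<Prod>c\<in>Co. if c \<in> A then card (W \<inter> Y) else w)" by (intro prod.cong) (auto simp: w)
    also have "\<dots> = card (W \<inter> Y) ^ card (Co \<inter> A) * w ^ card (Co - A)"
      using fin by (simp add: prod.If_cases Diff_eq)
    also have "\<dots> = card (W \<inter> Y) ^ \<theta> * w ^ (card Co - \<theta>)"
    proof -
      have "finite A" using A fin finite_subset by auto
      then show ?thesis using A fin by (auto simp: Int_absorb1 card_Diff_subset)
    qed
    also have "\<dots> \<le> b ^ \<theta> * w ^ (card Co - \<theta>)" using Y by (intro mult_le_mono1 power_mono) auto
    finally show ?thesis .
  qed
  have "{\<xi> \<in> Co \<rightarrow>\<^sub>E W. \<theta> \<le> card {c\<in>Co. \<xi> c \<in> Y}} \<subseteq> (\<Union>A\<in>?\<A>. {\<xi> \<in> Co \<rightarrow>\<^sub>E W. \<forall>c\<in>A. \<xi> c \<in> Y})"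
  proof
    fix \<xi> assume a: "\<xi> \<in> {\<xi> \<in> Co \<rightarrow>\<^sub>E W. \<theta> \<le> card {c\<in>Co. \<xi> c \<in> Y}}"
    then obtain A where "A \<subseteq> {c\<in>Co. \<xi> c \<in> Y}" "card A = \<theta>"
      by (metis (no_types, lifting) mem_Collect_eq obtain_subset_with_card_n)
    then show "\<xi> \<in> (\<Union>A\<in>?\<A>. {\<xi> \<in> Co \<rightarrow>\<^sub>E W. \<forall>c\<in>A. \<xi> c \<in> Y})" using a by blast
  qed
  then have "card {\<xi> \<in> Co \<rightarrow>\<^sub>E W. \<theta> \<le> card {c\<in>Co. \<xi> c \<in> Y}} \<le> card (\<Union>A\<in>?\<A>. {\<xi> \<in> Co \<rightarrow>\<^sub>E W. \<forall>c\<in>A. \<xi> c \<in> Y})"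
  proof (rule card_mono[rotated])
    show "finite (\<Union>A\<in>?\<A>. {\<xi> \<in> Co \<rightarrow>\<^sub>E W. \<forall>c\<in>A. \<xi> c \<in> Y})"
      by (rule finite_subset[of _ "Co \<rightarrow>\<^sub>E W"]) (use fin in \<open>auto intro: finite_PiE\<close>)
  qed
  also have "\<dots> \<le> (\<Sum>A\<in>?\<A>. card {\<xi> \<in> Co \<rightarrow>\<^sub>E W. \<forall>c\<in>A. \<xi> c \<in> Y})" by (rule card_UN_le[OF fA])
  also have "\<dots> \<le> (\<Sum>A\<in>?\<A>. b ^ \<theta> * w ^ (card Co - \<theta>))" by (intro sum_mono one)
  also have "\<dots> = card ?\<A> * (b ^ \<theta> * w ^ (card Co - \<theta>))" by simp
  also have "\<dots> \<le> card Co ^ \<theta> * (b ^ \<theta> * w ^ (card Co - \<theta>))" using cA by (rule mult_le_mono1)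
  finally have "real (card {\<xi> \<in> Co \<rightarrow>\<^sub>E W. \<theta> \<le> card {c\<in>Co. \<xi> c \<in> Y}})
      \<le> real (card Co ^ \<theta> * (b ^ \<theta> * w ^ (card Co - \<theta>)))" by (rule of_nat_mono)
  also have "\<dots> = real w ^ card Co * (real (card Co) * real b / real w) ^ \<theta>"
  proof -
    have "real w ^ card Co = real w ^ \<theta> * real w ^ (card Co - \<theta>)"
      using True by (simp flip: power_add)
    then show ?thesis using w(2) by (simp add: power_divide power_mult_distrib)
  qed
  finally show ?thesis .
qed

lemma sum_card_swap:
  assumes "finite X" "finite Y"
  shows "(\<Sum>x\<in>X. card {y\<in>Y. Q x y}) = (\<Sum>y\<in>Y. card {x\<in>X. Q x y})"
proof -
  have "(\<Sum>x\<in>X. card {y\<in>Y. Q x y}) = (\<Sum>x\<in>X. \<Sum>y\<in>Y. if Q x y then 1 else 0)"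
    using assms by (simp add: sum.If_cases Int_def)
  also have "\<dots> = (\<Sum>y\<in>Y. \<Sum>x\<in>X. if Q x y then 1 else 0)" by (rule sum.swap)
  also have "\<dots> = (\<Sum>y\<in>Y. card {x\<in>X. Q x y})" using assms by (simp add: sum.If_cases Int_def)
  finally show ?thesis .
qed

lemma closed_tuple_cong:
  "(\<And>i. i \<in> R \<Longrightarrow> \<rho> i = \<rho>' i) \<Longrightarrow> closed_tuple P Ls R n M I \<rho> = closed_tuple P Ls R n M I \<rho>'"
  unfolding closed_tuple_def by (intro bex_cong refl) auto

text \<open>The positions selected by \<iota> are distinct, one for each root. Hence every closed
  tuple extends to the same number of samples, and different tuples extend to disjoint sets of
  samples.\<close>

lemma samples_hitting:
  assumes fin: "finite R" "finite W" and \<iota>: "\<iota> \<in> R \<rightarrow>\<^sub>E {..<k}"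
  shows "card {\<rho> \<in> R \<rightarrow>\<^sub>E W. closed_tuple P Ls R n M I \<rho>} * card W ^ (k * card R - card R)
    \<le> card {\<xi> \<in> {..<k} \<times> R \<rightarrow>\<^sub>E W. closed_tuple P Ls R n M I (\<lambda>i. \<xi> (\<iota> i, i))}"
proof -
  let ?Co = "{..<k} \<times> R"
  let ?A = "{\<rho> \<in> R \<rightarrow>\<^sub>E W. closed_tuple P Ls R n M I \<rho>}"
  let ?X = "\<lambda>\<rho>. {\<xi> \<in> ?Co \<rightarrow>\<^sub>E W. \<forall>i\<in>R. \<xi> (\<iota> i, i) = \<rho> i}"
  let ?D = "(\<lambda>i. (\<iota> i, i)) ` R"
  have fCo: "finite ?Co" using fin by simp
  have fX: "finite (?Co \<rightarrow>\<^sub>E W)" using fCo fin by (intro finite_PiE)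
  have D: "?D \<subseteq> ?Co" "card ?D = card R" using \<iota> by (auto intro!: card_image simp: inj_on_def)
  have fA: "finite ?A" using fin by (auto intro: finite_PiE finite_subset[of _ "R \<rightarrow>\<^sub>E W"])
  have each: "card (?X \<rho>) = card W ^ (k * card R - card R)" if \<rho>: "\<rho> \<in> ?A" for \<rho>
  proof -
    let ?S = "\<lambda>c. if c \<in> ?D then {\<rho> (snd c)} else W"
    have "?X \<rho> = PiE ?Co ?S"
    proof (rule set_eqI)
      fix \<xi>
      have "(\<forall>c\<in>?Co. \<xi> c \<in> W) \<and> (\<forall>i\<in>R. \<xi> (\<iota> i, i) = \<rho> i) \<longleftrightarrow> (\<forall>c\<in>?Co. \<xi> c \<in> ?S c)"
      proof
        assume "(\<forall>c\<in>?Co. \<xi> c \<in> W) \<and> (\<forall>i\<in>R. \<xi> (\<iota> i, i) = \<rho> i)"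
        then show "\<forall>c\<in>?Co. \<xi> c \<in> ?S c" by auto
      next
        assume a: "\<forall>c\<in>?Co. \<xi> c \<in> ?S c"
        have 1: "\<xi> (\<iota> i, i) = \<rho> i" if "i \<in> R" for i
        proof -
          have "(\<iota> i, i) \<in> ?Co" "(\<iota> i, i) \<in> ?D" using that \<iota> by auto
          then show ?thesis using a by (metis (mono_tags, lifting) singletonD snd_conv)
        qed
        moreover have "\<xi> c \<in> W" if "c \<in> ?Co" for c
        proof (cases "c \<in> ?D")
          case True
          then obtain i where "i \<in> R" "c = (\<iota> i, i)" by auto
          then show ?thesis using 1 \<rho> by auto
        next
          case False
          then show ?thesis using a that by (metis (mono_tags, lifting))
        qed
        ultimately show "(\<forall>c\<in>?Co. \<xi> c \<in> W) \<and> (\<forall>i\<in>R. \<xi> (\<iota> i, i) = \<rho> i)" by blast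
      qed
      then show "\<xi> \<in> ?X \<rho> \<longleftrightarrow> \<xi> \<in> PiE ?Co ?S" by (simp only: PiE_iff mem_Collect_eq) blast
    qed
    then have "card (?X \<rho>) = (\<Prod>c\<in>?Co. card (?S c))" using fCo by (simp add: card_PiE)
    also have "\<dots> = (\<Prod>c\<in>?Co. if c \<in> ?D then 1 else card W)" by (intro prod.cong) auto
    also have "\<dots> = card W ^ card (?Co - ?D)" using fCo by (simp add: prod.If_cases Diff_eq)
    also have "card (?Co - ?D) = k * card R - card R"
    proof -
      have "finite ?D" using fin by simp
      then have "card (?Co - ?D) = card ?Co - card ?D" using D(1) by (rule card_Diff_subset)
      then show ?thesis using D(2) by (simp add: card_cartesian_product)
    qed
    finally show ?thesis .
  qed
  have "card ?A * card W ^ (k * card R - card R) = (\<Sum>\<rho>\<in>?A. card (?X \<rho>))" using each by simp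
  also have "\<dots> = card (\<Union>\<rho>\<in>?A. ?X \<rho>)"
  proof (rule card_UN_disjoint[symmetric, OF fA])
    show "\<forall>\<rho>\<in>?A. finite (?X \<rho>)"
      by (intro ballI finite_subset[OF _ fX]) auto
    show "\<forall>\<rho>\<in>?A. \<forall>\<rho>'\<in>?A. \<rho> \<noteq> \<rho>' \<longrightarrow> ?X \<rho> \<inter> ?X \<rho>' = {}"
    proof (intro ballI impI)
      fix \<rho> \<rho>' assume a: "\<rho> \<in> ?A" "\<rho>' \<in> ?A" "\<rho> \<noteq> \<rho>'"
      have "\<exists>i\<in>R. \<rho> i \<noteq> \<rho>' i"
      proof (rule ccontr)
        assume "\<not> (\<exists>i\<in>R. \<rho> i \<noteq> \<rho>' i)"
        then have "\<rho> = \<rho>'" using a by (intro PiE_ext[of \<rho> R "\<lambda>_. W" \<rho>']) auto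
        then show False using a by simp
      qed
      then show "?X \<rho> \<inter> ?X \<rho>' = {}" by fastforce
    qed
  qed
  also have "\<dots> \<le> card {\<xi> \<in> ?Co \<rightarrow>\<^sub>E W. closed_tuple P Ls R n M I (\<lambda>i. \<xi> (\<iota> i, i))}"
  proof (rule card_mono)
    show "finite {\<xi> \<in> ?Co \<rightarrow>\<^sub>E W. closed_tuple P Ls R n M I (\<lambda>i. \<xi> (\<iota> i, i))}"
      by (rule finite_subset[OF _ fX]) auto
    show "(\<Union>\<rho>\<in>?A. ?X \<rho>) \<subseteq> {\<xi> \<in> ?Co \<rightarrow>\<^sub>E W. closed_tuple P Ls R n M I (\<lambda>i. \<xi> (\<iota> i, i))}"
    proof (intro UN_least subsetI)
      fix \<rho> \<xi> assume a: "\<rho> \<in> ?A" "\<xi> \<in> ?X \<rho>"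
      have "closed_tuple P Ls R n M I (\<lambda>i. \<xi> (\<iota> i, i)) = closed_tuple P Ls R n M I \<rho>"
        by (rule closed_tuple_cong) (use a in auto)
      then show "\<xi> \<in> {\<xi> \<in> ?Co \<rightarrow>\<^sub>E W. closed_tuple P Ls R n M I (\<lambda>i. \<xi> (\<iota> i, i))}" using a by simp
    qed
  qed
  finally show ?thesis .
qed

text \<open>Chains are controlled only for root sets of at most \<kappa> vertices, and W is far
  larger. A uniform tuple in W can however be drawn by sampling k vertices per root and picking one
  of them for each root. By \<open>n1\<close> all but a fraction \<eta>/2 of the samples are spread
  out over vertices, blocks and fibres; for a spread-out sample \<open>maximal_chain\<close>
  provides U, and \<open>n2\<close> and \<open>n3\<close> turn the bound of
  \<open>sampled_count\<close> into a fraction \<eta>/4 + \<eta>/4.\<close>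

lemma closed_density:
  fixes \<eta> :: real and g k \<theta> b h d \<kappa> w :: nat
  assumes fin: "finite P" "finite Ls" and R: "R \<subseteq> P" "i' \<in> R" "i'' \<in> R" "i' \<noteq> i''"
    and Qs: "Qs \<subseteq> P" "\<And>q. q \<in> Qs \<Longrightarrow> \<exists>l\<in>Ls. i' \<in> l \<and> q \<in> l"
    and d: "card (incidences P Ls) \<le> d"
    and IX: "I \<subseteq> {..<n} \<times> {..<M}"
    and nochain: "\<And>X. X \<subseteq> {..<n} \<Longrightarrow> card X \<le> \<kappa> \<Longrightarrow>
      \<nexists>cs. length cs = h \<and> chain (cert P Ls) (\<lambda>U c. \<not> cert P Ls c \<subseteq> U)
        {fg\<in>embeddings P Ls n M. fst fg ` R \<subseteq> X} {} cs \<and> (\<Union>c\<in>set cs. cert P Ls c) \<subseteq> I"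
    and blk: "\<And>j. j < M \<Longrightarrow> card {x. (x, j) \<in> I} \<le> b"
    and fib: "\<And>z. z \<in> Qs \<rightarrow>\<^sub>E {..<n} \<Longrightarrow> card (fibre P Ls Qs i'' n M I z) \<le> b"
    and W: "W \<subseteq> {..<n}" "card W = w" "0 < w"
    and pos: "1 \<le> b" "0 < g" "0 < k" "k * card R \<le> \<kappa>"
    and n1: "(real M + real n + real n ^ card Qs) * (real (k * card R) * real b / real w) ^ \<theta> \<le> \<eta> / 2"
    and n2: "2 * real \<theta> * real (d * h) \<le> \<eta> / 4 * real g * real k"
    and n3: "real ((g * g) ^ card Qs) * real \<theta> \<le> \<eta> / 4 * real k"
  shows "real (card {\<rho> \<in> R \<rightarrow>\<^sub>E W. closed_tuple P Ls R n M I \<rho>}) \<le> \<eta> * real w ^ card R"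
proof -
  let ?Co = "{..<k} \<times> R"
  let ?cl = "\<lambda>\<xi> \<iota>. closed_tuple P Ls R n M I (\<lambda>i. \<xi> (\<iota> i, i))"
  let ?X = "?Co \<rightarrow>\<^sub>E W"
  let ?Y = "R \<rightarrow>\<^sub>E {..<k}"
  have fR: "finite R" using fin R finite_subset by auto
  have fQ: "finite Qs" using fin Qs finite_subset by auto
  have fW: "finite W" using W finite_subset by auto
  have fCo: "finite ?Co" using fR by simp
  have fX: "finite ?X" using fCo fW by (intro finite_PiE)
  have fY: "finite ?Y" using fR by (intro finite_PiE) auto
  have cCo: "card ?Co = k * card R" by (simp add: card_cartesian_product)
  define r where "r = card R"
  have r1: "r \<ge> 1" using R fR by (metis One_nat_def Suc_leI card_gt_0_iff empty_iff r_def)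
  have rCo: "r \<le> k * r" using pos by simp
  have cY: "card ?Y = k ^ r" using fR by (simp add: card_PiE r_def)
  define J where "J = (\<lambda>Y. {\<xi> \<in> ?X. \<theta> \<le> card {c\<in>?Co. \<xi> c \<in> Y}})"
  define q where "q = (real (k * card R) * real b / real w) ^ \<theta>"
  have q0: "q \<ge> 0" by (simp add: q_def)
  have J: "real (card (J Y)) \<le> real w ^ (k * r) * q" if "card (W \<inter> Y) \<le> b" for Y
    using concentrated_samples[OF fCo fW W(2,3) that, of \<theta>] by (simp add: J_def q_def cCo r_def)
  have Ib: "card (W \<inter> {x. (x, j) \<in> I}) \<le> b" if "j < M" for j
  proof -
    have "finite {x. (x, j) \<in> I}" by (rule finite_subset[of _ "{..<n}"]) (use IX in auto)
    then have "card (W \<inter> {x. (x, j) \<in> I}) \<le> card {x. (x, j) \<in> I}" by (intro card_mono) auto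
    then show ?thesis using blk[OF that] by linarith
  qed
  have Fb: "card (W \<inter> fibre P Ls Qs i'' n M I z) \<le> b" if "z \<in> Qs \<rightarrow>\<^sub>E {..<n}" for z
  proof -
    have "i'' \<in> P" using R by auto
    then have "fibre P Ls Qs i'' n M I z \<subseteq> {..<n}" by (auto simp: fibre_def embeddings_def)
    then have "finite (fibre P Ls Qs i'' n M I z)" using finite_subset by blast
    then have "card (W \<inter> fibre P Ls Qs i'' n M I z) \<le> card (fibre P Ls Qs i'' n M I z)" by (intro card_mono) auto
    then show ?thesis using fib[OF that] by linarith
  qed
  define B1 where "B1 = (\<Union>v\<in>{..<n}. J {v})"
  define B2 where "B2 = (\<Union>j\<in>{..<M}. J {x. (x, j) \<in> I})"
  define B3 where "B3 = (\<Union>z\<in>Qs \<rightarrow>\<^sub>E {..<n}. J (fibre P Ls Qs i'' n M I z))"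
  define Bad where "Bad = B1 \<union> B2 \<union> B3"
  have JX: "J Y \<subseteq> ?X" for Y by (auto simp: J_def)
  have BadX: "Bad \<subseteq> ?X" using JX unfolding Bad_def B1_def B2_def B3_def by blast
  have un: "real (card (\<Union>y\<in>T. J (F y))) \<le> real (card T) * (real w ^ (k * r) * q)"
    if "finite T" "\<And>y. y \<in> T \<Longrightarrow> card (W \<inter> F y) \<le> b" for T :: "'t set" and F
  proof -
    have "real (card (\<Union>y\<in>T. J (F y))) \<le> real (\<Sum>y\<in>T. card (J (F y)))"
      by (rule of_nat_mono, rule card_UN_le[OF that(1)])
    also have "\<dots> = (\<Sum>y\<in>T. real (card (J (F y))))" by simp
    also have "\<dots> \<le> (\<Sum>y\<in>T. real w ^ (k * r) * q)" using that(2) by (intro sum_mono J) auto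
    finally show ?thesis by simp
  qed
  have b1: "real (card B1) \<le> real n * (real w ^ (k * r) * q)"
  proof -
    have "card (W \<inter> {v}) \<le> b" for v using pos(1) card_mono[of "{v}" "W \<inter> {v}"] by simp
    then show ?thesis using un[of "{..<n}" "\<lambda>v. {v}"] by (simp add: B1_def)
  qed
  have b2: "real (card B2) \<le> real M * (real w ^ (k * r) * q)"
    using un[of "{..<M}" "\<lambda>j. {x. (x, j) \<in> I}"] Ib by (simp add: B2_def)
  have b3: "real (card B3) \<le> real n ^ card Qs * (real w ^ (k * r) * q)"
    using un[of "Qs \<rightarrow>\<^sub>E {..<n}" "\<lambda>z. fibre P Ls Qs i'' n M I z"] Fb fQ
    by (simp add: B3_def card_PiE finite_PiE)
  have bad: "real (card Bad) \<le> \<eta> / 2 * real w ^ (k * r)"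
  proof -
    have "card Bad \<le> card B1 + card B2 + card B3"
      unfolding Bad_def using card_Un_le[of "B1 \<union> B2" B3] card_Un_le[of B1 B2] by linarith
    then have "real (card Bad) \<le> real (card B1) + real (card B2) + real (card B3)" by linarith
    also have "\<dots> \<le> (real M + real n + real n ^ card Qs) * q * real w ^ (k * r)"
      using b1 b2 b3 by (simp add: algebra_simps)
    also have "\<dots> \<le> \<eta> / 2 * real w ^ (k * r)"
      using n1 by (intro mult_right_mono) (auto simp: q_def)
    finally show ?thesis .
  qed
  have good: "real (card {\<iota>\<in>?Y. ?cl \<xi> \<iota>}) \<le> \<eta> / 2 * real k ^ r" if \<xi>: "\<xi> \<in> ?X - Bad" for \<xi>
  proof -
    have XW: "\<xi> ` ?Co \<subseteq> W" using \<xi> by auto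
    have cX: "card (\<xi> ` ?Co) \<le> \<kappa>" using card_image_le[OF fCo, of \<xi>] cCo pos(4) by linarith
    let ?F = "{fg\<in>embeddings P Ls n M. fst fg ` R \<subseteq> \<xi> ` ?Co}"
    have fc: "finite (cert P Ls c) \<and> card (cert P Ls c) \<le> d" for c
    proof -
      have "finite (incidences P Ls)" using fin finite_incidences by auto
      then show ?thesis using d card_image_le[of "incidences P Ls"] unfolding cert_def
        by (meson finite_imageI le_trans)
    qed
    have "\<exists>U. finite U \<and> U \<subseteq> I \<and> card U \<le> d * h \<and> (\<forall>c\<in>?F. cert P Ls c \<subseteq> I \<longrightarrow> cert P Ls c \<subseteq> U)"
      by (rule maximal_chain) (use fc nochain[of "\<xi> ` ?Co"] XW W cX in auto)
    then obtain U where UU: "finite U \<and> U \<subseteq> I \<and> card U \<le> d * h \<and> (\<forall>c\<in>?F. cert P Ls c \<subseteq> I \<longrightarrow> cert P Ls c \<subseteq> U)"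
      by (rule exE)
    note U = UU[THEN conjunct1] UU[THEN conjunct2, THEN conjunct1]
      UU[THEN conjunct2, THEN conjunct2, THEN conjunct1]
      UU[THEN conjunct2, THEN conjunct2, THEN conjunct2, rule_format]
    have nJ: "card {c\<in>?Co. \<xi> c \<in> Y} \<le> \<theta>" if "\<xi> \<notin> J Y" for Y
      using that \<xi> by (simp add: J_def)
    have "g * card {\<iota>\<in>?Y. ?cl \<xi> \<iota>}
        \<le> 2 * \<theta> * (d * h) * k ^ (card R - 1) + g * ((g * g) ^ card Qs * \<theta> * k ^ (card R - 1))"
    proof (rule sampled_count[OF fin(1) R Qs IX U(1,2,3) _ pos(2)])
      show "cert P Ls fg \<subseteq> U" if "fg \<in> embeddings P Ls n M" "fst fg ` R \<subseteq> \<xi> ` ?Co" "cert P Ls fg \<subseteq> I" for fg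
        using U(4)[of fg] that by blast
      show "card {c\<in>?Co. \<xi> c = v} \<le> \<theta>" if "v < n" for v
        using nJ[of "{v}"] \<xi> that by (auto simp: Bad_def B1_def)
      show "card {c\<in>?Co. (\<xi> c, j) \<in> I} \<le> \<theta>" if "j < M" for j
        using nJ[of "{x. (x, j) \<in> I}"] \<xi> that by (auto simp: Bad_def B2_def)
      show "card {c\<in>?Co. \<xi> c \<in> fibre P Ls Qs i'' n M I z} \<le> \<theta>" if "z \<in> Qs \<rightarrow>\<^sub>E {..<n}" for z
        using nJ[of "fibre P Ls Qs i'' n M I z"] \<xi> that by (auto simp: Bad_def B3_def)
    qed
    then have "real (g * card {\<iota>\<in>?Y. ?cl \<xi> \<iota>})
        \<le> real (2 * \<theta> * (d * h) * k ^ (card R - 1) + g * ((g * g) ^ card Qs * \<theta> * k ^ (card R - 1)))"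
      by (rule of_nat_mono)
    also have "\<dots> = (2 * real \<theta> * real (d * h)) * real k ^ (r - 1)
        + real g * (real ((g * g) ^ card Qs) * real \<theta>) * real k ^ (r - 1)" by (simp add: r_def)
    also have "\<dots> \<le> (\<eta> / 4 * real g * real k) * real k ^ (r - 1) + real g * (\<eta> / 4 * real k) * real k ^ (r - 1)"
      by (intro add_mono mult_right_mono mult_left_mono n2 n3) auto
    also have "\<dots> = real g * (\<eta> / 2 * (real k * real k ^ (r - 1)))" by (simp add: algebra_simps)
    also have "real k * real k ^ (r - 1) = real k ^ r" using r1 by (simp add: power_eq_if)
    finally have "real g * real (card {\<iota>\<in>?Y. ?cl \<xi> \<iota>}) \<le> real g * (\<eta> / 2 * real k ^ r)" by simp
    then show ?thesis using pos(2) by simp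
  qed
  let ?A = "{\<rho> \<in> R \<rightarrow>\<^sub>E W. closed_tuple P Ls R n M I \<rho>}"
  \<comment> \<open>Pairs of a sample and an index tuple with closed candidates are counted in two
    ways: from below through \<open>samples_hitting\<close>, from above by splitting into
    \<open>Bad\<close> and the other samples.\<close>
  have "k ^ r * (card ?A * w ^ (k * r - r)) = (\<Sum>\<iota>\<in>?Y. card ?A * w ^ (k * r - r))" using cY by simp
  also have "\<dots> \<le> (\<Sum>\<iota>\<in>?Y. card {\<xi>\<in>?X. ?cl \<xi> \<iota>})"
    using samples_hitting[OF fR fW] W(2) unfolding r_def by (intro sum_mono) auto
  also have "\<dots> = (\<Sum>\<xi>\<in>?X. card {\<iota>\<in>?Y. ?cl \<xi> \<iota>})"
    using sum_card_swap[OF fX fY, of ?cl] by simp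
  finally have "real (k ^ r * (card ?A * w ^ (k * r - r))) \<le> real (\<Sum>\<xi>\<in>?X. card {\<iota>\<in>?Y. ?cl \<xi> \<iota>})"
    by (rule of_nat_mono)
  also have "\<dots> = (\<Sum>\<xi>\<in>?X. real (card {\<iota>\<in>?Y. ?cl \<xi> \<iota>}))" by simp
  also have "\<dots> = (\<Sum>\<xi>\<in>?X - Bad. real (card {\<iota>\<in>?Y. ?cl \<xi> \<iota>})) + (\<Sum>\<xi>\<in>Bad. real (card {\<iota>\<in>?Y. ?cl \<xi> \<iota>}))"
    by (rule sum.subset_diff[OF BadX fX])
  also have "\<dots> \<le> (\<Sum>\<xi>\<in>?X - Bad. \<eta> / 2 * real k ^ r) + (\<Sum>\<xi>\<in>Bad. real k ^ r)"
  proof (intro add_mono sum_mono good)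
    fix \<xi>
    have "card {\<iota>\<in>?Y. ?cl \<xi> \<iota>} \<le> card ?Y" using fY by (intro card_mono) auto
    then have "real (card {\<iota>\<in>?Y. ?cl \<xi> \<iota>}) \<le> real (k ^ r)" unfolding cY by (rule of_nat_mono)
    then show "real (card {\<iota>\<in>?Y. ?cl \<xi> \<iota>}) \<le> real k ^ r" by simp
  qed
  also have "\<dots> \<le> real w ^ (k * r) * (\<eta> / 2 * real k ^ r) + \<eta> / 2 * real w ^ (k * r) * real k ^ r"
  proof -
    have eta: "\<eta> \<ge> 0"
    proof -
      have "\<eta> / 2 \<ge> 0" by (rule order_trans[OF _ n1]) auto
      then show ?thesis by simp
    qed
    have "card (?X - Bad) \<le> card ?X" using fX by (intro card_mono) auto
    also have "\<dots> = w ^ (k * r)" using fCo cCo W(2) by (simp add: card_PiE r_def)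
    finally have "real (card (?X - Bad)) \<le> real (w ^ (k * r))" by (rule of_nat_mono)
    then have "real (card (?X - Bad)) * (\<eta> / 2 * real k ^ r) \<le> real w ^ (k * r) * (\<eta> / 2 * real k ^ r)"
      using eta by (intro mult_right_mono) auto
    moreover have "real (card Bad) * real k ^ r \<le> \<eta> / 2 * real w ^ (k * r) * real k ^ r"
      using bad by (intro mult_right_mono) auto
    ultimately show ?thesis unfolding sum_constant by linarith
  qed
  also have "\<dots> = real k ^ r * (\<eta> * real w ^ (k * r))" by (simp add: algebra_simps)
  also have "real w ^ (k * r) = real w ^ r * real w ^ (k * r - r)" using rCo by (simp flip: power_add)
  finally have "real k ^ r * real w ^ (k * r - r) * real (card ?A)
      \<le> real k ^ r * real w ^ (k * r - r) * (\<eta> * real w ^ r)" by (simp add: mult_ac)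
  moreover have "real k ^ r * real w ^ (k * r - r) > 0" using pos(3) W(3) by simp
  ultimately have "real (card ?A) \<le> \<eta> * real w ^ r" by (simp only: mult_le_cancel_left_pos)
  then show ?thesis by (simp add: r_def)
qed

section \<open>Critical types\<close>

lemma linear_space_line:
  assumes "linear_space T s LL" "x \<in> T" "y \<in> T" "x \<noteq> y"
  obtains l where "l \<in> LL" "x \<in> l" "y \<in> l"
proof -
  have "\<forall>x\<in>T. \<forall>y\<in>T. x \<noteq> y \<longrightarrow> (\<exists>!l. l \<in> LL \<and> x \<in> l \<and> y \<in> l)"
    using assms(1) unfolding linear_space_def by (rule conjunct2)
  then have "\<exists>!l. l \<in> LL \<and> x \<in> l \<and> y \<in> l" using assms(2,3,4) by simp
  then obtain l where "l \<in> LL \<and> x \<in> l \<and> y \<in> l" by (rule ex1E)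
  then show ?thesis using that[of l] by simp
qed

text \<open>\<open>LL\<close> is the linear space cut out by the blocks on a potential clique, \<open>P\<close> the critical part of it, and \<open>l0\<close> the
  line of the block whose \<open>s\<close>-set is to be spoilt.\<close>

definition critical_types :: "nat \<Rightarrow> nat \<Rightarrow> real \<Rightarrow> real \<Rightarrow> nat \<Rightarrow> nat \<Rightarrow> (nat set set \<times> nat set \<times> nat set) set" where
  "critical_types n M p \<Lambda> s t = {(LL, P, l0). linear_space {..<t} s LL \<and> P \<subseteq> {..<t} \<and> 3 \<le> card P \<and>
     (\<forall>S. S \<subset> P \<longrightarrow> 2 \<le> card S \<longrightarrow> \<Lambda> * pattern_weight n M p LL P \<le> pattern_weight n M p LL S) \<and>
     l0 \<in> LL \<and> 2 \<le> card (l0 \<inter> P)}"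

definition other_lines :: "nat set set \<Rightarrow> nat set \<Rightarrow> nat set \<Rightarrow> nat set set" where
  "other_lines LL P l0 = {l\<in>LL. l \<noteq> l0 \<and> 2 \<le> card (l \<inter> P)}"

text \<open>The assumptions are comparisons between powers of n, with room for \<Lambda> where it
  occurs. \<open>npx\<close>, \<open>nxx\<close> and \<open>big\<close> are what the case
  distinction in \<open>all_spokes_single\<close> consumes.\<close>

locale weights =
  fixes n M s t :: nat and p \<Lambda> :: real
  assumes p: "0 < p" "p \<le> 1" "p \<le> 1 / \<Lambda>" and L1: "1 < \<Lambda>" and n1: "1 \<le> n"
    and Mp: "1 \<le> real M * p" and x: "real M * p\<^sup>2 \<le> 1 / \<Lambda>"
    and np: "1 \<le> real n * p" "real n * p\<^sup>2 \<le> 1"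
    and npx: "1 \<le> real n * p * (real M * p\<^sup>2)" and nxx: "1 \<le> real n * (real M * p\<^sup>2)\<^sup>2"
    and big: "1 \<le> (real n * p)\<^sup>2 * (real M * p\<^sup>2) * (real n * p\<^sup>2) ^ (s - 2)"
    and s3: "3 \<le> s" and t2: "2 \<le> t"
begin

abbreviation "lw \<equiv> line_weight M p"
abbreviation "pw \<equiv> pattern_weight n M p"
abbreviation "types \<equiv> critical_types n M p \<Lambda> s t"

lemma M0: "real M > 0" using Mp p by (cases "M = 0") auto

lemma x1: "real M * p\<^sup>2 \<le> 1" using x L1 by (smt (verit) divide_le_eq_1_pos)

lemma x0: "real M * p\<^sup>2 > 0" using M0 p by simp

lemma lw_pos: "lw k > 0" using M0 p by (simp add: line_weight_def)

lemma lw_le1: "lw k \<le> 1"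
proof (cases "2 \<le> k")
  case True
  have "real M * p ^ k \<le> real M * p\<^sup>2" using True p by (intro mult_left_mono power_decreasing) auto
  then show ?thesis using x1 True by (simp add: line_weight_def)
qed (simp add: line_weight_def)

lemma pw_pos: "pw LL S > 0"
  unfolding pattern_weight_def using n1 lw_pos by (intro mult_pos_pos prod_pos) auto

lemma typesD:
  assumes "(LL, P, l0) \<in> types"
  shows "linear_space {..<t} s LL" "P \<subseteq> {..<t}" "3 \<le> card P" "l0 \<in> LL" "2 \<le> card (l0 \<inter> P)"
    "finite P" "finite LL" "finite (other_lines LL P l0)" "card (l0 \<inter> P) \<le> s"
    "\<And>S. S \<subset> P \<Longrightarrow> 2 \<le> card S \<Longrightarrow> \<Lambda> * pw LL P \<le> pw LL S"
    "\<And>l. l \<in> other_lines LL P l0 \<Longrightarrow> l \<in> LL \<and> l \<noteq> l0 \<and> 2 \<le> card (l \<inter> P)"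
proof -
  show a: "linear_space {..<t} s LL" "P \<subseteq> {..<t}" "3 \<le> card P" "l0 \<in> LL" "2 \<le> card (l0 \<inter> P)"
    "\<And>S. S \<subset> P \<Longrightarrow> 2 \<le> card S \<Longrightarrow> \<Lambda> * pw LL P \<le> pw LL S"
    using assms by (auto simp: critical_types_def)
  show "finite P" using a(2) finite_subset by blast
  show f: "finite LL" using linear_space_finite[OF a(1)] by simp
  show "finite (other_lines LL P l0)" using f by (simp add: other_lines_def)
  have l0: "l0 \<subseteq> {..<t}" "card l0 \<le> s" using a(1,4) by (auto simp: linear_space_def)
  have "finite l0" using l0(1) finite_subset by blast
  then have "card (l0 \<inter> P) \<le> card l0" by (intro card_mono) auto
  then show "card (l0 \<inter> P) \<le> s" using l0(2) by linarith
  show "\<And>l. l \<in> other_lines LL P l0 \<Longrightarrow> l \<in> LL \<and> l \<noteq> l0 \<and> 2 \<le> card (l \<inter> P)"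
    by (auto simp: other_lines_def)
qed

text \<open>A line with fewer than two points in P has weight 1 on every subset of P, so only
  \<open>l0\<close> and the other lines of the type remain.\<close>

lemma pw_split:
  assumes T: "(LL, P, l0) \<in> types" and S: "S \<subseteq> P"
  shows "pw LL S = pw (other_lines LL P l0) S * lw (card (l0 \<inter> S))"
proof -
  note D = typesD[OF T]
  have "(\<Prod>l\<in>LL. lw (card (l \<inter> S))) = lw (card (l0 \<inter> S)) * (\<Prod>l\<in>LL - {l0}. lw (card (l \<inter> S)))"
    using D by (simp add: prod.remove)
  also have "(\<Prod>l\<in>LL - {l0}. lw (card (l \<inter> S))) = (\<Prod>l\<in>other_lines LL P l0. lw (card (l \<inter> S)))"
  proof (rule prod.mono_neutral_right)
    show "finite (LL - {l0})" using D by simp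
    show "other_lines LL P l0 \<subseteq> LL - {l0}" by (auto simp: other_lines_def)
    show "\<forall>l\<in>LL - {l0} - other_lines LL P l0. lw (card (l \<inter> S)) = 1"
    proof
      fix l assume "l \<in> LL - {l0} - other_lines LL P l0"
      then have "card (l \<inter> P) < 2" by (auto simp: other_lines_def)
      moreover have "card (l \<inter> S) \<le> card (l \<inter> P)" using S D(6) by (intro card_mono) auto
      ultimately show "lw (card (l \<inter> S)) = 1" by (simp add: line_weight_def)
    qed
  qed
  finally show ?thesis by (simp add: pattern_weight_def)
qed

text \<open>All points of \<open>l0\<close> in P are roots, so \<open>l0\<close> contributes the
  same factor to the known part and to P, and criticality says that passing from the known part to P
  loses a factor \<Lambda>. If no point is missing, some incidence still is, and
  \<open>ext_weight_vertices_known\<close> gives the loss.\<close>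

lemma closing_weight:
  assumes T: "(LL, P, l0) \<in> types" and D: "D \<subset> incidences P (other_lines LL P l0)"
  shows "ext_weight n M p P (other_lines LL P l0) (l0 \<inter> P) D \<le> 1 / \<Lambda>"
proof -
  note TD = typesD[OF T]
  let ?Ls = "other_lines LL P l0" and ?R = "l0 \<inter> P"
  define S where "S = ?R \<union> fst ` D"
  have SP: "S \<subseteq> P" using D by (auto simp: S_def incidences_def)
  have D': "D \<subseteq> incidences P ?Ls" using D by auto
  have two: "\<And>l. l \<in> ?Ls \<Longrightarrow> 2 \<le> card (l \<inter> P)" using TD(11) by blast
  show ?thesis
  proof (cases "S = P")
    case True
    show ?thesis
      by (rule ext_weight_vertices_known[OF TD(6,8) D True[unfolded S_def] two p x1 x])
  next
    case False
    have c: "ext_weight n M p P ?Ls ?R D * pw ?Ls S \<le> pw ?Ls P"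
      unfolding S_def by (rule ext_weight_le[OF TD(6,8) D' _ two p(1,2) Mp x1]) auto
    have l0S: "l0 \<inter> S = l0 \<inter> P" using SP by (auto simp: S_def)
    have "ext_weight n M p P ?Ls ?R D * pw LL S = ext_weight n M p P ?Ls ?R D * pw ?Ls S * lw (card (l0 \<inter> P))"
      unfolding pw_split[OF T SP] l0S by simp
    also have "\<dots> \<le> pw ?Ls P * lw (card (l0 \<inter> P))" using c lw_pos by (intro mult_right_mono) (auto intro: less_imp_le)
    also have "\<dots> = pw LL P" by (simp add: pw_split[OF T order_refl])
    also have "\<dots> \<le> pw LL S / \<Lambda>"
    proof -
      have "card ?R \<le> card S" using SP TD(6) finite_subset by (intro card_mono) (auto simp: S_def)
      then have "\<Lambda> * pw LL P \<le> pw LL S" using TD(5,10) SP False by (intro TD(10)) auto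
      then show ?thesis using L1 by (simp add: field_simps)
    qed
    finally have "ext_weight n M p P ?Ls ?R D * pw LL S \<le> 1 / \<Lambda> * pw LL S" by simp
    then show ?thesis using pw_pos by (simp only: mult_le_cancel_right_pos)
  qed
qed

text \<open>Here only some points on \<open>l0\<close> are roots. The others still have to join the
  block of \<open>l0\<close>; the division leaves this probability uncharged, and it is charged when
  extensions are counted in \<open>few_extensions\<close>.\<close>

lemma rooted_weight:
  assumes T: "(LL, P, l0) \<in> types" and D: "D \<subseteq> incidences P (other_lines LL P l0)"
    and R: "R \<subset> l0 \<inter> P" "2 \<le> card R"
  shows "ext_weight n M p P (other_lines LL P l0) R D \<le> (1 / \<Lambda>) / p ^ (card (l0 \<inter> P) - card R)"
proof -
  note TD = typesD[OF T]
  let ?Ls = "other_lines LL P l0"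
  let ?v = "card (l0 \<inter> P)"
  define S where "S = R \<union> fst ` D"
  have RP: "R \<subseteq> P" using R by auto
  have SP: "S \<subseteq> P" using D RP by (auto simp: S_def incidences_def)
  have two: "\<And>l. l \<in> ?Ls \<Longrightarrow> 2 \<le> card (l \<inter> P)" using TD(11) by blast
  have c: "ext_weight n M p P ?Ls R D * pw ?Ls S \<le> pw ?Ls P"
    unfolding S_def by (rule ext_weight_le[OF TD(6,8) D RP two p(1,2) Mp x1])
  have Rv: "card R < ?v" using R TD(6) by (intro psubset_card_mono) auto
  have "ext_weight n M p P ?Ls R D * p ^ (?v - card R) \<le> 1 / \<Lambda>"
  proof (cases "S = P")
    case True
    then have "ext_weight n M p P ?Ls R D * pw ?Ls P \<le> 1 * pw ?Ls P" using c by simp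
    then have e1: "ext_weight n M p P ?Ls R D \<le> 1" using pw_pos by (simp only: mult_le_cancel_right_pos)
    have "p ^ (?v - card R) \<le> p ^ 1" using Rv p by (intro power_decreasing) auto
    then have "ext_weight n M p P ?Ls R D * p ^ (?v - card R) \<le> 1 * p"
      using e1 p by (intro mult_mono) auto
    then show ?thesis using p by simp
  next
    case False
    \<comment> \<open>Of the points on \<open>l0\<close>, c0 are known after exposure of D, and
      these enter the comparison of weights. Since c0 is at least |R|, replacing c0 by |R| in the
      exponent of p only decreases the product.\<close>
    define c0 where "c0 = card (l0 \<inter> S)"
    have fS: "finite S" using SP TD(6) finite_subset by blast
    have Rc: "card R \<le> c0" unfolding c0_def using R fS by (intro card_mono) (auto simp: S_def)
    have cv: "c0 \<le> ?v" unfolding c0_def using SP TD(6) by (intro card_mono) auto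
    have lwc: "lw c0 = real M * p ^ c0" "lw ?v = real M * p ^ ?v"
      using Rc R(2) cv by (auto simp: line_weight_def)
    have "ext_weight n M p P ?Ls R D * p ^ (?v - c0) * pw LL S
        = ext_weight n M p P ?Ls R D * pw ?Ls S * (real M * p ^ ?v)"
    proof -
      have pp: "p ^ (?v - c0) * p ^ c0 = p ^ ?v" using cv by (simp flip: power_add)
      have gen: "A * y * (c * (m * z)) = A * c * (m * (y * z))" for A y c m z :: real
        by (simp only: mult_ac)
      show ?thesis unfolding pw_split[OF T SP] c0_def[symmetric] lwc(1)
        by (rule trans[OF gen]) (simp only: pp)
    qed
    also have "\<dots> \<le> pw ?Ls P * (real M * p ^ ?v)" using c M0 p by (intro mult_right_mono) auto
    also have "\<dots> = pw LL P" by (simp add: pw_split[OF T order_refl] lwc(2))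
    also have "\<dots> \<le> pw LL S / \<Lambda>"
    proof -
      have "card R \<le> card S" using fS by (intro card_mono) (auto simp: S_def)
      then have "\<Lambda> * pw LL P \<le> pw LL S" using R(2) SP False by (intro TD(10)) auto
      then show ?thesis using L1 by (simp add: field_simps)
    qed
    finally have "ext_weight n M p P ?Ls R D * p ^ (?v - c0) * pw LL S \<le> 1 / \<Lambda> * pw LL S" by simp
    then have e: "ext_weight n M p P ?Ls R D * p ^ (?v - c0) \<le> 1 / \<Lambda>"
      using pw_pos by (simp only: mult_le_cancel_right_pos)
    have "ext_weight n M p P ?Ls R D * p ^ (?v - card R) \<le> ext_weight n M p P ?Ls R D * p ^ (?v - c0)"
    proof (intro mult_left_mono power_decreasing)
      show "0 \<le> ext_weight n M p P ?Ls R D" using p by (simp add: ext_weight_def)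
    qed (use Rc p in auto)
    then show ?thesis using e by linarith
  qed
  then show ?thesis using p by (simp only: pos_le_divide_eq zero_less_power)
qed

section \<open>Spokes: the other lines through one root\<close>

definition spokes :: "nat set set \<Rightarrow> nat set \<Rightarrow> nat set \<Rightarrow> nat \<Rightarrow> nat set set" where
  "spokes LL P l0 i = {l\<in>other_lines LL P l0. i \<in> l}"

text \<open>Two lines share at most one point, so a spoke at i leaves \<open>l0\<close> immediately:
  apart from i all its points in P are off \<open>l0\<close>.\<close>

lemma spoke_trace:
  assumes T: "(LL, P, l0) \<in> types" and i: "i \<in> l0 \<inter> P" and l: "l \<in> spokes LL P l0 i"
  shows "l \<inter> P = insert i (l \<inter> (P - l0))" "card (l \<inter> P) = card (l \<inter> (P - l0)) + 1" "1 \<le> card (l \<inter> (P - l0))"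
proof -
  note TD = typesD[OF T]
  have lL: "l \<in> LL" "l \<noteq> l0" "i \<in> l" "2 \<le> card (l \<inter> P)" using l unfolding spokes_def other_lines_def by blast+
  have le: "card (l \<inter> l0) \<le> 1" by (rule linear_space_inter[OF TD(1) _ lL(1) TD(4) lL(2)]) simp
  have "l \<subseteq> {..<t}" using lL(1) TD(1) unfolding linear_space_def by blast
  then have "finite (l \<inter> l0)" using finite_subset by blast
  then have "\<forall>x\<in>l \<inter> l0. \<forall>y\<in>l \<inter> l0. x = y" using le by (simp only: card_le_Suc0_iff_eq One_nat_def)
  then have "l \<inter> l0 = {i}" using i lL(3) by blast
  then show eq: "l \<inter> P = insert i (l \<inter> (P - l0))" using i lL(3) by auto
  have "finite (l \<inter> (P - l0))" "i \<notin> l \<inter> (P - l0)" using TD(6) i by auto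
  then show c: "card (l \<inter> P) = card (l \<inter> (P - l0)) + 1" unfolding eq by simp
  show "1 \<le> card (l \<inter> (P - l0))" using c lL(4) by linarith
qed

lemma card_spokes_le:
  assumes T: "(LL, P, l0) \<in> types" and i: "i \<in> l0 \<inter> P"
  shows "card (spokes LL P l0 i) \<le> card (P - l0)"
proof -
  note TD = typesD[OF T]
  have "\<exists>f. \<forall>l\<in>spokes LL P l0 i. f l \<in> l \<inter> (P - l0)"
  proof (intro bchoice ballI)
    fix l assume "l \<in> spokes LL P l0 i"
    then have "card (l \<inter> (P - l0)) \<noteq> 0" using spoke_trace(3)[OF T i] by force
    then show "\<exists>y. y \<in> l \<inter> (P - l0)" by (metis card.empty ex_in_conv)
  qed
  then obtain f where f: "\<And>l. l \<in> spokes LL P l0 i \<Longrightarrow> f l \<in> l \<inter> (P - l0)" by blast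
  have "inj_on f (spokes LL P l0 i)"
  proof (rule inj_onI)
    fix l l' assume a: "l \<in> spokes LL P l0 i" "l' \<in> spokes LL P l0 i" "f l = f l'"
    have "l \<in> LL" "l' \<in> LL" "i \<in> l" "i \<in> l'" using a by (auto simp: spokes_def other_lines_def)
    moreover have "f l \<in> l" "f l \<in> l'" "f l \<noteq> i" "f l \<in> P" using f[OF a(1)] f[OF a(2)] a(3) i by auto
    ultimately show "l = l'" using TD(1,2) i unfolding linear_space_def by blast
  qed
  then show ?thesis using f TD(6) by (intro card_inj_on_le[of f]) auto
qed

text \<open>Each point off \<open>l0\<close> is joined to i by a spoke, and if no spoke carries two
  such points these spokes are distinct.\<close>

lemma card_spokes_single:
  assumes T: "(LL, P, l0) \<in> types" and i: "i \<in> l0 \<inter> P"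
    and single: "\<And>l. l \<in> spokes LL P l0 i \<Longrightarrow> card (l \<inter> (P - l0)) = 1"
  shows "card (P - l0) \<le> card (spokes LL P l0 i)"
proof -
  note TD = typesD[OF T]
  have "\<exists>h. \<forall>z\<in>P - l0. h z \<in> spokes LL P l0 i \<and> z \<in> h z"
  proof (intro bchoice ballI)
    fix z assume z: "z \<in> P - l0"
    then have zt: "z \<in> {..<t}" "i \<in> {..<t}" "i \<noteq> z" using TD(2) i by auto
    obtain l where l: "l \<in> LL" "i \<in> l" "z \<in> l" using linear_space_line[OF TD(1) zt(2,1,3)] .
    have "{i, z} \<subseteq> l \<inter> P" using l i z by auto
    then have "card {i, z} \<le> card (l \<inter> P)" using TD(6) by (intro card_mono) auto
    then have "l \<in> spokes LL P l0 i" using l z zt by (auto simp: spokes_def other_lines_def)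
    then show "\<exists>y. y \<in> spokes LL P l0 i \<and> z \<in> y" using l by blast
  qed
  then obtain h where h: "\<And>z. z \<in> P - l0 \<Longrightarrow> h z \<in> spokes LL P l0 i \<and> z \<in> h z" by blast
  have "inj_on h (P - l0)"
  proof (rule inj_onI)
    fix z z' assume a: "z \<in> P - l0" "z' \<in> P - l0" "h z = h z'"
    have "{z, z'} \<subseteq> h z \<inter> (P - l0)" using h[OF a(1)] h[OF a(2)] a by auto
    moreover have "card (h z \<inter> (P - l0)) = 1" using single h[OF a(1)] by blast
    ultimately show "z = z'" by (metis card_1_singletonE insert_subset singletonD)
  qed
  moreover have "finite (spokes LL P l0 i)" using TD(8) by (simp add: spokes_def)
  ultimately show ?thesis using h by (intro card_inj_on_le[of h]) auto
qed

text \<open>Compare P with its part Q off \<open>l0\<close>, with q points. Going from Q to P adds v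
  points, the line \<open>l0\<close> and at most v q spokes, all of them pairs, so with x = M p^2
  the weight changes by a factor of at least n^v M p^v x^(v q). For q \<le> 1 this would make P as
  frequent as a pair on \<open>l0\<close>, which criticality forbids. For q \<ge> 2 criticality is
  applied to Q itself and the factor is at most 1.\<close>

lemma all_spokes_single:
  assumes T: "(LL, P, l0) \<in> types"
    and single: "\<And>i l. i \<in> l0 \<inter> P \<Longrightarrow> l \<in> spokes LL P l0 i \<Longrightarrow> card (l \<inter> (P - l0)) = 1"
  shows "(real M * p\<^sup>2) ^ card (P - l0) \<le> p"
proof -
  note TD = typesD[OF T]
  let ?x = "real M * p\<^sup>2"
  let ?v = "card (l0 \<inter> P)"
  define Q where "Q = P - l0"
  define q where "q = card Q"
  define C where "C = (\<Union>i\<in>l0 \<inter> P. spokes LL P l0 i)"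
  have fQ: "finite Q" "Q \<subseteq> P" using TD(6) by (auto simp: Q_def)
  have cC: "card C \<le> ?v * q"
  proof -
    have "card C \<le> (\<Sum>i\<in>l0 \<inter> P. card (spokes LL P l0 i))"
      unfolding C_def by (rule card_UN_le) (use TD(6) in auto)
    also have "\<dots> \<le> (\<Sum>i\<in>l0 \<inter> P. q)" unfolding q_def Q_def by (intro sum_mono card_spokes_le[OF T])
    finally show ?thesis by simp
  qed
  have CL: "C \<subseteq> LL - {l0}" by (auto simp: C_def spokes_def other_lines_def)
  have fC: "finite C" using CL TD(7) finite_subset by blast
  have line: "lw (card (l \<inter> Q)) * (if l \<in> C then ?x else 1) \<le> lw (card (l \<inter> P))" if l: "l \<in> LL - {l0}" for l
  proof (cases "l \<in> C")
    case True
    then obtain i where i: "i \<in> l0 \<inter> P" "l \<in> spokes LL P l0 i" by (auto simp: C_def)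
    have "card (l \<inter> P) = 2" "card (l \<inter> Q) = 1"
      using spoke_trace(2)[OF T i] single[OF i] by (auto simp: Q_def)
    then show ?thesis using True by (simp add: line_weight_def)
  next
    case False
    show ?thesis
    proof (cases "l \<inter> l0 \<inter> P = {}")
      case True
      then have "l \<inter> Q = l \<inter> P" by (auto simp: Q_def)
      then show ?thesis using False by simp
    next
      case meet: False
      then obtain i where i: "i \<in> l" "i \<in> l0 \<inter> P" by auto
      then have "\<not> 2 \<le> card (l \<inter> P)" using False l by (auto simp: C_def spokes_def other_lines_def)
      then have "lw (card (l \<inter> P)) = 1" by (simp add: line_weight_def)
      then show ?thesis using False lw_le1 by simp
    qed
  qed
  have l0Q: "l0 \<inter> Q = {}" by (auto simp: Q_def)
  have cP: "card P = ?v + q"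
  proof -
    have "P = (l0 \<inter> P) \<union> Q" by (auto simp: Q_def)
    moreover have "card ((l0 \<inter> P) \<union> Q) = ?v + q" unfolding q_def
      using TD(6) fQ by (intro card_Un_disjoint) (auto simp: Q_def)
    ultimately show ?thesis by metis
  qed
  have lower: "pw LL Q * (real n ^ ?v * (real M * p ^ ?v) * ?x ^ (?v * q)) \<le> pw LL P"
  proof -
    have prodQ: "(\<Prod>l\<in>LL. lw (card (l \<inter> Q))) = (\<Prod>l\<in>LL - {l0}. lw (card (l \<inter> Q)))"
      using TD(4,7) l0Q by (simp add: prod.remove line_weight_def)
    have prodP: "(\<Prod>l\<in>LL. lw (card (l \<inter> P))) = (real M * p ^ ?v) * (\<Prod>l\<in>LL - {l0}. lw (card (l \<inter> P)))"
      using TD(4,5,7) by (simp add: prod.remove line_weight_def)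
    have "?x ^ (?v * q) \<le> ?x ^ card C" using cC x0 x1 by (intro power_decreasing) auto
    also have "\<dots> = (\<Prod>l\<in>LL - {l0}. if l \<in> C then ?x else 1)"
    proof -
      have "(\<Prod>l\<in>LL - {l0}. if l \<in> C then ?x else 1) = (\<Prod>l\<in>C. ?x)"
        using CL TD(7) by (subst prod.inter_restrict[symmetric]) (auto simp: Int_absorb1)
      then show ?thesis by simp
    qed
    finally have "(\<Prod>l\<in>LL - {l0}. lw (card (l \<inter> Q))) * ?x ^ (?v * q)
        \<le> (\<Prod>l\<in>LL - {l0}. lw (card (l \<inter> Q))) * (\<Prod>l\<in>LL - {l0}. if l \<in> C then ?x else 1)"
      by (intro mult_left_mono prod_nonneg) (auto intro: less_imp_le[OF lw_pos])
    also have "\<dots> = (\<Prod>l\<in>LL - {l0}. lw (card (l \<inter> Q)) * (if l \<in> C then ?x else 1))"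
      by (simp only: prod.distrib)
    also have "\<dots> \<le> (\<Prod>l\<in>LL - {l0}. lw (card (l \<inter> P)))"
    proof (intro prod_mono conjI line)
      fix l
      show "0 \<le> lw (card (l \<inter> Q)) * (if l \<in> C then ?x else 1)"
        using x0 lw_pos[of "card (l \<inter> Q)"] by (auto intro!: mult_nonneg_nonneg)
    qed
    finally have core: "(\<Prod>l\<in>LL - {l0}. lw (card (l \<inter> Q))) * ?x ^ (?v * q) \<le> (\<Prod>l\<in>LL - {l0}. lw (card (l \<inter> P)))" .
    have "pw LL Q * (real n ^ ?v * (real M * p ^ ?v) * ?x ^ (?v * q))
        = (real n ^ card P * (real M * p ^ ?v)) * ((\<Prod>l\<in>LL - {l0}. lw (card (l \<inter> Q))) * ?x ^ (?v * q))"
      unfolding pattern_weight_def prodQ cP q_def[symmetric] power_add by (simp only: mult_ac)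
    also have "\<dots> \<le> (real n ^ card P * (real M * p ^ ?v)) * (\<Prod>l\<in>LL - {l0}. lw (card (l \<inter> P)))"
      using core p by (intro mult_left_mono) auto
    also have "\<dots> = pw LL P" unfolding pattern_weight_def prodP by (simp only: mult_ac)
    finally show ?thesis .
  qed
  have v2: "?v \<ge> 2" and vs: "?v \<le> s" using TD by auto
  define c where "c = ?v - 2"
  have vc: "?v = c + 2" using v2 by (simp add: c_def)
  have pair: "\<Lambda> * pw LL P \<le> (real n)\<^sup>2 * ?x"
  proof -
    obtain S where S: "S \<subseteq> l0 \<inter> P" "card S = 2" using v2 by (metis obtain_subset_with_card_n)
    have "S \<noteq> P" using S(2) TD(3) by auto
    then have "\<Lambda> * pw LL P \<le> pw LL S" using S by (intro TD(10)) auto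
    moreover have "pw LL S = (real n)\<^sup>2 * ?x"
    proof -
      have "l0 \<inter> S = S" using S by auto
      have "(\<Prod>l\<in>LL - {l0}. lw (card (l \<inter> S))) = 1"
      proof (rule prod.neutral, rule ballI)
        fix l assume l: "l \<in> LL - {l0}"
        have "card (l \<inter> l0) \<le> 1" using linear_space_inter[OF TD(1) _ _ TD(4)] l by simp
        moreover have "card (l \<inter> S) \<le> card (l \<inter> l0)"
        proof (rule card_mono)
          have "l \<in> LL" using l by simp
          then have "l \<subseteq> {..<t}" using TD(1) unfolding linear_space_def by simp
          then show "finite (l \<inter> l0)" using finite_subset by blast
          show "l \<inter> S \<subseteq> l \<inter> l0" using S by blast
        qed
        ultimately show "lw (card (l \<inter> S)) = 1" by (simp add: line_weight_def)
      qed
      then have "(\<Prod>l\<in>LL. lw (card (l \<inter> S))) = lw 2"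
        using TD(4,7) \<open>l0 \<inter> S = S\<close> S(2) by (simp add: prod.remove)
      then show ?thesis using S(2) by (simp add: pattern_weight_def line_weight_def)
    qed
    ultimately show ?thesis by simp
  qed
  have nv: "real n ^ ?v * (real M * p ^ ?v) = (real n)\<^sup>2 * ?x * (real n * p) ^ c"
    unfolding vc by (simp add: power_add power_mult_distrib power2_eq_square mult_ac)
  consider "q = 0" | "q = 1" | "q \<ge> 2" by linarith
  then show ?thesis
  proof cases
    case 1
    have "pw LL Q = 1"
    proof -
      have "Q = {}" using 1 fQ by (simp add: q_def)
      then show ?thesis by (simp add: pattern_weight_def line_weight_def)
    qed
    then have "(real n)\<^sup>2 * ?x * (real n * p) ^ c \<le> pw LL P" using lower nv 1 by simp
    moreover have "(real n)\<^sup>2 * ?x * 1 \<le> (real n)\<^sup>2 * ?x * (real n * p) ^ c"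
      using np x0 by (intro mult_left_mono one_le_power) auto
    ultimately have "(real n)\<^sup>2 * ?x \<le> pw LL P" by simp
    then have "\<Lambda> * ((real n)\<^sup>2 * ?x) \<le> \<Lambda> * pw LL P" using L1 by (intro mult_left_mono) auto
    then have "\<Lambda> * ((real n)\<^sup>2 * ?x) \<le> 1 * ((real n)\<^sup>2 * ?x)" using pair by linarith
    moreover have "(real n)\<^sup>2 * ?x > 0" using n1 x0 by simp
    ultimately have "\<Lambda> \<le> 1" by (simp only: mult_le_cancel_right_pos)
    then show ?thesis using L1 by simp
  next
    case 2
    have "pw LL Q = real n"
    proof -
      have "lw (card (l \<inter> Q)) = 1" for l
      proof -
        have "card (l \<inter> Q) \<le> card Q" using fQ by (intro card_mono) auto
        then show ?thesis using 2 by (simp add: q_def line_weight_def)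
      qed
      then show ?thesis using 2 by (simp add: pattern_weight_def q_def)
    qed
    then have "real n * ((real n)\<^sup>2 * ?x * (real n * p) ^ c * ?x ^ ?v) \<le> pw LL P"
      using lower nv 2 by simp
    moreover have "real n * ((real n)\<^sup>2 * ?x * (real n * p) ^ c * ?x ^ ?v)
        = ((real n)\<^sup>2 * ?x) * ((real n * ?x\<^sup>2) * (real n * p * ?x) ^ c)"
      unfolding vc by (simp add: power_add power_mult_distrib power2_eq_square mult_ac)
    moreover have "((real n)\<^sup>2 * ?x) * 1 \<le> ((real n)\<^sup>2 * ?x) * ((real n * ?x\<^sup>2) * (real n * p * ?x) ^ c)"
    proof (intro mult_left_mono)
      have "1 * 1 \<le> (real n * ?x\<^sup>2) * (real n * p * ?x) ^ c"
        using nxx npx by (intro mult_mono one_le_power) auto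
      then show "1 \<le> (real n * ?x\<^sup>2) * (real n * p * ?x) ^ c" by simp
    qed (use x0 in simp)
    ultimately have "(real n)\<^sup>2 * ?x \<le> pw LL P" by linarith
    then have "\<Lambda> * ((real n)\<^sup>2 * ?x) \<le> \<Lambda> * pw LL P" using L1 by (intro mult_left_mono) auto
    then have "\<Lambda> * ((real n)\<^sup>2 * ?x) \<le> 1 * ((real n)\<^sup>2 * ?x)" using pair by linarith
    moreover have "(real n)\<^sup>2 * ?x > 0" using n1 x0 by simp
    ultimately have "\<Lambda> \<le> 1" by (simp only: mult_le_cancel_right_pos)
    then show ?thesis using L1 by simp
  next
    case 3
    have QP: "Q \<subset> P"
    proof -
      have "card Q \<noteq> card P" using cP v2 by (simp add: q_def)
      then show ?thesis using fQ(2) by auto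
    qed
    have "\<Lambda> * pw LL P \<le> pw LL Q" using QP 3 by (intro TD(10)) (auto simp: q_def)
    moreover have "pw LL P \<le> \<Lambda> * pw LL P" using L1 pw_pos[of LL P] by simp
    ultimately have "pw LL Q * (real n ^ ?v * (real M * p ^ ?v) * ?x ^ (?v * q)) \<le> pw LL Q * 1"
      using lower by linarith
    then have le1: "real n ^ ?v * (real M * p ^ ?v) * ?x ^ (?v * q) \<le> 1"
      using pw_pos by (simp only: mult_le_cancel_left_pos)
    show ?thesis
    proof (rule ccontr)
      assume "\<not> ?thesis"
      \<comment> \<open>With x^q replaced by the smaller p, the factor becomes (n p)^2 x (n p^2)^(v
        - 2). As n p^2 \<le> 1 and v \<le> s, this is at least 1 by \<open>big\<close>, the desired
        contradiction.\<close>
      then have lt: "p < ?x ^ q" by (simp add: q_def Q_def)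
      have "p ^ ?v < (?x ^ q) ^ ?v" using lt p v2 by (intro power_strict_mono) auto
      then have "p ^ ?v < ?x ^ (?v * q)" by (simp add: power_mult[symmetric] mult.commute)
      then have "real n ^ ?v * (real M * p ^ ?v) * p ^ ?v < real n ^ ?v * (real M * p ^ ?v) * ?x ^ (?v * q)"
        using n1 M0 p by (intro mult_strict_left_mono) auto
      then have lt1: "real n ^ ?v * (real M * p ^ ?v) * p ^ ?v < 1" using le1 by linarith
      have "real n ^ ?v * (real M * p ^ ?v) * p ^ ?v = (real n * p)\<^sup>2 * ?x * (real n * p\<^sup>2) ^ c"
        unfolding vc by (simp add: power_add power_mult_distrib power2_eq_square mult_ac)
      moreover have "(real n * p)\<^sup>2 * ?x * (real n * p\<^sup>2) ^ (s - 2) \<le> (real n * p)\<^sup>2 * ?x * (real n * p\<^sup>2) ^ c"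
        using vs np p x0 by (intro mult_left_mono power_decreasing) (auto simp: c_def)
      ultimately show False using big lt1 by linarith
    qed
  qed
qed

text \<open>A block has about n p vertices. The aim is a root i with no more candidates than that
  once the points off \<open>l0\<close> are placed, so a factor p must be gained from the spokes at
  i. One spoke with two points off \<open>l0\<close> provides it, and i is chosen with such a spoke
  if any root has one. Otherwise all spokes at all roots are pairs and
  \<open>all_spokes_single\<close> provides it.\<close>

lemma spoke_weight:
  assumes T: "(LL, P, l0) \<in> types"
  shows "\<exists>i\<in>l0 \<inter> P. \<forall>D. D \<subseteq> incidences (insert i (P - l0)) (spokes LL P l0 i) \<longrightarrow>
    ext_weight n M p (insert i (P - l0)) (spokes LL P l0 i) (P - l0) D \<le> real n * p"
proof -
  note TD = typesD[OF T]
  let ?x = "real M * p\<^sup>2"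
  define Q where "Q = P - l0"
  have px: "p \<le> ?x"
  proof -
    have "1 * p \<le> (real M * p) * p" using Mp p by (intro mult_right_mono) auto
    then show ?thesis by (simp add: power2_eq_square)
  qed
  define Big where "Big = {i\<in>l0 \<inter> P. \<exists>l\<in>spokes LL P l0 i. 2 \<le> card (l \<inter> Q)}"
  obtain i where i: "i \<in> l0 \<inter> P" and choice: "Big \<noteq> {} \<Longrightarrow> i \<in> Big"
  proof (cases "Big = {}")
    case True
    have "l0 \<inter> P \<noteq> {}" using TD(5) by auto
    then show ?thesis using True that by blast
  next
    case False
    then show ?thesis using that unfolding Big_def by blast
  qed
  let ?P = "insert i Q" and ?Ls = "spokes LL P l0 i"
  have fin: "finite ?P" "finite ?Ls" using TD(6,8) by (auto simp: Q_def spokes_def)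
  have iQ: "i \<notin> Q" using i by (auto simp: Q_def)
  have tr: "l \<inter> ?P = l \<inter> P" "card (l \<inter> ?P) = card (l \<inter> Q) + 1" "1 \<le> card (l \<inter> Q)" "i \<in> l" if "l \<in> ?Ls" for l
  proof -
    show il: "i \<in> l" using that by (simp add: spokes_def)
    show "l \<inter> ?P = l \<inter> P" using spoke_trace(1)[OF T i that] il by (auto simp: Q_def)
    then show "card (l \<inter> ?P) = card (l \<inter> Q) + 1" "1 \<le> card (l \<inter> Q)"
      using spoke_trace(2,3)[OF T i that] by (auto simp: Q_def)
  qed
  have "ext_weight n M p ?P ?Ls Q D \<le> real n * p" if D: "D \<subseteq> incidences ?P ?Ls" for D
  proof -
    let ?w = "\<lambda>l. (if l \<in> snd ` D then 1 else real M) * p ^ (card (l \<inter> ?P) - card {j. (j, l) \<in> D})"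
    have ew: "ext_weight n M p ?P ?Ls Q D = real n ^ card (?P - Q - fst ` D) * (\<Prod>l\<in>?Ls. ?w l)"
      by (rule ext_weight_prod[OF fin D])
    have w0: "0 \<le> ?w l" for l using p by simp
    have nd: "{j. (j, l) \<in> D} = {}" if "l \<notin> snd ` D" for l using that by force
    have out: "?w l = real M * p ^ card (l \<inter> ?P)" if "l \<notin> snd ` D" for l using nd[OF that] that by simp
    have w1: "?w l \<le> 1" if l: "l \<in> ?Ls" for l
    proof (cases "l \<in> snd ` D")
      case True
      then show ?thesis using p by (simp add: power_le_one)
    next
      case False
      have "real M * p ^ card (l \<inter> ?P) \<le> ?x" using tr(2,3)[OF l] p by (intro mult_left_mono power_decreasing) auto
      then show ?thesis using out[OF False] x1 by linarith
    qed
    show ?thesis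
    proof (cases "i \<in> fst ` D")
      case True
      then have "?P - Q - fst ` D = {}" by auto
      then have "card (?P - Q - fst ` D) = 0" by (simp only: card.empty)
      then have "ext_weight n M p ?P ?Ls Q D = (\<Prod>l\<in>?Ls. ?w l)" unfolding ew by (simp only: power_0 mult_1)
      also have "\<dots> \<le> 1" using w0 w1 by (intro prod_le_1) auto
      finally show ?thesis using np by linarith
    next
      case False
      then have "?P - Q - fst ` D = {i}" using iQ by auto
      then have "card (?P - Q - fst ` D) = 1" by (simp only: card.insert card.empty finite.emptyI empty_iff) simp
      then have ew1: "ext_weight n M p ?P ?Ls Q D = real n * (\<Prod>l\<in>?Ls. ?w l)" unfolding ew by (simp only: power_one_right)
      have wl: "?w l \<le> (if 2 \<le> card (l \<inter> Q) then p else ?x)" if l: "l \<in> ?Ls" for l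
      proof (cases "l \<in> snd ` D")
        case True
        have "{j. (j, l) \<in> D} \<subseteq> l \<inter> Q"
        proof
          fix j assume "j \<in> {j. (j, l) \<in> D}"
          then have "(j, l) \<in> D" by simp
          moreover from this have "j \<noteq> i" using False by force
          ultimately show "j \<in> l \<inter> Q" using D by (auto simp: incidences_def)
        qed
        then have "card {j. (j, l) \<in> D} \<le> card (l \<inter> Q)" using fin by (intro card_mono) auto
        then have "p ^ (card (l \<inter> ?P) - card {j. (j, l) \<in> D}) \<le> p ^ 1"
          using tr(2)[OF l] p by (intro power_decreasing) auto
        then have "?w l \<le> p" using True by simp
        then show ?thesis using px by simp
      next
        case nl: False
        show ?thesis
        proof (cases "2 \<le> card (l \<inter> Q)")
          case True
          then have "real M * p ^ card (l \<inter> ?P) \<le> real M * p ^ 3"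
            using tr(2)[OF l] p by (intro mult_left_mono power_decreasing) auto
          also have "\<dots> = ?x * p" by (simp add: power2_eq_square power3_eq_cube)
          also have "\<dots> \<le> 1 * p" using x1 p by (intro mult_right_mono) auto
          finally show ?thesis using True out[OF nl] by simp
        next
          case False
          then have "real M * p ^ card (l \<inter> ?P) \<le> ?x"
            using tr(2,3)[OF l] p by (intro mult_left_mono power_decreasing) auto
          then show ?thesis using False out[OF nl] by simp
        qed
      qed
      have "(\<Prod>l\<in>?Ls. ?w l) \<le> p"
      proof (cases "Big = {}")
        case False
        then obtain l where l: "l \<in> ?Ls" "2 \<le> card (l \<inter> Q)" using choice by (auto simp: Big_def)
        have "(\<Prod>l\<in>?Ls. ?w l) = ?w l * (\<Prod>l\<in>?Ls - {l}. ?w l)" using fin l by (simp add: prod.remove)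
        also have "\<dots> \<le> ?w l * 1" using w0 w1 by (intro mult_left_mono prod_le_1) auto
        also have "\<dots> \<le> p" using wl[OF l(1)] l(2) by simp
        finally show ?thesis .
      next
        case True
        have single: "card (l \<inter> (P - l0)) = 1" if "j \<in> l0 \<inter> P" "l \<in> spokes LL P l0 j" for j l
        proof -
          have "\<not> 2 \<le> card (l \<inter> Q)" using True that by (auto simp: Big_def)
          then show ?thesis using spoke_trace(3)[OF T that] by (simp add: Q_def)
        qed
        have "(\<Prod>l\<in>?Ls. ?w l) \<le> (\<Prod>l\<in>?Ls. ?x)"
        proof (intro prod_mono conjI w0)
          fix l assume l: "l \<in> ?Ls"
          have "card (l \<inter> Q) = 1" using single[OF i l] by (simp add: Q_def)
          then show "?w l \<le> ?x" using wl[OF l] by simp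
        qed
        also have "\<dots> = ?x ^ card ?Ls" by simp
        also have "\<dots> \<le> ?x ^ card (P - l0)"
          using card_spokes_single[OF T i single[OF i]] x0 x1 by (intro power_decreasing) auto
        also have "\<dots> \<le> p" by (rule all_spokes_single[OF T single])
        finally show ?thesis .
      qed
      then show ?thesis unfolding ew1 by (intro mult_left_mono) auto
    qed
  qed
  then show ?thesis using i unfolding Q_def by blast
qed

end

section \<open>Quality of an incidence structure\<close>

lemma chain_mono: "chain C ok F U cs \<Longrightarrow> F \<subseteq> F' \<Longrightarrow> chain C ok F' U cs"
  by (induction cs arbitrary: U) auto

definition no_long_chain :: "nat \<Rightarrow> nat \<Rightarrow> nat \<Rightarrow> nat \<Rightarrow> nat set \<Rightarrow> nat set set \<Rightarrow> nat set \<Rightarrow> (nat \<times> nat) set \<Rightarrow> bool" where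
  "no_long_chain n M \<kappa> h P Ls R I \<longleftrightarrow> (\<forall>X. X \<subseteq> {..<n} \<longrightarrow> card X \<le> \<kappa> \<longrightarrow>
     (\<nexists>cs. length cs = h \<and> chain (cert P Ls) (\<lambda>U c. \<not> cert P Ls c \<subseteq> U)
        {fg\<in>embeddings P Ls n M. fst fg ` R \<subseteq> X} {} cs \<and> (\<Union>c\<in>set cs. cert P Ls c) \<subseteq> I))"

text \<open>Roles of the parameters: \<open>w\<close> is the size of the sets W, \<open>k\<close>
  the number of samples per root, \<open>h\<close> the chain length, \<open>\<theta>\<close> the
  threshold for concentrated samples, \<open>g\<close> the limit for heavy vertices and blocks,
  \<open>b\<close> the bound on blocks and fibres, \<open>K\<close> the order of moments. The
  inequalities \<open>den1\<close> to \<open>den3\<close> feed \<open>closed_density\<close>;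
  \<open>un1\<close> to \<open>un4\<close> are union bounds, one for each condition in
  \<open>quality\<close>.\<close>

locale construction = weights n M s t p \<Lambda>
  for n M s t :: nat and p \<Lambda> :: real +
  fixes w k h \<theta> g K b :: nat and \<eta> :: real
  assumes eta: "0 < \<eta>" and pos: "0 < w" "1 \<le> b" "0 < g" "0 < k"
    and kn: "k * t \<le> n"
    and den1: "(real M + real n + real n ^ t) * (real (k * t) * real b / real w) ^ \<theta> \<le> \<eta> / 2"
    and den2: "2 * real \<theta> * real ((t * 2 ^ t) * h) \<le> \<eta> / 4 * real g * real k"
    and den3: "real ((g * g) ^ t) * real \<theta> \<le> \<eta> / 4 * real k"
    and un1: "real M * ((real n * p + real K) / real b) ^ K \<le> 1 / 16"
    and un2: "2 ^ (2 ^ t) * 2 ^ t * 2 ^ t * 2 ^ t * real n ^ t *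
      (2 ^ (t * 2 ^ t) * (real (t * 2 ^ t * K) + 1) ^ (t * 2 ^ t) / (\<Lambda> * \<eta>)) ^ K \<le> 1 / 16"
    and un3: "2 ^ (2 ^ t) * 2 ^ t * 2 ^ t * real n ^ t *
      (2 ^ (t * 2 ^ t) * (real (t * 2 ^ t * K) + 1) ^ (t * 2 ^ t) * (real n * p) / real b) ^ K \<le> 1 / 16"
    and un4: "2 ^ t * 2 ^ (2 ^ t) * 2 ^ t * real n ^ (k * t) *
      (real (k * t) ^ t * (2 ^ (t * 2 ^ t) * (real (t * 2 ^ t * h) + 1) ^ (t * 2 ^ t) / \<Lambda>)) ^ h \<le> 1 / 16"
begin

definition spoke_vertex :: "nat set set \<Rightarrow> nat set \<Rightarrow> nat set \<Rightarrow> nat" where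
  "spoke_vertex LL P l0 = (SOME i. i \<in> l0 \<inter> P \<and> (\<forall>D. D \<subseteq> incidences (insert i (P - l0)) (spokes LL P l0 i) \<longrightarrow>
    ext_weight n M p (insert i (P - l0)) (spokes LL P l0 i) (P - l0) D \<le> real n * p))"

lemma spoke_vertex:
  assumes "(LL, P, l0) \<in> types"
  shows "spoke_vertex LL P l0 \<in> l0 \<inter> P"
    "\<And>D. D \<subseteq> incidences (insert (spoke_vertex LL P l0) (P - l0)) (spokes LL P l0 (spoke_vertex LL P l0)) \<Longrightarrow>
      ext_weight n M p (insert (spoke_vertex LL P l0) (P - l0)) (spokes LL P l0 (spoke_vertex LL P l0)) (P - l0) D \<le> real n * p"
proof -
  have "\<exists>i. i \<in> l0 \<inter> P \<and> (\<forall>D. D \<subseteq> incidences (insert i (P - l0)) (spokes LL P l0 i) \<longrightarrow>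
    ext_weight n M p (insert i (P - l0)) (spokes LL P l0 i) (P - l0) D \<le> real n * p)"
    using spoke_weight[OF assms] by (simp only: Bex_def)
  note * = someI_ex[OF this, folded spoke_vertex_def]
  show "spoke_vertex LL P l0 \<in> l0 \<inter> P" using * by (rule conjunct1)
  show "\<And>D. D \<subseteq> incidences (insert (spoke_vertex LL P l0) (P - l0)) (spokes LL P l0 (spoke_vertex LL P l0)) \<Longrightarrow>
      ext_weight n M p (insert (spoke_vertex LL P l0) (P - l0)) (spokes LL P l0 (spoke_vertex LL P l0)) (P - l0) D \<le> real n * p"
    using *[THEN conjunct2] by simp
qed

text \<open>The inserted pattern is a pair of vertices in one block. It puts the simpler way of
  being spoilt into the same form as the critical types.\<close>

definition closing_patterns :: "(nat set \<times> nat set set \<times> nat set) set" where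
  "closing_patterns = insert ({0, 1}, {{0, 1}}, {0, 1})
     ((\<lambda>(LL, P, l0). (P, other_lines LL P l0, l0 \<inter> P)) ` types)"

lemma closing_patterns_cases:
  assumes "(P, Ls, R) \<in> closing_patterns"
  obtains "P = {0, 1}" "Ls = {{0, 1}}" "R = {0, 1}"
    | LL l0 where "(LL, P, l0) \<in> types" "Ls = other_lines LL P l0" "R = l0 \<inter> P"
proof -
  have "P = {0, 1} \<and> Ls = {{0, 1}} \<and> R = {0, 1} \<or>
      (\<exists>LL l0. (LL, P, l0) \<in> types \<and> Ls = other_lines LL P l0 \<and> R = l0 \<inter> P)"
    using assms unfolding closing_patterns_def by auto
  then show ?thesis using that by (elim disjE exE conjE)
qed

definition rooted_count :: "(nat \<times> nat) set \<Rightarrow> nat set \<Rightarrow> nat set set \<Rightarrow> nat set \<Rightarrow> (nat \<Rightarrow> nat) \<Rightarrow> nat" where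
  "rooted_count I P Ls R \<rho> = card {fg\<in>embeddings P Ls n M. (\<forall>i\<in>R. fst fg i = \<rho> i) \<and> cert P Ls fg \<subseteq> I}"

definition small_blocks :: "(nat \<times> nat) set \<Rightarrow> bool" where
  "small_blocks I \<longleftrightarrow> I \<subseteq> {..<n} \<times> {..<M} \<and> (\<forall>j<M. card {x. (x, j) \<in> I} \<le> b)"

text \<open>Meant for the case that \<open>R\<close> are the roots inside the s-set to be spoilt:
  the power of p is the probability that the remaining roots join the block, wherever they
  are.\<close>

definition few_extensions :: "(nat \<times> nat) set \<Rightarrow> bool" where
  "few_extensions I \<longleftrightarrow> (\<forall>LL P l0 R. (LL, P, l0) \<in> types \<longrightarrow> R \<subset> l0 \<inter> P \<longrightarrow> 2 \<le> card R \<longrightarrow>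
     (\<forall>\<rho>\<in>R \<rightarrow>\<^sub>E {..<n}. real (rooted_count I P (other_lines LL P l0) R \<rho>) * p ^ (card (l0 \<inter> P) - card R) \<le> \<eta>))"

definition small_fibres :: "(nat \<times> nat) set \<Rightarrow> bool" where
  "small_fibres I \<longleftrightarrow> (\<forall>LL P l0. (LL, P, l0) \<in> types \<longrightarrow> (\<forall>z\<in>(P - l0) \<rightarrow>\<^sub>E {..<n}.
     card (fibre P (other_lines LL P l0) (P - l0) (spoke_vertex LL P l0) n M I z) \<le> b))"

definition short_chains :: "(nat \<times> nat) set \<Rightarrow> bool" where
  "short_chains I \<longleftrightarrow> (\<forall>P Ls R. (P, Ls, R) \<in> closing_patterns \<longrightarrow> no_long_chain n M (k * t) h P Ls R I)"

definition quality :: "(nat \<times> nat) set \<Rightarrow> bool" where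
  "quality I \<longleftrightarrow> small_blocks I \<and> few_extensions I \<and> small_fibres I \<and> short_chains I"

lemma card_incidences_le:
  assumes "P \<subseteq> {..<t}" "Ls \<subseteq> Pow {..<t}"
  shows "card (incidences P Ls) \<le> t * 2 ^ t"
proof -
  have f: "finite P" "finite Ls" using assms finite_subset by (blast, metis finite_Pow_iff finite_lessThan finite_subset)
  have "card (incidences P Ls) \<le> card (P \<times> Ls)" using f by (intro card_mono) (auto simp: incidences_def)
  also have "\<dots> = card P * card Ls" by (simp add: card_cartesian_product)
  also have "\<dots> \<le> t * 2 ^ t"
  proof (rule mult_le_mono)
    show "card P \<le> t" using assms(1) card_mono[of "{..<t}" P] by simp
    show "card Ls \<le> 2 ^ t" using assms(2) card_mono[of "Pow {..<t}" Ls] by (simp add: card_Pow)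
  qed
  finally show ?thesis .
qed

lemma types_lines:
  assumes "(LL, P, l0) \<in> types"
  shows "other_lines LL P l0 \<subseteq> Pow {..<t}"
proof
  fix l assume "l \<in> other_lines LL P l0"
  then have "l \<in> LL" by (simp add: other_lines_def)
  then show "l \<in> Pow {..<t}" using typesD(1)[OF assms] unfolding linear_space_def by simp
qed

lemma closing_patternsD:
  assumes "(P, Ls, R) \<in> closing_patterns"
  shows "finite P" "finite Ls" "R \<subseteq> P" "P \<subseteq> {..<t}" "Ls \<subseteq> Pow {..<t}" "2 \<le> card R"
    "\<And>D. D \<subset> incidences P Ls \<Longrightarrow> ext_weight n M p P Ls R D \<le> 1 / \<Lambda>"
proof -
  have "finite P \<and> finite Ls \<and> R \<subseteq> P \<and> P \<subseteq> {..<t} \<and> Ls \<subseteq> Pow {..<t} \<and> 2 \<le> card R \<and>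
      (\<forall>D. D \<subset> incidences P Ls \<longrightarrow> ext_weight n M p P Ls R D \<le> 1 / \<Lambda>)"
    using assms
  proof (cases rule: closing_patterns_cases)
    case 1
    have "ext_weight n M p P Ls R D \<le> 1 / \<Lambda>" if D: "D \<subset> incidences P Ls" for D
    proof (rule ext_weight_vertices_known[OF _ _ D _ _ p x1 x])
      show "finite P" "finite Ls" using 1 by simp_all
      have "fst ` D \<subseteq> P" using D unfolding incidences_def by force
      then show "R \<union> fst ` D = P" using 1 by blast
      show "2 \<le> card (l \<inter> P)" if "l \<in> Ls" for l
      proof -
        have "l \<inter> P = {0, 1}" using that 1 by simp
        then show ?thesis by simp
      qed
    qed
    moreover have "finite P" "finite Ls" "R \<subseteq> P" "P \<subseteq> {..<t}" "Ls \<subseteq> Pow {..<t}" "2 \<le> card R"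
      unfolding 1 using t2 by auto
    ultimately show ?thesis by simp
  next
    case (2 LL l0)
    note TD = typesD[OF 2(1)]
    have "\<forall>D. D \<subset> incidences P Ls \<longrightarrow> ext_weight n M p P Ls R D \<le> 1 / \<Lambda>"
      using closing_weight[OF 2(1)] 2 by simp
    then show ?thesis using TD(2,5,6,8) types_lines[OF 2(1)] 2(2,3) by simp
  qed
  then show "finite P" "finite Ls" "R \<subseteq> P" "P \<subseteq> {..<t}" "Ls \<subseteq> Pow {..<t}" "2 \<le> card R"
    "\<And>D. D \<subset> incidences P Ls \<Longrightarrow> ext_weight n M p P Ls R D \<le> 1 / \<Lambda>" by simp_all
qed

lemma finite_fibre: "i \<in> P \<Longrightarrow> finite (fibre P Ls Q i n M I z)"
  by (rule finite_subset[of _ "{..<n}"]) (auto simp: fibre_def embeddings_def)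

text \<open>Every condition bounds a count or forbids a configuration of incidences, so it survives
  their removal. This is what passes from all blocks to the red ones.\<close>

lemma quality_mono:
  assumes q: "quality I" and sub: "I' \<subseteq> I"
  shows "quality I'"
proof -
  have q1: "small_blocks I" and q2: "few_extensions I" and q3: "small_fibres I" and q4: "short_chains I"
    using q by (simp_all add: quality_def)
  have IX: "I \<subseteq> {..<n} \<times> {..<M}" using q1 by (simp add: small_blocks_def)
  have "card {x. (x, j) \<in> I'} \<le> b" if "j < M" for j
  proof -
    have "finite {x. (x, j) \<in> I}" by (rule finite_subset[of _ "{..<n}"]) (use IX in auto)
    then have "card {x. (x, j) \<in> I'} \<le> card {x. (x, j) \<in> I}" using sub by (intro card_mono) auto
    moreover have "card {x. (x, j) \<in> I} \<le> b" using q1 that by (simp add: small_blocks_def)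
    ultimately show ?thesis by linarith
  qed
  then have "small_blocks I'" using IX sub by (auto simp: small_blocks_def)
  moreover have "few_extensions I'"
    unfolding few_extensions_def
  proof (intro allI impI ballI)
    fix LL P l0 R \<rho> assume T: "(LL, P, l0) \<in> types" and R: "R \<subset> l0 \<inter> P" "2 \<le> card R" and \<rho>: "\<rho> \<in> R \<rightarrow>\<^sub>E {..<n}"
    have "rooted_count I' P (other_lines LL P l0) R \<rho> \<le> rooted_count I P (other_lines LL P l0) R \<rho>"
      unfolding rooted_count_def
    proof (rule card_mono)
      show "finite {fg\<in>embeddings P (other_lines LL P l0) n M. (\<forall>i\<in>R. fst fg i = \<rho> i) \<and> cert P (other_lines LL P l0) fg \<subseteq> I}"
        by (rule finite_subset[OF _ finite_embeddings[OF typesD(6,8)[OF T], of n M]]) simp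
    qed (use sub in blast)
    then have "real (rooted_count I' P (other_lines LL P l0) R \<rho>) * p ^ (card (l0 \<inter> P) - card R)
       \<le> real (rooted_count I P (other_lines LL P l0) R \<rho>) * p ^ (card (l0 \<inter> P) - card R)"
      using p by (intro mult_right_mono) auto
    moreover have "real (rooted_count I P (other_lines LL P l0) R \<rho>) * p ^ (card (l0 \<inter> P) - card R) \<le> \<eta>"
      using q2 T R \<rho> unfolding few_extensions_def by simp
    ultimately show "real (rooted_count I' P (other_lines LL P l0) R \<rho>) * p ^ (card (l0 \<inter> P) - card R) \<le> \<eta>" by linarith
  qed
  moreover have "small_fibres I'"
    unfolding small_fibres_def
  proof (intro allI impI ballI)
    fix LL P l0 z assume T: "(LL, P, l0) \<in> types" and z: "z \<in> (P - l0) \<rightarrow>\<^sub>E {..<n}"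
    have "card (fibre P (other_lines LL P l0) (P - l0) (spoke_vertex LL P l0) n M I' z)
        \<le> card (fibre P (other_lines LL P l0) (P - l0) (spoke_vertex LL P l0) n M I z)"
    proof (rule card_mono)
      show "finite (fibre P (other_lines LL P l0) (P - l0) (spoke_vertex LL P l0) n M I z)"
        using spoke_vertex(1)[OF T] by (intro finite_fibre) auto
      show "fibre P (other_lines LL P l0) (P - l0) (spoke_vertex LL P l0) n M I' z
          \<subseteq> fibre P (other_lines LL P l0) (P - l0) (spoke_vertex LL P l0) n M I z"
        unfolding fibre_def using sub by blast
    qed
    moreover have "card (fibre P (other_lines LL P l0) (P - l0) (spoke_vertex LL P l0) n M I z) \<le> b"
      using q3 T z unfolding small_fibres_def by simp
    ultimately show "card (fibre P (other_lines LL P l0) (P - l0) (spoke_vertex LL P l0) n M I' z) \<le> b" by linarith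
  qed
  moreover have "short_chains I'"
    unfolding short_chains_def
  proof (intro allI impI)
    fix P Ls R assume "(P, Ls, R) \<in> closing_patterns"
    then have "no_long_chain n M (k * t) h P Ls R I" using q4 unfolding short_chains_def by simp
    then show "no_long_chain n M (k * t) h P Ls R I'" using sub unfolding no_long_chain_def by blast
  qed
  ultimately show ?thesis by (simp add: quality_def)
qed

text \<open>For a critical type, i'' is the spoke vertex, whose fibres are small, and i' any other
  root; each point off \<open>l0\<close> is joined to i' by a line of the pattern. For the pair
  pattern Q consists of the point 1 itself, and fibres have at most one vertex.\<close>

lemma quality_density:
  assumes q: "quality I" and W: "W \<subseteq> {..<n}" "card W = w" and pat: "(P, Ls, R) \<in> closing_patterns"
  shows "real (card {\<rho> \<in> R \<rightarrow>\<^sub>E W. closed_tuple P Ls R n M I \<rho>}) \<le> \<eta> * real w ^ card R"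
proof -
  note PP = closing_patternsD[OF pat]
  have q1: "small_blocks I" and q3: "small_fibres I" and q4: "short_chains I"
    using q by (simp_all add: quality_def)
  have IX: "I \<subseteq> {..<n} \<times> {..<M}" and blk: "\<And>j. j < M \<Longrightarrow> card {x. (x, j) \<in> I} \<le> b"
    using q1 by (simp_all add: small_blocks_def)
  have noc: "no_long_chain n M (k * t) h P Ls R I" using q4 pat unfolding short_chains_def by simp
  have cRt: "card R \<le> t"
  proof -
    have "card R \<le> card {..<t}" using PP(3,4) by (intro card_mono) auto
    then show ?thesis by simp
  qed
  have main: "real (card {\<rho> \<in> R \<rightarrow>\<^sub>E W. closed_tuple P Ls R n M I \<rho>}) \<le> \<eta> * real w ^ card R"
    if i: "i' \<in> R" "i'' \<in> R" "i' \<noteq> i''" and Q: "Q \<subseteq> P" "\<And>q. q \<in> Q \<Longrightarrow> \<exists>l\<in>Ls. i' \<in> l \<and> q \<in> l"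
      and fib: "\<And>z. z \<in> Q \<rightarrow>\<^sub>E {..<n} \<Longrightarrow> card (fibre P Ls Q i'' n M I z) \<le> b" for i' i'' Q
  proof (rule closed_density[OF PP(1,2,3) i Q card_incidences_le[OF PP(4,5)] IX _ blk fib W pos(1) pos(2,3,4), where h = h and \<kappa> = "k * t" and \<theta> = \<theta>])
    show "\<nexists>cs. length cs = h \<and> chain (cert P Ls) (\<lambda>U c. \<not> cert P Ls c \<subseteq> U)
        {fg\<in>embeddings P Ls n M. fst fg ` R \<subseteq> X} {} cs \<and> (\<Union>c\<in>set cs. cert P Ls c) \<subseteq> I"
      if "X \<subseteq> {..<n}" "card X \<le> k * t" for X
      using noc[unfolded no_long_chain_def, rule_format, OF that] .
    show "k * card R \<le> k * t" using cRt by (rule mult_le_mono2)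
    have cQ: "card Q \<le> t"
    proof -
      have "card Q \<le> card {..<t}" using Q(1) PP(4) by (intro card_mono) auto
      then show ?thesis by simp
    qed
    have "real (k * card R) \<le> real (k * t)" using cRt by (intro of_nat_mono mult_le_mono2)
    then have "(real (k * card R) * real b / real w) ^ \<theta> \<le> (real (k * t) * real b / real w) ^ \<theta>"
      by (intro power_mono divide_right_mono mult_right_mono) auto
    moreover have "real n ^ card Q \<le> real n ^ t" using n1 cQ by (intro power_increasing) auto
    ultimately have "(real M + real n + real n ^ card Q) * (real (k * card R) * real b / real w) ^ \<theta>
       \<le> (real M + real n + real n ^ t) * (real (k * t) * real b / real w) ^ \<theta>"
      by (intro mult_mono add_left_mono) auto
    then show "(real M + real n + real n ^ card Q) * (real (k * card R) * real b / real w) ^ \<theta> \<le> \<eta> / 2"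
      using den1 by linarith
    show "2 * real \<theta> * real ((t * 2 ^ t) * h) \<le> \<eta> / 4 * real g * real k" by (rule den2)
    have "(g * g) ^ card Q \<le> (g * g) ^ t" using cQ pos(3) by (intro power_increasing) auto
    then have "real ((g * g) ^ card Q) * real \<theta> \<le> real ((g * g) ^ t) * real \<theta>"
      by (intro mult_right_mono of_nat_mono) auto
    then show "real ((g * g) ^ card Q) * real \<theta> \<le> \<eta> / 4 * real k" using den3 by linarith
  qed
  show ?thesis using pat
  proof (cases rule: closing_patterns_cases)
    case 1
    show ?thesis
    proof (rule main[of 0 1 "{1}"])
      fix z :: "nat \<Rightarrow> nat"
      have "fibre P Ls {1} 1 n M I z \<subseteq> {z 1}" by (auto simp: fibre_def)
      then have "card (fibre P Ls {1} 1 n M I z) \<le> card {z 1}" by (intro card_mono) auto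
      then show "card (fibre P Ls {1} 1 n M I z) \<le> b" using pos(2) by simp
    qed (use 1 in auto)
  next
    case (2 LL l0)
    note TD = typesD[OF 2(1)]
    define i where "i = spoke_vertex LL P l0"
    have iR: "i \<in> R" using spoke_vertex(1)[OF 2(1)] 2(3) by (simp add: i_def)
    have "R \<noteq> {i}" using PP(6) by auto
    then obtain i' where i': "i' \<in> R" "i' \<noteq> i" using iR by blast
    show ?thesis
    proof (rule main[OF i'(1) iR i'(2), of "P - l0"])
      fix q assume q: "q \<in> P - l0"
      have iq: "i' \<in> {..<t}" "q \<in> {..<t}" "i' \<noteq> q" "i' \<in> P" using q i'(1) 2(3) TD(2) by auto
      obtain l where l: "l \<in> LL" "i' \<in> l" "q \<in> l" using linear_space_line[OF TD(1) iq(1,2,3)] .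
      have "card {i', q} \<le> card (l \<inter> P)" using l q iq TD(6) by (intro card_mono) auto
      then have "2 \<le> card (l \<inter> P)" using iq(3) by simp
      moreover have "l \<noteq> l0" using l(3) q by blast
      ultimately have "l \<in> Ls" using l(1) unfolding 2(2) other_lines_def by simp
      then show "\<exists>l\<in>Ls. i' \<in> l \<and> q \<in> l" using l by blast
    next
      fix z assume z: "z \<in> (P - l0) \<rightarrow>\<^sub>E {..<n}"
      show "card (fibre P Ls (P - l0) i n M I z) \<le> b"
        using q3[unfolded small_fibres_def, rule_format, OF 2(1) z] unfolding i_def 2(2) .
    qed auto
  qed
qed

end

section \<open>The probability that quality fails\<close>

lemma prob_union_le:
  fixes \<Omega> :: "'w pmf"
  assumes "finite A" "\<And>a. a \<in> A \<Longrightarrow> measure_pmf.prob \<Omega> (B a) \<le> c" "real (card A) \<le> N" "0 \<le> c"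
  shows "measure_pmf.prob \<Omega> (\<Union>a\<in>A. B a) \<le> N * c"
proof -
  have "measure_pmf.prob \<Omega> (\<Union>a\<in>A. B a) \<le> (\<Sum>a\<in>A. measure_pmf.prob \<Omega> (B a))"
    by (rule measure_UNION_le) (use assms in auto)
  also have "\<dots> \<le> (\<Sum>a\<in>A. c)" by (intro sum_mono assms)
  also have "\<dots> = real (card A) * c" by simp
  also have "\<dots> \<le> N * c" using assms by (intro mult_right_mono)
  finally show ?thesis .
qed

lemma finite_types: "finite (critical_types n M p \<Lambda> s t)"
  and card_types: "real (card (critical_types n M p \<Lambda> s t)) \<le> 2 ^ (2 ^ t) * 2 ^ t * 2 ^ t"
proof -
  let ?B = "Pow (Pow {..<t}) \<times> Pow {..<t} \<times> Pow {..<t}"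
  have sub: "critical_types n M p \<Lambda> s t \<subseteq> ?B"
    by (auto simp: critical_types_def linear_space_def)
  have fB: "finite ?B" by auto
  show "finite (critical_types n M p \<Lambda> s t)" using sub fB finite_subset by blast
  have "card (critical_types n M p \<Lambda> s t) \<le> card ?B" by (rule card_mono[OF fB sub])
  also have "\<dots> = 2 ^ (2 ^ t) * (2 ^ t * 2 ^ t)" by (simp add: card_cartesian_product card_Pow)
  finally have "real (card (critical_types n M p \<Lambda> s t)) \<le> real (2 ^ (2 ^ t) * (2 ^ t * 2 ^ t))" by (rule of_nat_mono)
  then show "real (card (critical_types n M p \<Lambda> s t)) \<le> 2 ^ (2 ^ t) * 2 ^ t * 2 ^ t" by (simp add: mult.assoc)
qed

locale random_construction = construction n M s t p \<Lambda> w k h \<theta> g K b \<eta>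
    + random_incidence \<Omega> I "{..<n} \<times> {..<M}" p
  for n M s t :: nat and p \<Lambda> :: real and w k h \<theta> g K b :: nat and \<eta> :: real
    and \<Omega> :: "'w pmf" and I :: "'w \<Rightarrow> (nat \<times> nat) set" +
  assumes IX: "I \<omega> \<subseteq> {..<n} \<times> {..<M}"
begin

abbreviation "d \<equiv> t * 2 ^ t"

lemma weight_factor_le:
  fixes c u \<mu> :: real
  assumes "card (incidences P Ls) \<le> d" "card U \<le> d * m" "0 \<le> \<mu>"
  shows "2 ^ card (incidences P Ls) * (real (card U) + 1) ^ card (incidences P Ls) * \<mu>
    \<le> 2 ^ d * (real (d * m) + 1) ^ d * \<mu>"
proof (intro mult_right_mono mult_mono)
  show "(2 :: real) ^ card (incidences P Ls) \<le> 2 ^ d" using assms by (intro power_increasing) auto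
  have "real (card U) \<le> real (d * m)" using assms(2) by (rule of_nat_mono)
  then have "(real (card U) + 1) ^ card (incidences P Ls) \<le> (real (d * m) + 1) ^ card (incidences P Ls)"
    by (intro power_mono add_right_mono) auto
  also have "\<dots> \<le> (real (d * m) + 1) ^ d" using assms by (intro power_increasing) auto
  finally show "(real (card U) + 1) ^ card (incidences P Ls) \<le> (real (d * m) + 1) ^ d" .
qed (use assms in auto)

lemma prob_rooted_count:
  assumes P: "P \<subseteq> {..<t}" "Ls \<subseteq> Pow {..<t}" and mu: "0 \<le> \<mu>" and l: "0 < l"
    and W: "\<And>D. D \<subseteq> incidences P Ls \<Longrightarrow> ext_weight n M p P Ls R D \<le> \<mu>"
  shows "measure_pmf.prob \<Omega> {\<omega>. l \<le> real (rooted_count (I \<omega>) P Ls R \<rho>)}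
    \<le> (2 ^ d * (real (d * K) + 1) ^ d * \<mu> / l) ^ K"
proof -
  let ?F = "{fg\<in>embeddings P Ls n M. \<forall>i\<in>R. fst fg i = \<rho> i}"
  have fin: "finite P" "finite Ls" using P finite_subset by (blast, metis finite_Pow_iff finite_lessThan finite_subset)
  have fF: "finite ?F" using finite_embeddings[OF fin, of n M] by simp
  have cI: "card (incidences P Ls) \<le> d" by (rule card_incidences_le[OF P])
  have "measure_pmf.prob \<Omega> {\<omega>. l \<le> real (card {c\<in>?F. cert P Ls c \<subseteq> I \<omega>})}
      \<le> (2 ^ d * (real (d * K) + 1) ^ d * \<mu> / l) ^ K"
  proof (rule prob_large_count[OF fF _ _ _ l])
    show "cert P Ls c \<subseteq> {..<n} \<times> {..<M} \<and> card (cert P Ls c) \<le> d" if "c \<in> ?F" for c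
    proof
      show "cert P Ls c \<subseteq> {..<n} \<times> {..<M}" using cert_subset that by blast
      have "card (cert P Ls c) \<le> card (incidences P Ls)"
        unfolding cert_def using finite_incidences[OF fin] by (rule card_image_le)
      then show "card (cert P Ls c) \<le> d" using cI by linarith
    qed
    show "0 \<le> 2 ^ d * (real (d * K) + 1) ^ d * \<mu>" using mu by simp
    fix U :: "(nat \<times> nat) set" assume U: "finite U" "card U \<le> d * K"
    have eq: "?F = {fg\<in>embeddings P Ls n M. (\<forall>i\<in>R. fst fg i = \<rho> i) \<and> revealed P Ls U fg \<in> Pow (incidences P Ls)}"
      by (auto simp: revealed_def)
    have "(\<Sum>c\<in>?F. p ^ card (cert P Ls c - U))
        \<le> 2 ^ card (incidences P Ls) * (real (card U) + 1) ^ card (incidences P Ls) * \<mu>"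
      unfolding eq by (rule embedding_sum_le[OF fin U(1) p01 order_refl]) (use W mu in auto)
    also have "\<dots> \<le> 2 ^ d * (real (d * K) + 1) ^ d * \<mu>" by (rule weight_factor_le[OF cI U(2) mu])
    finally show "(\<Sum>c\<in>?F. p ^ card (cert P Ls c - U)) \<le> 2 ^ d * (real (d * K) + 1) ^ d * \<mu>" .
  qed
  moreover have "{c\<in>?F. cert P Ls c \<subseteq> I \<omega>} = {fg\<in>embeddings P Ls n M. (\<forall>i\<in>R. fst fg i = \<rho> i) \<and> cert P Ls fg \<subseteq> I \<omega>}" for \<omega>
    by auto
  ultimately show ?thesis unfolding rooted_count_def by simp
qed

text \<open>Certificates are single incidences here. At most K of them are already exposed and
  contribute 1 instead of p, which explains the summand K.\<close>

lemma prob_block_size: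
  shows "measure_pmf.prob \<Omega> {\<omega>. real b \<le> real (card {x. (x, j) \<in> I \<omega>})} \<le> ((real n * p + real K) / real b) ^ K"
proof (cases "j < M")
  case True
  have "measure_pmf.prob \<Omega> {\<omega>. real b \<le> real (card {c\<in>{..<n}. {(c, j)} \<subseteq> I \<omega>})} \<le> ((real n * p + real K) / real b) ^ K"
  proof (rule prob_large_count[where d = 1 and C = "\<lambda>c. {(c, j)}"])
    fix U :: "(nat \<times> nat) set" assume U: "finite U" "card U \<le> 1 * K"
    have "(\<Sum>c<n. p ^ card ({(c, j)} - U)) \<le> (\<Sum>c<n. p + (if (c, j) \<in> U then 1 else 0))"
    proof (rule sum_mono)
      fix c
      show "p ^ card ({(c, j)} - U) \<le> p + (if (c, j) \<in> U then 1 else 0)"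
      proof (cases "(c, j) \<in> U")
        case True
        then have "{(c, j)} - U = {}" by simp
        then have "card ({(c, j)} - U) = 0" by (simp only: card.empty)
        then show ?thesis using p True by simp
      next
        case False
        then have "{(c, j)} - U = {(c, j)}" by blast
        then have "card ({(c, j)} - U) = 1" by simp
        then show ?thesis using False by simp
      qed
    qed
    also have "\<dots> = real n * p + real (card {c\<in>{..<n}. (c, j) \<in> U})"
      by (simp add: sum.distrib sum.If_cases Int_def)
    also have "\<dots> \<le> real n * p + real K"
    proof -
      have "card {c\<in>{..<n}. (c, j) \<in> U} \<le> card U"
        by (rule card_inj_on_le[of "\<lambda>c. (c, j)"]) (use U in \<open>auto simp: inj_on_def\<close>)
      then show ?thesis using U by simp
    qed
    finally show "(\<Sum>c<n. p ^ card ({(c, j)} - U)) \<le> real n * p + real K" .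
  qed (use True pos p in auto)
  moreover have "{c\<in>{..<n}. {(c, j)} \<subseteq> I \<omega>} = {x. (x, j) \<in> I \<omega>}" for \<omega> using IX[of \<omega>] by auto
  ultimately show ?thesis by simp
next
  case False
  then have "{x. (x, j) \<in> I \<omega>} = {}" for \<omega> using IX[of \<omega>] by auto
  then have "card {x. (x, j) \<in> I \<omega>} = 0" for \<omega> by (simp only: card.empty)
  then have "{\<omega>. real b \<le> real (card {x. (x, j) \<in> I \<omega>})} = {}" using pos by auto
  then have "measure_pmf.prob \<Omega> {\<omega>. real b \<le> real (card {x. (x, j) \<in> I \<omega>})} = 0" by (simp only: measure_empty)
  then show ?thesis using p by simp
qed

text \<open>Keeping only the spokes at i drops conditions, so every member of the fibre is the image
  of i under an embedding of the smaller pattern.\<close>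

lemma card_fibre_le:
  assumes T: "(LL, P, l0) \<in> types" and i: "i \<in> l0 \<inter> P"
  shows "card (fibre P (other_lines LL P l0) (P - l0) i n M I0 z)
    \<le> rooted_count I0 (insert i (P - l0)) (spokes LL P l0 i) (P - l0) z"
proof -
  note TD = typesD[OF T]
  let ?P = "insert i (P - l0)" and ?Ls = "spokes LL P l0 i" and ?L = "other_lines LL P l0"
  let ?E = "{fg\<in>embeddings ?P ?Ls n M. (\<forall>q\<in>P - l0. fst fg q = z q) \<and> cert ?P ?Ls fg \<subseteq> I0}"
  have PP: "?P \<subseteq> P" "?Ls \<subseteq> ?L" using i by (auto simp: spokes_def)
  have fE: "finite ?E"
    by (rule finite_subset[OF _ finite_embeddings[of ?P ?Ls n M]])
       (use TD(6,8) PP in \<open>auto intro: finite_subset\<close>)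
  have "fibre P ?L (P - l0) i n M I0 z \<subseteq> (\<lambda>fg. fst fg i) ` ?E"
  proof
    fix v assume "v \<in> fibre P ?L (P - l0) i n M I0 z"
    then obtain f f' where e: "(f, f') \<in> embeddings P ?L n M" "cert P ?L (f, f') \<subseteq> I0" "\<forall>q\<in>P - l0. f q = z q" "f i = v"
      by (auto simp: fibre_def)
    let ?fg = "(restrict f ?P, restrict f' ?Ls)"
    have ff: "f \<in> P \<rightarrow>\<^sub>E {..<n}" "f' \<in> ?L \<rightarrow>\<^sub>E {..<M}" "inj_on f P" "inj_on f' ?L"
      using e(1) by (auto simp: embeddings_def)
    have "restrict f ?P \<in> ?P \<rightarrow>\<^sub>E {..<n}" "restrict f' ?Ls \<in> ?Ls \<rightarrow>\<^sub>E {..<M}"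
      unfolding restrict_PiE_iff using ff PP by (auto simp: PiE_iff subset_iff)
    moreover have "inj_on (restrict f ?P) ?P" "inj_on (restrict f' ?Ls) ?Ls"
      using ff PP inj_on_subset by (metis inj_on_restrict_eq)+
    ultimately have em: "?fg \<in> embeddings ?P ?Ls n M" by (simp add: embeddings_def)
    have "cert ?P ?Ls ?fg \<subseteq> cert P ?L (f, f')"
    proof
      fix y assume "y \<in> cert ?P ?Ls ?fg"
      then obtain j l where jl: "(j, l) \<in> incidences ?P ?Ls" "y = (restrict f ?P j, restrict f' ?Ls l)"
        by (auto simp: cert_def)
      then have j: "l \<in> ?Ls" "j \<in> l" "j \<in> ?P" by (auto simp: incidences_def)
      then have "y = (f j, f' l)" using jl(2) by simp
      moreover have "(j, l) \<in> incidences P ?L" using j PP by (auto simp: incidences_def)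
      ultimately show "y \<in> cert P ?L (f, f')" unfolding cert_def by force
    qed
    then have "?fg \<in> ?E" using em e by auto
    moreover have "fst ?fg i = v" using e(4) by simp
    ultimately show "v \<in> (\<lambda>fg. fst fg i) ` ?E" by (metis (no_types, lifting) image_eqI)
  qed
  then have "card (fibre P ?L (P - l0) i n M I0 z) \<le> card ((\<lambda>fg. fst fg i) ` ?E)"
    using fE by (intro card_mono) auto
  also have "\<dots> \<le> card ?E" by (rule card_image_le[OF fE])
  finally show ?thesis by (simp add: rooted_count_def)
qed

text \<open>A new member of a chain has an incidence outside U, so its exposed set is a proper
  subset of the incidences and its extension weight is at most 1 / \<Lambda>. The factor with
  exponent t bounds the placements of the roots in X.\<close>

lemma prob_long_chain_pattern:
  assumes pat: "(P, Ls, R) \<in> closing_patterns" and X: "X \<subseteq> {..<n}" "card X = k * t"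
  shows "measure_pmf.prob \<Omega> {\<omega>. \<exists>cs. length cs = h \<and> chain (cert P Ls) (\<lambda>U c. \<not> cert P Ls c \<subseteq> U)
        {fg\<in>embeddings P Ls n M. fst fg ` R \<subseteq> X} {} cs \<and> (\<Union>c\<in>set cs. cert P Ls c) \<subseteq> I \<omega>}
    \<le> (real (k * t) ^ t * (2 ^ d * (real (d * h) + 1) ^ d / \<Lambda>)) ^ h"
proof -
  note PP = closing_patternsD[OF pat]
  let ?F = "{fg\<in>embeddings P Ls n M. fst fg ` R \<subseteq> X}"
  let ?Inc = "incidences P Ls"
  have fin: "finite P" "finite Ls" using PP by auto
  have fF: "finite ?F" using finite_embeddings[OF fin, of n M] by simp
  have fR: "finite R" using PP(3) fin finite_subset by blast
  have fX: "finite X" using X finite_subset by blast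
  have cI: "card ?Inc \<le> d" by (rule card_incidences_le[OF PP(4,5)])
  have cR: "card R \<le> t"
  proof -
    have "card R \<le> card {..<t}" using PP(3,4) by (intro card_mono) auto
    then show ?thesis by simp
  qed
  show ?thesis
  proof (rule prob_long_chain[OF fF, where d = d])
    show "cert P Ls c \<subseteq> {..<n} \<times> {..<M} \<and> card (cert P Ls c) \<le> d" if "c \<in> ?F" for c
    proof
      show "cert P Ls c \<subseteq> {..<n} \<times> {..<M}" using cert_subset that by blast
      have "card (cert P Ls c) \<le> card ?Inc"
        unfolding cert_def using finite_incidences[OF fin] by (rule card_image_le)
      then show "card (cert P Ls c) \<le> d" using cI by linarith
    qed
    show "0 \<le> real (k * t) ^ t * (2 ^ d * (real (d * h) + 1) ^ d / \<Lambda>)" using L1 by simp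
    fix U :: "(nat \<times> nat) set" assume U: "finite U" "card U \<le> d * h"
    let ?\<D> = "Pow ?Inc - {?Inc}"
    let ?E = "\<lambda>\<rho>. {fg\<in>embeddings P Ls n M. (\<forall>i\<in>R. fst fg i = \<rho> i) \<and> revealed P Ls U fg \<in> ?\<D>}"
    have fE: "finite (?E \<rho>)" for \<rho> using finite_embeddings[OF fin, of n M] by simp
    have sub: "{c\<in>?F. \<not> cert P Ls c \<subseteq> U} \<subseteq> (\<Union>\<rho>\<in>R \<rightarrow>\<^sub>E X. ?E \<rho>)"
    proof
      fix fg assume a: "fg \<in> {c\<in>?F. \<not> cert P Ls c \<subseteq> U}"
      have "restrict (fst fg) R \<in> R \<rightarrow>\<^sub>E X" unfolding restrict_PiE_iff using a by auto
      moreover have "revealed P Ls U fg \<in> ?\<D>"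
        using a by (force simp: revealed_def cert_def)
      then have "fg \<in> ?E (restrict (fst fg) R)" using a by simp
      ultimately show "fg \<in> (\<Union>\<rho>\<in>R \<rightarrow>\<^sub>E X. ?E \<rho>)" by blast
    qed
    have fP: "finite (R \<rightarrow>\<^sub>E X)" using fR fX by (intro finite_PiE)
    have "(\<Sum>c\<in>{c\<in>?F. \<not> cert P Ls c \<subseteq> U}. p ^ card (cert P Ls c - U))
        \<le> (\<Sum>c\<in>(\<Union>\<rho>\<in>R \<rightarrow>\<^sub>E X. ?E \<rho>). p ^ card (cert P Ls c - U))"
      by (rule sum_mono2[OF _ sub]) (use fP fE p in auto)
    also have "\<dots> = (\<Sum>\<rho>\<in>R \<rightarrow>\<^sub>E X. \<Sum>c\<in>?E \<rho>. p ^ card (cert P Ls c - U))"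
    proof (rule sum.UNION_disjoint[OF fP])
      show "\<forall>\<rho>\<in>R \<rightarrow>\<^sub>E X. finite (?E \<rho>)" using fE by blast
      show "\<forall>\<rho>\<in>R \<rightarrow>\<^sub>E X. \<forall>\<rho>'\<in>R \<rightarrow>\<^sub>E X. \<rho> \<noteq> \<rho>' \<longrightarrow> ?E \<rho> \<inter> ?E \<rho>' = {}"
      proof (intro ballI impI)
        fix \<rho> \<rho>' assume a: "\<rho> \<in> R \<rightarrow>\<^sub>E X" "\<rho>' \<in> R \<rightarrow>\<^sub>E X" "\<rho> \<noteq> \<rho>'"
        have "\<exists>i\<in>R. \<rho> i \<noteq> \<rho>' i"
        proof (rule ccontr)
          assume "\<not> (\<exists>i\<in>R. \<rho> i \<noteq> \<rho>' i)"
          then have "\<rho> = \<rho>'" using a by (intro PiE_ext[of \<rho> R "\<lambda>_. X" \<rho>']) auto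
          then show False using a by simp
        qed
        then show "?E \<rho> \<inter> ?E \<rho>' = {}" by fastforce
      qed
    qed
    also have "\<dots> \<le> (\<Sum>\<rho>\<in>R \<rightarrow>\<^sub>E X. 2 ^ d * (real (d * h) + 1) ^ d * (1 / \<Lambda>))"
    proof (rule sum_mono)
      fix \<rho>
      have "(\<Sum>c\<in>?E \<rho>. p ^ card (cert P Ls c - U)) \<le> 2 ^ card ?Inc * (real (card U) + 1) ^ card ?Inc * (1 / \<Lambda>)"
        by (rule embedding_sum_le[OF fin U(1) p01]) (use PP(7) L1 in auto)
      also have "\<dots> \<le> 2 ^ d * (real (d * h) + 1) ^ d * (1 / \<Lambda>)"
        by (rule weight_factor_le[OF cI U(2)]) (use L1 in simp)
      finally show "(\<Sum>c\<in>?E \<rho>. p ^ card (cert P Ls c - U)) \<le> 2 ^ d * (real (d * h) + 1) ^ d * (1 / \<Lambda>)" .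
    qed
    also have "\<dots> = real (k * t) ^ card R * (2 ^ d * (real (d * h) + 1) ^ d / \<Lambda>)"
      using fR X(2) by (simp add: card_PiE)
    also have "\<dots> \<le> real (k * t) ^ t * (2 ^ d * (real (d * h) + 1) ^ d / \<Lambda>)"
    proof (rule mult_right_mono)
      have "1 \<le> k * t" using pos(4) t2 by simp
      then have "real 1 \<le> real (k * t)" by (rule of_nat_mono)
      then have "1 \<le> real (k * t)" by (simp only: of_nat_1)
      then show "real (k * t) ^ card R \<le> real (k * t) ^ t" using cR by (intro power_increasing)
    qed (use L1 in simp)
    finally show "(\<Sum>c\<in>{c\<in>?F. \<not> cert P Ls c \<subseteq> U}. p ^ card (cert P Ls c - U))
        \<le> real (k * t) ^ t * (2 ^ d * (real (d * h) + 1) ^ d / \<Lambda>)" .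
  qed
qed

lemma prob_not_quality: "measure_pmf.prob \<Omega> {\<omega>. \<not> quality (I \<omega>)} \<le> 1 / 4"
proof -
  let ?pr = "measure_pmf.prob \<Omega>"
  define B1 where "B1 = (\<Union>j\<in>{..<M}. {\<omega>. real b \<le> real (card {x. (x, j) \<in> I \<omega>})})"
  define F2 where "F2 = (\<lambda>LL P l0. \<Union>R\<in>{R. R \<subset> l0 \<inter> P \<and> 2 \<le> card R}. \<Union>\<rho>\<in>R \<rightarrow>\<^sub>E {..<n}.
     {\<omega>. \<eta> / p ^ (card (l0 \<inter> P) - card R) \<le> real (rooted_count (I \<omega>) P (other_lines LL P l0) R \<rho>)})"
  define B2 where "B2 = (\<Union>a\<in>types. case a of (LL, P, l0) \<Rightarrow> F2 LL P l0)"
  define F3 where "F3 = (\<lambda>LL P l0. \<Union>z\<in>(P - l0) \<rightarrow>\<^sub>E {..<n}.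
     {\<omega>. real b \<le> real (rooted_count (I \<omega>) (insert (spoke_vertex LL P l0) (P - l0)) (spokes LL P l0 (spoke_vertex LL P l0)) (P - l0) z)})"
  define B3 where "B3 = (\<Union>a\<in>types. case a of (LL, P, l0) \<Rightarrow> F3 LL P l0)"
  define F4 where "F4 = (\<lambda>P Ls R. \<Union>X\<in>{X. X \<subseteq> {..<n} \<and> card X = k * t}.
     {\<omega>. \<exists>cs. length cs = h \<and> chain (cert P Ls) (\<lambda>U c. \<not> cert P Ls c \<subseteq> U)
        {fg\<in>embeddings P Ls n M. fst fg ` R \<subseteq> X} {} cs \<and> (\<Union>c\<in>set cs. cert P Ls c) \<subseteq> I \<omega>})"
  define B4 where "B4 = (\<Union>a\<in>closing_patterns. case a of (P, Ls, R) \<Rightarrow> F4 P Ls R)"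
  let ?B = "2 ^ d * (real (d * K) + 1) ^ d"
  have p1: "?pr B1 \<le> 1 / 16"
  proof -
    have "?pr B1 \<le> real M * ((real n * p + real K) / real b) ^ K"
      unfolding B1_def by (rule prob_union_le) (use prob_block_size p in auto)
    then show ?thesis using un1 by linarith
  qed
  have nt: "real n ^ c \<le> real n ^ t" if "c \<le> t" for c using that n1 by (intro power_increasing) auto
  have p2: "?pr B2 \<le> 1 / 16"
  proof -
    have "?pr B2 \<le> 2 ^ (2 ^ t) * 2 ^ t * 2 ^ t * (2 ^ t * (real n ^ t * (?B / (\<Lambda> * \<eta>)) ^ K))"
      unfolding B2_def
    proof (rule prob_union_le[OF finite_types _ card_types])
      fix a assume a: "a \<in> types"
      obtain LL P l0 where e: "a = (LL, P, l0)" by (rule prod_cases3)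
      have T: "(LL, P, l0) \<in> types" using a e by simp
      note TD = typesD[OF T]
      show "?pr (case a of (LL, P, l0) \<Rightarrow> F2 LL P l0)
        \<le> 2 ^ t * (real n ^ t * (?B / (\<Lambda> * \<eta>)) ^ K)"
        unfolding e case_prod_conv F2_def
      proof (rule prob_union_le)
        have sub: "{R. R \<subset> l0 \<inter> P \<and> 2 \<le> card R} \<subseteq> Pow {..<t}" using TD(2) by auto
        then show "finite {R. R \<subset> l0 \<inter> P \<and> 2 \<le> card R}" using finite_subset by blast
        have "card {R. R \<subset> l0 \<inter> P \<and> 2 \<le> card R} \<le> card (Pow {..<t})" using sub by (intro card_mono) auto
        then have "real (card {R. R \<subset> l0 \<inter> P \<and> 2 \<le> card R}) \<le> real (2 ^ t)"
          by (intro of_nat_mono) (simp add: card_Pow)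
        then show "real (card {R. R \<subset> l0 \<inter> P \<and> 2 \<le> card R}) \<le> 2 ^ t" by simp
        fix R assume R: "R \<in> {R. R \<subset> l0 \<inter> P \<and> 2 \<le> card R}"
        then have fR: "finite R" "card R \<le> t"
        proof -
          have "R \<subseteq> {..<t}" using R TD(2) by auto
          then show "finite R" "card R \<le> t" using card_mono[of "{..<t}" R] finite_subset by auto
        qed
        show "?pr (\<Union>\<rho>\<in>R \<rightarrow>\<^sub>E {..<n}.
            {\<omega>. \<eta> / p ^ (card (l0 \<inter> P) - card R) \<le> real (rooted_count (I \<omega>) P (other_lines LL P l0) R \<rho>)})
          \<le> real n ^ t * (?B / (\<Lambda> * \<eta>)) ^ K"
        proof (rule prob_union_le)
          show "finite (R \<rightarrow>\<^sub>E {..<n})" using fR by (intro finite_PiE) auto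
          show "real (card (R \<rightarrow>\<^sub>E {..<n})) \<le> real n ^ t" using fR nt by (simp add: card_PiE)
          fix \<rho>
          let ?q = "p ^ (card (l0 \<inter> P) - card R)"
          have q0: "?q > 0" using p by simp
          \<comment> \<open>The same power of p divides the bound of \<open>rooted_weight\<close>
            and the threshold, and cancels.\<close>
          have "?pr {\<omega>. \<eta> / ?q \<le> real (rooted_count (I \<omega>) P (other_lines LL P l0) R \<rho>)}
              \<le> (2 ^ d * (real (d * K) + 1) ^ d * ((1 / \<Lambda>) / ?q) / (\<eta> / ?q)) ^ K"
            by (rule prob_rooted_count[OF TD(2) types_lines[OF T]])
               (use rooted_weight[OF T] R L1 eta q0 in auto)
          also have "2 ^ d * (real (d * K) + 1) ^ d * ((1 / \<Lambda>) / ?q) / (\<eta> / ?q) = ?B / (\<Lambda> * \<eta>)"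
            using q0 p by simp
          finally show "?pr {\<omega>. \<eta> / ?q \<le> real (rooted_count (I \<omega>) P (other_lines LL P l0) R \<rho>)} \<le> (?B / (\<Lambda> * \<eta>)) ^ K" .
          show "0 \<le> (?B / (\<Lambda> * \<eta>)) ^ K" using L1 eta by simp
        qed
      next
        show "0 \<le> real n ^ t * (?B / (\<Lambda> * \<eta>)) ^ K" using L1 eta by simp
      qed
    next
      show "0 \<le> 2 ^ t * (real n ^ t * (?B / (\<Lambda> * \<eta>)) ^ K)" using L1 eta by simp
    qed
    then show ?thesis using un2 by (simp only: mult.assoc)
  qed
  have p3: "?pr B3 \<le> 1 / 16"
  proof -
    have "?pr B3 \<le> 2 ^ (2 ^ t) * 2 ^ t * 2 ^ t * (real n ^ t * (?B * (real n * p) / real b) ^ K)"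
      unfolding B3_def
    proof (rule prob_union_le[OF finite_types _ card_types])
      fix a assume a: "a \<in> types"
      obtain LL P l0 where e: "a = (LL, P, l0)" by (rule prod_cases3)
      have T: "(LL, P, l0) \<in> types" using a e by simp
      note TD = typesD[OF T]
      let ?i = "spoke_vertex LL P l0"
      have PL: "insert ?i (P - l0) \<subseteq> {..<t}" "spokes LL P l0 ?i \<subseteq> Pow {..<t}"
        using TD(2) spoke_vertex(1)[OF T] types_lines[OF T] by (auto simp: spokes_def)
      have fR: "finite (P - l0)" "card (P - l0) \<le> t"
        using TD(2,6) card_mono[of "{..<t}" "P - l0"] by auto
      show "?pr (case a of (LL, P, l0) \<Rightarrow> F3 LL P l0)
        \<le> real n ^ t * (?B * (real n * p) / real b) ^ K"
        unfolding e case_prod_conv F3_def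
      proof (rule prob_union_le)
        show "finite ((P - l0) \<rightarrow>\<^sub>E {..<n})" using fR by (intro finite_PiE) auto
        show "real (card ((P - l0) \<rightarrow>\<^sub>E {..<n})) \<le> real n ^ t" using fR nt by (simp add: card_PiE)
        show "?pr {\<omega>. real b \<le> real (rooted_count (I \<omega>) (insert ?i (P - l0)) (spokes LL P l0 ?i) (P - l0) z)}
            \<le> (?B * (real n * p) / real b) ^ K" for z
          by (rule prob_rooted_count[OF PL]) (use spoke_vertex(2)[OF T] p pos in auto)
        show "0 \<le> (?B * (real n * p) / real b) ^ K" using p by simp
      qed
    next
      show "0 \<le> real n ^ t * (?B * (real n * p) / real b) ^ K" using p by simp
    qed
    then show ?thesis using un3 by (simp only: mult.assoc)
  qed
  have p4: "?pr B4 \<le> 1 / 16"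
  proof -
    let ?\<nu> = "(real (k * t) ^ t * (2 ^ d * (real (d * h) + 1) ^ d / \<Lambda>)) ^ h"
    let ?S = "Pow {..<t} \<times> Pow (Pow {..<t}) \<times> Pow {..<t}"
    have nu0: "0 \<le> ?\<nu>" using L1 by simp
    have sub: "closing_patterns \<subseteq> ?S"
    proof
      fix y assume y: "y \<in> closing_patterns"
      obtain P Ls R where e: "y = (P, Ls, R)" by (cases y) auto
      have "P \<subseteq> {..<t}" "Ls \<subseteq> Pow {..<t}" "R \<subseteq> P" using closing_patternsD[of P Ls R] y e by auto
      then show "y \<in> ?S" unfolding e by blast
    qed
    have fS: "finite ?S" by auto
    have fc: "finite closing_patterns" using sub fS finite_subset by blast
    have "card closing_patterns \<le> card ?S" by (rule card_mono[OF fS sub])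
    also have "\<dots> = 2 ^ t * (2 ^ (2 ^ t) * 2 ^ t)" by (simp add: card_cartesian_product card_Pow)
    finally have "real (card closing_patterns) \<le> real (2 ^ t * (2 ^ (2 ^ t) * 2 ^ t))" by (rule of_nat_mono)
    then have cc: "real (card closing_patterns) \<le> 2 ^ t * 2 ^ (2 ^ t) * 2 ^ t" by (simp add: mult.assoc)
    have "?pr B4 \<le> 2 ^ t * 2 ^ (2 ^ t) * 2 ^ t * (real n ^ (k * t) * ?\<nu>)"
      unfolding B4_def
    proof (rule prob_union_le[OF fc _ cc])
      fix a assume a: "a \<in> closing_patterns"
      obtain P Ls R where e: "a = (P, Ls, R)" by (rule prod_cases3)
      have pat: "(P, Ls, R) \<in> closing_patterns" using a e by simp
      show "?pr (case a of (P, Ls, R) \<Rightarrow> F4 P Ls R) \<le> real n ^ (k * t) * ?\<nu>"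
        unfolding e case_prod_conv F4_def
      proof (rule prob_union_le)
        show "finite {X. X \<subseteq> {..<n} \<and> card X = k * t}" by (rule finite_subset[of _ "Pow {..<n}"]) auto
        have "card {X. X \<subseteq> {..<n} \<and> card X = k * t} \<le> n ^ (k * t)"
          using kn by (simp add: n_subsets binomial_le_pow)
        then have "real (card {X. X \<subseteq> {..<n} \<and> card X = k * t}) \<le> real (n ^ (k * t))" by (rule of_nat_mono)
        then show "real (card {X. X \<subseteq> {..<n} \<and> card X = k * t}) \<le> real n ^ (k * t)" by simp
        fix X assume X: "X \<in> {X. X \<subseteq> {..<n} \<and> card X = k * t}"
        show "?pr {\<omega>. \<exists>cs. length cs = h \<and> chain (cert P Ls) (\<lambda>U c. \<not> cert P Ls c \<subseteq> U)
          {fg\<in>embeddings P Ls n M. fst fg ` R \<subseteq> X} {} cs \<and> (\<Union>c\<in>set cs. cert P Ls c) \<subseteq> I \<omega>} \<le> ?\<nu>"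
          by (rule prob_long_chain_pattern[OF pat]) (use X in auto)
      qed (rule nu0)
    next
      show "0 \<le> real n ^ (k * t) * ?\<nu>" using nu0 by (intro mult_nonneg_nonneg) auto
    qed
    then show ?thesis using un4 by (simp only: mult.assoc)
  qed
  have "{\<omega>. \<not> quality (I \<omega>)} \<subseteq> B1 \<union> B2 \<union> B3 \<union> B4"
  proof
    fix \<omega> assume nq: "\<omega> \<in> {\<omega>. \<not> quality (I \<omega>)}"
    show "\<omega> \<in> B1 \<union> B2 \<union> B3 \<union> B4"
    proof (rule ccontr)
      assume nB: "\<omega> \<notin> B1 \<union> B2 \<union> B3 \<union> B4"
      have "small_blocks (I \<omega>)"
        unfolding small_blocks_def
      proof (intro conjI allI impI IX)
        fix j assume j: "j < M"
        have "\<omega> \<notin> B1" using nB by simp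
        then have "\<not> real b \<le> real (card {x. (x, j) \<in> I \<omega>})" using j unfolding B1_def by simp
        then show "card {x. (x, j) \<in> I \<omega>} \<le> b" by simp
      qed
      moreover have "few_extensions (I \<omega>)"
        unfolding few_extensions_def
      proof (intro allI impI ballI)
        fix LL P l0 R \<rho> assume T: "(LL, P, l0) \<in> types" and R: "R \<subset> l0 \<inter> P" "2 \<le> card R" and \<rho>: "\<rho> \<in> R \<rightarrow>\<^sub>E {..<n}"
        have nb: "\<omega> \<notin> B2" using nB by simp
        have "\<not> \<eta> / p ^ (card (l0 \<inter> P) - card R) \<le> real (rooted_count (I \<omega>) P (other_lines LL P l0) R \<rho>)"
        proof
          assume "\<eta> / p ^ (card (l0 \<inter> P) - card R) \<le> real (rooted_count (I \<omega>) P (other_lines LL P l0) R \<rho>)"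
          then have "\<omega> \<in> B2" unfolding B2_def
            using R \<rho> by (intro UN_I[OF T]) (auto simp: F2_def)
          then show False using nb by simp
        qed
        then show "real (rooted_count (I \<omega>) P (other_lines LL P l0) R \<rho>) * p ^ (card (l0 \<inter> P) - card R) \<le> \<eta>"
          using p by (simp add: not_le pos_less_divide_eq less_imp_le)
      qed
      moreover have "small_fibres (I \<omega>)"
        unfolding small_fibres_def
      proof (intro allI impI ballI)
        fix LL P l0 z assume T: "(LL, P, l0) \<in> types" and z: "z \<in> (P - l0) \<rightarrow>\<^sub>E {..<n}"
        have nb: "\<omega> \<notin> B3" using nB by simp
        have "\<not> real b \<le> real (rooted_count (I \<omega>) (insert (spoke_vertex LL P l0) (P - l0)) (spokes LL P l0 (spoke_vertex LL P l0)) (P - l0) z)"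
        proof
          assume "real b \<le> real (rooted_count (I \<omega>) (insert (spoke_vertex LL P l0) (P - l0)) (spokes LL P l0 (spoke_vertex LL P l0)) (P - l0) z)"
          then have "\<omega> \<in> B3" unfolding B3_def using z by (intro UN_I[OF T]) (auto simp: F3_def)
          then show False using nb by simp
        qed
        then show "card (fibre P (other_lines LL P l0) (P - l0) (spoke_vertex LL P l0) n M (I \<omega>) z) \<le> b"
          using card_fibre_le[OF T spoke_vertex(1)[OF T], of "I \<omega>" z] by linarith
      qed
      moreover have "short_chains (I \<omega>)"
        unfolding short_chains_def
      proof (intro allI impI)
        fix P Ls R assume pat: "(P, Ls, R) \<in> closing_patterns"
        show "no_long_chain n M (k * t) h P Ls R (I \<omega>)"
          unfolding no_long_chain_def
        proof (intro allI impI notI)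
          fix X assume X: "X \<subseteq> {..<n}" "card X \<le> k * t"
          assume "\<exists>cs. length cs = h \<and> chain (cert P Ls) (\<lambda>U c. \<not> cert P Ls c \<subseteq> U)
             {fg\<in>embeddings P Ls n M. fst fg ` R \<subseteq> X} {} cs \<and> (\<Union>c\<in>set cs. cert P Ls c) \<subseteq> I \<omega>"
          then obtain cs where cs: "length cs = h \<and> chain (cert P Ls) (\<lambda>U c. \<not> cert P Ls c \<subseteq> U)
             {fg\<in>embeddings P Ls n M. fst fg ` R \<subseteq> X} {} cs \<and> (\<Union>c\<in>set cs. cert P Ls c) \<subseteq> I \<omega>" by (rule exE)
          \<comment> \<open>The union bound runs over sets of exactly k t vertices; enlarging X only
            admits more chains.\<close>
          obtain X' where X': "X \<subseteq> X'" "X' \<subseteq> {..<n}" "card X' = k * t"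
            using exists_subset_between[of X "k * t" "{..<n}"] X kn by auto
          have "chain (cert P Ls) (\<lambda>U c. \<not> cert P Ls c \<subseteq> U) {fg\<in>embeddings P Ls n M. fst fg ` R \<subseteq> X'} {} cs"
            by (rule chain_mono[OF cs[THEN conjunct2, THEN conjunct1]]) (use X'(1) in auto)
          then have "\<exists>cs. length cs = h \<and> chain (cert P Ls) (\<lambda>U c. \<not> cert P Ls c \<subseteq> U)
             {fg\<in>embeddings P Ls n M. fst fg ` R \<subseteq> X'} {} cs \<and> (\<Union>c\<in>set cs. cert P Ls c) \<subseteq> I \<omega>"
            using cs by (intro exI[of _ cs] conjI) simp_all
          then have "\<omega> \<in> B4" unfolding B4_def using X' by (intro UN_I[OF pat]) (auto simp: F4_def)
          then show False using nB by simp
        qed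
      qed
      ultimately have "quality (I \<omega>)" by (simp add: quality_def)
      then show False using nq by blast
    qed
  qed
  then have "?pr {\<omega>. \<not> quality (I \<omega>)} \<le> ?pr (B1 \<union> B2 \<union> B3 \<union> B4)"
    by (intro measure_pmf.finite_measure_mono) auto
  also have "\<dots> \<le> ?pr B1 + ?pr B2 + ?pr B3 + ?pr B4"
    using measure_Un_le[of "B1 \<union> B2 \<union> B3" "measure_pmf \<Omega>" B4]
      measure_Un_le[of "B1 \<union> B2" "measure_pmf \<Omega>" B3]
      measure_Un_le[of B1 "measure_pmf \<Omega>" B2] by simp
  finally show ?thesis using p1 p2 p3 p4 by linarith
qed

end

section \<open>Random labelled blocks\<close>

text \<open>By \<open>loc\<close>, the function \<Phi> \<omega> depends only on the coordinates in
  Q, so once these are fixed the coordinates in B contribute independent factors, each of mean at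
  most c. In the induction the new coordinate is integrated innermost.\<close>

lemma nn_integral_conditional_product:
  fixes blk :: "'b pmf" and \<Phi> :: "(nat \<Rightarrow> 'b) \<Rightarrow> 'b \<Rightarrow> ennreal"
  assumes "finite B" "finite Q" "Q \<inter> B = {}"
    and loc: "\<And>\<omega> \<omega>'. (\<forall>j\<in>Q. \<omega> j = \<omega>' j) \<Longrightarrow> \<Phi> \<omega> = \<Phi> \<omega>'"
    and bound: "\<And>\<omega>. (\<integral>\<^sup>+\<beta>. \<Phi> \<omega> \<beta> \<partial>blk) \<le> c"
  shows "(\<integral>\<^sup>+\<omega>. (\<Prod>j\<in>B. \<Phi> \<omega> (\<omega> j)) \<partial>Pi_pmf (Q \<union> B) d (\<lambda>_. blk)) \<le> c ^ card B"
  using assms(1,3)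
proof (induction B rule: finite_induct)
  case (insert j B)
  let ?\<Omega> = "Pi_pmf (Q \<union> B) d (\<lambda>_. blk)"
  have j: "j \<notin> Q \<union> B" and dis: "Q \<inter> B = {}" using insert by auto
  have "Pi_pmf (Q \<union> insert j B) d (\<lambda>_. blk) = bind_pmf blk (\<lambda>y. bind_pmf ?\<Omega> (\<lambda>f. return_pmf (f(j := y))))"
    using Pi_pmf_insert'[of "Q \<union> B" j d "\<lambda>_. blk"] insert(1) assms(2) j by simp
  also have "\<dots> = bind_pmf ?\<Omega> (\<lambda>f. bind_pmf blk (\<lambda>y. return_pmf (f(j := y))))"
    by (rule bind_commute_pmf)
  finally have eq: "Pi_pmf (Q \<union> insert j B) d (\<lambda>_. blk) = \<dots>" .
  have upd: "\<Phi> (f(j := y)) = \<Phi> f" for f y by (rule loc) (use j in auto)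
  have pr: "(\<Prod>i\<in>insert j B. \<Phi> (f(j := y)) ((f(j := y)) i)) = (\<Prod>i\<in>B. \<Phi> f (f i)) * \<Phi> f y" for f y
  proof -
    have "(\<Prod>i\<in>B. \<Phi> f ((f(j := y)) i)) = (\<Prod>i\<in>B. \<Phi> f (f i))" by (rule prod.cong) (use insert(2) in auto)
    then show ?thesis using insert(1,2) by (simp only: upd prod.insert) (simp add: mult.commute)
  qed
  have "(\<integral>\<^sup>+\<omega>. (\<Prod>i\<in>insert j B. \<Phi> \<omega> (\<omega> i)) \<partial>Pi_pmf (Q \<union> insert j B) d (\<lambda>_. blk))
     = (\<integral>\<^sup>+f. \<integral>\<^sup>+y. (\<Prod>i\<in>B. \<Phi> f (f i)) * \<Phi> f y \<partial>blk \<partial>?\<Omega>)"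
    unfolding eq nn_integral_bind_pmf by (subst nn_integral_return_pmf) (simp_all only: pr zero_le)
  also have "\<dots> = (\<integral>\<^sup>+f. (\<Prod>i\<in>B. \<Phi> f (f i)) * (\<integral>\<^sup>+y. \<Phi> f y \<partial>blk) \<partial>?\<Omega>)"
    by (simp add: nn_integral_cmult)
  also have "\<dots> \<le> (\<integral>\<^sup>+f. (\<Prod>i\<in>B. \<Phi> f (f i)) * c \<partial>?\<Omega>)"
    by (intro nn_integral_mono mult_left_mono bound) auto
  also have "\<dots> = (\<integral>\<^sup>+f. (\<Prod>i\<in>B. \<Phi> f (f i)) \<partial>?\<Omega>) * c"
    by (simp add: nn_integral_multc)
  also have "\<dots> \<le> c ^ card B * c" by (intro mult_right_mono insert.IH dis) auto
  finally show ?case using insert(1,2) by (simp add: mult.commute)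
qed simp

lemma card_between:
  assumes "finite A" "D \<subseteq> A"
  shows "card {Q. D \<subseteq> Q \<and> Q \<subseteq> A} = 2 ^ (card A - card D)"
proof -
  have "bij_betw (\<lambda>Q. Q \<union> D) (Pow (A - D)) {Q. D \<subseteq> Q \<and> Q \<subseteq> A}"
    by (rule bij_betwI[where g = "\<lambda>Q. Q - D"]) (use assms in auto)
  then have "card {Q. D \<subseteq> Q \<and> Q \<subseteq> A} = card (Pow (A - D))" using bij_betw_same_card by metis
  also have "\<dots> = 2 ^ card (A - D)" using assms by (simp add: card_Pow)
  also have "card (A - D) = card A - card D" using assms finite_subset by (intro card_Diff_subset) auto
  finally show ?thesis .
qed

lemma sum_Pow_power_complement:
  fixes c :: real
  assumes "finite A"
  shows "(\<Sum>Q\<in>Pow A. c ^ card (A - Q)) = (1 + c) ^ card A"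
proof -
  have "(\<Sum>Q\<in>Pow A. c ^ card (A - Q)) = (\<Sum>Q\<in>Pow A. c ^ card Q)"
    by (rule sum.reindex_bij_witness[of _ "\<lambda>Q. A - Q" "\<lambda>Q. A - Q"]) (auto simp: double_diff)
  also have "\<dots> = (\<Sum>Q\<in>Pow A. (\<Prod>i\<in>Q. c))" by simp
  also have "\<dots> = (\<Prod>i\<in>A. c + 1)" using prod_add[OF assms, of "\<lambda>_. c" "\<lambda>_. 1"] by simp
  finally show ?thesis by (simp add: add.commute)
qed

text \<open>Q is the set of red indices. For fixed j, among the Q that leave j blue a proportion of
  at least 2^(-m) contains the witness D, so on average the first term outweighs the second.\<close>

lemma sum_random_split_nonneg:

  assumes fin: "finite A"
    and hit: "\<And>j. j \<in> A \<Longrightarrow> H j \<Longrightarrow> \<exists>D. D \<subseteq> A - {j} \<and> card D \<le> m \<and> (\<forall>Q. D \<subseteq> Q \<longrightarrow> Q \<subseteq> A - {j} \<longrightarrow> S Q j)"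
  shows "0 \<le> (\<Sum>Q\<in>Pow A. \<Sum>j\<in>A - Q. of_bool (S Q j) - of_bool (H j) / 2 ^ m :: real)"
proof -
  let ?a = "\<lambda>Q j. of_bool (S Q j) - of_bool (H j) / 2 ^ m :: real"
  have "(\<Sum>Q\<in>Pow A. \<Sum>j\<in>A - Q. ?a Q j) = (\<Sum>Q\<in>Pow A. \<Sum>j\<in>{j\<in>A. j \<notin> Q}. ?a Q j)"
    by (intro sum.cong) auto
  also have "\<dots> = (\<Sum>j\<in>A. \<Sum>Q\<in>{Q\<in>Pow A. j \<notin> Q}. ?a Q j)"
    using fin by (intro sum.swap_restrict) auto
  also have "\<dots> \<ge> 0"
  proof (rule sum_nonneg)
    fix j assume j: "j \<in> A"
    let ?X = "{Q\<in>Pow A. j \<notin> Q}"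
    have X: "?X = Pow (A - {j})" by auto
    have fX: "finite ?X" unfolding X using fin by simp
    show "0 \<le> (\<Sum>Q\<in>?X. ?a Q j)"
    proof (cases "H j")
      case True
      obtain D where D: "D \<subseteq> A - {j}" "card D \<le> m" "\<forall>Q. D \<subseteq> Q \<longrightarrow> Q \<subseteq> A - {j} \<longrightarrow> S Q j"
        using hit[OF j True] by auto
      have cD: "card D \<le> card (A - {j})" using D(1) fin by (intro card_mono) auto
      have "{Q. D \<subseteq> Q \<and> Q \<subseteq> A - {j}} \<subseteq> {Q\<in>?X. S Q j}" using D(3) by auto
      then have "card {Q. D \<subseteq> Q \<and> Q \<subseteq> A - {j}} \<le> card {Q\<in>?X. S Q j}"
        by (intro card_mono finite_subset[OF _ fX]) auto
      then have "2 ^ (card (A - {j}) - card D) \<le> card {Q\<in>?X. S Q j}"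
        using card_between[of "A - {j}" D] fin D(1) by simp
      then have "real (2 ^ (card (A - {j}) - card D)) \<le> real (card {Q\<in>?X. S Q j})" by (rule of_nat_mono)
      moreover have "real (card ?X) / 2 ^ m \<le> real (2 ^ (card (A - {j}) - card D))"
      proof -
        have "card ?X = 2 ^ card (A - {j})" unfolding X using fin by (simp add: card_Pow)
        then have "real (card ?X) = 2 ^ (card (A - {j}) - card D) * 2 ^ card D"
          using cD by (simp flip: power_add)
        also have "\<dots> \<le> 2 ^ (card (A - {j}) - card D) * 2 ^ m"
          using D(2) by (intro mult_left_mono power_increasing) auto
        finally show ?thesis by (simp add: field_simps)
      qed
      moreover have "(\<Sum>Q\<in>?X. ?a Q j) = real (card {Q\<in>?X. S Q j}) - real (card ?X) / 2 ^ m"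
      proof -
        have "(\<Sum>Q\<in>?X. of_bool (S Q j) :: real) = real (card {Q\<in>?X. S Q j})"
          using fX by (simp add: of_bool_def sum.If_cases Int_def)
        then show ?thesis using True by (simp add: sum_subtractf)
      qed
      ultimately show ?thesis by linarith
    qed (simp add: sum_nonneg)
  qed
  finally show ?thesis .
qed

text \<open>Colour every block red or blue uniformly at random. A hit blue block is spoilt by the red blocks alone
  with probability at least \<open>2\<^sup>-\<^sup>m\<close>, and given the red blocks the blue ones are independent.\<close>

lemma prob_all_hits_spoilt:
  fixes blk :: "'b pmf" and SP :: "nat set \<Rightarrow> (nat \<Rightarrow> 'b) \<Rightarrow> 'b \<Rightarrow> bool" and M m :: nat
  assumes gam: "0 \<le> \<gamma>" "\<gamma> \<le> 1"
    and loc: "\<And>Q \<omega> \<omega>'. (\<forall>j\<in>Q. \<omega> j = \<omega>' j) \<Longrightarrow> SP Q \<omega> = SP Q \<omega>'"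
       "\<And>Q \<omega> \<omega>'. (\<forall>j\<in>Q. \<omega> j = \<omega>' j) \<Longrightarrow> G Q \<omega> = G Q \<omega>'"
    and bnd: "\<And>Q \<omega>. Q \<subseteq> {..<M} \<Longrightarrow> G Q \<omega> \<Longrightarrow>
       (\<integral>\<^sup>+\<beta>. ennreal (exp (of_bool (SP Q \<omega> \<beta>) - of_bool (H \<beta>) / 2 ^ m)) \<partial>blk) \<le> ennreal (1 - \<gamma>)"
    and FG: "\<And>\<omega> Q. \<omega> \<in> F \<Longrightarrow> Q \<subseteq> {..<M} \<Longrightarrow> G Q \<omega>"
    and FH: "\<And>\<omega> j. \<omega> \<in> F \<Longrightarrow> j < M \<Longrightarrow> H (\<omega> j) \<Longrightarrow>
       \<exists>D. D \<subseteq> {..<M} - {j} \<and> card D \<le> m \<and> (\<forall>Q. D \<subseteq> Q \<longrightarrow> Q \<subseteq> {..<M} - {j} \<longrightarrow> SP Q \<omega> (\<omega> j))"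
  shows "measure_pmf.prob (Pi_pmf {..<M} d (\<lambda>_. blk)) F \<le> (1 - \<gamma> / 2) ^ M"
proof -
  let ?\<Omega> = "Pi_pmf {..<M} d (\<lambda>_. blk)" and ?A = "{..<M}"
  \<comment> \<open>An exponential tilt: a spoilt blue block counts +1, a hit one -1/2^m. On F the
    total exponent is nonnegative on average over Q, whereas for a fixed Q each factor has mean at
    most 1 - \<gamma>, which by \<open>bnd\<close> holds whenever \<open>G\<close> does.\<close>
  define E where "E Q \<omega> \<beta> = exp (of_bool (SP Q \<omega> \<beta>) - of_bool (H \<beta>) / 2 ^ m :: real)" for Q \<omega> \<beta>
  \<comment> \<open>The value 0 outside G makes the bound on the mean unconditional; on F nothing
    changes because \<open>FG\<close> gives G there for every red set.\<close>
  define \<Phi> where "\<Phi> Q \<omega> \<beta> = (if G Q \<omega> then ennreal (E Q \<omega> \<beta>) else 0)" for Q \<omega> \<beta>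
  have ind: "indicator F \<omega> \<le> (\<Sum>Q\<in>Pow ?A. ennreal (1 / 2 ^ M) * (\<Prod>j\<in>?A - Q. \<Phi> Q \<omega> (\<omega> j)))" for \<omega>
  proof (cases "\<omega> \<in> F")
    case True
    let ?y = "\<lambda>Q. \<Sum>j\<in>?A - Q. of_bool (SP Q \<omega> (\<omega> j)) - of_bool (H (\<omega> j)) / 2 ^ m :: real"
    have y0: "0 \<le> (\<Sum>Q\<in>Pow ?A. ?y Q)"
      by (rule sum_random_split_nonneg) (use FH[OF True] in auto)
    have "2 ^ M + (\<Sum>Q\<in>Pow ?A. ?y Q) = (\<Sum>Q\<in>Pow ?A. 1 + ?y Q)"
      by (simp add: sum.distrib card_Pow)
    \<comment> \<open>The inequality 1 + y \<le> exp y turns the averaged inequality into a lower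
      bound for an average of products, to which independence applies.\<close>
    also have "\<dots> \<le> (\<Sum>Q\<in>Pow ?A. exp (?y Q))" by (intro sum_mono exp_ge_add_one_self)
    also have "\<dots> = (\<Sum>Q\<in>Pow ?A. \<Prod>j\<in>?A - Q. E Q \<omega> (\<omega> j))"
      unfolding E_def by (intro sum.cong refl exp_sum) simp
    finally have "1 \<le> (1 / 2 ^ M) * (\<Sum>Q\<in>Pow ?A. \<Prod>j\<in>?A - Q. E Q \<omega> (\<omega> j))"
      using y0 by (simp add: field_simps)
    then have "ennreal 1 \<le> ennreal ((1 / 2 ^ M) * (\<Sum>Q\<in>Pow ?A. \<Prod>j\<in>?A - Q. E Q \<omega> (\<omega> j)))"
      by (rule ennreal_leI)
    also have "\<dots> = (\<Sum>Q\<in>Pow ?A. ennreal ((1 / 2 ^ M) * (\<Prod>j\<in>?A - Q. E Q \<omega> (\<omega> j))))"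
      by (subst sum_ennreal) (simp_all add: sum_distrib_left E_def prod_nonneg)
    also have "\<dots> = (\<Sum>Q\<in>Pow ?A. ennreal (1 / 2 ^ M) * (\<Prod>j\<in>?A - Q. \<Phi> Q \<omega> (\<omega> j)))"
    proof (rule sum.cong[OF refl])
      fix Q assume "Q \<in> Pow ?A"
      then have G: "G Q \<omega>" using FG[OF True] by simp
      have "(\<Prod>j\<in>?A - Q. \<Phi> Q \<omega> (\<omega> j)) = (\<Prod>j\<in>?A - Q. ennreal (E Q \<omega> (\<omega> j)))"
        by (simp add: \<Phi>_def G)
      also have "\<dots> = ennreal (\<Prod>j\<in>?A - Q. E Q \<omega> (\<omega> j))" by (rule prod_ennreal) (simp add: E_def)
      finally show "ennreal ((1 / 2 ^ M) * (\<Prod>j\<in>?A - Q. E Q \<omega> (\<omega> j)))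
        = ennreal (1 / 2 ^ M) * (\<Prod>j\<in>?A - Q. \<Phi> Q \<omega> (\<omega> j))"
        by (simp only:) (rule ennreal_mult', simp)
    qed
    finally show ?thesis using True by simp
  qed simp
  have one: "(\<integral>\<^sup>+\<omega>. (\<Prod>j\<in>?A - Q. \<Phi> Q \<omega> (\<omega> j)) \<partial>?\<Omega>) \<le> ennreal ((1 - \<gamma>) ^ card (?A - Q))"
    if Q: "Q \<in> Pow ?A" for Q
  proof -
    have "(\<integral>\<^sup>+\<omega>. (\<Prod>j\<in>?A - Q. \<Phi> Q \<omega> (\<omega> j)) \<partial>Pi_pmf (Q \<union> (?A - Q)) d (\<lambda>_. blk)) \<le> ennreal (1 - \<gamma>) ^ card (?A - Q)"
    proof (rule nn_integral_conditional_product)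
      show "finite Q" using Q finite_subset[of Q ?A] by simp
      show "\<Phi> Q \<omega> = \<Phi> Q \<omega>'" if "\<forall>j\<in>Q. \<omega> j = \<omega>' j" for \<omega> \<omega>'
        unfolding \<Phi>_def E_def loc(1)[OF that] loc(2)[OF that] ..
      show "(\<integral>\<^sup>+\<beta>. \<Phi> Q \<omega> \<beta> \<partial>blk) \<le> ennreal (1 - \<gamma>)" for \<omega>
        using bnd[of Q \<omega>] Q by (cases "G Q \<omega>") (simp_all add: \<Phi>_def E_def)
    qed auto
    moreover have "Q \<union> (?A - Q) = ?A" using Q by auto
    ultimately show ?thesis using gam by (simp add: ennreal_power)
  qed
  have "ennreal (measure_pmf.prob ?\<Omega> F) = (\<integral>\<^sup>+\<omega>. indicator F \<omega> \<partial>?\<Omega>)"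
    by (simp add: measure_pmf.emeasure_eq_measure)
  also have "\<dots> \<le> (\<integral>\<^sup>+\<omega>. (\<Sum>Q\<in>Pow ?A. ennreal (1 / 2 ^ M) * (\<Prod>j\<in>?A - Q. \<Phi> Q \<omega> (\<omega> j))) \<partial>?\<Omega>)"
    by (intro nn_integral_mono ind)
  also have "\<dots> = (\<Sum>Q\<in>Pow ?A. ennreal (1 / 2 ^ M) * (\<integral>\<^sup>+\<omega>. (\<Prod>j\<in>?A - Q. \<Phi> Q \<omega> (\<omega> j)) \<partial>?\<Omega>))"
    by (simp add: nn_integral_sum nn_integral_cmult)
  also have "\<dots> \<le> (\<Sum>Q\<in>Pow ?A. ennreal (1 / 2 ^ M) * ennreal ((1 - \<gamma>) ^ card (?A - Q)))"
    by (intro sum_mono mult_left_mono one) auto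
  also have "\<dots> = (\<Sum>Q\<in>Pow ?A. ennreal (1 / 2 ^ M * (1 - \<gamma>) ^ card (?A - Q)))"
    using gam by (intro sum.cong refl ennreal_mult[symmetric]) auto
  also have "\<dots> = ennreal (\<Sum>Q\<in>Pow ?A. 1 / 2 ^ M * (1 - \<gamma>) ^ card (?A - Q))"
    using gam by (intro sum_ennreal) auto
  \<comment> \<open>Each block is blue with probability 1/2 and then contributes 1 - \<gamma>, so it
    contributes 1 - \<gamma>/2 on average.\<close>
  also have "(\<Sum>Q\<in>Pow ?A. 1 / 2 ^ M * (1 - \<gamma>) ^ card (?A - Q)) = 1 / 2 ^ M * (1 + (1 - \<gamma>)) ^ M"
    using sum_Pow_power_complement[of ?A "1 - \<gamma>"] by (simp only: sum_distrib_left[symmetric] finite_lessThan card_lessThan)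
  also have "\<dots> = (1 - \<gamma> / 2) ^ M" by (simp flip: power_divide add: diff_divide_distrib)
  finally show ?thesis using gam by (simp add: ennreal_le_iff)
qed

section \<open>The distribution of labelled blocks\<close>

text \<open>Label \<open>0\<close> means that the vertex is not in the block.\<close>

definition label_pmf :: "real \<Rightarrow> nat \<Rightarrow> nat pmf" where
  "label_pmf p s = bind_pmf (bernoulli_pmf p) (\<lambda>c. if c then pmf_of_set {1..s} else return_pmf 0)"

definition block_pmf :: "nat \<Rightarrow> real \<Rightarrow> nat \<Rightarrow> (nat \<Rightarrow> nat) pmf" where
  "block_pmf n p s = Pi_pmf {..<n} 0 (\<lambda>_. label_pmf p s)"

lemma prob_label:
  assumes "0 \<le> p" "p \<le> 1" "0 < s"
  shows "i \<in> {1..s} \<Longrightarrow> measure_pmf.prob (label_pmf p s) {i} = p / real s"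
    and "measure_pmf.prob (label_pmf p s) {0} = 1 - p"
    and "measure_pmf.prob (label_pmf p s) {i. i \<noteq> 0} = p"
proof -
  have pm: "pmf (label_pmf p s) i = pmf (pmf_of_set {1..s}) i * p + pmf (return_pmf 0) i * (1 - p)" for i
    unfolding label_pmf_def pmf_bind using assms by (subst integral_bernoulli_pmf) simp_all
  show "measure_pmf.prob (label_pmf p s) {i} = p / real s" if "i \<in> {1..s}"
    using pm[of i] that assms by (simp add: measure_pmf_single)
  show p0: "measure_pmf.prob (label_pmf p s) {0} = 1 - p"
    using pm[of 0] assms by (simp add: measure_pmf_single)
  have "{i::nat. i \<noteq> 0} = space (measure_pmf (label_pmf p s)) - {0}" by auto
  then have "measure_pmf.prob (label_pmf p s) {i. i \<noteq> 0} = 1 - measure_pmf.prob (label_pmf p s) {0}"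
    using measure_pmf.prob_compl[of "{0}" "label_pmf p s"] by simp
  then show "measure_pmf.prob (label_pmf p s) {i. i \<noteq> 0} = p" using p0 by simp
qed

lemma prob_block:
  assumes "A \<subseteq> {..<n}"
  shows "measure_pmf.prob (block_pmf n p s) {\<beta>. \<forall>x\<in>A. \<beta> x \<in> B x} = (\<Prod>x\<in>A. measure_pmf.prob (label_pmf p s) (B x))"
proof -
  have "{\<beta>. \<forall>x\<in>A. \<beta> x \<in> B x} = Pi {..<n} (\<lambda>x. if x \<in> A then B x else UNIV)"
    using assms by (auto simp: Pi_def)
  then have "measure_pmf.prob (block_pmf n p s) {\<beta>. \<forall>x\<in>A. \<beta> x \<in> B x}
     = (\<Prod>x\<in>{..<n}. measure_pmf.prob (label_pmf p s) (if x \<in> A then B x else UNIV))"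
    by (simp add: block_pmf_def measure_Pi_pmf_Pi)
  also have "\<dots> = (\<Prod>x\<in>A. measure_pmf.prob (label_pmf p s) (if x \<in> A then B x else UNIV))"
    using assms by (intro prod.mono_neutral_right) auto
  finally show ?thesis by simp
qed

lemma prob_block_support:
  assumes "A \<subseteq> {..<n}" "0 \<le> p" "p \<le> 1" "0 < s"
  shows "measure_pmf.prob (block_pmf n p s) {\<beta>. \<forall>x\<in>A. \<beta> x \<noteq> 0} = p ^ card A"
  using prob_block[OF assms(1), of p s "\<lambda>_. {i. i \<noteq> 0}"] prob_label(3)[OF assms(2-4)] by simp

definition blocks_pmf :: "nat \<Rightarrow> nat \<Rightarrow> real \<Rightarrow> nat \<Rightarrow> (nat \<Rightarrow> nat \<Rightarrow> nat) pmf" where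
  "blocks_pmf n M p s = Pi_pmf {..<M} (\<lambda>_. 0) (\<lambda>_. block_pmf n p s)"

definition block_incidence :: "nat \<Rightarrow> nat \<Rightarrow> nat set \<Rightarrow> (nat \<Rightarrow> nat \<Rightarrow> nat) \<Rightarrow> (nat \<times> nat) set" where
  "block_incidence n M Q \<omega> = {(x, j). x < n \<and> j < M \<and> j \<in> Q \<and> \<omega> j x \<noteq> 0}"

text \<open>Memberships of different vertices in different blocks are independent with probability
  p, which supplies the product bound of \<open>random_incidence\<close>.\<close>

lemma prob_block_incidence:
  assumes R: "R \<subseteq> {..<n} \<times> {..<M}" and p: "0 \<le> p" "p \<le> 1" "0 < s"
  shows "measure_pmf.prob (blocks_pmf n M p s) {\<omega>. R \<subseteq> block_incidence n M UNIV \<omega>} = p ^ card R"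
proof -
  let ?A = "\<lambda>j. {x. (x, j) \<in> R}"
  have fR: "finite R" using R finite_subset by blast
  have A: "?A j \<subseteq> {..<n}" for j using R by auto
  have "{\<omega>. R \<subseteq> block_incidence n M UNIV \<omega>} = Pi {..<M} (\<lambda>j. {\<beta>. \<forall>x\<in>?A j. \<beta> x \<noteq> 0})"
    using R by (auto simp: block_incidence_def Pi_def)
  then have "measure_pmf.prob (blocks_pmf n M p s) {\<omega>. R \<subseteq> block_incidence n M UNIV \<omega>}
     = (\<Prod>j\<in>{..<M}. measure_pmf.prob (block_pmf n p s) {\<beta>. \<forall>x\<in>?A j. \<beta> x \<noteq> 0})"
    by (simp only: blocks_pmf_def measure_Pi_pmf_Pi finite_lessThan)
  also have "\<dots> = (\<Prod>j\<in>{..<M}. p ^ card (?A j))"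
    by (intro prod.cong refl prob_block_support A p)
  also have "\<dots> = p ^ (\<Sum>j\<in>{..<M}. card (?A j))" by (simp add: power_sum)
  also have "(\<Sum>j\<in>{..<M}. card (?A j)) = card R"
  proof -
    have "(\<Sum>j\<in>{..<M}. card (?A j)) = card (SIGMA j:{..<M}. ?A j)"
      using A by (intro card_SigmaI[symmetric]) (auto intro: finite_subset)
    also have "\<dots> = card R"
      by (rule bij_betw_same_card[of "\<lambda>(j, x). (x, j)"], rule bij_betwI[where g = "\<lambda>(x, j). (j, x)"]) (use R in auto)
    finally show ?thesis .
  qed
  finally show ?thesis .
qed

text \<open>Fix one bijection with the labels for each s-set S. The events that the block meets W
  exactly in S with these labels are disjoint, so their probabilities add up. There are at least
  (w/s)^s sets, and by Bernoulli's inequality the rest of W stays out of the block with probability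
  at least 1 - w p \<ge> 1/2.\<close>

lemma prob_rainbow_lower:
  assumes W: "W \<subseteq> {..<n}" "card W = w" "s \<le> w" and p: "0 \<le> p" "p \<le> 1" "0 < s" and wp: "real w * p \<le> 1 / 2"
  shows "1 / 2 * (real w * p / (real s)\<^sup>2) ^ s
    \<le> measure_pmf.prob (block_pmf n p s) {\<beta>. \<exists>S\<subseteq>W. card S = s \<and> \<beta> ` S \<subseteq> {1..s} \<and> inj_on \<beta> S}"
    (is "_ \<le> measure_pmf.prob _ ?H")
proof -
  let ?SS = "{S. S \<subseteq> W \<and> card S = s}"
  have fW: "finite W" using W(1) finite_subset by blast
  have fSS: "finite ?SS" using fW by simp
  have "\<exists>\<phi>. bij_betw \<phi> S {1..s}" if "S \<in> ?SS" for S
    using that fW finite_subset by (intro finite_same_card_bij) auto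
  then obtain \<phi> where \<phi>: "\<And>S. S \<in> ?SS \<Longrightarrow> bij_betw (\<phi> S) S {1..s}" by metis
  define E where "E S = {\<beta>. \<forall>x\<in>W. \<beta> x \<in> (if x \<in> S then {\<phi> S x} else {0})}" for S
  have pE: "1 / 2 * (p / real s) ^ s \<le> measure_pmf.prob (block_pmf n p s) (E S)" if S: "S \<in> ?SS" for S
  proof -
    have fS: "finite S" using S fW finite_subset by blast
    have "measure_pmf.prob (block_pmf n p s) (E S) = (\<Prod>x\<in>W. measure_pmf.prob (label_pmf p s) (if x \<in> S then {\<phi> S x} else {0}))"
      unfolding E_def by (rule prob_block[OF W(1)])
    also have "\<dots> = (\<Prod>x\<in>W. if x \<in> S then p / real s else 1 - p)"
    proof (rule prod.cong[OF refl])
      fix x assume "x \<in> W"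
      have "x \<in> S \<Longrightarrow> \<phi> S x \<in> {1..s}" using \<phi>[OF S] bij_betwE by blast
      then show "measure_pmf.prob (label_pmf p s) (if x \<in> S then {\<phi> S x} else {0}) = (if x \<in> S then p / real s else 1 - p)"
        using prob_label(1,2)[OF p] by simp
    qed
    also have "\<dots> = (p / real s) ^ s * (1 - p) ^ (w - s)"
    proof -
      have "W \<inter> S = S" "card (W - S) = w - s" using S W fS card_Diff_subset[of S W] by auto
      then show ?thesis using fW S by (simp add: prod.If_cases Diff_eq[symmetric])
    qed
    also have "\<dots> \<ge> (p / real s) ^ s * (1 / 2)"
    proof (rule mult_left_mono)
      have "real (w - s) * p \<le> real w * p" using p by (intro mult_right_mono) auto
      then have "1 / 2 \<le> 1 + real (w - s) * (- p)" using wp by simp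
      also have "\<dots> \<le> (1 + - p) ^ (w - s)" using p by (intro Bernoulli_inequality) simp
      finally show "1 / 2 \<le> (1 - p) ^ (w - s)" by simp
    qed (use p in simp)
    finally show ?thesis by (simp add: mult.commute)
  qed
  have disj: "disjoint_family_on E ?SS"
    unfolding disjoint_family_on_def
  proof (intro ballI impI)
    fix S S' assume S: "S \<in> ?SS" "S' \<in> ?SS" "S \<noteq> S'"
    have supp: "{x\<in>W. \<beta> x \<noteq> 0} = T" if b: "\<beta> \<in> E T" and T: "T \<in> ?SS" for \<beta> T
    proof -
      have 1: "\<beta> x \<noteq> 0" if "x \<in> T" for x
      proof -
        have "\<phi> T x \<in> {1..s}" using bij_betw_apply[OF \<phi>[OF T] that] .
        moreover have "x \<in> W" using that T by auto
        then have "\<beta> x = \<phi> T x" using b that unfolding E_def by (auto dest: bspec)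
        ultimately show ?thesis by simp
      qed
      have 2: "\<beta> x = 0" if "x \<in> W" "x \<notin> T" for x using b that unfolding E_def by (auto dest: bspec)
      show ?thesis
      proof (intro equalityI subsetI)
        fix x assume "x \<in> {x\<in>W. \<beta> x \<noteq> 0}"
        then show "x \<in> T" using 2[of x] by (cases "x \<in> T") simp_all
      next
        fix x assume "x \<in> T"
        then show "x \<in> {x\<in>W. \<beta> x \<noteq> 0}" using 1[of x] T by auto
      qed
    qed
    show "E S \<inter> E S' = {}"
    proof (rule equals0I)
      fix \<beta> assume "\<beta> \<in> E S \<inter> E S'"
      then show False using supp[of \<beta> S] supp[of \<beta> S'] S by simp
    qed
  qed
  have sub: "(\<Union>S\<in>?SS. E S) \<subseteq> ?H"
  proof
    fix \<beta> assume "\<beta> \<in> (\<Union>S\<in>?SS. E S)"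
    then obtain S where S: "S \<in> ?SS" and b: "\<beta> \<in> E S" by blast
    have eq: "\<beta> x = \<phi> S x" if "x \<in> S" for x
    proof -
      have "x \<in> W" using that S by auto
      then show ?thesis using b that unfolding E_def by (auto dest: bspec)
    qed
    have "inj_on (\<phi> S) S" using \<phi>[OF S] by (rule bij_betw_imp_inj_on)
    then have "inj_on \<beta> S" by (simp add: inj_on_def eq)
    moreover have "\<beta> ` S \<subseteq> {1..s}"
    proof (rule image_subsetI)
      fix x assume "x \<in> S"
      then show "\<beta> x \<in> {1..s}" using eq[of x] bij_betw_apply[OF \<phi>[OF S], of x] by simp
    qed
    ultimately show "\<beta> \<in> ?H" using S by blast
  qed
  have "1 / 2 * (real w * p / (real s)\<^sup>2) ^ s = (real w / real s) ^ s * (1 / 2 * (p / real s) ^ s)"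
    by (simp add: power2_eq_square power_mult_distrib power_divide)
  also have "\<dots> \<le> real (card ?SS) * (1 / 2 * (p / real s) ^ s)"
    using binomial_ge_n_over_k_pow_k[of s w, where 'a = real] W fW p
    by (intro mult_right_mono) (auto simp: n_subsets)
  also have "\<dots> = (\<Sum>S\<in>?SS. 1 / 2 * (p / real s) ^ s)" by simp
  also have "\<dots> \<le> (\<Sum>S\<in>?SS. measure_pmf.prob (block_pmf n p s) (E S))" by (intro sum_mono pE)
  also have "\<dots> = measure_pmf.prob (block_pmf n p s) (\<Union>S\<in>?SS. E S)"
    using fSS disj by (intro measure_pmf.finite_measure_finite_Union[symmetric]) auto
  also have "\<dots> \<le> measure_pmf.prob (block_pmf n p s) ?H"
    using sub by (intro measure_pmf.finite_measure_mono) auto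
  finally show ?thesis .
qed

text \<open>The integrand is at most 1, minus 1 - exp(-c) on a hit, plus exp 1 on a spoilt block. By
  \<open>u\<close> the loss from spoilt blocks eats up at most half of the gain from hits.\<close>

lemma nn_integral_exp_spoilt:
  fixes blk :: "'b pmf"
  assumes c: "0 \<le> c" and lo: "h \<le> measure_pmf.prob blk {\<beta>. H \<beta>}" and up: "measure_pmf.prob blk {\<beta>. S \<beta>} \<le> u"
    and u: "exp 1 * u \<le> (1 - exp (- c)) * h / 2"
  shows "(\<integral>\<^sup>+\<beta>. ennreal (exp (of_bool (S \<beta>) - of_bool (H \<beta>) * c)) \<partial>blk) \<le> ennreal (1 - (1 - exp (- c)) * h / 2)"
proof -
  let ?pr = "measure_pmf.prob blk"
  let ?f = "\<lambda>\<beta>. 1 - (1 - exp (- c)) * indicator {\<beta>. H \<beta>} \<beta> + exp 1 * indicator {\<beta>. S \<beta>} \<beta> :: real"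
  have c1: "exp (- c) \<le> 1" "0 < exp (- c)" using c by simp_all
  have e1: "exp (1 - c) \<le> exp 1" using c by simp
  have f: "exp (of_bool (S \<beta>) - of_bool (H \<beta>) * c) \<le> ?f \<beta>" for \<beta>
  proof -
    have "exp (1 - c) \<le> exp (- c) + exp 1" using e1 c1(2) by linarith
    then show ?thesis by (cases "S \<beta>"; cases "H \<beta>") simp_all
  qed
  have f0: "0 \<le> ?f \<beta>" for \<beta> using f[of \<beta>] exp_ge_zero order_trans by blast
  have int: "integrable (measure_pmf blk) (indicator A :: 'b \<Rightarrow> real)" for A
    by (rule measure_pmf.integrable_const_bound[where B = 1]) (auto simp: indicator_def)
  have "(\<integral>\<^sup>+\<beta>. ennreal (exp (of_bool (S \<beta>) - of_bool (H \<beta>) * c)) \<partial>blk) \<le> (\<integral>\<^sup>+\<beta>. ennreal (?f \<beta>) \<partial>blk)"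
    by (intro nn_integral_mono ennreal_leI f)
  also have "\<dots> = ennreal (\<integral>\<beta>. ?f \<beta> \<partial>blk)"
    using f0 int by (intro nn_integral_eq_integral) auto
  also have "(\<integral>\<beta>. ?f \<beta> \<partial>blk) = 1 - (1 - exp (- c)) * ?pr {\<beta>. H \<beta>} + exp 1 * ?pr {\<beta>. S \<beta>}"
    using int by simp
  also have "ennreal \<dots> \<le> ennreal (1 - (1 - exp (- c)) * h / 2)"
  proof (rule ennreal_leI)
    have "(1 - exp (- c)) * h \<le> (1 - exp (- c)) * ?pr {\<beta>. H \<beta>}" using lo c1 by (intro mult_left_mono) auto
    moreover have "exp 1 * ?pr {\<beta>. S \<beta>} \<le> exp 1 * u" using up by (intro mult_left_mono) auto
    ultimately show "1 - (1 - exp (- c)) * ?pr {\<beta>. H \<beta>} + exp 1 * ?pr {\<beta>. S \<beta>} \<le> 1 - (1 - exp (- c)) * h / 2"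
      using u by linarith
  qed
  finally show ?thesis .
qed

section \<open>Spoilt sets\<close>

lemma card_supersets:
  assumes "finite W" "finite A" "card A \<le> r"
  shows "card {S. S \<subseteq> W \<and> card S = r \<and> A \<subseteq> S} \<le> card W ^ (r - card A)"
proof -
  let ?X = "{B. B \<subseteq> W \<and> card B = r - card A}"
  have fX: "finite ?X" using assms(1) by simp
  have "card {S. S \<subseteq> W \<and> card S = r \<and> A \<subseteq> S} \<le> card ?X"
  proof (rule card_inj_on_le[where f = "\<lambda>S. S - A", OF _ _ fX])
    show "inj_on (\<lambda>S. S - A) {S. S \<subseteq> W \<and> card S = r \<and> A \<subseteq> S}" by (rule inj_onI) blast
    show "(\<lambda>S. S - A) ` {S. S \<subseteq> W \<and> card S = r \<and> A \<subseteq> S} \<subseteq> ?X"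
      using card_Diff_subset[OF assms(2)] by auto
  qed
  also have "\<dots> = card W choose (r - card A)" using assms(1) by (rule n_subsets)
  also have "\<dots> \<le> card W ^ (r - card A)"
    using binomial_le_pow[of "r - card A" "card W"] by (cases "r - card A \<le> card W") (simp_all add: binomial_eq_0)
  finally show ?thesis .
qed

context construction
begin

text \<open>\<open>\<beta>\<close> labels the block in question and \<open>I\<close> belongs to the
  other blocks. All roots must lie in the block but only two of them in S: the edges of a clique
  inside one block may come from different s-sets, so a single S need not contain all roots.\<close>

definition spoils :: "nat set \<Rightarrow> (nat \<Rightarrow> nat) \<Rightarrow> (nat \<times> nat) set \<Rightarrow> bool" where
  "spoils S \<beta> I \<longleftrightarrow> (\<exists>x\<in>S. \<exists>y\<in>S. x \<noteq> y \<and> (\<exists>j. (x, j) \<in> I \<and> (y, j) \<in> I)) \<or>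
     (\<exists>LL P l0 fg. (LL, P, l0) \<in> types \<and> fg \<in> embeddings P (other_lines LL P l0) n M \<and>
        cert P (other_lines LL P l0) fg \<subseteq> I \<and> (\<forall>i\<in>l0 \<inter> P. \<beta> (fst fg i) \<noteq> 0) \<and>
        2 \<le> card {i\<in>l0 \<inter> P. fst fg i \<in> S})"

text \<open>The s-set has to lie in the block but not to be rainbow. Only an upper bound for the
  probability is wanted, and this way it depends on the support of \<open>\<beta>\<close>
  alone.\<close>

definition spoilt :: "nat set \<Rightarrow> (nat \<Rightarrow> nat) \<Rightarrow> (nat \<times> nat) set \<Rightarrow> bool" where
  "spoilt W \<beta> I \<longleftrightarrow> (\<exists>S. S \<subseteq> W \<and> card S = s \<and> (\<forall>x\<in>S. \<beta> x \<noteq> 0) \<and> spoils S \<beta> I)"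

lemma spoils_mono: "spoils S \<beta> I \<Longrightarrow> I \<subseteq> I' \<Longrightarrow> spoils S \<beta> I'"
  unfolding spoils_def by blast

text \<open>The witness uses a single other block, or one block per line of a type, and lines are
  subsets of a t-element set. All these blocks are red with probability at least 2^-(2^t), the
  source of this constant later on.\<close>

lemma spoils_local:
  assumes sp: "spoils S \<beta> I" and I: "I \<subseteq> {..<n} \<times> ({..<M} - {j})"
  shows "\<exists>D. D \<subseteq> {..<M} - {j} \<and> card D \<le> 2 ^ t \<and> spoils S \<beta> {(x, i)\<in>I. i \<in> D}"
  using sp[unfolded spoils_def]
proof (elim disjE bexE exE conjE)
  fix x y i assume xy: "x \<in> S" "y \<in> S" "x \<noteq> y" "(x, i) \<in> I" "(y, i) \<in> I"
  have "spoils S \<beta> {(x, i')\<in>I. i' \<in> {i}}" unfolding spoils_def using xy by blast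
  moreover have "{i} \<subseteq> {..<M} - {j}" using xy I by auto
  ultimately show ?thesis by (intro exI[of _ "{i}"]) simp
next
  fix LL P l0 fg assume h: "(LL, P, l0) \<in> types" "fg \<in> embeddings P (other_lines LL P l0) n M"
    "cert P (other_lines LL P l0) fg \<subseteq> I" "\<forall>i\<in>l0 \<inter> P. \<beta> (fst fg i) \<noteq> 0" "2 \<le> card {i\<in>l0 \<inter> P. fst fg i \<in> S}"
  let ?O = "other_lines LL P l0"
  let ?D = "snd ` cert P ?O fg"
  have fin: "finite ?O" using typesD(8)[OF h(1)] .
  have "?D \<subseteq> {..<M} - {j}" using h(3) I by auto
  moreover have "card ?D \<le> 2 ^ t"
  proof -
    have "?D \<subseteq> snd fg ` ?O" unfolding cert_def incidences_def by auto
    then have "card ?D \<le> card ?O" using fin by (meson card_image_le card_mono finite_imageI order_trans)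
    also have "\<dots> \<le> card (Pow {..<t})" using types_lines[OF h(1)] by (intro card_mono) auto
    finally show ?thesis by (simp add: card_Pow)
  qed
  moreover have "cert P ?O fg \<subseteq> {(x, i)\<in>I. i \<in> ?D}" using h(3) by force
  then have "spoils S \<beta> {(x, i)\<in>I. i \<in> ?D}" unfolding spoils_def using h(1,2,4,5) by blast
  ultimately show ?thesis by (intro exI[of _ ?D]) blast
qed

abbreviation "blk \<equiv> block_pmf n p s"

lemma prob_support: "A \<subseteq> {..<n} \<Longrightarrow> measure_pmf.prob blk {\<beta>. \<forall>x\<in>A. \<beta> x \<noteq> 0} = p ^ card A"
  using p s3 by (intro prob_block_support) auto

text \<open>All roots lie in S: there are at most \<eta> w^r closed tuples of r roots, at most w^(s
  - r) ways to complete one to S, and S lies in the block with probability p^s.\<close>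

lemma prob_closed_roots:
  assumes q: "quality I" and W: "W \<subseteq> {..<n}" "card W = w" and pat: "(P, Ls, R) \<in> closing_patterns" and Rs: "card R \<le> s"
  shows "measure_pmf.prob blk {\<beta>. \<exists>\<rho> S. \<rho> \<in> R \<rightarrow>\<^sub>E W \<and> closed_tuple P Ls R n M I \<rho> \<and> inj_on \<rho> R \<and>
      S \<subseteq> W \<and> card S = s \<and> \<rho> ` R \<subseteq> S \<and> (\<forall>x\<in>S. \<beta> x \<noteq> 0)} \<le> \<eta> * (real w * p) ^ s"
    (is "measure_pmf.prob _ ?E \<le> _")
proof -
  have fW: "finite W" using W(1) finite_subset by blast
  have fR: "finite R" using closing_patternsD(1,3)[OF pat] finite_subset by blast
  let ?A = "{\<rho> \<in> R \<rightarrow>\<^sub>E W. closed_tuple P Ls R n M I \<rho>}"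
  let ?S = "\<lambda>\<rho>. {S. S \<subseteq> W \<and> card S = s \<and> \<rho> ` R \<subseteq> S}"
  let ?B = "\<lambda>\<rho>. if inj_on \<rho> R then (\<Union>S\<in>?S \<rho>. {\<beta>. \<forall>x\<in>S. \<beta> x \<noteq> 0}) else {}"
  have fA: "finite ?A" using finite_PiE[OF fR, of "\<lambda>_. W"] fW by simp
  have "measure_pmf.prob blk (?B \<rho>) \<le> real w ^ (s - card R) * p ^ s" for \<rho>
  proof (cases "inj_on \<rho> R")
    case True
    have "measure_pmf.prob blk (\<Union>S\<in>?S \<rho>. {\<beta>. \<forall>x\<in>S. \<beta> x \<noteq> 0}) \<le> real w ^ (s - card R) * p ^ s"
    proof (rule prob_union_le)
      show "finite (?S \<rho>)" using fW by simp
      show "measure_pmf.prob blk {\<beta>. \<forall>x\<in>S. \<beta> x \<noteq> 0} \<le> p ^ s" if "S \<in> ?S \<rho>" for S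
      proof -
        have "S \<subseteq> {..<n}" using that W(1) by blast
        then show ?thesis using prob_support[of S] that by simp
      qed
      have "card (?S \<rho>) \<le> w ^ (s - card R)"
        using card_supersets[OF fW, of "\<rho> ` R" s] fR Rs card_image[OF True] W(2) by simp
      then have "real (card (?S \<rho>)) \<le> real (w ^ (s - card R))" by (rule of_nat_mono)
      then show "real (card (?S \<rho>)) \<le> real w ^ (s - card R)" by simp
    qed (use p in simp)
    then show ?thesis using True by simp
  qed (use p in simp)
  then have "measure_pmf.prob blk (\<Union>\<rho>\<in>?A. ?B \<rho>) \<le> (\<eta> * real w ^ card R) * (real w ^ (s - card R) * p ^ s)"
    using p by (intro prob_union_le fA quality_density[OF q W pat]) auto
  also have "\<dots> = \<eta> * (real w ^ (card R + (s - card R)) * p ^ s)" by (simp only: power_add mult.assoc)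
  also have "\<dots> = \<eta> * (real w * p) ^ s" using Rs by (simp add: power_mult_distrib)
  finally have "measure_pmf.prob blk (\<Union>\<rho>\<in>?A. ?B \<rho>) \<le> \<eta> * (real w * p) ^ s" .
  moreover have "?E \<subseteq> (\<Union>\<rho>\<in>?A. ?B \<rho>)"
  proof
    fix \<beta> assume "\<beta> \<in> ?E"
    then obtain \<rho> S where r: "\<rho> \<in> R \<rightarrow>\<^sub>E W" "closed_tuple P Ls R n M I \<rho>" "inj_on \<rho> R"
      and S: "S \<subseteq> W" "card S = s" "\<rho> ` R \<subseteq> S" "\<forall>x\<in>S. \<beta> x \<noteq> 0" by (elim CollectE exE conjE)
    have "\<rho> \<in> ?A" using r by simp
    moreover have "\<beta> \<in> ?B \<rho>" using r(3) S by auto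
    ultimately show "\<beta> \<in> (\<Union>\<rho>\<in>?A. ?B \<rho>)" by (intro UN_I[of \<rho>])
  qed
  then have "measure_pmf.prob blk ?E \<le> measure_pmf.prob blk (\<Union>\<rho>\<in>?A. ?B \<rho>)"
    by (intro measure_pmf.finite_measure_mono) auto
  ultimately show ?thesis by linarith
qed

text \<open>\<open>R\<close> is the exact set of roots inside S. The other roots are then disjoint
  from S, and the probabilities that S and these roots join the block multiply.\<close>

definition spoilt_by :: "nat set \<Rightarrow> (nat \<times> nat) set \<Rightarrow> nat set set \<times> nat set \<times> nat set \<Rightarrow> nat set \<Rightarrow> (nat \<Rightarrow> nat) set" where
  "spoilt_by W I = (\<lambda>(LL, P, l0) R. {\<beta>. R \<subseteq> l0 \<inter> P \<and> 2 \<le> card R \<and> (\<exists>fg S. fg \<in> embeddings P (other_lines LL P l0) n M \<and>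
     cert P (other_lines LL P l0) fg \<subseteq> I \<and> S \<subseteq> W \<and> card S = s \<and> fst fg ` R \<subseteq> S \<and> fst fg ` (l0 \<inter> P - R) \<inter> S = {} \<and>
     (\<forall>x\<in>S. \<beta> x \<noteq> 0) \<and> (\<forall>i\<in>l0 \<inter> P. \<beta> (fst fg i) \<noteq> 0))})"

text \<open>If all roots are in S, the density of closed tuples applies. If some are outside S they
  may be outside W as well, where density says nothing; then all extensions of the roots in R are
  counted by \<open>few_extensions\<close>, with the additional power of p for the outside
  roots.\<close>

lemma prob_spoilt_by:
  assumes q: "quality I" and W: "W \<subseteq> {..<n}" "card W = w" and T: "(LL, P, l0) \<in> types"
  shows "measure_pmf.prob blk (spoilt_by W I (LL, P, l0) R) \<le> \<eta> * (real w * p) ^ s"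
proof -
  let ?O = "other_lines LL P l0" and ?E = "spoilt_by W I (LL, P, l0) R"
  note TD = typesD[OF T]
  have fW: "finite W" using W(1) finite_subset by blast
  have fl: "finite (l0 \<inter> P)" using TD(6) by simp
  have pos': "0 \<le> \<eta> * (real w * p) ^ s" using eta p by simp
  consider "\<not> (R \<subseteq> l0 \<inter> P \<and> 2 \<le> card R)" | "R = l0 \<inter> P" | "R \<subset> l0 \<inter> P" "2 \<le> card R" by blast
  then show ?thesis
  proof cases
    case 1
    then have "?E = {}" unfolding spoilt_by_def by auto
    then show ?thesis using pos' by simp
  next
    case 2
    have pat: "(P, ?O, R) \<in> closing_patterns" unfolding closing_patterns_def using T 2 by force
    let ?F = "{\<beta>. \<exists>\<rho> S. \<rho> \<in> R \<rightarrow>\<^sub>E W \<and> closed_tuple P ?O R n M I \<rho> \<and> inj_on \<rho> R \<and>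
      S \<subseteq> W \<and> card S = s \<and> \<rho> ` R \<subseteq> S \<and> (\<forall>x\<in>S. \<beta> x \<noteq> 0)}"
    have "?E \<subseteq> ?F"
    proof
      fix \<beta> assume "\<beta> \<in> ?E"
      then obtain fg S where h: "fg \<in> embeddings P ?O n M" "cert P ?O fg \<subseteq> I" "S \<subseteq> W" "card S = s" "fst fg ` R \<subseteq> S"
        "\<forall>x\<in>S. \<beta> x \<noteq> 0" unfolding spoilt_by_def by auto
      let ?r = "restrict (fst fg) R"
      have "inj_on (fst fg) P" using h(1) unfolding embeddings_def by auto
      then have "inj_on ?r R" using 2 by (auto simp: inj_on_def)
      moreover have "?r \<in> R \<rightarrow>\<^sub>E W" using h(3,5) by auto
      moreover have "closed_tuple P ?O R n M I ?r" unfolding closed_tuple_def using h(1,2) by auto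
      moreover have "?r ` R \<subseteq> S" using h(5) by auto
      ultimately show "\<beta> \<in> ?F" using h(3,4,6) by blast
    qed
    then have "measure_pmf.prob blk ?E \<le> measure_pmf.prob blk ?F"
      by (intro measure_pmf.finite_measure_mono) auto
    also have "\<dots> \<le> \<eta> * (real w * p) ^ s" using prob_closed_roots[OF q W pat] TD(9) 2 by simp
    finally show ?thesis .
  next
    case 3
    let ?r = "card R" and ?r' = "card (l0 \<inter> P)"
    have fR: "finite R" using 3 fl finite_subset by blast
    have rr: "?r < ?r'" using 3 fl psubset_card_mono by blast
    have rs: "?r \<le> s" using rr TD(9) by linarith
    let ?G = "\<lambda>\<rho>. {fg\<in>embeddings P ?O n M. (\<forall>i\<in>R. fst fg i = \<rho> i) \<and> cert P ?O fg \<subseteq> I}"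
    let ?S = "\<lambda>fg :: (nat \<Rightarrow> nat) \<times> (nat set \<Rightarrow> nat). {S. S \<subseteq> W \<and> card S = s \<and> fst fg ` R \<subseteq> S}"
    let ?B = "\<lambda>(fg :: (nat \<Rightarrow> nat) \<times> (nat set \<Rightarrow> nat)) S. if fst fg ` (l0 \<inter> P - R) \<inter> S = {} then {\<beta>. \<forall>x\<in>S \<union> fst fg ` (l0 \<inter> P - R). \<beta> x \<noteq> 0} else {}"
    have fG: "finite (?G \<rho>)" for \<rho> using finite_embeddings[OF TD(6,8)] by simp
    have one: "measure_pmf.prob blk (\<Union>S\<in>?S fg. ?B fg S) \<le> real w ^ (s - ?r) * p ^ (s + (?r' - ?r))"
      if fg: "fg \<in> embeddings P ?O n M" for fg
    proof (rule prob_union_le)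
      have inj: "inj_on (fst fg) P" and rng: "fst fg ` P \<subseteq> {..<n}" using fg unfolding embeddings_def by auto
      show "finite (?S fg)" using fW by simp
      have cR: "card (fst fg ` R) = ?r" using inj 3(1) by (intro card_image) (auto simp: inj_on_def)
      have "card (?S fg) \<le> w ^ (s - ?r)"
        using card_supersets[OF fW, of "fst fg ` R" s] fR rs cR W(2) by simp
      then have "real (card (?S fg)) \<le> real (w ^ (s - ?r))" by (rule of_nat_mono)
      then show "real (card (?S fg)) \<le> real w ^ (s - ?r)" by simp
      show "0 \<le> p ^ (s + (?r' - ?r))" using p by simp
      fix S assume S: "S \<in> ?S fg"
      show "measure_pmf.prob blk (?B fg S) \<le> p ^ (s + (?r' - ?r))"
      proof (cases "fst fg ` (l0 \<inter> P - R) \<inter> S = {}")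
        case True
        have fS: "finite S" using S fW finite_subset by blast
        have "inj_on (fst fg) (l0 \<inter> P - R)" using inj by (auto simp: inj_on_def)
        then have "card (fst fg ` (l0 \<inter> P - R)) = ?r' - ?r"
          using card_Diff_subset[OF fR psubset_imp_subset[OF 3(1)]] by (simp add: card_image)
        then have "card (S \<union> fst fg ` (l0 \<inter> P - R)) = s + (?r' - ?r)"
          using True S fS fl by (subst card_Un_disjoint) auto
        moreover have "S \<union> fst fg ` (l0 \<inter> P - R) \<subseteq> {..<n}" using S W(1) rng by auto
        ultimately show ?thesis using prob_support[of "S \<union> fst fg ` (l0 \<inter> P - R)"] True by simp
      qed (use p in simp)
    qed
    have two: "measure_pmf.prob blk (\<Union>fg\<in>?G \<rho>. \<Union>S\<in>?S fg. ?B fg S) \<le> \<eta> * (real w ^ (s - ?r) * p ^ s)"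
      if \<rho>: "\<rho> \<in> R \<rightarrow>\<^sub>E W" for \<rho>
    proof -
      have "measure_pmf.prob blk (\<Union>fg\<in>?G \<rho>. \<Union>S\<in>?S fg. ?B fg S)
          \<le> real (card (?G \<rho>)) * (real w ^ (s - ?r) * p ^ (s + (?r' - ?r)))"
        using p by (intro prob_union_le fG one) auto
      also have "\<dots> = (real (rooted_count I P ?O R \<rho>) * p ^ (?r' - ?r)) * (real w ^ (s - ?r) * p ^ s)"
        unfolding rooted_count_def by (simp add: power_add)
      also have "\<dots> \<le> \<eta> * (real w ^ (s - ?r) * p ^ s)"
      proof (rule mult_right_mono)
        have "few_extensions I" using q by (simp add: quality_def)
        moreover have "\<rho> \<in> R \<rightarrow>\<^sub>E {..<n}" using \<rho> W(1) by auto
        ultimately show "real (rooted_count I P ?O R \<rho>) * p ^ (?r' - ?r) \<le> \<eta>"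
          unfolding few_extensions_def using T 3 by simp
      qed (use p in simp)
      finally show ?thesis .
    qed
    have "measure_pmf.prob blk (\<Union>\<rho>\<in>R \<rightarrow>\<^sub>E W. \<Union>fg\<in>?G \<rho>. \<Union>S\<in>?S fg. ?B fg S)
        \<le> real w ^ ?r * (\<eta> * (real w ^ (s - ?r) * p ^ s))"
    proof (rule prob_union_le)
      show "finite (R \<rightarrow>\<^sub>E W)" using fR fW by (intro finite_PiE)
      show "real (card (R \<rightarrow>\<^sub>E W)) \<le> real w ^ ?r" using fR W(2) by (simp add: card_PiE)
    qed (use two eta p in simp_all)
    also have "\<dots> = \<eta> * (real w ^ (?r + (s - ?r)) * p ^ s)" by (simp only: power_add mult.assoc mult.left_commute)
    also have "\<dots> = \<eta> * (real w * p) ^ s" using rs by (simp add: power_mult_distrib)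
    finally have fin: "measure_pmf.prob blk (\<Union>\<rho>\<in>R \<rightarrow>\<^sub>E W. \<Union>fg\<in>?G \<rho>. \<Union>S\<in>?S fg. ?B fg S) \<le> \<eta> * (real w * p) ^ s" .
    have "?E \<subseteq> (\<Union>\<rho>\<in>R \<rightarrow>\<^sub>E W. \<Union>fg\<in>?G \<rho>. \<Union>S\<in>?S fg. ?B fg S)"
    proof
      fix \<beta> assume "\<beta> \<in> ?E"
      then obtain fg S where h: "fg \<in> embeddings P ?O n M" "cert P ?O fg \<subseteq> I" "S \<subseteq> W" "card S = s" "fst fg ` R \<subseteq> S"
        "fst fg ` (l0 \<inter> P - R) \<inter> S = {}" "\<forall>x\<in>S. \<beta> x \<noteq> 0" "\<forall>i\<in>l0 \<inter> P. \<beta> (fst fg i) \<noteq> 0"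
        unfolding spoilt_by_def by auto
      have 1: "restrict (fst fg) R \<in> R \<rightarrow>\<^sub>E W" using h(3,5) by auto
      have 2: "fg \<in> ?G (restrict (fst fg) R)" using h(1,2) by simp
      have 3: "S \<in> ?S fg" using h(3,4,5) by simp
      have 4: "\<beta> \<in> ?B fg S" using h(6,7,8) by auto
      show "\<beta> \<in> (\<Union>\<rho>\<in>R \<rightarrow>\<^sub>E W. \<Union>fg\<in>?G \<rho>. \<Union>S\<in>?S fg. ?B fg S)"
        by (rule UN_I[OF 1], rule UN_I[OF 2], rule UN_I[OF 3], rule 4)
    qed
    then have "measure_pmf.prob blk ?E \<le> measure_pmf.prob blk (\<Union>\<rho>\<in>R \<rightarrow>\<^sub>E W. \<Union>fg\<in>?G \<rho>. \<Union>S\<in>?S fg. ?B fg S)"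
      by (intro measure_pmf.finite_measure_mono) auto
    then show ?thesis using fin by linarith
  qed
qed

lemma closed_pair:
  assumes "I \<subseteq> {..<n} \<times> {..<M}" "(x, j) \<in> I" "(y, j) \<in> I" "x \<noteq> y"
  shows "closed_tuple {0, 1} {{0, 1}} {0, 1} n M I (\<lambda>i\<in>{0, 1}. if i = 0 then x else y)"
proof -
  let ?f = "\<lambda>i\<in>{0, 1 :: nat}. if i = 0 then x else y" and ?g = "\<lambda>l\<in>{{0, 1 :: nat}}. j"
  have "(?f, ?g) \<in> embeddings {0, 1} {{0, 1}} n M" using assms by (auto simp: embeddings_def inj_on_def)
  moreover have "cert {0, 1} {{0, 1}} (?f, ?g) \<subseteq> I" using assms by (auto simp: cert_def incidences_def)
  ultimately show ?thesis unfolding closed_tuple_def by (intro bexI[of _ "(?f, ?g)"]) simp_all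
qed

lemma prob_spoilt:
  assumes q: "quality I" and W: "W \<subseteq> {..<n}" "card W = w"
  shows "measure_pmf.prob blk {\<beta>. spoilt W \<beta> I}
    \<le> (1 + 2 ^ (2 ^ t) * 2 ^ t * 2 ^ t * 2 ^ t) * (\<eta> * (real w * p) ^ s)"
proof -
  have IX: "I \<subseteq> {..<n} \<times> {..<M}" using q by (simp add: quality_def small_blocks_def)
  let ?u = "\<eta> * (real w * p) ^ s"
  have u0: "0 \<le> ?u" using eta p by simp
  let ?E1 = "{\<beta>. \<exists>\<rho> S. \<rho> \<in> {0, 1} \<rightarrow>\<^sub>E W \<and> closed_tuple {0, 1} {{0, 1}} {0, 1} n M I \<rho> \<and> inj_on \<rho> {0, 1} \<and>
      S \<subseteq> W \<and> card S = s \<and> \<rho> ` {0, 1} \<subseteq> S \<and> (\<forall>x\<in>S. \<beta> x \<noteq> 0)}"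
  let ?E2 = "\<Union>\<tau>\<in>types. \<Union>R\<in>Pow {..<t}. spoilt_by W I \<tau> R"
  have "({0, 1}, {{0, 1}}, {0, 1}) \<in> closing_patterns" unfolding closing_patterns_def by simp
  then have p1: "measure_pmf.prob blk ?E1 \<le> ?u" using s3 by (intro prob_closed_roots[OF q W]) simp_all
  have inner: "measure_pmf.prob blk (\<Union>R\<in>Pow {..<t}. spoilt_by W I \<tau> R) \<le> 2 ^ t * ?u" if "\<tau> \<in> types" for \<tau>
  proof (rule prob_union_le)
    show "measure_pmf.prob blk (spoilt_by W I \<tau> R) \<le> ?u" for R
      using that by (cases \<tau>) (simp only: prob_spoilt_by[OF q W])
  qed (use u0 in \<open>simp_all add: card_Pow\<close>)
  have p2: "measure_pmf.prob blk ?E2 \<le> (2 ^ (2 ^ t) * 2 ^ t * 2 ^ t) * (2 ^ t * ?u)"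
    by (rule prob_union_le[OF finite_types inner card_types]) (use u0 in simp_all)
  have "{\<beta>. spoilt W \<beta> I} \<subseteq> ?E1 \<union> ?E2"
  proof
    fix \<beta> assume "\<beta> \<in> {\<beta>. spoilt W \<beta> I}"
    then obtain S where S: "S \<subseteq> W" "card S = s" "\<forall>x\<in>S. \<beta> x \<noteq> 0" and sp: "spoils S \<beta> I"
      unfolding spoilt_def by auto
    show "\<beta> \<in> ?E1 \<union> ?E2"
      using sp[unfolded spoils_def]
    proof (elim disjE bexE exE conjE)
      fix x y j assume xy: "x \<in> S" "y \<in> S" "x \<noteq> y" "(x, j) \<in> I" "(y, j) \<in> I"
      let ?f = "\<lambda>i\<in>{0, 1 :: nat}. if i = 0 then x else y"
      have "?f \<in> {0, 1} \<rightarrow>\<^sub>E W" "inj_on ?f {0, 1}" "?f ` {0, 1} \<subseteq> S" using xy S by (auto simp: inj_on_def)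
      then have "\<beta> \<in> ?E1" using closed_pair[OF IX xy(4,5,3)] S by blast
      then show ?thesis ..
    next
      fix LL P l0 fg assume h: "(LL, P, l0) \<in> types" "fg \<in> embeddings P (other_lines LL P l0) n M"
        "cert P (other_lines LL P l0) fg \<subseteq> I" "\<forall>i\<in>l0 \<inter> P. \<beta> (fst fg i) \<noteq> 0" "2 \<le> card {i\<in>l0 \<inter> P. fst fg i \<in> S}"
      let ?R = "{i\<in>l0 \<inter> P. fst fg i \<in> S}"
      have a: "?R \<subseteq> l0 \<inter> P" "fst fg ` ?R \<subseteq> S" "fst fg ` (l0 \<inter> P - ?R) \<inter> S = {}" by auto
      have "\<beta> \<in> spoilt_by W I (LL, P, l0) ?R"
        unfolding spoilt_by_def prod.case
        by (intro CollectI conjI a(1) h(5) exI[of _ fg] exI[of _ S] h(2,3,4) S a(2,3))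
      moreover have "?R \<in> Pow {..<t}" using typesD(2)[OF h(1)] by auto
      ultimately have "\<beta> \<in> ?E2" using h(1) by (intro UN_I[of "(LL, P, l0)"] UN_I[of ?R])
      then show ?thesis ..
    qed
  qed
  then have "measure_pmf.prob blk {\<beta>. spoilt W \<beta> I} \<le> measure_pmf.prob blk (?E1 \<union> ?E2)"
    by (intro measure_pmf.finite_measure_mono) auto
  also have "\<dots> \<le> measure_pmf.prob blk ?E1 + measure_pmf.prob blk ?E2" by (rule measure_Un_le) auto
  also have "\<dots> \<le> ?u + (2 ^ (2 ^ t) * 2 ^ t * 2 ^ t) * (2 ^ t * ?u)" using p1 p2 by linarith
  also have "\<dots> = (1 + 2 ^ (2 ^ t) * 2 ^ t * 2 ^ t * 2 ^ t) * ?u" by (simp only: distrib_right mult_1 mult.assoc)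
  finally show ?thesis .
qed

\<comment> \<open>Every large vertex set contains an unspoilt rainbow set\<close>
end

text \<open>\<open>eta_small\<close> makes a spoilt block rare compared with a hit one, with room
  for the factor exp 1 of the exponential tilt. \<open>un5\<close> is the union bound over all sets
  W.\<close>

locale block_construction = construction +
  assumes sw: "s \<le> w" and wp: "real w * p \<le> 1 / 2"
    and eta_small: "exp 1 * (1 + 2 ^ (2 ^ t) * 2 ^ t * 2 ^ t * 2 ^ t) * \<eta> * (real s)\<^sup>2 ^ s \<le> (1 - exp (- (1 / 2 ^ (2 ^ t)))) / 4"
    and un5: "real n ^ w * exp (- ((1 - exp (- (1 / 2 ^ (2 ^ t)))) / 8 * (real w * p / (real s)\<^sup>2) ^ s) * real M) \<le> 1 / 4"
begin

definition rainbow :: "nat set \<Rightarrow> (nat \<Rightarrow> nat) \<Rightarrow> bool" where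
  "rainbow S \<beta> \<longleftrightarrow> card S = s \<and> \<beta> ` S \<subseteq> {1..s} \<and> inj_on \<beta> S"

definition good :: "(nat \<Rightarrow> nat \<Rightarrow> nat) \<Rightarrow> nat \<Rightarrow> nat set \<Rightarrow> bool" where
  "good \<omega> j S \<longleftrightarrow> rainbow S (\<omega> j) \<and> \<not> spoils S (\<omega> j) (block_incidence n M (- {j}) \<omega>)"

text \<open>If W contains no good set, every block that has a rainbow set in W is spoilt there by
  the other blocks. This is the event of \<open>prob_all_hits_spoilt\<close>, with quality of the
  red blocks as the condition G.\<close>

lemma prob_no_good:
  assumes W: "W \<subseteq> {..<n}" "card W = w"
  shows "measure_pmf.prob (blocks_pmf n M p s) {\<omega>. quality (block_incidence n M UNIV \<omega>) \<and> (\<forall>j<M. \<forall>S\<subseteq>W. \<not> good \<omega> j S)}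
    \<le> exp (- ((1 - exp (- (1 / 2 ^ (2 ^ t)))) / 8 * (real w * p / (real s)\<^sup>2) ^ s) * real M)"
proof -
  define c where "c = (1 / 2 ^ (2 ^ t) :: real)"
  define h where "h = 1 / 2 * (real w * p / (real s)\<^sup>2) ^ s"
  define \<gamma> where "\<gamma> = (1 - exp (- c)) * h / 2"
  let ?N = "1 + 2 ^ (2 ^ t) * 2 ^ t * 2 ^ t * 2 ^ t :: real"
  let ?F = "{\<omega>. quality (block_incidence n M UNIV \<omega>) \<and> (\<forall>j<M. \<forall>S\<subseteq>W. \<not> good \<omega> j S)}"
  let ?H = "\<lambda>\<beta>. \<exists>S\<subseteq>W. card S = s \<and> \<beta> ` S \<subseteq> {1..s} \<and> inj_on \<beta> S"
  have c0: "0 \<le> c" unfolding c_def by simp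
  have ec: "0 \<le> 1 - exp (- c)" "1 - exp (- c) \<le> 1" using c0 by simp_all
  have h0: "0 \<le> h" unfolding h_def using p by simp
  have hH: "h \<le> measure_pmf.prob blk {\<beta>. ?H \<beta>}"
    unfolding h_def using p s3 by (intro prob_rainbow_lower W sw wp) auto
  then have h1: "h \<le> 1" using measure_pmf.prob_le_1 order_trans by blast
  have small: "exp 1 * (?N * (\<eta> * (real w * p) ^ s)) \<le> (1 - exp (- c)) * h / 2"
  proof -
    have s0: "(0::real) < (real s)\<^sup>2 ^ s" using s3 by simp
    have "exp 1 * (?N * (\<eta> * (real w * p) ^ s)) = (exp 1 * ?N * \<eta> * (real s)\<^sup>2 ^ s) * ((real w * p) ^ s / (real s)\<^sup>2 ^ s)"
    proof -
      have "(real s)\<^sup>2 ^ s * ((real w * p) ^ s / (real s)\<^sup>2 ^ s) = (real w * p) ^ s" using s3 by auto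
      then show ?thesis by (simp only: mult.assoc)
    qed
    also have "\<dots> \<le> ((1 - exp (- c)) / 4) * ((real w * p) ^ s / (real s)\<^sup>2 ^ s)"
      using p eta_small unfolding c_def by (intro mult_right_mono) auto
    also have "\<dots> = (1 - exp (- c)) * h / 2" unfolding h_def by (simp add: power_divide)
    finally show ?thesis .
  qed
  have "measure_pmf.prob (blocks_pmf n M p s) ?F \<le> (1 - \<gamma> / 2) ^ M"
    unfolding blocks_pmf_def
  proof (rule prob_all_hits_spoilt[where SP = "\<lambda>Q \<omega> \<beta>. spoilt W \<beta> (block_incidence n M Q \<omega>)"
        and G = "\<lambda>Q \<omega>. quality (block_incidence n M Q \<omega>)" and H = ?H and m = "2 ^ t"])
    show "0 \<le> \<gamma>" unfolding \<gamma>_def using ec h0 by simp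
    have "(1 - exp (- c)) * h \<le> 1 * 1" using ec h0 h1 by (intro mult_mono) auto
    then show "\<gamma> \<le> 1" unfolding \<gamma>_def by simp
    fix Q :: "nat set" and \<omega> \<omega>' assume "\<forall>j\<in>Q. \<omega> j = (\<omega>' j :: nat \<Rightarrow> nat)"
    then have "block_incidence n M Q \<omega> = block_incidence n M Q \<omega>'" unfolding block_incidence_def by auto
    then show "(\<lambda>\<beta>. spoilt W \<beta> (block_incidence n M Q \<omega>)) = (\<lambda>\<beta>. spoilt W \<beta> (block_incidence n M Q \<omega>'))"
      "quality (block_incidence n M Q \<omega>) = quality (block_incidence n M Q \<omega>')" by simp_all
  next
    fix Q \<omega> assume qu: "quality (block_incidence n M Q \<omega>)"
    have "(\<integral>\<^sup>+\<beta>. ennreal (exp (of_bool (spoilt W \<beta> (block_incidence n M Q \<omega>)) - of_bool (?H \<beta>) * c)) \<partial>blk)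
        \<le> ennreal (1 - (1 - exp (- c)) * h / 2)"
      by (rule nn_integral_exp_spoilt[OF c0 hH prob_spoilt[OF qu W] small])
    then show "(\<integral>\<^sup>+\<beta>. ennreal (exp (of_bool (spoilt W \<beta> (block_incidence n M Q \<omega>)) - of_bool (?H \<beta>) / 2 ^ 2 ^ t)) \<partial>blk)
        \<le> ennreal (1 - \<gamma>)"
      by (simp add: c_def \<gamma>_def)
  next
    fix \<omega> Q assume "\<omega> \<in> ?F"
    then have "quality (block_incidence n M UNIV \<omega>)" by simp
    then show "quality (block_incidence n M Q \<omega>)" by (rule quality_mono) (auto simp: block_incidence_def)
  next
    fix \<omega> j assume F: "\<omega> \<in> ?F" and j: "j < M" and "?H (\<omega> j)"
    then obtain S where S: "S \<subseteq> W" "card S = s" "\<omega> j ` S \<subseteq> {1..s}" "inj_on (\<omega> j) S" by auto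
    have supp: "\<forall>x\<in>S. \<omega> j x \<noteq> 0" using S(3) by force
    let ?I = "block_incidence n M (- {j}) \<omega>"
    have sp: "spoils S (\<omega> j) ?I" using F j S unfolding good_def rainbow_def by blast
    have I: "?I \<subseteq> {..<n} \<times> ({..<M} - {j})" unfolding block_incidence_def by auto
    obtain D where D: "D \<subseteq> {..<M} - {j}" "card D \<le> 2 ^ t" "spoils S (\<omega> j) {(x, i)\<in>?I. i \<in> D}"
      using spoils_local[OF sp I] by (elim exE conjE)
    have "spoilt W (\<omega> j) (block_incidence n M Q \<omega>)" if "D \<subseteq> Q" for Q
    proof -
      have "{(x, i)\<in>?I. i \<in> D} \<subseteq> block_incidence n M Q \<omega>" using that unfolding block_incidence_def by auto
      then have "spoils S (\<omega> j) (block_incidence n M Q \<omega>)" by (rule spoils_mono[OF D(3)])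
      then show ?thesis unfolding spoilt_def using S(1,2) supp by blast
    qed
    then show "\<exists>D\<subseteq>{..<M} - {j}. card D \<le> 2 ^ t \<and> (\<forall>Q. D \<subseteq> Q \<longrightarrow> Q \<subseteq> {..<M} - {j} \<longrightarrow> spoilt W (\<omega> j) (block_incidence n M Q \<omega>))"
      using D(1,2) by blast
  qed
  also have "\<dots> \<le> exp (- (\<gamma> / 2)) ^ M"
  proof (rule power_mono)
    show "1 - \<gamma> / 2 \<le> exp (- (\<gamma> / 2))" using exp_ge_add_one_self[of "- (\<gamma> / 2)"] by simp
    have "(1 - exp (- c)) * h \<le> 1 * 1" using ec h0 h1 by (intro mult_mono) auto
    then show "0 \<le> 1 - \<gamma> / 2" unfolding \<gamma>_def by simp
  qed
  also have "\<dots> = exp (- (\<gamma> / 2) * real M)" by (simp add: exp_of_nat_mult[symmetric] mult.commute)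
  also have "\<gamma> / 2 = (1 - exp (- (1 / 2 ^ (2 ^ t)))) / 8 * (real w * p / (real s)\<^sup>2) ^ s"
    unfolding \<gamma>_def h_def c_def by simp
  finally show ?thesis .
qed

lemma good_blocks_exist:
  "\<exists>\<omega>. \<forall>W\<subseteq>{..<n}. card W = w \<longrightarrow> (\<exists>j<M. \<exists>S\<subseteq>W. good \<omega> j S)"
proof -
  interpret rc: random_construction n M s t p \<Lambda> w k h \<theta> g K b \<eta> "blocks_pmf n M p s" "block_incidence n M UNIV"
  proof
    show "0 \<le> p" using p by simp
    show "finite ({..<n} \<times> {..<M})" by simp
    show "measure_pmf.prob (blocks_pmf n M p s) {\<omega>. R \<subseteq> block_incidence n M UNIV \<omega>} \<le> p ^ card R"
      if "R \<subseteq> {..<n} \<times> {..<M}" for R using prob_block_incidence[OF that, of p s] p s3 by simp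
    show "block_incidence n M UNIV \<omega> \<subseteq> {..<n} \<times> {..<M}" for \<omega> by (auto simp: block_incidence_def)
  qed
  let ?pr = "measure_pmf.prob (blocks_pmf n M p s)"
  let ?Q = "{\<omega>. \<not> quality (block_incidence n M UNIV \<omega>)}"
  let ?W = "{W. W \<subseteq> {..<n} \<and> card W = w}"
  let ?F = "\<lambda>W. {\<omega>. quality (block_incidence n M UNIV \<omega>) \<and> (\<forall>j<M. \<forall>S\<subseteq>W. \<not> good \<omega> j S)}"
  have q: "?pr ?Q \<le> 1 / 4" by (rule rc.prob_not_quality)
  have cW: "real (card ?W) \<le> real n ^ w"
  proof -
    have "card ?W \<le> n ^ w" by (cases "w \<le> n") (simp_all add: n_subsets binomial_le_pow binomial_eq_0)
    then have "real (card ?W) \<le> real (n ^ w)" by (rule of_nat_mono)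
    then show ?thesis by simp
  qed
  have "?pr (\<Union>W\<in>?W. ?F W) \<le> real n ^ w * exp (- ((1 - exp (- (1 / 2 ^ (2 ^ t)))) / 8 * (real w * p / (real s)\<^sup>2) ^ s) * real M)"
    by (rule prob_union_le[OF _ _ cW]) (use prob_no_good in auto)
  then have "?pr (\<Union>W\<in>?W. ?F W) \<le> 1 / 4" using un5 by linarith
  then have "?pr (?Q \<union> (\<Union>W\<in>?W. ?F W)) < 1"
    using q measure_Un_le[of ?Q "measure_pmf (blocks_pmf n M p s)" "\<Union>W\<in>?W. ?F W"] by simp
  then have "?Q \<union> (\<Union>W\<in>?W. ?F W) \<noteq> UNIV" by (intro notI) simp
  then obtain \<omega> where w: "\<omega> \<notin> ?Q" "\<omega> \<notin> (\<Union>W\<in>?W. ?F W)" by blast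
  have "\<exists>j<M. \<exists>S\<subseteq>W. good \<omega> j S" if "W \<subseteq> {..<n}" "card W = w" for W
  proof -
    have "\<omega> \<notin> ?F W" using w(2) that by blast
    then show ?thesis using w(1) by blast
  qed
  then show ?thesis by blast
qed

end

section \<open>The graph\<close>

text \<open>The right-hand side is \<Lambda>^2 times the weight of a pair. So the whole linear space
  remains rarer than a pair even when a factor \<Lambda> is charged for each point.\<close>

locale graph_construction = block_construction +
  assumes key: "linear_space {..<t} s LL \<Longrightarrow>
    \<Lambda> ^ t * pattern_weight n M p LL {..<t} < \<Lambda>\<^sup>2 * (real n ^ 2 * (real M * p\<^sup>2))"
begin

definition edges :: "(nat \<Rightarrow> nat \<Rightarrow> nat) \<Rightarrow> nat set set" where
  "edges \<omega> = {e. card e = 2 \<and> (\<exists>j<M. \<exists>S. S \<subseteq> {..<n} \<and> good \<omega> j S \<and> e \<subseteq> S)}"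

lemma simple_edges: "simple_graph {..<n} (edges \<omega>)"
proof -
  have "e \<in> [{..<n}]\<^bsup>2\<^esup>" if "e \<in> edges \<omega>" for e
  proof -
    have "card e = 2" "e \<subseteq> {..<n}" using that unfolding edges_def by auto
    then show ?thesis using finite_subset[of e "{..<n}"] by (simp add: nsets_def)
  qed
  then show ?thesis unfolding simple_graph_def by auto
qed

lemma pair_weight:
  assumes ls: "linear_space {..<t} s LL" and ab: "a < t" "a2 < t" "a \<noteq> a2"
  shows "pw LL {a, a2} = real n ^ 2 * (real M * p\<^sup>2)"
proof -
  have fL: "finite LL" using linear_space_finite[OF ls] by simp
  obtain l where l: "l \<in> LL" "a \<in> l" "a2 \<in> l"
    by (rule linear_space_line[OF ls, of a a2]) (use ab in simp_all)
  have lw: "lw (card (l' \<inter> {a, a2})) = 1" if "l' \<in> LL - {l}" for l'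
  proof -
    have "card (l' \<inter> l) \<le> 1" using linear_space_inter[OF ls _ _ l(1), of l'] that by simp
    moreover have "card (l' \<inter> {a, a2}) \<le> card (l' \<inter> l)"
    proof (rule card_mono)
      have "l \<subseteq> {..<t}" using ls l(1) unfolding linear_space_def by simp
      then show "finite (l' \<inter> l)" using finite_subset by blast
    qed (use l in auto)
    ultimately show ?thesis by (simp add: line_weight_def)
  qed
  have "l \<inter> {a, a2} = {a, a2}" using l by auto
  then have "lw (card (l \<inter> {a, a2})) = real M * p\<^sup>2" using ab by (simp add: line_weight_def power2_eq_square)
  moreover have "(\<Prod>l'\<in>LL - {l}. lw (card (l' \<inter> {a, a2}))) = 1" using lw by (intro prod.neutral) blast
  ultimately have "(\<Prod>l'\<in>LL. lw (card (l' \<inter> {a, a2}))) = real M * p\<^sup>2"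
    using prod.remove[OF fL l(1), of "\<lambda>l'. lw (card (l' \<inter> {a, a2}))"] by simp
  then show ?thesis unfolding pattern_weight_def using ab by (simp add: power2_eq_square)
qed

text \<open>Minimise \<Lambda>^|P| times the weight of P over all P with at least two points.
  Against a proper subset S the minimiser wins by at least one factor \<Lambda>, which is
  criticality; it is not a pair, because by \<open>key\<close> the full point set already has a
  smaller value than any pair.\<close>

lemma critical_subset_exists:
  assumes ls: "linear_space {..<t} s LL"
  obtains P where "P \<subseteq> {..<t}" "3 \<le> card P"
    "\<forall>S. S \<subset> P \<longrightarrow> 2 \<le> card S \<longrightarrow> \<Lambda> * pw LL P \<le> pw LL S"
proof -
  let ?X = "{P. P \<subseteq> {..<t} \<and> 2 \<le> card P}" and ?v = "\<lambda>P. \<Lambda> ^ card P * pw LL P"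
  have fX: "finite ?X" by (rule finite_subset[of _ "Pow {..<t}"]) auto
  have tX: "{..<t} \<in> ?X" using t2 by simp
  then have "?X \<noteq> {}" by blast
  then obtain P where PX: "P \<in> ?X" and Pm: "?v P = Min (?v ` ?X)"
    using Min_in[of "?v ` ?X"] fX by (metis (no_types, lifting) finite_imageI image_iff image_is_empty)
  have min: "?v P \<le> ?v S" if "S \<in> ?X" for S unfolding Pm using fX that by (intro Min_le) auto
  have P: "P \<subseteq> {..<t}" "2 \<le> card P" using PX by auto
  have fP: "finite P" using P(1) finite_subset by blast
  have lt: "?v P < \<Lambda>\<^sup>2 * (real n ^ 2 * (real M * p\<^sup>2))"
    using min[OF tX] key[OF ls] by simp
  have "card P \<noteq> 2"
  proof
    assume c: "card P = 2"
    then obtain a b where ab: "P = {a, b}" "a \<noteq> b" unfolding card_2_iff by auto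
    then have "pw LL P = real n ^ 2 * (real M * p\<^sup>2)" using pair_weight[OF ls, of a b] P(1) by simp
    then show False using lt c by simp
  qed
  then have c3: "3 \<le> card P" using P(2) by linarith
  have "\<Lambda> * pw LL P \<le> pw LL S" if S: "S \<subset> P" "2 \<le> card S" for S
  proof -
    have cS: "card S < card P" using S(1) fP by (rule psubset_card_mono[rotated])
    have L0: "0 < \<Lambda> ^ card S" using L1 by simp
    have "\<Lambda> ^ card S * (\<Lambda> * pw LL P) = \<Lambda> ^ (card S + 1) * pw LL P" by simp
    also have "\<dots> \<le> \<Lambda> ^ card P * pw LL P"
      using cS L1 pw_pos[of LL P] by (intro mult_right_mono power_increasing) auto
    also have "\<dots> \<le> \<Lambda> ^ card S * pw LL S" using min[of S] S P by auto
    finally show ?thesis using L0 by simp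
  qed
  then show ?thesis using that P(1) c3 by blast
qed

text \<open>The edge comes from an unspoilt set S of some block j, and another block through both
  ends would spoil S. So the block of an edge is unique.\<close>

lemma edge_block:
  assumes c: "[T]\<^bsup>2\<^esup> \<subseteq> edges \<omega>" and xy: "x \<in> T" "y \<in> T" "x \<noteq> y"
  obtains j S where "j < M" "S \<subseteq> {..<n}" "good \<omega> j S" "x \<in> S" "y \<in> S" "\<omega> j x \<noteq> 0" "\<omega> j y \<noteq> 0" "\<omega> j x \<noteq> \<omega> j y"
    "\<forall>i<M. \<omega> i x \<noteq> 0 \<longrightarrow> \<omega> i y \<noteq> 0 \<longrightarrow> i = j"
proof -
  have "{x, y} \<in> [T]\<^bsup>2\<^esup>" using xy by (simp add: nsets_def)
  then have "{x, y} \<in> edges \<omega>" using c by blast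
  then obtain j S where j: "j < M" "S \<subseteq> {..<n}" "good \<omega> j S" "{x, y} \<subseteq> S" unfolding edges_def by auto
  have S: "x \<in> S" "y \<in> S" using j(4) by auto
  have r: "\<omega> j ` S \<subseteq> {1..s}" "inj_on (\<omega> j) S" and ns: "\<not> spoils S (\<omega> j) (block_incidence n M (- {j}) \<omega>)"
    using j(3) unfolding good_def rainbow_def by auto
  have lab: "\<omega> j x \<in> {1..s}" "\<omega> j y \<in> {1..s}" using r(1) S by auto
  have "i = j" if i: "i < M" "\<omega> i x \<noteq> 0" "\<omega> i y \<noteq> 0" for i
  proof (rule ccontr)
    assume ij: "i \<noteq> j"
    have "x < n" "y < n" using S j(2) by auto
    then have "(x, i) \<in> block_incidence n M (- {j}) \<omega>" "(y, i) \<in> block_incidence n M (- {j}) \<omega>"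
      using i ij by (simp_all add: block_incidence_def)
    then have "spoils S (\<omega> j) (block_incidence n M (- {j}) \<omega>)" unfolding spoils_def using S xy(3) by blast
    then show False using ns by simp
  qed
  moreover have "\<omega> j x \<noteq> \<omega> j y" using r(2) S xy(3) unfolding inj_on_def by blast
  ultimately show ?thesis using that[OF j(1,2,3) S] lab by simp
qed

text \<open>The blocks trace a linear space on a t-clique. Take a critical subset P of it and two
  points of P: they lie in an unspoilt s-set S of the block j through them. The blocks of the other
  lines form a certificate for the type with \<open>l0\<close> the trace of j, and at least two
  roots are in S, so S is spoilt after all.\<close>

lemma K_free_edges: "K_free t {..<n} (edges \<omega>)"
  unfolding K_free_def
proof
  assume "\<exists>T\<in>[{..<n}]\<^bsup>t\<^esup>. [T]\<^bsup>2\<^esup> \<subseteq> edges \<omega>"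
  then obtain T where T: "T \<subseteq> {..<n}" "finite T" "card T = t" and cl: "[T]\<^bsup>2\<^esup> \<subseteq> edges \<omega>"
    unfolding nsets_def by auto
  obtain \<phi> where \<phi>: "bij_betw \<phi> {..<t} T"
    using finite_same_card_bij[of "{..<t}" T] T by auto
  have \<phi>T: "\<phi> i \<in> T" if "i < t" for i using bij_betw_apply[OF \<phi>] that by simp
  have \<phi>inj: "\<phi> i \<noteq> \<phi> i'" if "i < t" "i' < t" "i \<noteq> i'" for i i'
    using bij_betw_imp_inj_on[OF \<phi>] that unfolding inj_on_def by auto
  define tr where "tr j = {i. i < t \<and> \<omega> j (\<phi> i) \<noteq> 0}" for j
  define J where "J = {j. j < M \<and> 2 \<le> card (tr j)}"
  have ftr: "finite (tr j)" for j by (simp add: tr_def)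
  have block: "\<exists>j S. j < M \<and> S \<subseteq> {..<n} \<and> good \<omega> j S \<and> \<phi> a \<in> S \<and> \<phi> b \<in> S \<and> a \<in> tr j \<and> b \<in> tr j \<and>
      \<omega> j (\<phi> a) \<noteq> \<omega> j (\<phi> b) \<and> (\<forall>i<M. a \<in> tr i \<longrightarrow> b \<in> tr i \<longrightarrow> i = j)"
    if ab: "a < t" "b < t" "a \<noteq> b" for a b
  proof -
    have tr_iff: "a \<in> tr i \<longleftrightarrow> \<omega> i (\<phi> a) \<noteq> 0" "b \<in> tr i \<longleftrightarrow> \<omega> i (\<phi> b) \<noteq> 0" for i using ab by (simp_all add: tr_def)
    obtain j S where "j < M" "S \<subseteq> {..<n}" "good \<omega> j S" "\<phi> a \<in> S" "\<phi> b \<in> S" "\<omega> j (\<phi> a) \<noteq> 0" "\<omega> j (\<phi> b) \<noteq> 0"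
      "\<omega> j (\<phi> a) \<noteq> \<omega> j (\<phi> b)" "\<forall>i<M. \<omega> i (\<phi> a) \<noteq> 0 \<longrightarrow> \<omega> i (\<phi> b) \<noteq> 0 \<longrightarrow> i = j"
      using edge_block[OF cl \<phi>T[OF ab(1)] \<phi>T[OF ab(2)] \<phi>inj[OF ab]] .
    then show ?thesis unfolding tr_iff by (intro exI[of _ j] exI[of _ S] conjI)
  qed
  have memJ: "j \<in> J" if "j < M" "a \<in> tr j" "b \<in> tr j" "a \<noteq> b" for j a b
  proof -
    have "card {a, b} \<le> card (tr j)" using that ftr by (intro card_mono) auto
    then show ?thesis using that unfolding J_def by simp
  qed
  have two: "\<exists>a b. a \<in> tr j \<and> b \<in> tr j \<and> a \<noteq> b" if "j \<in> J" for j
  proof -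
    have "2 \<le> card (tr j)" using that unfolding J_def by simp
    then obtain B where "B \<subseteq> tr j" "card B = 2" by (rule obtain_subset_with_card_n)
    then show ?thesis unfolding card_2_iff by auto
  qed
  \<comment> \<open>Different blocks have different traces, so each line can be sent back to its
    block; this gives the injective line map of the embedding.\<close>
  have injtr: "inj_on tr J"
  proof (rule inj_onI)
    fix j j' assume jj: "j \<in> J" "j' \<in> J" "tr j = tr j'"
    obtain a b where ab: "a \<in> tr j" "b \<in> tr j" "a \<noteq> b" using two[OF jj(1)] by blast
    have t': "a < t" "b < t" using ab unfolding tr_def by auto
    obtain i where i: "\<forall>i'<M. a \<in> tr i' \<longrightarrow> b \<in> tr i' \<longrightarrow> i' = i" using block[OF t' ab(3)] by blast
    have h: "i' = i" if "i' \<in> J" "a \<in> tr i'" "b \<in> tr i'" for i'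
      by (rule i[rule_format, OF _ that(2,3)]) (use that(1) in \<open>simp add: J_def\<close>)
    have "j = i" using h[OF jj(1)] ab by simp
    moreover have "j' = i" using h[OF jj(2)] ab jj(3) by simp
    ultimately show "j = j'" by simp
  qed
  \<comment> \<open>This is where the labels matter: two points of one trace span an edge of that
    very block, so their labels are different elements of {1..s}.\<close>
  have small: "card (tr j) \<le> s" if jJ: "j \<in> J" for j
  proof -
    have jM: "j < M" using jJ unfolding J_def by simp
    have pr: "\<omega> j (\<phi> a) \<noteq> \<omega> j (\<phi> b) \<and> \<omega> j (\<phi> a) \<in> {1..s}" if ab: "a \<in> tr j" "b \<in> tr j" "a \<noteq> b" for a b
    proof -
      have t': "a < t" "b < t" using ab unfolding tr_def by auto
      obtain i S where i: "good \<omega> i S" "\<phi> a \<in> S" "\<omega> i (\<phi> a) \<noteq> \<omega> i (\<phi> b)" "\<forall>i'<M. a \<in> tr i' \<longrightarrow> b \<in> tr i' \<longrightarrow> i' = i"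
        using block[OF t' ab(3)] by blast
      have "i = j" using i(4)[rule_format, OF jM ab(1,2)] by simp
      moreover have "\<omega> i (\<phi> a) \<in> {1..s}" using i(1,2) unfolding good_def rainbow_def by auto
      ultimately show ?thesis using i(3) by simp
    qed
    have "inj_on (\<lambda>a. \<omega> j (\<phi> a)) (tr j)" by (rule inj_onI) (use pr in blast)
    moreover have "(\<lambda>a. \<omega> j (\<phi> a)) ` tr j \<subseteq> {1..s}"
    proof (rule image_subsetI)
      fix a assume a: "a \<in> tr j"
      obtain b c where bc: "b \<in> tr j" "c \<in> tr j" "b \<noteq> c" using two[OF jJ] by blast
      show "\<omega> j (\<phi> a) \<in> {1..s}" using pr[of a b] pr[of a c] a bc by (cases "a = b") simp_all
    qed
    ultimately have "card (tr j) \<le> card {1..s}" by (rule card_inj_on_le) simp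
    then show ?thesis by simp
  qed
  define LL where "LL = tr ` J"
  have ls: "linear_space {..<t} s LL"
    unfolding linear_space_def
  proof (intro conjI ballI impI)
    fix l assume "l \<in> LL"
    then obtain j where j: "j \<in> J" "l = tr j" unfolding LL_def by blast
    show "l \<subseteq> {..<t}" unfolding j(2) tr_def by auto
    show "2 \<le> card l" using j unfolding J_def by simp
    show "card l \<le> s" using small[OF j(1)] j(2) by simp
  next
    fix a b assume "a \<in> {..<t}" "b \<in> {..<t}" and ab: "a \<noteq> b"
    then have t': "a < t" "b < t" by auto
    obtain j where j: "j < M" "a \<in> tr j" "b \<in> tr j" "\<forall>i<M. a \<in> tr i \<longrightarrow> b \<in> tr i \<longrightarrow> i = j"
      using block[OF t' ab] by blast
    show "\<exists>!l. l \<in> LL \<and> a \<in> l \<and> b \<in> l"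
    proof (rule ex1I[of _ "tr j"])
      show "tr j \<in> LL \<and> a \<in> tr j \<and> b \<in> tr j" using memJ[OF j(1,2,3) ab] j(2,3) unfolding LL_def by simp
      fix l assume l: "l \<in> LL \<and> a \<in> l \<and> b \<in> l"
      then obtain i where i: "i \<in> J" "l = tr i" unfolding LL_def by blast
      have "i = j" by (rule j(4)[rule_format]) (use l i in \<open>simp_all add: J_def\<close>)
      then show "l = tr j" using i by simp
    qed
  qed
  obtain P where P: "P \<subseteq> {..<t}" "3 \<le> card P" "\<forall>S. S \<subset> P \<longrightarrow> 2 \<le> card S \<longrightarrow> \<Lambda> * pw LL P \<le> pw LL S"
    using critical_subset_exists[OF ls] .
  obtain B where "B \<subseteq> P" "card B = 2" using obtain_subset_with_card_n[of 2 P] P(2) by auto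
  then obtain a b where ab: "a \<in> P" "b \<in> P" "a \<noteq> b" unfolding card_2_iff by auto
  have t': "a < t" "b < t" using ab P(1) by auto
  obtain j S where j: "j < M" "S \<subseteq> {..<n}" "good \<omega> j S" "\<phi> a \<in> S" "\<phi> b \<in> S" "a \<in> tr j" "b \<in> tr j"
    using block[OF t' ab(3)] by blast
  have jJ: "j \<in> J" using memJ[OF j(1,6,7) ab(3)] .
  let ?l = "tr j"
  have fP: "finite P" using P(1) finite_subset by blast
  have ab2: "2 \<le> card ({i\<in>?l \<inter> P. \<phi> i \<in> S})"
  proof -
    have "card {a, b} \<le> card {i\<in>?l \<inter> P. \<phi> i \<in> S}" using ab j fP by (intro card_mono) auto
    then show ?thesis using ab by simp
  qed
  also have "\<dots> \<le> card (?l \<inter> P)" using fP by (intro card_mono) auto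
  finally have lP: "2 \<le> card (?l \<inter> P)" .
  have ty: "(LL, P, ?l) \<in> types"
    unfolding critical_types_def using ls P lP jJ unfolding LL_def by simp
  let ?O = "other_lines LL P ?l"
  let ?f = "restrict \<phi> P" and ?g = "restrict (the_inv_into J tr) ?O"
  have O: "l \<in> tr ` J" "l \<noteq> ?l" if "l \<in> ?O" for l using that unfolding other_lines_def LL_def by auto
  have g: "the_inv_into J tr l \<in> J" "tr (the_inv_into J tr l) = l" if "l \<in> ?O" for l
    using the_inv_into_into[OF injtr O(1)[OF that]] f_the_inv_into_f[OF injtr O(1)[OF that]] by auto
  have emb: "(?f, ?g) \<in> embeddings P ?O n M"
  proof -
    have "?f \<in> P \<rightarrow>\<^sub>E {..<n}" using \<phi>T P(1) T(1) by auto
    moreover have "?g \<in> ?O \<rightarrow>\<^sub>E {..<M}" using g(1) unfolding J_def by auto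
    moreover have "inj_on ?f P"
    proof (rule inj_onI)
      fix i i' assume ii: "i \<in> P" "i' \<in> P" "?f i = ?f i'"
      then show "i = i'" using \<phi>inj[of i i'] P(1) by (cases "i = i'") auto
    qed
    moreover have "inj_on ?g ?O"
    proof (rule inj_onI)
      fix l l' assume l: "l \<in> ?O" "l' \<in> ?O" "?g l = ?g l'"
      then have "tr (the_inv_into J tr l) = tr (the_inv_into J tr l')" by simp
      then show "l = l'" using g(2) l by simp
    qed
    ultimately show ?thesis unfolding embeddings_def by simp
  qed
  moreover have "cert P ?O (?f, ?g) \<subseteq> block_incidence n M (- {j}) \<omega>"
  proof
    fix z assume "z \<in> cert P ?O (?f, ?g)"
    then obtain i l where il: "l \<in> ?O" "i \<in> l" "i \<in> P" "z = (\<phi> i, the_inv_into J tr l)"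
      unfolding cert_def incidences_def by auto
    let ?j = "the_inv_into J tr l"
    have "?j \<noteq> j" using g(2)[OF il(1)] O(2)[OF il(1)] by auto
    moreover have "?j < M" using g(1)[OF il(1)] unfolding J_def by simp
    moreover have "i \<in> tr ?j" using g(2)[OF il(1)] il(2) by simp
    then have "\<omega> ?j (\<phi> i) \<noteq> 0" unfolding tr_def by simp
    moreover have "\<phi> i < n" using \<phi>T[of i] il(3) P(1) T(1) by auto
    ultimately show "z \<in> block_incidence n M (- {j}) \<omega>" unfolding il(4) block_incidence_def by simp
  qed
  moreover have "\<forall>i\<in>?l \<inter> P. \<omega> j (fst (?f, ?g) i) \<noteq> 0" unfolding tr_def by simp
  moreover have "2 \<le> card {i\<in>?l \<inter> P. fst (?f, ?g) i \<in> S}"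
  proof -
    have "{i\<in>?l \<inter> P. fst (?f, ?g) i \<in> S} = {i\<in>?l \<inter> P. \<phi> i \<in> S}" by auto
    then show ?thesis using ab2 by simp
  qed
  ultimately have "spoils S (\<omega> j) (block_incidence n M (- {j}) \<omega>)"
    unfolding spoils_def using ty by blast
  then show False using j(3) unfolding good_def by simp
qed

lemma erdos_rogers_le: "erdos_rogers s t n \<le> w"
proof -
  obtain \<omega> where \<omega>: "\<forall>W\<subseteq>{..<n}. card W = w \<longrightarrow> (\<exists>j<M. \<exists>S\<subseteq>W. good \<omega> j S)"
    using good_blocks_exist by blast
  have s1: "1 \<le> s" using s3 by simp
  obtain W where W: "W \<subseteq> {..<n}" "K_free s W (induced_edges (edges \<omega>) W)"
    and cW: "card W = max_induced_K_free s {..<n} (edges \<omega>)"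
    using max_induced_K_free_attained(1)[of "{..<n}" s "edges \<omega>"] s1 by auto
  have "card W < w"
  proof (rule ccontr)
    assume "\<not> card W < w"
    then obtain W' where W': "W' \<subseteq> W" "card W' = w" using obtain_subset_with_card_n[of w W] by auto
    have "W' \<subseteq> {..<n}" using W'(1) W(1) by (rule order_trans)
    then have "\<exists>j<M. \<exists>S\<subseteq>W'. good \<omega> j S" using \<omega> W'(2) by simp
    then obtain j S where S: "j < M" "S \<subseteq> W'" "good \<omega> j S" by blast
    have cS: "card S = s" using S(3) unfolding good_def rainbow_def by simp
    have fS: "finite S" using cS s1 card_ge_0_finite by force
    have SW: "S \<subseteq> W" "S \<subseteq> {..<n}" using S(2) W' W(1) by auto
    have "S \<in> [W]\<^bsup>s\<^esup>" using SW fS cS by (simp add: nsets_def)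
    moreover have "[S]\<^bsup>2\<^esup> \<subseteq> induced_edges (edges \<omega>) W"
    proof
      fix e assume "e \<in> [S]\<^bsup>2\<^esup>"
      then have e: "e \<subseteq> S" "card e = 2" unfolding nsets_def by auto
      then have "e \<in> edges \<omega>" unfolding edges_def using S(1,3) SW(2) by blast
      then show "e \<in> induced_edges (edges \<omega>) W" unfolding induced_edges_def using e SW by auto
    qed
    ultimately show False using W(2) unfolding K_free_def by blast
  qed
  moreover have "erdos_rogers s t n \<le> max_induced_K_free s {..<n} (edges \<omega>)"
    unfolding erdos_rogers_def
    by (intro cInf_lower CollectI exI[of _ "{..<n}"] exI[of _ "edges \<omega>"] conjI refl simple_edges K_free_edges) simp_all
  ultimately show ?thesis using cW by simp
qed

end

section \<open>Choice of parameters\<close>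

text \<open>This is \<open>linear_space_cost\<close> in terms of weights. One factor M p^2 is kept
  for the pair on the right, and every further line is bounded by y n^(-e). There is a further line,
  since a line has at most s < t points, and a single factor y is retained.\<close>

lemma clique_weight_bound:
  fixes s t n M :: nat and y p :: real
  assumes st: "s \<ge> 3" "s + 2 \<le> t" "t \<le> 2 * s - 1" and ls: "linear_space {..<t} s LL" and n1: "1 \<le> n"
    and p: "p = real n powr (alpha s t - 1)" and y: "0 \<le> y" "y \<le> 1"
    and x: "real M * p\<^sup>2 \<le> y * real n powr (- edge_exp s t)"
  shows "pattern_weight n M p LL {..<t} \<le> real n ^ 2 * (real M * p\<^sup>2) * y"
proof -
  define X where "X = real M * p\<^sup>2"
  define e where "e = edge_exp s t"
  define N where "N = real n"
  define c where "c = (\<Sum>l\<in>LL. real (card l) - 2)"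
  have N: "1 \<le> N" using n1 unfolding N_def by simp
  have X0: "0 \<le> X" unfolding X_def by simp
  have fL: "finite LL" using linear_space_finite[OF ls] by simp
  have lD: "l \<subseteq> {..<t}" "2 \<le> card l" "card l \<le> s" if "l \<in> LL" for l
    using ls that unfolding linear_space_def by auto
  obtain l0 where l0: "l0 \<in> LL" "0 \<in> l0" "1 \<in> l0"
    by (rule linear_space_line[OF ls, of 0 1]) (use st in simp_all)
  have "\<exists>v<t. v \<notin> l0"
  proof (rule ccontr)
    assume "\<not> (\<exists>v<t. v \<notin> l0)"
    then have "{..<t} \<subseteq> l0" by auto
    then have "card {..<t} \<le> card l0" using lD(1)[OF l0(1)] finite_subset by (intro card_mono) auto
    then show False using lD(3)[OF l0(1)] st by simp
  qed
  then obtain v where v: "v < t" "v \<notin> l0" by blast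
  obtain l1 where l1: "l1 \<in> LL" "0 \<in> l1" "v \<in> l1"
  proof (rule linear_space_line[OF ls, of 0 v])
    show "0 \<noteq> v" using v l0 by (cases "v = 0") auto
  qed (use v st in simp_all)
  have "card {l0, l1} \<le> card LL" using l0 l1 fL by (intro card_mono) auto
  moreover have "l0 \<noteq> l1" using v l1 by blast
  ultimately have c2: "2 \<le> card LL" by simp
  have lw: "line_weight M p (card (l \<inter> {..<t})) = X * N powr ((alpha s t - 1) * (real (card l) - 2))" if l: "l \<in> LL" for l
  proof -
    have "l \<inter> {..<t} = l" using lD(1)[OF l] by auto
    moreover have "p ^ card l = p\<^sup>2 * p ^ (card l - 2)" using lD(2)[OF l]
      by (simp only: power_add[symmetric] le_add_diff_inverse)
    moreover have "p ^ (card l - 2) = N powr ((alpha s t - 1) * (real (card l) - 2))"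
    proof -
      have "p ^ (card l - 2) = p powr real (card l - 2)" using N unfolding p N_def by (intro powr_realpow[symmetric]) simp
      also have "\<dots> = N powr ((alpha s t - 1) * real (card l - 2))" unfolding p N_def by (rule powr_powr)
      finally show ?thesis using lD(2)[OF l] by (simp add: of_nat_diff)
    qed
    ultimately show ?thesis using lD(2)[OF l] unfolding line_weight_def X_def by simp
  qed
  have "(\<Prod>l\<in>LL. line_weight M p (card (l \<inter> {..<t}))) = (\<Prod>l\<in>LL. X * N powr ((alpha s t - 1) * (real (card l) - 2)))"
    by (rule prod.cong[OF refl lw])
  also have "\<dots> = X ^ card LL * (\<Prod>l\<in>LL. N powr ((alpha s t - 1) * (real (card l) - 2)))"
    by (simp add: prod.distrib)
  also have "(\<Prod>l\<in>LL. N powr ((alpha s t - 1) * (real (card l) - 2))) = N powr ((alpha s t - 1) * c)"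
    unfolding c_def sum_distrib_left using N fL by (intro powr_sum[symmetric]) auto
  finally have pwe: "pattern_weight n M p LL {..<t} = N ^ t * (X ^ card LL * N powr ((alpha s t - 1) * c))"
    unfolding pattern_weight_def N_def by simp
  define r where "r = card LL - 1"
  have r: "card LL = Suc r" "1 \<le> r" using c2 unfolding r_def by simp_all
  have "X ^ r \<le> (y * N powr (- e)) ^ r" using x X0 unfolding X_def N_def e_def by (intro power_mono) auto
  also have "\<dots> = y ^ r * N powr (- e * real r)"
  proof -
    have "(N powr (- e)) ^ r = (N powr (- e)) powr real r" using N by (intro powr_realpow[symmetric]) simp
    then show ?thesis by (simp add: power_mult_distrib powr_powr)
  qed
  also have "\<dots> \<le> y * N powr (- e * real r)"
    using y r(2) power_decreasing[of 1 r y] by (intro mult_right_mono) auto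
  finally have Xr: "X ^ r \<le> y * N powr (- e * real r)" .
  have "N ^ t = N powr real t" using N by (intro powr_realpow[symmetric]) simp
  then have "pattern_weight n M p LL {..<t} = N powr real t * (X * X ^ r * N powr ((alpha s t - 1) * c))"
    using pwe r(1) by simp
  also have "\<dots> \<le> N powr real t * (X * (y * N powr (- e * real r)) * N powr ((alpha s t - 1) * c))"
    using X0 Xr by (intro mult_left_mono mult_right_mono) auto
  also have "\<dots> = X * y * N powr (real t - e * real r + (alpha s t - 1) * c)"
  proof -
    have "N powr (real t - e * real r + (alpha s t - 1) * c) = N powr real t * N powr (- e * real r) * N powr ((alpha s t - 1) * c)"
      by (simp flip: powr_add)
    then show ?thesis by simp
  qed
  also have "\<dots> \<le> X * y * N powr 2"
  proof (intro mult_left_mono powr_mono)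
    have "real t - 2 + e \<le> (\<Sum>l\<in>LL. e + (real (card l) - 2) * (1 - alpha s t))"
      using linear_space_cost[OF st ls] unfolding e_def by simp
    also have "\<dots> = e * real (card LL) + c * (1 - alpha s t)"
      unfolding c_def by (simp add: sum.distrib sum_distrib_right)
    also have "e * real (card LL) = e + e * real r" using r(1) by (simp add: algebra_simps)
    finally show "real t - e * real r + (alpha s t - 1) * c \<le> 2" by (simp add: algebra_simps)
  qed (use X0 y N in auto)
  also have "\<dots> = N ^ 2 * X * y" using N by (simp add: powr_realpow[of N 2, simplified])
  finally show ?thesis unfolding X_def N_def .
qed

text \<open>The common shape of the union bounds: X counts choices and is exponential in m u,
  whereas z to the power m m u decays like exp(-m m u). With m at least T + 1 a factor exp(-m) is
  left over to absorb B.\<close>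

lemma exp_decay_bound:
  fixes m u :: nat and T B X z :: real
  assumes z: "0 \<le> z" "z \<le> exp (- 1)" and X: "0 \<le> X" "X \<le> exp (T * real m * real u)" and u: "1 \<le> u"
    and T: "T + 1 \<le> real m" and B: "0 \<le> B" "B \<le> real m"
  shows "B * X * z ^ (m * m * u) \<le> 1"
proof -
  have "z ^ (m * m * u) \<le> exp (- 1) ^ (m * m * u)" using z by (intro power_mono)
  also have "\<dots> = exp (- (real m * real m * real u))" by (simp flip: exp_of_nat_mult)
  finally have "X * z ^ (m * m * u) \<le> exp (T * real m * real u) * exp (- (real m * real m * real u))"
    using X z by (intro mult_mono) auto
  also have "\<dots> = exp (- ((real m - T) * (real m * real u)))" by (simp add: algebra_simps flip: exp_add)
  also have "\<dots> \<le> exp (- (1 * (real m * 1)))"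
  proof -
    have "1 * (real m * 1) \<le> (real m - T) * (real m * real u)" using T u by (intro mult_mono) auto
    then show ?thesis by simp
  qed
  finally have "B * (X * z ^ (m * m * u)) \<le> real m * exp (- real m)"
    using B X z by (intro mult_mono) auto
  also have "\<dots> \<le> exp (real m) * exp (- real m)"
  proof (rule mult_right_mono)
    show "real m \<le> exp (real m)" using exp_ge_add_one_self[of "real m"] by linarith
  qed simp
  also have "\<dots> = 1" by (simp flip: exp_add)
  finally show ?thesis by (simp add: mult.assoc)
qed

lemma power_ratio_le:
  fixes m A :: real
  assumes "1 \<le> m" "Suc j \<le> C" "0 \<le> A"
  shows "A * m ^ j / m ^ C \<le> A / m"
proof -
  have "A * m ^ j / m ^ C \<le> A * m ^ j / m ^ Suc j"
    using assms by (intro divide_left_mono power_increasing mult_pos_pos) auto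
  also have "\<dots> = A / m" using assms by simp
  finally show ?thesis .
qed

lemma divide_le_exp_minus_one:
  fixes m A :: real
  assumes "exp 1 * A \<le> m" "0 < m"
  shows "A / m \<le> exp (- 1)"
  using assms by (simp add: exp_minus field_simps)

text \<open>Since (2s - 3)\<alpha> = e + (2s - 4)/2, the number \<alpha> is a weighted mean of e and
  1/2; so \<alpha> < 1/2 forces e < \<alpha>.\<close>

lemma exponent_bounds:
  fixes s t :: nat
  assumes st: "s \<ge> 3" "s + 2 \<le> t" "t \<le> 2 * s - 1"
  shows "0 < edge_exp s t" "alpha s t < 1 / 2" "edge_exp s t < 1 / 2" "edge_exp s t < alpha s t"
proof -
  define al where "al = alpha s t"
  define e where "e = edge_exp s t"
  have e0: "0 < e" and al2: "al < 1 / 2" using exponent_facts(1,2)[OF st] unfolding e_def al_def by simp_all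
  have ee: "e = (2 * real s - 3) * al - (real s - 2)" unfolding e_def al_def edge_exp_def by simp
  have "e < (2 * real s - 3) * (1 / 2) - (real s - 2)"
    unfolding ee using al2 st(1) by (intro diff_strict_right_mono mult_strict_left_mono) auto
  then have e2: "e < 1 / 2" by (simp add: field_simps)
  have ale: "e < al"
  proof -
    have a: "(2 * real s - 4) * e < (2 * real s - 4) * (1 / 2)" using e2 st(1) by (intro mult_strict_left_mono) auto
    have "(2 * real s - 3) * e < (2 * real s - 3) * al"
    proof -
      have "(2 * real s - 3) * e = (2 * real s - 4) * e + e" by (simp add: algebra_simps)
      also have "\<dots> < (2 * real s - 4) * (1 / 2) + e" using a by simp
      also have "\<dots> = (2 * real s - 3) * al" using ee by (simp add: algebra_simps)
      finally show ?thesis .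
    qed
    then show ?thesis using st(1) by (simp add: mult_less_cancel_left)
  qed
  show "0 < edge_exp s t" "alpha s t < 1 / 2" "edge_exp s t < 1 / 2" "edge_exp s t < alpha s t"
    using e0 al2 e2 ale unfolding e_def al_def by simp_all
qed

text \<open>In the application m is log n rounded up; the auxiliary parameters are powers of m up to
  powers of n and rounding. Their exponents are forced in this order: \<open>k0\<close> by
  \<open>den3\<close>, where g^(2t) \<theta> is m^(10t + 2); \<open>cb\<close> by
  \<open>un3\<close>; \<open>C\<close> by \<open>un4\<close>; \<open>c1\<close> by
  \<open>den1\<close> and by the comparison of \<Lambda>^t with the gain y. \<open>D\<close> bounds
  all powers of m that have to stay below a power of n.\<close>

lemma polylog_parameters:
  fixes s t n m d k0 cb C c1 R D :: nat and al e \<delta> \<eta> :: real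
  assumes st: "s \<ge> 3" "s + 2 \<le> t" "t \<le> 2 * s - 1"
    and d: "d = t * 2 ^ t" and k0: "k0 = 10 * t + 3" and cb: "cb = 2 * d + 1"
    and C: "C = k0 * t + (k0 + 2) * d + 1" and c1: "c1 = k0 + cb + 1 + C * t + 5"
    and R: "R = (s - 1) * (c1 + 1)" and D: "D = 2 * R + C + c1 + k0 + 5"
    and al: "al = alpha s t" and e: "e = edge_exp s t"
    and \<delta>: "\<delta> = 1 - exp (- (1 / 2 ^ (2 ^ t)))"
    and \<eta>: "\<eta> = \<delta> / (4 * (exp 1 * (1 + 2 ^ (2 ^ t) * 2 ^ t * 2 ^ t * 2 ^ t) * (real s)\<^sup>2 ^ s))"
    and n2: "2 \<le> n" and mL: "ln (real n) \<le> real m"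
    and big: "3 \<le> m" "s \<le> m" "real t + 1 \<le> real m" "exp 1 * real t \<le> real m" "6 / \<eta> \<le> real m" "8 * real d / \<eta> \<le> real m"
      "16 * (2 ^ (2 ^ t) * 2 ^ t * 2 ^ t * 2 ^ t) \<le> real m" "exp 1 * (2 ^ d * (real d + 1) ^ d / \<eta>) \<le> real m"
      "exp 1 * (2 ^ d * (real d + 1) ^ d) \<le> real m" "exp 1 * (real t ^ t * (2 ^ d * (real d + 1) ^ d)) \<le> real m"
      "8 * (real s)\<^sup>2 ^ s / \<delta> \<le> real m" "exp 1 * 2 \<le> real m"
    and pows: "\<And>\<epsilon>. \<epsilon> \<in> {1 - al, 1 - al - e, e, al - e, 1 - 2 * e, al, 1 - 2 * al, 1} \<Longrightarrow> real m ^ D \<le> real n powr \<epsilon>"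
  shows "erdos_rogers s t n \<le> nat \<lceil>real n powr al\<rceil> * m ^ c1"
proof -
  have e0: "0 < e" and al2: "al < 1 / 2" and e2: "e < 1 / 2" and ale: "e < al"
    using exponent_bounds[OF st] unfolding e al by simp_all
  have al0: "0 < al" using ale e0 by linarith
  have ee: "e = (2 * real s - 3) * al - (real s - 2)" unfolding e al edge_exp_def by simp
  define N where "N = real n"
  define \<mu> where "\<mu> = real m"
  have N2: "2 \<le> N" using n2 unfolding N_def by simp
  have \<mu>3: "3 \<le> \<mu>" using big(1) unfolding \<mu>_def by simp
  have \<mu>D: "\<mu> ^ j \<le> N powr \<epsilon>" if "j \<le> D" "\<epsilon> \<in> {1 - al, 1 - al - e, e, al - e, 1 - 2 * e, al, 1 - 2 * al, 1}" for j \<epsilon>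
  proof -
    have "\<mu> ^ j \<le> \<mu> ^ D" using that(1) \<mu>3 by (intro power_increasing) auto
    then show ?thesis using pows[OF that(2)] unfolding \<mu>_def N_def by linarith
  qed
  have \<delta>0: "0 < \<delta>" unfolding \<delta> by simp
  define G :: real where "G = 2 ^ (2 ^ t) * 2 ^ t * 2 ^ t * 2 ^ t"
  have G0: "0 < G" unfolding G_def by simp
  have \<eta>0: "0 < \<eta>" unfolding \<eta> G_def[symmetric] using \<delta>0 st(1) G0 by simp
  have Nexp: "N ^ j \<le> exp (real j * \<mu>)" for j
  proof -
    have "N ^ j = exp (ln N) ^ j" using N2 by simp
    also have "\<dots> \<le> exp \<mu> ^ j" using mL unfolding N_def \<mu>_def by (intro power_mono) auto
    finally show ?thesis by (simp flip: exp_of_nat_mult)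
  qed

  define p where "p = N powr (al - 1)"
  define q where "q = nat \<lceil>N powr al\<rceil>"
  define w where "w = q * m ^ c1"
  define k where "k = m ^ k0"
  \<comment> \<open>The factor k pays for the union bound over the roughly n^(k t) sets of sampled
    vertices.\<close>
  define h where "h = m * m * k"
  define K where "K = m * m"
  define g where "g = m ^ 5"
  define b where "b = q * m ^ cb"
  define \<Lambda> where "\<Lambda> = \<mu> ^ C"
  \<comment> \<open>This makes (w p)^s M at least w m^3, while \<open>un5\<close> asks for about w
    log n; the spare powers of m absorb constants.\<close>
  define Z where "Z = \<mu> ^ 3 / (real w ^ (s - 1) * p ^ s)"
  define M where "M = nat \<lceil>Z\<rceil>"
  have p0: "0 < p" unfolding p_def using N2 by simp
  have p1: "p \<le> 1" unfolding p_def using N2 al2 powr_mono[of "al - 1" 0 N] by simp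
  have npN: "N * p = N powr al" unfolding p_def using N2 powr_add[of N 1 "al - 1"] by simp
  have Nal1: "1 \<le> N powr al" using N2 al0 by (intro ge_one_powr_ge_zero) auto
  have q1: "N powr al \<le> real q" and q2: "real q \<le> 2 * N powr al"
    unfolding q_def using Nal1 by linarith+
  have q0: "0 < real q" using q1 Nal1 by linarith
  have rw: "real w = real q * \<mu> ^ c1" unfolding w_def \<mu>_def by simp
  have w1: "N powr al * \<mu> ^ c1 \<le> real w" unfolding rw using q1 \<mu>3 by (intro mult_right_mono) auto
  have w2: "real w \<le> N powr al * \<mu> ^ (c1 + 1)"
  proof -
    have "real w \<le> 2 * N powr al * \<mu> ^ c1" unfolding rw using q2 \<mu>3 by (intro mult_right_mono) auto
    also have "\<dots> \<le> \<mu> * N powr al * \<mu> ^ c1" using \<mu>3 by (intro mult_right_mono) auto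
    finally show ?thesis by (simp add: mult_ac)
  qed
  have w0: "0 < real w" unfolding rw using q0 \<mu>3 by simp
  \<comment> \<open>Chosen so that Z p^2 is m^3 / V; up to powers of m it is n^e, which is how the
    exponent e arises.\<close>
  define V where "V = real w ^ (s - 1) * p ^ (s - 2)"
  have V0: "0 < V" unfolding V_def using w0 p0 by simp
  have base: "(N powr al) ^ (s - 1) * p ^ (s - 2) = N powr e"
  proof -
    have "(N powr al) ^ (s - 1) = (N powr al) powr real (s - 1)" using N2 by (intro powr_realpow[symmetric]) simp
    moreover have "p ^ (s - 2) = p powr real (s - 2)" using p0 by (intro powr_realpow[symmetric])
    moreover have "al * real (s - 1) + (al - 1) * real (s - 2) = e"
      unfolding ee using st(1) by (simp add: of_nat_diff algebra_simps)
    ultimately show ?thesis unfolding p_def by (simp add: powr_powr flip: powr_add)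
  qed
  have V1: "N powr e * \<mu> ^ (c1 * (s - 1)) \<le> V"
  proof -
    have "(N powr al * \<mu> ^ c1) ^ (s - 1) \<le> real w ^ (s - 1)" using w1 \<mu>3 by (intro power_mono) auto
    then have "(N powr al * \<mu> ^ c1) ^ (s - 1) * p ^ (s - 2) \<le> V" unfolding V_def using p0 by (intro mult_right_mono) auto
    moreover have "(N powr al * \<mu> ^ c1) ^ (s - 1) * p ^ (s - 2) = ((N powr al) ^ (s - 1) * p ^ (s - 2)) * \<mu> ^ (c1 * (s - 1))"
      by (simp only: power_mult_distrib power_mult mult_ac)
    ultimately show ?thesis unfolding base by simp
  qed
  have V2: "V \<le> N powr e * \<mu> ^ R"
  proof -
    have "real w ^ (s - 1) \<le> (N powr al * \<mu> ^ (c1 + 1)) ^ (s - 1)" using w2 w0 by (intro power_mono) auto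
    then have "V \<le> (N powr al * \<mu> ^ (c1 + 1)) ^ (s - 1) * p ^ (s - 2)" unfolding V_def using p0 by (intro mult_right_mono) auto
    moreover have "(N powr al * \<mu> ^ (c1 + 1)) ^ (s - 1) * p ^ (s - 2) = ((N powr al) ^ (s - 1) * p ^ (s - 2)) * (\<mu> ^ (c1 + 1)) ^ (s - 1)"
      by (simp only: power_mult_distrib mult_ac)
    moreover have "(\<mu> ^ (c1 + 1)) ^ (s - 1) = \<mu> ^ R" unfolding R by (simp only: power_mult[symmetric] mult.commute)
    ultimately show ?thesis unfolding base by simp
  qed
  have "s = (s - 2) + 2" using st(1) by simp
  then have ps: "p ^ s = p ^ (s - 2) * p\<^sup>2" using power_add[of p "s - 2" 2] by simp
  have Zp: "Z * p\<^sup>2 = \<mu> ^ 3 / V" unfolding Z_def V_def ps using p0 w0 by (simp add: field_simps)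
  have xlo: "N powr (- e) / \<mu> ^ R \<le> Z * p\<^sup>2"
  proof -
    have "N powr (- e) / \<mu> ^ R = 1 / (N powr e * \<mu> ^ R)" by (simp add: powr_minus field_simps)
    also have "\<dots> \<le> 1 / V" using V2 V0 by (intro divide_left_mono) auto
    also have "\<dots> \<le> \<mu> ^ 3 / V" using \<mu>3 V0 by (intro divide_right_mono) auto
    finally show ?thesis unfolding Zp .
  qed
  \<comment> \<open>M p^2 may fall below n^(-e) by a factor m^R. This is harmless wherever a
    positive power of n is left over, as in the uses that follow.\<close>
  have gain: "1 \<le> N powr a * (N powr (- e) / \<mu> ^ R)" if "a - e \<in> {1 - al, 1 - al - e, e, al - e, 1 - 2 * e, al, 1 - 2 * al, 1}" for a
  proof -
    have "\<mu> ^ R \<le> N powr (a - e)" by (rule \<mu>D[OF _ that]) (simp add: D)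
    also have "N powr (a - e) = N powr a * N powr (- e)" by (simp flip: powr_add)
    finally show ?thesis using \<mu>3 by simp
  qed
  have pinv: "N powr (1 - al) * p = 1" unfolding p_def using N2 by (simp flip: powr_add)
  have Z1: "1 \<le> Z"
  proof -
    have "1 \<le> N powr (1 - al) * (N powr (- e) / \<mu> ^ R)" by (rule gain) simp
    also have "\<dots> \<le> N powr (1 - al) * (Z * p\<^sup>2)" using xlo by (intro mult_left_mono) auto
    also have "\<dots> = (N powr (1 - al) * p) * (Z * p)" by (simp add: power2_eq_square)
    finally have "1 \<le> Z * p" unfolding pinv by simp
    also have "\<dots> \<le> Z * 1"
    proof (rule mult_left_mono[OF p1])
      show "0 \<le> Z" unfolding Z_def using w0 p0 \<mu>3 by simp
    qed
    finally show ?thesis by simp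
  qed
  have M1: "Z \<le> real M" and M2: "real M \<le> 2 * Z" unfolding M_def using Z1 by linarith+
  define x where "x = real M * p\<^sup>2"
  have x1: "N powr (- e) / \<mu> ^ R \<le> x"
  proof -
    have "Z * p\<^sup>2 \<le> x" unfolding x_def using M1 by (intro mult_right_mono) auto
    then show ?thesis using xlo by linarith
  qed
  have x0: "0 < x" using x1 N2 \<mu>3 by (smt (verit) divide_pos_pos powr_gt_zero zero_less_power)
  \<comment> \<open>The gain comes from enlarging w by m^c1: since M carries w to the power -(s -
    1), a larger w makes do with fewer blocks.\<close>
  define y where "y = 2 * \<mu> ^ 3 / \<mu> ^ (c1 * (s - 1))"
  have y0: "0 \<le> y" unfolding y_def using \<mu>3 by simp
  have x2: "x \<le> y * N powr (- e)"
  proof -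
    have "x \<le> 2 * Z * p\<^sup>2" unfolding x_def using M2 by (intro mult_right_mono) auto
    also have "\<dots> = 2 * (\<mu> ^ 3 / V)" using Zp by simp
    also have "\<dots> \<le> 2 * (\<mu> ^ 3 / (N powr e * \<mu> ^ (c1 * (s - 1))))"
      using V1 V0 \<mu>3 N2 by (intro mult_left_mono divide_left_mono mult_pos_pos) auto
    also have "\<dots> = y * N powr (- e)" unfolding y_def by (simp add: powr_minus field_simps)
    finally show ?thesis .
  qed
  \<comment> \<open>The summand C t + 5 in \<open>c1\<close> serves this inequality: it beats
    \<Lambda>^t = m^(C t) and the loss 2 m^3.\<close>
  have Ly: "\<Lambda> ^ t * y < 1"
  proof -
    have "C * t + 5 \<le> c1 * (s - 1)"
    proof -
      have "C * t + 5 \<le> c1 * 1" unfolding c1 by simp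
      also have "\<dots> \<le> c1 * (s - 1)" using st(1) by (intro mult_le_mono2) simp
      finally show ?thesis .
    qed
    then have "\<mu> ^ (C * t + 5) \<le> \<mu> ^ (c1 * (s - 1))" using \<mu>3 by (intro power_increasing) auto
    moreover have "\<Lambda> ^ t * (2 * \<mu> ^ 3) < \<mu> ^ (C * t + 5)"
    proof -
      have "\<Lambda> ^ t * (2 * \<mu> ^ 3) = \<mu> ^ (C * t + 3) * 2" unfolding \<Lambda>_def by (simp add: power_mult power_add)
      also have "\<dots> < \<mu> ^ (C * t + 3) * \<mu>\<^sup>2"
      proof (rule mult_strict_left_mono)
        have "3 * 3 \<le> \<mu> * \<mu>" using \<mu>3 by (intro mult_mono) auto
        then show "2 < \<mu>\<^sup>2" by (simp add: power2_eq_square)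
      qed (use \<mu>3 in simp)
      also have "\<dots> = \<mu> ^ (C * t + 5)" by (simp add: power_add eval_nat_numeral)
      finally show ?thesis .
    qed
    ultimately have "\<Lambda> ^ t * (2 * \<mu> ^ 3) < \<mu> ^ (c1 * (s - 1))" by linarith
    then show ?thesis unfolding y_def times_divide_eq_right using \<mu>3 by (subst divide_less_eq_1_pos) auto
  qed
  have L1: "1 < \<Lambda>" unfolding \<Lambda>_def using \<mu>3 by (intro one_less_power) (auto simp: C)
  have y1: "y \<le> 1"
  proof -
    have "1 * y \<le> \<Lambda> ^ t * y" using L1 y0 by (intro mult_right_mono) auto
    then show ?thesis using Ly by linarith
  qed
  have key: "\<Lambda> ^ t * pattern_weight n M p LL {..<t} < \<Lambda>\<^sup>2 * (real n ^ 2 * (real M * p\<^sup>2))"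
    if ls: "linear_space {..<t} s LL" for LL
  proof -
    have "pattern_weight n M p LL {..<t} \<le> real n ^ 2 * (real M * p\<^sup>2) * y"
      by (rule clique_weight_bound[OF st ls _ _ y0 y1]) (use n2 x2 in \<open>simp_all add: p_def N_def al x_def e\<close>)
    then have "\<Lambda> ^ t * pattern_weight n M p LL {..<t} \<le> \<Lambda> ^ t * (real n ^ 2 * (real M * p\<^sup>2) * y)"
      using L1 by (intro mult_left_mono) auto
    also have "\<dots> = (\<Lambda> ^ t * y) * (N ^ 2 * x)" unfolding N_def x_def by (simp only: mult_ac)
    also have "\<dots> < \<Lambda>\<^sup>2 * (N ^ 2 * x)"
    proof (rule mult_strict_right_mono)
      have "1 \<le> \<Lambda>\<^sup>2" using L1 by (intro one_le_power) auto
      then show "\<Lambda> ^ t * y < \<Lambda>\<^sup>2" using Ly by linarith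
    qed (use x0 N2 in simp)
    finally show ?thesis unfolding N_def x_def .
  qed

  have xx: "real M * p\<^sup>2 = x" unfolding x_def ..
  have W1: "p \<le> 1 / \<Lambda>"
  proof -
    have "\<Lambda> \<le> N powr (1 - al)" unfolding \<Lambda>_def by (rule \<mu>D) (simp_all add: D)
    then have "\<Lambda> * p \<le> N powr (1 - al) * p" using p0 by (intro mult_right_mono) auto
    then show ?thesis unfolding pinv using L1 by (simp add: field_simps)
  qed
  have W2: "1 \<le> real M * p"
  proof -
    have "1 \<le> N powr (1 - al) * (N powr (- e) / \<mu> ^ R)" by (rule gain) simp
    also have "\<dots> \<le> N powr (1 - al) * x" using x1 by (intro mult_left_mono) auto
    also have "\<dots> = (N powr (1 - al) * p) * (real M * p)" unfolding x_def by (simp add: power2_eq_square)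
    finally show ?thesis unfolding pinv by simp
  qed
  have W3: "real M * p\<^sup>2 \<le> 1 / \<Lambda>"
  proof -
    have "\<Lambda> \<le> N powr e" unfolding \<Lambda>_def by (rule \<mu>D) (simp_all add: D)
    then have "1 / N powr e \<le> 1 / \<Lambda>" using L1 N2 by (intro divide_left_mono) auto
    moreover have "y * N powr (- e) \<le> 1 * N powr (- e)" using y1 by (intro mult_right_mono) auto
    ultimately show ?thesis using x2 unfolding xx by (simp add: powr_minus_divide)
  qed
  have W4: "1 \<le> real n * p" using npN Nal1 unfolding N_def by simp
  have npp: "real n * p\<^sup>2 = N powr (2 * al - 1)"
  proof -
    have "real n * p\<^sup>2 = N powr al * p" using npN unfolding N_def by (simp add: power2_eq_square)
    then show ?thesis unfolding p_def by (simp flip: powr_add)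
  qed
  have W5: "real n * p\<^sup>2 \<le> 1" unfolding npp using powr_mono[of "2 * al - 1" 0 N] N2 al2 by simp
  have W6: "1 \<le> real n * p * (real M * p\<^sup>2)"
  proof -
    have "1 \<le> N powr al * (N powr (- e) / \<mu> ^ R)" by (rule gain) simp
    also have "\<dots> \<le> N powr al * x" using x1 by (intro mult_left_mono) auto
    finally show ?thesis unfolding xx npN[symmetric] unfolding N_def .
  qed
  have W7: "1 \<le> real n * (real M * p\<^sup>2)\<^sup>2"
  proof -
    have "\<mu> ^ (2 * R) \<le> N powr (1 - 2 * e)" by (rule \<mu>D) (simp_all add: D)
    also have "\<dots> = N * (N powr (- e) * N powr (- e))"
      using N2 by (simp add: algebra_simps flip: powr_add) (simp add: powr_diff powr_minus_divide)
    finally have "1 \<le> N * (N powr (- e) / \<mu> ^ R)\<^sup>2"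
      using \<mu>3 by (simp add: power2_eq_square power_mult field_simps mult_2 power_add)
    also have "\<dots> \<le> N * x\<^sup>2" using x1 N2 \<mu>3 by (intro mult_left_mono power_mono) auto
    finally show ?thesis unfolding xx N_def .
  qed
  have W8: "1 \<le> (real n * p)\<^sup>2 * (real M * p\<^sup>2) * (real n * p\<^sup>2) ^ (s - 2)"
  proof -
    define a where "a = 2 * al + (2 * al - 1) * real (s - 2)"
    have "(N powr (2 * al - 1)) ^ (s - 2) = (N powr (2 * al - 1)) powr real (s - 2)" using N2 by (intro powr_realpow[symmetric]) simp
    then have 1: "(N powr al)\<^sup>2 * (N powr (2 * al - 1)) ^ (s - 2) = N powr a"
      unfolding a_def by (simp add: powr_powr power2_eq_square flip: powr_add)
    \<comment> \<open>The dependence on s cancels, and the exponent left for the gain is \<alpha>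
      itself.\<close>
    have "a - e = al" unfolding a_def ee using st(1) by (simp add: of_nat_diff algebra_simps)
    then have "1 \<le> N powr a * (N powr (- e) / \<mu> ^ R)" by (intro gain) simp
    also have "\<dots> \<le> N powr a * x" using x1 by (intro mult_left_mono) auto
    also have "\<dots> = (N powr al)\<^sup>2 * x * (N powr (2 * al - 1)) ^ (s - 2)" unfolding 1[symmetric] by (simp only: mult_ac)
    finally show ?thesis unfolding xx npp npN[symmetric] unfolding N_def .
  qed

  have m0: "0 < m" using big(1) by simp
  have qpos: "0 < q" using q0 by simp
  have pos: "0 < w" "1 \<le> b" "0 < g" "0 < k"
    unfolding w_def b_def g_def k_def using m0 qpos by (simp_all add: Suc_le_eq)
  have kn: "k * t \<le> n"
  proof -
    have "\<mu> ^ (k0 + 1) \<le> N powr 1" by (rule \<mu>D) (simp_all add: D)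
    moreover have "\<mu> ^ k0 * real t \<le> \<mu> ^ k0 * \<mu>" using big(3) \<mu>3 unfolding \<mu>_def by (intro mult_left_mono) auto
    moreover have "\<mu> ^ (k0 + 1) = \<mu> ^ k0 * \<mu>" "N powr 1 = N" using N2 by simp_all
    ultimately have "\<mu> ^ k0 * real t \<le> N" by linarith
    then have "real (k * t) \<le> real n" unfolding k_def \<mu>_def N_def by simp
    then show ?thesis by (simp only: of_nat_le_iff)
  qed
  have Mn: "real M \<le> N ^ 2"
  proof -
    have "real M * p\<^sup>2 \<le> 1" using W3 L1 by (smt (verit) divide_le_eq_1_pos)
    then have "N powr (1 - al) * N powr (1 - al) * (real M * p\<^sup>2) \<le> N powr (1 - al) * N powr (1 - al) * 1"
      by (intro mult_left_mono) auto
    moreover have "N powr (1 - al) * N powr (1 - al) * (real M * p\<^sup>2) = (N powr (1 - al) * p) * (N powr (1 - al) * p) * real M"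
      by (simp only: power2_eq_square mult_ac)
    then have "N powr (1 - al) * N powr (1 - al) * (real M * p\<^sup>2) = real M" unfolding pinv by simp
    moreover have "N powr (1 - al) * N powr (1 - al) \<le> N powr 1 * N powr 1" using N2 al0 by (intro mult_mono powr_mono) auto
    ultimately have "real M \<le> N powr 1 * N powr 1" by linarith
    then show ?thesis using N2 by (simp add: power2_eq_square)
  qed
  have \<mu>t: "real t + 1 \<le> \<mu>" using big(3) unfolding \<mu>_def .
  have den1: "(real M + real n + real n ^ t) * (real (k * t) * real b / real w) ^ K \<le> \<eta> / 2"
  proof -
    have ratio: "real (k * t) * real b / real w = real t * \<mu> ^ (k0 + cb) / \<mu> ^ c1"
      unfolding rw k_def b_def \<mu>_def using q0 by (simp add: power_add field_simps)
    have z: "real (k * t) * real b / real w \<le> exp (- 1)"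
    proof -
      have "real (k * t) * real b / real w \<le> real t / \<mu>" unfolding ratio using \<mu>3 by (intro power_ratio_le) (auto simp: c1)
      also have "\<dots> \<le> exp (- 1)" using big(4) \<mu>3 unfolding \<mu>_def by (intro divide_le_exp_minus_one) auto
      finally show ?thesis .
    qed
    have nt: "N ^ 2 \<le> N ^ t" "N ^ 1 \<le> N ^ t" using N2 st by (intro power_increasing; simp)+
    have "(6 / \<eta>) * N ^ t * (real (k * t) * real b / real w) ^ (m * m * 1) \<le> 1"
    proof (rule exp_decay_bound[OF _ z])
      show "N ^ t \<le> exp (real t * real m * real 1)" using Nexp[of t] unfolding \<mu>_def by simp
    qed (use big(3,5) N2 \<eta>0 in simp_all)
    then have "6 / \<eta> * (N ^ t * (real (k * t) * real b / real w) ^ K) \<le> 1" unfolding K_def by (simp only: mult.assoc mult_1_right)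
    then have "6 * (N ^ t * (real (k * t) * real b / real w) ^ K) \<le> \<eta>" using \<eta>0 by (simp add: pos_divide_le_eq)
    moreover have "(real M + real n + real n ^ t) * (real (k * t) * real b / real w) ^ K \<le> (3 * N ^ t) * (real (k * t) * real b / real w) ^ K"
    proof (rule mult_right_mono)
      have "real M \<le> N ^ t" "N \<le> N ^ t" using Mn nt by simp_all
      then show "real M + real n + real n ^ t \<le> 3 * N ^ t" unfolding N_def by linarith
    qed simp
    ultimately show ?thesis by linarith
  qed
  have den2: "2 * real K * real ((t * 2 ^ t) * h) \<le> \<eta> / 4 * real g * real k"
  proof -
    have "8 * real d \<le> \<mu> * \<eta>" using big(6) \<eta>0 unfolding \<mu>_def by (simp add: field_simps)
    then have "8 * real d * \<mu> ^ (k0 + 4) \<le> \<mu> * \<eta> * \<mu> ^ (k0 + 4)" using \<mu>3 by (intro mult_right_mono) auto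
    moreover have "2 * real K * real ((t * 2 ^ t) * h) = 2 * real d * \<mu> ^ (k0 + 4)"
      unfolding K_def h_def k_def \<mu>_def d by (simp add: power_add power4_eq_xxxx)
    moreover have "\<eta> / 4 * real g * real k = \<mu> * \<eta> * \<mu> ^ (k0 + 4) / 4"
      unfolding g_def k_def \<mu>_def by (simp add: power_add power4_eq_xxxx eval_nat_numeral)
    ultimately show ?thesis by linarith
  qed
  have den3: "real ((g * g) ^ t) * real K \<le> \<eta> / 4 * real k"
  proof -
    have "0 < d" unfolding d using st by simp
    then have "4 \<le> 8 * real d" by simp
    then have "4 / \<eta> \<le> 8 * real d / \<eta>" using \<eta>0 by (intro divide_right_mono) auto
    then have "4 / \<eta> \<le> \<mu>" using big(6) unfolding \<mu>_def by linarith
    then have "4 \<le> \<mu> * \<eta>" using \<eta>0 by (simp add: field_simps)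
    then have "4 * \<mu> ^ (10 * t + 2) \<le> \<mu> * \<eta> * \<mu> ^ (10 * t + 2)" using \<mu>3 by (intro mult_right_mono) auto
    moreover have "real ((g * g) ^ t) * real K = \<mu> ^ (10 * t + 2)"
    proof -
      have "g * g = m ^ 10" unfolding g_def by (simp flip: power_add)
      then have "real ((g * g) ^ t) * real K = (\<mu> ^ 10) ^ t * \<mu>\<^sup>2" unfolding K_def \<mu>_def by (simp add: power2_eq_square)
      then show ?thesis by (simp only: power_add power_mult)
    qed
    moreover have "\<eta> / 4 * real k = \<mu> * \<eta> * \<mu> ^ (10 * t + 2) / 4"
      unfolding k_def k0 \<mu>_def by (simp add: power_add eval_nat_numeral)
    ultimately show ?thesis by linarith
  qed
  have bq: "(real n * p) / real b \<le> 1 / \<mu> ^ cb"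
  proof -
    have "(real n * p) / real b \<le> real q / real b" using q1 npN unfolding N_def by (intro divide_right_mono) auto
    also have "\<dots> = 1 / \<mu> ^ cb" unfolding b_def \<mu>_def using q0 by simp
    finally show ?thesis .
  qed
  have G16: "16 * G \<le> \<mu>" using big(7) unfolding G_def \<mu>_def .
  have two1: "(1::real) \<le> 2 ^ t" by simp
  have un1: "real M * ((real n * p + real K) / real b) ^ K \<le> 1 / 16"
  proof -
    have z: "(real n * p + real K) / real b \<le> exp (- 1)"
    proof -
      have "real K / real b \<le> real K / \<mu> ^ cb"
      proof (rule divide_left_mono)
        show "\<mu> ^ cb \<le> real b"
        proof -
          have "1 * \<mu> ^ cb \<le> real q * \<mu> ^ cb" using qpos \<mu>3 by (intro mult_right_mono) auto
          then show ?thesis unfolding b_def \<mu>_def by simp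
        qed
      qed (use \<mu>3 pos in auto)
      then have "(real n * p + real K) / real b \<le> (1 + \<mu>\<^sup>2) / \<mu> ^ cb"
        using bq unfolding K_def \<mu>_def by (simp add: add_divide_distrib power2_eq_square)
      also have "\<dots> \<le> 2 * \<mu>\<^sup>2 / \<mu> ^ cb" using \<mu>3 by (intro divide_right_mono) auto
      also have "\<dots> \<le> 2 / \<mu>"
      proof (rule power_ratio_le)
        have "0 < d" unfolding d using st by simp
        then show "Suc 2 \<le> cb" unfolding cb by simp
      qed (use \<mu>3 in auto)
      also have "\<dots> \<le> exp (- 1)" using big(12) \<mu>3 unfolding \<mu>_def by (intro divide_le_exp_minus_one) auto
      finally show ?thesis .
    qed
    have "16 * real M * ((real n * p + real K) / real b) ^ (m * m * 1) \<le> 1"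
    proof (rule exp_decay_bound[OF _ z])
      show "real M \<le> exp (real 2 * real m * real 1)" using Mn Nexp[of 2] unfolding \<mu>_def by simp
      have "1 \<le> G" unfolding G_def using one_le_power[of "2::real"] by (intro mult_ge1_I) simp_all
      then show "16 \<le> real m" using G16 unfolding \<mu>_def by linarith
    qed (use \<mu>3 p0 in \<open>simp_all add: \<mu>_def\<close>)
    then show ?thesis unfolding K_def by simp
  qed
  have dj: "(real (d * j) + 1) ^ d \<le> (real d + 1) ^ d * real j ^ d" if "1 \<le> j" for j
  proof -
    have "real (d * j) + 1 \<le> (real d + 1) * real j" using that by (simp add: algebra_simps)
    then have "(real (d * j) + 1) ^ d \<le> ((real d + 1) * real j) ^ d" by (intro power_mono) auto
    then show ?thesis by (simp only: power_mult_distrib)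
  qed
  have K1: "1 \<le> K" and h1: "1 \<le> h" unfolding K_def h_def k_def using m0 by (simp_all add: Suc_le_eq)
  have Kd: "real K ^ d = \<mu> ^ (2 * d)" unfolding K_def \<mu>_def by (simp add: power_mult power2_eq_square power_mult_distrib)
  define A where "A = 2 ^ d * (real d + 1) ^ d"
  have A0: "0 \<le> A" unfolding A_def by simp
  have AK: "2 ^ d * (real (d * K) + 1) ^ d \<le> A * \<mu> ^ (2 * d)"
    using mult_left_mono[OF dj[OF K1], of "2 ^ d"] unfolding A_def Kd by (simp add: mult.assoc)
  have un2: "2 ^ (2 ^ t) * 2 ^ t * 2 ^ t * 2 ^ t * real n ^ t *
      (2 ^ (t * 2 ^ t) * (real (t * 2 ^ t * K) + 1) ^ (t * 2 ^ t) / (\<Lambda> * \<eta>)) ^ K \<le> 1 / 16"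
  proof -
    define z where "z = 2 ^ d * (real (d * K) + 1) ^ d / (\<Lambda> * \<eta>)"
    have z0: "0 \<le> z" unfolding z_def using L1 \<eta>0 by simp
    have z: "z \<le> exp (- 1)"
    proof -
      have "z \<le> A * \<mu> ^ (2 * d) / (\<Lambda> * \<eta>)" unfolding z_def using AK L1 \<eta>0 by (intro divide_right_mono) auto
      also have "\<dots> = (A / \<eta>) * \<mu> ^ (2 * d) / \<mu> ^ C" unfolding \<Lambda>_def by simp
      also have "\<dots> \<le> (A / \<eta>) / \<mu>"
        using \<mu>3 A0 \<eta>0 by (intro power_ratio_le) (auto simp: C algebra_simps)
      also have "\<dots> \<le> exp (- 1)" using big(8) \<mu>3 unfolding \<mu>_def A_def by (intro divide_le_exp_minus_one) auto
      finally show ?thesis .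
    qed
    have "16 * G * N ^ t * z ^ (m * m * 1) \<le> 1"
    proof (rule exp_decay_bound[OF z0 z])
      show "N ^ t \<le> exp (real t * real m * real 1)" using Nexp[of t] unfolding \<mu>_def by simp
    qed (use G16 G0 big(3) N2 in \<open>simp_all add: \<mu>_def\<close>)
    then have "G * N ^ t * z ^ K \<le> 1 / 16" unfolding K_def by simp
    then show ?thesis unfolding G_def N_def z_def d .
  qed
  have un3: "2 ^ (2 ^ t) * 2 ^ t * 2 ^ t * real n ^ t *
      (2 ^ (t * 2 ^ t) * (real (t * 2 ^ t * K) + 1) ^ (t * 2 ^ t) * (real n * p) / real b) ^ K \<le> 1 / 16"
  proof -
    define z where "z = 2 ^ d * (real (d * K) + 1) ^ d * (real n * p) / real b"
    have z0: "0 \<le> z" unfolding z_def using p0 by simp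
    have z: "z \<le> exp (- 1)"
    proof -
      have "z \<le> (A * \<mu> ^ (2 * d)) * (1 / \<mu> ^ cb)"
        using mult_mono[OF AK bq] p0 A0 \<mu>3 unfolding z_def by simp
      also have "\<dots> = A * \<mu> ^ (2 * d) / \<mu> ^ cb" by simp
      also have "\<dots> \<le> A / \<mu>" using \<mu>3 A0 by (intro power_ratio_le) (auto simp: cb)
      also have "\<dots> \<le> exp (- 1)" using big(9) \<mu>3 unfolding \<mu>_def A_def by (intro divide_le_exp_minus_one) auto
      finally show ?thesis .
    qed
    define G' :: real where "G' = 2 ^ (2 ^ t) * 2 ^ t * 2 ^ t"
    have "0 < G'" "G' * 1 \<le> G' * 2 ^ t" unfolding G'_def by simp_all
    then have G': "0 < G'" "16 * G' \<le> \<mu>" using G16 unfolding G_def G'_def by linarith+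
    have "16 * G' * N ^ t * z ^ (m * m * 1) \<le> 1"
    proof (rule exp_decay_bound[OF z0 z])
      show "N ^ t \<le> exp (real t * real m * real 1)" using Nexp[of t] unfolding \<mu>_def by simp
    qed (use G' big(3) N2 in \<open>simp_all add: \<mu>_def\<close>)
    then have "G' * N ^ t * z ^ K \<le> 1 / 16" unfolding K_def by simp
    then show ?thesis unfolding G'_def N_def z_def d .
  qed
  have un4: "2 ^ t * 2 ^ (2 ^ t) * 2 ^ t * real n ^ (k * t) *
      (real (k * t) ^ t * (2 ^ (t * 2 ^ t) * (real (t * 2 ^ t * h) + 1) ^ (t * 2 ^ t) / \<Lambda>)) ^ h \<le> 1 / 16"
  proof -
    define z where "z = real (k * t) ^ t * (2 ^ d * (real (d * h) + 1) ^ d / \<Lambda>)"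
    have z0: "0 \<le> z" unfolding z_def using L1 by simp
    have hd: "real h ^ d = \<mu> ^ ((k0 + 2) * d)"
    proof -
      have "real h = \<mu> ^ (k0 + 2)" unfolding h_def k_def \<mu>_def by (simp add: power_add power2_eq_square)
      then show ?thesis by (simp only: power_mult)
    qed
    have Ah: "2 ^ d * (real (d * h) + 1) ^ d \<le> A * \<mu> ^ ((k0 + 2) * d)"
      using mult_left_mono[OF dj[OF h1], of "2 ^ d"] unfolding A_def hd by (simp add: mult.assoc)
    have kt: "real (k * t) ^ t = real t ^ t * \<mu> ^ (k0 * t)"
      unfolding k_def \<mu>_def by (simp add: power_mult_distrib power_mult mult.commute)
    have z: "z \<le> exp (- 1)"
    proof -
      have "z \<le> (real t ^ t * \<mu> ^ (k0 * t)) * (A * \<mu> ^ ((k0 + 2) * d) / \<Lambda>)"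
        unfolding z_def kt using Ah L1 \<mu>3 by (intro mult_left_mono divide_right_mono) auto
      also have "\<dots> = (real t ^ t * A) * \<mu> ^ (k0 * t + (k0 + 2) * d) / \<mu> ^ C"
        unfolding \<Lambda>_def power_add[of \<mu> "k0 * t"] by (simp only: times_divide_eq_right mult_ac)
      also have "\<dots> \<le> (real t ^ t * A) / \<mu>" using \<mu>3 A0 by (intro power_ratio_le) (auto simp: C)
      also have "\<dots> \<le> exp (- 1)" using big(10) \<mu>3 unfolding \<mu>_def A_def by (intro divide_le_exp_minus_one) auto
      finally show ?thesis .
    qed
    define G' :: real where "G' = 2 ^ t * 2 ^ (2 ^ t) * 2 ^ t"
    have "0 < G'" "G' * 1 \<le> G' * 2 ^ t" unfolding G'_def by simp_all
    moreover have "G' * 2 ^ t = G" unfolding G'_def G_def by (simp only: mult_ac)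
    ultimately have G': "0 < G'" "16 * G' \<le> \<mu>" using G16 by linarith+
    have "16 * G' * N ^ (k * t) * z ^ (m * m * k) \<le> 1"
    proof (rule exp_decay_bound[OF z0 z])
      show "N ^ (k * t) \<le> exp (real t * real m * real k)" using Nexp[of "k * t"] unfolding \<mu>_def by (simp add: mult_ac)
    qed (use G' big(3) N2 pos in \<open>simp_all add: \<mu>_def\<close>)
    then have "G' * N ^ (k * t) * z ^ h \<le> 1 / 16" unfolding h_def by simp
    then show ?thesis unfolding G'_def N_def z_def d .
  qed
  have sw: "s \<le> w"
  proof -
    have "m ^ 1 \<le> m ^ c1" using m0 by (intro power_increasing) (auto simp: c1)
    also have "\<dots> \<le> w" unfolding w_def using qpos by simp
    finally show ?thesis using big(2) by simp
  qed
  have wp: "real w * p \<le> 1 / 2"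
  proof -
    have "\<mu> ^ (c1 + 2) \<le> N powr (1 - 2 * al)" by (rule \<mu>D) (simp_all add: D)
    then have "\<mu> ^ (c1 + 2) * (N powr al * p) \<le> N powr (1 - 2 * al) * (N powr al * p)" using p0 by (intro mult_right_mono) auto
    also have "\<dots> = 1" unfolding p_def using N2 by (simp flip: powr_add)
    finally have a: "\<mu> * (N powr al * \<mu> ^ (c1 + 1) * p) \<le> 1" by (simp add: mult_ac)
    have "real w * p \<le> N powr al * \<mu> ^ (c1 + 1) * p" using w2 p0 by (intro mult_right_mono) auto
    moreover have "2 * (real w * p) \<le> \<mu> * (real w * p)" using \<mu>3 p0 w0 by (intro mult_right_mono) auto
    ultimately have "2 * (real w * p) \<le> \<mu> * (N powr al * \<mu> ^ (c1 + 1) * p)"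
      using \<mu>3 by (smt (verit) mult_left_mono)
    then show ?thesis using a by linarith
  qed
  have eta_small: "exp 1 * (1 + 2 ^ (2 ^ t) * 2 ^ t * 2 ^ t * 2 ^ t) * \<eta> * (real s)\<^sup>2 ^ s \<le> (1 - exp (- (1 / 2 ^ (2 ^ t)))) / 4"
  proof -
    have "0 < exp 1 * (1 + G) * (real s)\<^sup>2 ^ s" using G0 st(1) by simp
    then have "exp 1 * (1 + G) * \<eta> * (real s)\<^sup>2 ^ s = \<delta> / 4" unfolding \<eta> G_def[symmetric] by (simp add: field_simps)
    then show ?thesis unfolding G_def \<delta> by simp
  qed
  have un5: "real n ^ w * exp (- ((1 - exp (- (1 / 2 ^ (2 ^ t)))) / 8 * (real w * p / (real s)\<^sup>2) ^ s) * real M) \<le> 1 / 4"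
  proof -
    define \<kappa> where "\<kappa> = \<delta> / (8 * (real s)\<^sup>2 ^ s)"
    have s0: "0 < (real s)\<^sup>2 ^ s" using st(1) by simp
    have \<kappa>0: "0 < \<kappa>" unfolding \<kappa>_def using \<delta>0 s0 by simp
    have \<kappa>m: "1 \<le> \<kappa> * \<mu>" using big(11) \<delta>0 s0 unfolding \<kappa>_def \<mu>_def by (simp add: field_simps)
    have "real w * \<mu> ^ 3 = (real w * p) ^ s * Z"
    proof -
      have "real w ^ s = real w ^ (s - 1) * real w" using st(1) by (simp flip: power_Suc2)
      then show ?thesis unfolding Z_def power_mult_distrib using w0 p0 by (simp add: field_simps)
    qed
    also have "\<dots> \<le> (real w * p) ^ s * real M" using M1 w0 p0 by (intro mult_left_mono) auto
    finally have "\<kappa> * (real w * \<mu> ^ 3) \<le> \<kappa> * ((real w * p) ^ s * real M)" using \<kappa>0 by (intro mult_left_mono) auto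
    moreover have "\<delta> / 8 * (real w * p / (real s)\<^sup>2) ^ s * real M = \<kappa> * ((real w * p) ^ s * real M)"
      unfolding \<kappa>_def by (simp add: power_divide)
    moreover have "real w * (\<mu> + 2) \<le> \<kappa> * (real w * \<mu> ^ 3)"
    proof -
      have "3 * \<mu> \<le> \<mu> * \<mu>" using \<mu>3 by (intro mult_right_mono) auto
      then have "\<mu> + 2 \<le> 1 * \<mu>\<^sup>2" using \<mu>3 unfolding power2_eq_square by linarith
      also have "\<dots> \<le> (\<kappa> * \<mu>) * \<mu>\<^sup>2" using \<kappa>m by (intro mult_right_mono) auto
      finally have "real w * (\<mu> + 2) \<le> real w * ((\<kappa> * \<mu>) * \<mu>\<^sup>2)" using w0 by (intro mult_left_mono) auto
      then show ?thesis by (simp add: power2_eq_square power3_eq_cube mult_ac)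
    qed
    ultimately have "real w * (\<mu> + 2) \<le> \<delta> / 8 * (real w * p / (real s)\<^sup>2) ^ s * real M" by linarith
    then have "exp (- (\<delta> / 8 * (real w * p / (real s)\<^sup>2) ^ s) * real M) \<le> exp (- (real w * (\<mu> + 2)))" by simp
    then have "real n ^ w * exp (- (\<delta> / 8 * (real w * p / (real s)\<^sup>2) ^ s) * real M) \<le> exp (real w * \<mu>) * exp (- (real w * (\<mu> + 2)))"
      using Nexp[of w] unfolding N_def by (intro mult_mono) auto
    also have "\<dots> = exp (- 2 * real w)" by (simp add: algebra_simps flip: exp_add)
    also have "\<dots> \<le> exp (- 2 * 1)" using pos(1) by simp
    also have "\<dots> \<le> 1 / 4"
    proof -
      have "2 * 2 \<le> exp 1 * exp (1::real)" using exp_ge_add_one_self[of 1] by (intro mult_mono) auto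
      then have "4 \<le> exp (2::real)" by (simp flip: exp_add)
      then show ?thesis by (simp add: exp_minus field_simps)
    qed
    finally show ?thesis unfolding \<delta> .
  qed
  have n1: "1 \<le> n" and t2: "2 \<le> t" using n2 st by simp_all
  \<comment> \<open>\<open>K\<close> occurs twice, as the threshold \<theta> for concentrated
    samples and as the order of moments.\<close>
  interpret graph_construction n M s t p \<Lambda> w k h K g K b \<eta>
    by unfold_locales
      (fact p0 p1 W1 L1 n1 W2 W3 W4 W5 W6 W7 W8 st(1) t2 \<eta>0 pos kn den1 den2 den3 un1 un2 un3 un4 sw wp eta_small un5 | erule key)+
  show ?thesis using erdos_rogers_le unfolding w_def q_def N_def .
qed

section \<open>Large n\<close>

lemma eventually_le_ln: "\<forall>\<^sub>F n in sequentially. c \<le> ln (real n)"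
  using filterlim_compose[OF ln_at_top filterlim_real_sequentially] by (simp add: filterlim_at_top)

lemma eventually_ceiling_ln_power_le:
  assumes "0 < \<epsilon>"
  shows "\<forall>\<^sub>F n in sequentially. real (nat \<lceil>ln (real n)\<rceil>) ^ D \<le> real n powr \<epsilon>"
proof -
  have lim: "filterlim (\<lambda>n. \<epsilon> * ln (real n)) at_top sequentially"
    by (rule filterlim_tendsto_pos_mult_at_top[OF tendsto_const assms filterlim_compose[OF ln_at_top filterlim_real_sequentially]])
  have "((\<lambda>n. (\<epsilon> * ln (real n)) ^ D / exp (\<epsilon> * ln (real n))) \<longlongrightarrow> 0) sequentially"
    by (rule filterlim_compose[OF tendsto_power_div_exp_0 lim])
  \<comment> \<open>The threshold makes up for bounding the rounded logarithm by 2 log n and for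
    rescaling the logarithm by \<epsilon>.\<close>
  then have "\<forall>\<^sub>F n in sequentially. (\<epsilon> * ln (real n)) ^ D / exp (\<epsilon> * ln (real n)) < (\<epsilon> / 2) ^ D"
    by (rule order_tendstoD(2)) (use assms in simp)
  with eventually_le_ln[of 1] eventually_gt_at_top[of 0] show ?thesis
  proof eventually_elim
    case (elim n)
    define L where "L = ln (real n)"
    have "real (nat \<lceil>L\<rceil>) \<le> 2 * L" using elim(1) unfolding L_def by linarith
    then have "real (nat \<lceil>L\<rceil>) ^ D \<le> (2 * L) ^ D" by (intro power_mono) auto
    also have "2 * L = (2 / \<epsilon>) * (\<epsilon> * L)" using assms by simp
    also have "((2 / \<epsilon>) * (\<epsilon> * L)) ^ D = (2 / \<epsilon>) ^ D * (\<epsilon> * L) ^ D" by (rule power_mult_distrib)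
    also have "\<dots> \<le> (2 / \<epsilon>) ^ D * ((\<epsilon> / 2) ^ D * exp (\<epsilon> * L))"
    proof (rule mult_left_mono)
      show "(\<epsilon> * L) ^ D \<le> (\<epsilon> / 2) ^ D * exp (\<epsilon> * L)"
        using elim(3) unfolding L_def by (simp only: pos_divide_less_eq exp_gt_zero less_imp_le)
    qed (use assms in simp)
    also have "\<dots> = exp (\<epsilon> * L)"
    proof -
      have "(2 / \<epsilon>) ^ D * (\<epsilon> / 2) ^ D = (2 / \<epsilon> * (\<epsilon> / 2)) ^ D" by (rule power_mult_distrib[symmetric])
      also have "2 / \<epsilon> * (\<epsilon> / 2) = 1" using assms by simp
      finally have "(2 / \<epsilon>) ^ D * (\<epsilon> / 2) ^ D = 1" by simp
      then show ?thesis by (simp only: mult.assoc[symmetric] mult_1)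
    qed
    also have "\<dots> = real n powr \<epsilon>" using elim(2) unfolding L_def powr_def by simp
    finally show ?case unfolding L_def .
  qed
qed

theorem theorem1p3:
  fixes s t :: nat
  assumes "s \<ge> 3" and "s + 2 \<le> t" and "t \<le> 2 * s - 1"
  shows "\<exists>c :: real. \<forall>\<^sub>F n in sequentially.
           real (erdos_rogers s t n) \<le> real n powr alpha s t * ln (real n) powr c"
proof -
  define d where "d = t * 2 ^ t"
  define k0 where "k0 = 10 * t + 3"
  define cb where "cb = 2 * d + 1"
  define C where "C = k0 * t + (k0 + 2) * d + 1"
  define c1 where "c1 = k0 + cb + 1 + C * t + 5"
  define R where "R = (s - 1) * (c1 + 1)"
  define D where "D = 2 * R + C + c1 + k0 + 5"
  define al where "al = alpha s t"
  define e where "e = edge_exp s t"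
  define \<delta> :: real where "\<delta> = 1 - exp (- (1 / 2 ^ (2 ^ t)))"
  define \<eta> :: real where "\<eta> = \<delta> / (4 * (exp 1 * (1 + 2 ^ (2 ^ t) * 2 ^ t * 2 ^ t * 2 ^ t) * (real s)\<^sup>2 ^ s))"
  note defs = d_def k0_def cb_def C_def c1_def R_def D_def al_def e_def \<delta>_def \<eta>_def
  define Cs where "Cs = {3, real s, real t + 1, exp 1 * real t, 6 / \<eta>, 8 * real d / \<eta>,
      16 * (2 ^ (2 ^ t) * 2 ^ t * 2 ^ t * 2 ^ t), exp 1 * (2 ^ d * (real d + 1) ^ d / \<eta>),
      exp 1 * (2 ^ d * (real d + 1) ^ d), exp 1 * (real t ^ t * (2 ^ d * (real d + 1) ^ d)),
      8 * (real s)\<^sup>2 ^ s / \<delta>, exp 1 * 2, 2 * 2 ^ c1}"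
  define Es where "Es = {1 - al, 1 - al - e, e, al - e, 1 - 2 * e, al, 1 - 2 * al, 1}"
  note ex = exponent_bounds[OF assms, folded al_def e_def]
  have pos: "0 < \<epsilon>" if "\<epsilon> \<in> Es" for \<epsilon> using that ex unfolding Es_def by auto
  have ev1: "\<forall>\<^sub>F n in sequentially. \<forall>c\<in>Cs. c \<le> ln (real n)"
    by (rule eventually_ball_finite) (simp_all add: Cs_def eventually_le_ln)
  have ev2: "\<forall>\<^sub>F n in sequentially. \<forall>\<epsilon>\<in>Es. real (nat \<lceil>ln (real n)\<rceil>) ^ D \<le> real n powr \<epsilon>"
  proof (rule eventually_ball_finite)
    show "finite Es" by (simp add: Es_def)
    show "\<forall>\<epsilon>\<in>Es. \<forall>\<^sub>F n in sequentially. real (nat \<lceil>ln (real n)\<rceil>) ^ D \<le> real n powr \<epsilon>"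
      using eventually_ceiling_ln_power_le pos by blast
  qed
  \<comment> \<open>The additional power of log n absorbs the constant 2 * 2^c1 that the two
    roundings produce.\<close>
  have "\<forall>\<^sub>F n in sequentially. real (erdos_rogers s t n) \<le> real n powr alpha s t * ln (real n) powr (real c1 + 1)"
    using ev1 ev2 eventually_ge_at_top[of 2]
  proof eventually_elim
    case (elim n)
    define L where "L = ln (real n)"
    define m where "m = nat \<lceil>L\<rceil>"
    have Lc: "c \<le> L" if "c \<in> Cs" for c using elim(1) that unfolding L_def by simp
    have L3: "3 \<le> L" by (rule Lc) (simp add: Cs_def)
    have Lm: "L \<le> real m" "real m \<le> 2 * L" unfolding m_def using L3 by linarith+
    have mc: "c \<le> real m" if "c \<in> Cs" for c using Lc[OF that] Lm by linarith
    have m3: "3 \<le> m" "s \<le> m" using mc[of 3] mc[of "real s"] by (simp_all add: Cs_def)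
    have "erdos_rogers s t n \<le> nat \<lceil>real n powr al\<rceil> * m ^ c1"
    proof (rule polylog_parameters[OF assms defs elim(3)])
      show "ln (real n) \<le> real m" using Lm unfolding L_def by simp
      show "real m ^ D \<le> real n powr \<epsilon>" if "\<epsilon> \<in> {1 - al, 1 - al - e, e, al - e, 1 - 2 * e, al, 1 - 2 * al, 1}" for \<epsilon>
        using elim(2) that unfolding m_def L_def Es_def by blast
    qed (rule m3 | rule mc, simp add: Cs_def)+
    then have "real (erdos_rogers s t n) \<le> real (nat \<lceil>real n powr al\<rceil> * m ^ c1)" by (rule of_nat_mono)
    also have "\<dots> = real (nat \<lceil>real n powr al\<rceil>) * real m ^ c1" by simp
    also have "\<dots> \<le> (2 * real n powr al) * (2 * L) ^ c1"
    proof (intro mult_mono power_mono)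
      have "1 \<le> real n powr al" using elim(3) ex by (intro ge_one_powr_ge_zero) auto
      then show "real (nat \<lceil>real n powr al\<rceil>) \<le> 2 * real n powr al" by linarith
    qed (use Lm in auto)
    also have "\<dots> = real n powr al * ((2 * 2 ^ c1) * L ^ c1)" by (simp add: power_mult_distrib)
    also have "\<dots> \<le> real n powr al * (L * L ^ c1)"
    proof (intro mult_left_mono mult_right_mono)
      show "2 * 2 ^ c1 \<le> L" by (rule Lc) (simp add: Cs_def)
    qed (use L3 in auto)
    also have "L * L ^ c1 = L powr (real c1 + 1)" using L3 powr_realpow[of L "Suc c1"] by (simp add: add.commute)
    finally show ?case unfolding al_def L_def .
  qed
  then show ?thesis by blast
qed

end
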